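(* Fix $m\ge 1$ and let $h:\mathbb{R}_+\times H\to\mathbb{R}_{>0}$ satisfy: (i) $h\in\mathrm{dom}_m(L)$ and $h^{-1}Lh\in C_m(\mathbb{R}_+\times H)$; (ii) $h$ is Fréchet differentiable in $x$ with $D_xh\in C_m(\mathbb{R}_+\times H;H)$; (iii) the process $$E^h(t)=\frac{h(t,X(t))}{h(0,x_0)}\exp\Big(-\int_0^t\frac{Lh}{h}(s,X(s))\,ds\Big),\quad t\ge 0,$$ is a $\mathbb{P}$-martingale. Let $\mathbb{P}^h$ be the unique measure on $\mathcal{F}$ such that $d\mathbb{P}^h|_{\mathcal{F}_t}=E^h(t)\,d\mathbb{P}|_{\mathcal{F}_t}$ for all $t\geq 0$. Then, for any $T>0$, the process $$W^h(t)=W(t)-\int_0^t\sqrt{Q}\,D_x\log h(s,X(s))\,ds,\quad t\in[0,T],$$ is a cylindrical Wiener process with respect to $\mathbb{P}^h$. In particular, $X$ under $\mathbb{P}^h$ is a mild solution to the SPDE $$dX(t)=\big[AX(t)+F(t,X(t))+Q\,D_x\log h(t,X(t))\big]dt+\sqrt{Q}\,dW^h(t),\quad t\in[0,T].$$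
   Context: Stochastic basis. $H$ is a Hilbert space embedded in another Hilbert space $H'$ by a Hilbert–Schmidt embedding $J:H\hookrightarrow H'$. $\Omega=C(\mathbb{R}_+;H')$ with the (Polish) topology of locally uniform convergence, $\mathcal{F}$ is its Borel $\sigma$-algebra, $\eta_t(\omega)=\omega(t)$ is the canonical process and $\mathcal{F}_t=\bigcap_{\varepsilon>0}\sigma(\eta_s:s\le t+\varepsilon)$. $\mathbb{P}$ is the Gaussian measure on $(\Omega,\mathcal F)$ under which $\eta$ is a Wiener process on $H'$ with covariance operator $JJ^*$, i.e. a cylindrical Wiener process on $H$, denoted $W$. SPDE. Consider $dX(t)=[AX(t)+F(t,X(t))]dt+\sqrt{Q}\,dW(t)$, $t\ge s$, $X(s)=x\in H$, where: $A$ generates a strongly continuous semigroup $(S_t)_{t\ge0}$ on $H$; $W$ is a cylindrical Wiener process on $H$; $Q$ is a symmetric positive operator on $H$ such that $Q_t=\int_0^tS_sQS_s^*\,ds$ satisfies $\sup_t\mathrm{tr}(Q_t)<\infty$; and there is $C_F>0$ with $\|F(t,x)-F(t,y)\|\le C_F\|x-y\|$ and $\|F(t,x)\|\le C_F(1+\|x\|)$ for all $t\ge0$, $x,y\in H$. The unique mild solution is the continuous $(\mathcal F_t)$-adapted process with $X(t,s,x)=S_{t-s}x+\int_s^tS_{t-u}F(u,X(u,s,x))\,du+\int_s^tS_{t-u}\sqrt{Q}\,dW(u)$. A point $x_0\in H$ is fixed and $X(t)=X(t,0,x_0)$. Function spaces and generator. For a Banach space $E$, $C_m(\mathbb{R}_+\times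 H;E)$ is the Banach space of continuous $\varphi:\mathbb{R}_+\times H\to E$ with $\|\varphi\|_m=\sup_{t,x}|\varphi(t,x)|_E/(1+\|x\|^m)<\infty$; $C_m(\mathbb{R}_+\times H)$ is the case $E=\mathbb{R}$. Functions $\varphi_n$ $\pi$-converge to $\varphi$ if $\sup_n\|\varphi_n\|_m<\infty$ and $\varphi_n\to\varphi$ pointwise; $\pi\text{-}\lim_{t\downarrow0}$ means $\pi$-convergence along every sequence $t_n\downarrow0$. The transition semigroup is $(T_t\varphi)(s,x)=\mathbb{E}[\varphi(s+t,X(s+t,s,x))]$ on $C_m(\mathbb{R}_+\times H)$. Its infinitesimal generator $L$ has domain $\mathrm{dom}_m(L)=\{\varphi\in C_m(\mathbb{R}_+\times H):\exists\psi\in C_m(\mathbb{R}_+\times H),\ \pi\text{-}\lim_{t\downarrow0}(T_t\varphi-\varphi)/t=\psi\}$ and $(L\varphi)(s,x)=\lim_{t\downarrow0}\frac{(T_t\varphi)(s,x)-\varphi(s,x)}{t}$. *)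

theory Defs
  imports "HOL-Probability.Probability"
begin

text \<open>
  Separable real Hilbert spaces are types of sort
  \<open>{real_inner, banach, second_countable_topology}\<close>. Separability is no restriction here: a space
  with an injective Hilbert--Schmidt embedding is separable, and the target space \<open>H'\<close> has to be
  separable for \<open>C(\<real>\<^sub>+; H')\<close> to be Polish.
\<close>

section \<open>Operators on Hilbert spaces\<close>

definition is_onb :: "'a::real_inner set \<Rightarrow> bool" where
  "is_onb B \<longleftrightarrow> pairwise orthogonal B \<and> (\<forall>b\<in>B. norm b = 1) \<and> closure (span B) = UNIV"

definition some_onb :: "'a::real_inner set" where
  "some_onb = (SOME B. is_onb B)"

text \<open>The squared Hilbert--Schmidt norm, with value \<open>\<infinity>\<close> if the operator is not Hilbert--Schmidt.\<close>

definition hs_norm_sq :: "('a::real_inner \<Rightarrow> 'b::real_normed_vector) \<Rightarrow> ennreal" where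
  "hs_norm_sq B = infsum (\<lambda>e. ennreal ((norm (B e))\<^sup>2)) some_onb"

definition hilbert_schmidt_embedding :: "('a::real_inner \<Rightarrow> 'b::real_inner) \<Rightarrow> bool" where
  "hilbert_schmidt_embedding J \<longleftrightarrow> bounded_linear J \<and> inj J \<and> hs_norm_sq J < \<infinity>"

text \<open>The trace, used for positive operators only.\<close>

definition trace_op :: "('a::real_inner \<Rightarrow> 'a) \<Rightarrow> ennreal" where
  "trace_op C = infsum (\<lambda>e. ennreal (C e \<bullet> e)) some_onb"

definition sym_pos_op :: "('a::real_inner \<Rightarrow> 'a) \<Rightarrow> bool" where
  "sym_pos_op Q \<longleftrightarrow> bounded_linear Q \<and> (\<forall>x y. Q x \<bullet> y = x \<bullet> Q y) \<and> (\<forall>x. 0 \<le> Q x \<bullet> x)"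

definition is_sqrt_op :: "('a::real_inner \<Rightarrow> 'a) \<Rightarrow> ('a \<Rightarrow> 'a) \<Rightarrow> bool" where
  "is_sqrt_op Q R \<longleftrightarrow> sym_pos_op R \<and> R \<circ> R = Q"

definition C0_semigroup :: "(real \<Rightarrow> 'a::real_normed_vector \<Rightarrow> 'a) \<Rightarrow> bool" where
  "C0_semigroup S \<longleftrightarrow>
     (\<forall>t\<ge>0. bounded_linear (S t)) \<and> S 0 = id \<and>
     (\<forall>s\<ge>0. \<forall>t\<ge>0. S (s + t) = S s \<circ> S t) \<and>
     (\<forall>x. ((\<lambda>t. S t x) \<longlongrightarrow> x) (at_right 0))"

definition generates_semigroup ::
    "'a::real_normed_vector set \<Rightarrow> ('a \<Rightarrow> 'a) \<Rightarrow> (real \<Rightarrow> 'a \<Rightarrow> 'a) \<Rightarrow> bool" where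
  "generates_semigroup domA A S \<longleftrightarrow>
     C0_semigroup S \<and>
     domA = {x. \<exists>y. ((\<lambda>t. (S t x - x) /\<^sub>R t) \<longlongrightarrow> y) (at_right 0)} \<and>
     (\<forall>x\<in>domA. ((\<lambda>t. (S t x - x) /\<^sub>R t) \<longlongrightarrow> A x) (at_right 0))"

definition cov_op ::
    "(real \<Rightarrow> 'a \<Rightarrow> 'a) \<Rightarrow> ('a \<Rightarrow> 'a) \<Rightarrow> real \<Rightarrow> 'a
       \<Rightarrow> 'a::{real_inner, banach, second_countable_topology}" where
  "cov_op S Q t x = (LINT u:{0..t}|lborel. S u (Q (adjoint (S u) x)))"

definition gradient :: "('a::real_inner \<Rightarrow> real) \<Rightarrow> 'a \<Rightarrow> 'a" where
  "gradient f x = (THE D. GDERIV f x :> D)"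

section \<open>The canonical path space\<close>

text \<open>
  Paths are functions on \<open>\<real>\<close> that take the fixed value \<open>undefined\<close> on the negative half line, so that
  two paths are equal iff they agree on \<open>\<real>\<^sub>+\<close>.
\<close>

definition path_space :: "(real \<Rightarrow> 'k::metric_space) set" where
  "path_space = {\<omega> \<in> extensional {0..}. continuous_on {0..} \<omega>}"

text \<open>Open sets of the topology of locally uniform convergence.\<close>

definition path_open :: "(real \<Rightarrow> 'k::metric_space) set \<Rightarrow> bool" where
  "path_open U \<longleftrightarrow> U \<subseteq> path_space \<and>
     (\<forall>\<omega>\<in>U. \<exists>b>0. \<exists>\<epsilon>>0. \<forall>\<omega>'\<in>path_space. (\<forall>t\<in>{0..b}. dist (\<omega>' t) (\<omega> t) < \<epsilon>) \<longrightarrow> \<omega>' \<in> U)"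

definition path_borel :: "(real \<Rightarrow> 'k::metric_space) measure" where
  "path_borel = sigma path_space {U. path_open U}"

definition coord :: "real \<Rightarrow> (real \<Rightarrow> 'k) \<Rightarrow> 'k" where
  "coord t \<omega> = \<omega> t"

definition natural_filtration :: "real \<Rightarrow> (real \<Rightarrow> 'k::metric_space) measure" where
  "natural_filtration t =
     sigma path_space {coord s -` B \<inter> path_space | s B. 0 \<le> s \<and> s \<le> t \<and> B \<in> sets borel}"

definition canonical_filtration :: "real \<Rightarrow> (real \<Rightarrow> 'k::metric_space) measure" where
  "canonical_filtration t = sigma path_space (\<Inter>\<epsilon>\<in>{0<..}. sets (natural_filtration (t + \<epsilon>)))"

section \<open>Wiener processes\<close>

definition real_gaussian :: "real \<Rightarrow> real measure" where
  "real_gaussian v = (if v = 0 then return borel 0 else density lborel (normal_density 0 (sqrt v)))"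

definition centered_gaussian ::
    "'w measure \<Rightarrow> ('k::real_inner \<Rightarrow> 'k) \<Rightarrow> ('w \<Rightarrow> 'k) \<Rightarrow> bool" where
  "centered_gaussian M C Y \<longleftrightarrow> Y \<in> borel_measurable M \<and>
     (\<forall>k. distr M borel (\<lambda>\<omega>. Y \<omega> \<bullet> k) = real_gaussian (C k \<bullet> k))"

definition wiener_process ::
    "'w measure \<Rightarrow> (real \<Rightarrow> 'w measure) \<Rightarrow> ('k::real_inner \<Rightarrow> 'k) \<Rightarrow> real set
       \<Rightarrow> (real \<Rightarrow> 'w \<Rightarrow> 'k) \<Rightarrow> bool" where
  "wiener_process M Fil C I W \<longleftrightarrow>
     prob_space M \<and>
     (\<forall>t\<in>I. W t \<in> borel_measurable (Fil t)) \<and>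
     (AE \<omega> in M. W 0 \<omega> = 0) \<and>
     (AE \<omega> in M. continuous_on I (\<lambda>t. W t \<omega>)) \<and>
     (\<forall>s\<in>I. \<forall>t\<in>I. s < t \<longrightarrow>
        prob_space.indep_set M (sets (Fil s))
          {(\<lambda>\<omega>. W t \<omega> - W s \<omega>) -` B \<inter> space M | B. B \<in> sets borel} \<and>
        centered_gaussian M (\<lambda>k. (t - s) *\<^sub>R C k) (\<lambda>\<omega>. W t \<omega> - W s \<omega>))"

text \<open>
  A cylindrical Wiener process on \<open>H\<close>, realised through \<open>J\<close> as a Wiener process on \<open>H'\<close>.
\<close>

definition cylindrical_wiener ::
    "'w measure \<Rightarrow> (real \<Rightarrow> 'w measure) \<Rightarrow> ('h::real_inner \<Rightarrow> 'k::real_inner) \<Rightarrow> real set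
       \<Rightarrow> (real \<Rightarrow> 'w \<Rightarrow> 'k) \<Rightarrow> bool" where
  "cylindrical_wiener M Fil J I W \<longleftrightarrow> wiener_process M Fil (J \<circ> adjoint J) I W"

section \<open>Stochastic integrals of deterministic operator-valued integrands\<close>

text \<open>
  An elementary integrand is \<open>\<Sum>i<N. 1\<^bsub>(p i, p (i+1)]\<^esub> B i\<close> with bounded linear \<open>B i : H' \<rightarrow> H\<close>; its
  integral with respect to the \<open>H'\<close>-valued process \<open>W\<close> is the obvious sum. The integral of
  \<open>\<Phi> : [s,t] \<rightarrow> L\<^sub>2(H)\<close> is the \<open>L\<^sup>2\<close>-limit of integrals of elementary integrands whose restrictions
  along \<open>J\<close> converge to \<open>\<Phi>\<close> in \<open>L\<^sup>2([s,t]; L\<^sub>2(H))\<close>.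
\<close>

definition elem_op ::
    "nat \<Rightarrow> (nat \<Rightarrow> real) \<Rightarrow> (nat \<Rightarrow> 'k \<Rightarrow> 'h::real_vector) \<Rightarrow> real \<Rightarrow> 'k \<Rightarrow> 'h" where
  "elem_op N p B u v = (\<Sum>i<N. indicator {p i<..p (Suc i)} u *\<^sub>R B i v)"

definition elem_integral ::
    "(real \<Rightarrow> 'w \<Rightarrow> 'k::ab_group_add) \<Rightarrow> nat \<Rightarrow> (nat \<Rightarrow> real) \<Rightarrow> (nat \<Rightarrow> 'k \<Rightarrow> 'h::ab_group_add)
       \<Rightarrow> 'w \<Rightarrow> 'h" where
  "elem_integral W N p B \<omega> = (\<Sum>i<N. B i (W (p (Suc i)) \<omega> - W (p i) \<omega>))"

definition has_stoch_integral ::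
    "'w measure \<Rightarrow> ('h::real_inner \<Rightarrow> 'k::real_normed_vector) \<Rightarrow> (real \<Rightarrow> 'w \<Rightarrow> 'k)
       \<Rightarrow> (real \<Rightarrow> 'h \<Rightarrow> 'h) \<Rightarrow> real \<Rightarrow> real \<Rightarrow> ('w \<Rightarrow> 'h) \<Rightarrow> bool" where
  "has_stoch_integral M J W \<Phi> s t Z \<longleftrightarrow>
     Z \<in> borel_measurable M \<and>
     (\<exists>N p B.
        (\<forall>n. s \<le> p n 0 \<and> p n (N n) \<le> t \<and>
             (\<forall>i<N n. p n i \<le> p n (Suc i) \<and> bounded_linear (B n i))) \<and>
        (\<lambda>n. \<integral>\<^sup>+u\<in>{s..t}. hs_norm_sq (\<lambda>v. \<Phi> u v - elem_op (N n) (p n) (B n) u (J v)) \<partial>lborel)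
          \<longlonglongrightarrow> 0 \<and>
        (\<lambda>n. \<integral>\<^sup>+\<omega>. ennreal ((norm (Z \<omega> - elem_integral W (N n) (p n) (B n) \<omega>))\<^sup>2) \<partial>M) \<longlonglongrightarrow> 0)"

section \<open>Mild solutions\<close>

text \<open>
  Mild solution on the time interval \<open>I\<close>, started at time \<open>s\<close> in \<open>x\<close>, of
  \<open>dX = [A X + G(t,X)] dt + R dW\<close>, where \<open>A\<close> generates \<open>S\<close>.

  The canonical filtration is not completed, so an adapted process all of whose paths are
  continuous need not exist. ``Continuous and adapted'' is therefore read as progressively
  measurable with almost surely continuous paths. The exceptional null sets for statements about
  the process up to time \<open>t\<close> are taken in \<open>Fil t\<close> (this is what \<open>restr_to_subalg M (Fil t)\<close> expresses).
\<close>

definition mild_solution ::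
    "'w measure \<Rightarrow> (real \<Rightarrow> 'w measure)
       \<Rightarrow> ('h::{real_inner, banach, second_countable_topology} \<Rightarrow> 'k::real_normed_vector)
       \<Rightarrow> (real \<Rightarrow> 'w \<Rightarrow> 'k) \<Rightarrow> (real \<Rightarrow> 'h \<Rightarrow> 'h) \<Rightarrow> (real \<Rightarrow> 'h \<Rightarrow> 'h) \<Rightarrow> ('h \<Rightarrow> 'h)
       \<Rightarrow> real \<Rightarrow> 'h \<Rightarrow> real set \<Rightarrow> (real \<Rightarrow> 'w \<Rightarrow> 'h) \<Rightarrow> bool" where
  "mild_solution M Fil J W S G R s x I X \<longleftrightarrow>
     (\<forall>t\<in>I.
        (\<lambda>(r, \<omega>). X r \<omega>) \<in> borel_measurable (restrict_space borel {s..t} \<Otimes>\<^sub>M Fil t) \<and>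
        (AE \<omega> in restr_to_subalg M (Fil t). continuous_on {s..t} (\<lambda>r. X r \<omega>)) \<and>
        (AE \<omega> in restr_to_subalg M (Fil t).
           set_integrable lborel {s..t} (\<lambda>u. S (t - u) (G u (X u \<omega>)))) \<and>
        (\<exists>Z \<in> borel_measurable (Fil t).
           has_stoch_integral M J W (\<lambda>u. S (t - u) \<circ> R) s t Z \<and>
           (AE \<omega> in restr_to_subalg M (Fil t).
              X t \<omega> = S (t - s) x + (LINT u:{s..t}|lborel. S (t - u) (G u (X u \<omega>))) + Z \<omega>)))"

section \<open>Weighted function spaces, transition semigroup and generator\<close>

text \<open>
  Functions on \<open>\<real>\<^sub>+ \<times> H\<close> are curried functions on \<open>\<real> \<times> H\<close> of which only the values at nonnegative
  times matter.
\<close>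

definition Cm_norm :: "real \<Rightarrow> (real \<Rightarrow> 'h::real_normed_vector \<Rightarrow> 'e::real_normed_vector) \<Rightarrow> ennreal" where
  "Cm_norm m \<phi> = (SUP (t, x)\<in>{0..} \<times> UNIV. ennreal (norm (\<phi> t x) / (1 + norm x powr m)))"

definition Cm_space :: "real \<Rightarrow> (real \<Rightarrow> 'h::real_normed_vector \<Rightarrow> 'e::real_normed_vector) set" where
  "Cm_space m = {\<phi>. continuous_on ({0..} \<times> UNIV) (\<lambda>(t, x). \<phi> t x) \<and> Cm_norm m \<phi> < \<infinity>}"

definition pi_converges ::
    "real \<Rightarrow> (nat \<Rightarrow> real \<Rightarrow> 'h::real_normed_vector \<Rightarrow> 'e::real_normed_vector)
       \<Rightarrow> (real \<Rightarrow> 'h \<Rightarrow> 'e) \<Rightarrow> bool" where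
  "pi_converges m \<phi>n \<phi> \<longleftrightarrow>
     (SUP n. Cm_norm m (\<phi>n n)) < \<infinity> \<and> (\<forall>t\<ge>0. \<forall>x. (\<lambda>n. \<phi>n n t x) \<longlonglongrightarrow> \<phi> t x)"

text \<open>\<open>X t s x\<close> is the solution at time \<open>t\<close> started at time \<open>s\<close> in \<open>x\<close>.\<close>

definition transition ::
    "'w measure \<Rightarrow> (real \<Rightarrow> real \<Rightarrow> 'h \<Rightarrow> 'w \<Rightarrow> 'h) \<Rightarrow> real \<Rightarrow> (real \<Rightarrow> 'h \<Rightarrow> real) \<Rightarrow> real \<Rightarrow> 'h \<Rightarrow> real"
  where
  "transition P X t \<phi> s x = (\<integral>\<omega>. \<phi> (s + t) (X (s + t) s x \<omega>) \<partial>P)"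

definition gen_dom ::
    "'w measure \<Rightarrow> (real \<Rightarrow> real \<Rightarrow> 'h::real_normed_vector \<Rightarrow> 'w \<Rightarrow> 'h) \<Rightarrow> real
       \<Rightarrow> (real \<Rightarrow> 'h \<Rightarrow> real) set" where
  "gen_dom P X m = {\<phi> \<in> Cm_space m. \<exists>\<psi>\<in>Cm_space m.
     \<forall>\<tau>. (\<forall>n. \<tau> n > 0) \<and> decseq \<tau> \<and> \<tau> \<longlonglongrightarrow> 0 \<longrightarrow>
       pi_converges m (\<lambda>n s x. (transition P X (\<tau> n) \<phi> s x - \<phi> s x) / \<tau> n) \<psi>}"

definition gen ::
    "'w measure \<Rightarrow> (real \<Rightarrow> real \<Rightarrow> 'h \<Rightarrow> 'w \<Rightarrow> 'h) \<Rightarrow> (real \<Rightarrow> 'h \<Rightarrow> real) \<Rightarrow> real \<Rightarrow> 'h \<Rightarrow> real" where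
  "gen P X \<phi> s x = Lim (at_right 0) (\<lambda>t. (transition P X t \<phi> s x - \<phi> s x) / t)"

section \<open>Change of measure\<close>

definition is_martingale :: "'w measure \<Rightarrow> (real \<Rightarrow> 'w measure) \<Rightarrow> (real \<Rightarrow> 'w \<Rightarrow> real) \<Rightarrow> bool" where
  "is_martingale M Fil Y \<longleftrightarrow>
     (\<forall>t\<ge>0. Y t \<in> borel_measurable (Fil t) \<and> integrable M (Y t)) \<and>
     (\<forall>s\<ge>0. \<forall>t\<ge>s. AE \<omega> in M. real_cond_exp M (Fil s) (Y t) \<omega> = Y s \<omega>)"

definition density_process ::
    "'w measure \<Rightarrow> (real \<Rightarrow> real \<Rightarrow> 'h \<Rightarrow> 'w \<Rightarrow> 'h) \<Rightarrow> 'h \<Rightarrow> (real \<Rightarrow> 'h \<Rightarrow> real) \<Rightarrow> real \<Rightarrow> 'w \<Rightarrow> real" where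
  "density_process P X x0 h t \<omega> =
     h t (X t 0 x0 \<omega>) / h 0 x0 *
     exp (- (LINT s:{0..t}|lborel. gen P X h s (X s 0 x0 \<omega>) / h s (X s 0 x0 \<omega>)))"

text \<open>\<open>W\<^sup>h\<close>, as an \<open>H'\<close>-valued process: the \<open>H\<close>-valued drift is embedded by \<open>J\<close>.\<close>

definition shifted_process ::
    "('h::{real_inner, banach, second_countable_topology} \<Rightarrow> 'k::real_vector) \<Rightarrow> ('h \<Rightarrow> 'h)
       \<Rightarrow> (real \<Rightarrow> real \<Rightarrow> 'h \<Rightarrow> 'w \<Rightarrow> 'h) \<Rightarrow> 'h \<Rightarrow> (real \<Rightarrow> 'h \<Rightarrow> real)
       \<Rightarrow> (real \<Rightarrow> 'w \<Rightarrow> 'k) \<Rightarrow> real \<Rightarrow> 'w \<Rightarrow> 'k" where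
  "shifted_process J R X x0 h W t \<omega> =
     W t \<omega> - J (LINT s:{0..t}|lborel. R (gradient (\<lambda>y. ln (h s y)) (X s 0 x0 \<omega>)))"

end

theory Submission
 imports Defs
begin

text \<open>
 No stochastic calculus is needed. On a short interval \<open>(u, v]\<close>, the real exponentials of the increment
 of a coordinate \<open>\<beta>\<close> of \<open>W\<close> are Cameron--Martin densities, and the corresponding shift of the path
 moves the mild solution \<open>X v\<close> by a multiple of \<open>(v - u) q\<close> up to \<open>o(v - u)\<close>. Up to third order the
 imaginary exponential of the increment is a combination of the two real exponentials with
 parameters \<open>1\<close> and \<open>-1\<close>, so the shifts determine how the characteristic function of \<open>\<beta>\<close> under \<open>P\<^sup>h\<close>
 changes over one step of a partition, up to an error controlled by the martingale \<open>E\<^sup>h\<close>. Summing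
 over refining partitions gives the conditional characteristic functions of the increments of \<open>W\<^sup>h\<close>,
 so \<open>W\<^sup>h\<close> is a Wiener process. For the mild equation, elementary integrals against \<open>W\<close> under \<open>P\<close> and
 against \<open>W\<^sup>h\<close> under \<open>P\<^sup>h\<close> have the same joint law; so the elementary integrals that approximate the
 stochastic convolution also converge against \<open>W\<^sup>h\<close>, and their differences are the drift integrals.
\<close>

text \<open>Ito's formula cannot be applied to \<open>h t (X t)\<close>: \<open>h\<close> has one
  derivative in space, and its generator is known only through \<pi>-limits. But a Cameron--Martin
  shift over a step of length \<open>d\<close> moves the solution by order \<open>d\<close>, not
  \<open>sqrt d\<close>, so one derivative of \<open>h\<close> is enough to evaluate it; what
  happens to \<open>h\<close> along the unshifted path is taken care of by the martingale property.
  The martingale is merely integrable, and \<open>h\<close>, its gradient and the potential grow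
  polynomially. The estimates are therefore run on paths along which the solution has norm at most
  \<open>R\<close> and \<open>h\<close> is at least \<open>1 / R\<close>; all else is charged to the
  mass of the remaining paths, which vanishes as \<open>R\<close> grows. The two measures are
  compared on each \<open>\<F> t\<close> separately, and the filtration is not completed.
  Exceptional sets are thus carried inside \<open>\<F> t\<close>, and an event of
  \<open>\<F> t\<close> is turned into an event about coordinates by allowing a little more
  time.\<close>

abbreviation (input) Filtration (\<open>\<F>\<close>) where "\<F> \<equiv> canonical_filtration"

section \<open>Hilbert space geometry\<close>

text \<open>In a minimising sequence the midpoints stay in \<open>S\<close> and so have norm at
  least \<open>d\<close>; the parallelogram law then makes the sequence Cauchy, and completeness
  gives the minimiser.\<close>

lemma closed_convex_min_norm:
 fixes S :: "'a::{real_inner,banach} set"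
 assumes "closed S" "convex S" "S \<noteq> {}"
 obtains x where "x \<in> S" "\<And>y. y \<in> S ==> norm x \<le> norm y"
proof -
 define d where "d = Inf (norm ` S)"
 have bdd: "bdd_below (norm ` S)" by (rule bdd_belowI[of _ 0]) auto
 have dle: "d \<le> norm y" if "y \<in> S" for y
  unfolding d_def using that bdd by (intro cInf_lower) auto
 have d0: "0 \<le> d" unfolding d_def using assms(3) by (intro cInf_greatest) auto
 have "\<exists>x\<in>S. norm x < d + inverse (real (Suc n))" for n
 proof -
  have "Inf (norm ` S) < d + inverse (real (Suc n))" by (simp add: d_def)
  then show ?thesis using cInf_less_iff[of "norm ` S"] assms(3) bdd by auto
 qed
 then obtain x where x: "\<And>n. x n \<in> S" "\<And>n. norm (x n) < d + inverse (real (Suc n))" by metis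
 have dist2: "(norm (x m - x n))\<^sup>2 \<le> 4 * (2 * d + 1) * inverse (real (Suc N))"
  if "m \<ge> N" "n \<ge> N" for m n N
 proof -
  define r where "r = inverse (real (Suc N))"
  have r: "0 < r" "r \<le> 1" by (auto simp: r_def field_simps)
  have A: "norm (x k) \<le> d + r" if "k \<ge> N" for k
  proof -
   have "inverse (real (Suc k)) \<le> r" unfolding r_def using that by (simp add: field_simps)
   with x(2)[of k] show ?thesis by linarith
  qed
  have "(1/2) *\<^sub>R x m + (1/2) *\<^sub>R x n \<in> S"
   using convexD[OF assms(2) x(1)[of m] x(1)[of n], of "1/2" "1/2"] by simp
  from dle[OF this] have "2 * d \<le> norm (x m + x n)"
   by (simp flip: scaleR_add_right)
  then have 1: "(2*d)\<^sup>2 \<le> (norm (x m + x n))\<^sup>2" using d0 by (intro power_mono) auto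
  have "(norm (x m - x n))\<^sup>2 = 2 * (norm (x m))\<^sup>2 + 2 * (norm (x n))\<^sup>2 - (norm (x m + x n))\<^sup>2"
   by (simp add: power2_norm_eq_inner inner_diff_left inner_diff_right inner_add_left inner_add_right)
  also have "\<dots> \<le> 2 * (d+r)\<^sup>2 + 2 * (d+r)\<^sup>2 - (2*d)\<^sup>2"
   using 1 power_mono[OF A[OF that(1)], of 2] power_mono[OF A[OF that(2)], of 2] by simp
  also have "\<dots> = 4 * (2 * d + r) * r" by (simp add: power2_eq_square algebra_simps)
  also have "\<dots> \<le> 4 * (2 * d + 1) * r" using r d0 by (intro mult_right_mono) auto
  finally show ?thesis by (simp add: r_def)
 qed
 have "Cauchy x"
 proof (rule metric_CauchyI)
  fix e :: real assume "e > 0"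
  have "(\<lambda>N. 4 * (2 * d + 1) * inverse (real (Suc N))) \<longlonglongrightarrow> 4 * (2 * d + 1) * 0"
   by (intro tendsto_intros LIMSEQ_inverse_real_of_nat)
  then have "eventually (\<lambda>N. 4 * (2 * d + 1) * inverse (real (Suc N)) < e\<^sup>2) sequentially"
   using \<open>e > 0\<close> by (intro order_tendstoD(2)) auto
  then obtain N where "4 * (2 * d + 1) * inverse (real (Suc N)) < e\<^sup>2"
   by (auto simp: eventually_sequentially)
  then have "(norm (x m - x n))\<^sup>2 < e\<^sup>2" if "m \<ge> N" "n \<ge> N" for m n
   using dist2[OF that] by linarith
  then show "\<exists>M. \<forall>m\<ge>M. \<forall>n\<ge>M. dist (x m) (x n) < e"
   using \<open>e > 0\<close> unfolding dist_norm
   by (intro exI[of _ N] allI impI) (auto intro: power_less_imp_less_base[of _ 2])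
 qed
 then obtain l where l: "x \<longlonglongrightarrow> l" by (auto simp: Cauchy_convergent_iff convergent_def)
 have "l \<in> S" using closed_sequentially[OF assms(1)] x(1) l by blast
 have "(\<lambda>n. d + inverse (real (Suc n))) \<longlonglongrightarrow> d + 0"
  by (intro tendsto_intros LIMSEQ_inverse_real_of_nat)
 then have "norm l \<le> d + 0"
  using l x(2) by (intro LIMSEQ_le[OF tendsto_norm[OF l]]) (auto intro: less_imp_le)
 with \<open>l \<in> S\<close> dle show thesis by (intro that[of l]) fastforce+
qed

text \<open>Take the point of least norm in \<open>z + V\<close>: if it were not orthogonal to some
  \<open>v\<close>, subtracting its component along \<open>v\<close> would shorten it. Used for
  kernels in the Riesz theorem and for closed spans in the construction of bases.\<close>

lemma closed_affine_min_norm_orthogonal: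
 fixes V :: "'a::{real_inner,banach} set"
 assumes "closed V" "subspace V"
 obtains x where "x - z \<in> V" "\<And>v. v \<in> V ==> x \<bullet> v = 0"
proof -
 define S where "S = (+) z ` V"
 have "closed S" unfolding S_def using assms(1) by (rule closed_translation)
 moreover have "convex S" unfolding S_def by (intro convex_translation subspace_imp_convex assms)
 moreover have "S \<noteq> {}" unfolding S_def using subspace_0[OF assms(2)] by blast
 ultimately obtain x where x: "x \<in> S" "\<And>y. y \<in> S ==> norm x \<le> norm y"
  using closed_convex_min_norm by blast
 have "x \<bullet> v = 0" if "v \<in> V" for v
 proof (cases "v = 0")
  case False
  define c where "c = (x \<bullet> v) / (v \<bullet> v)"
  have "x - c *\<^sub>R v \<in> S"
  proof -
   from x(1) obtain w where "x = z + w" "w \<in> V" by (auto simp: S_def)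
   then show ?thesis unfolding S_def using assms(2) that
    by (intro image_eqI[of _ _ "w - c *\<^sub>R v"]) (auto intro!: subspace_diff subspace_scale)
  qed
  from x(2)[OF this] have "(norm x)\<^sup>2 \<le> (norm (x - c *\<^sub>R v))\<^sup>2" by (intro power_mono) auto
  also have "\<dots> = (norm x)\<^sup>2 - 2 * c * (x \<bullet> v) + c\<^sup>2 * (v \<bullet> v)"
   unfolding power2_norm_eq_inner
   by (simp add: inner_diff_left inner_diff_right inner_commute power2_eq_square algebra_simps)
  also have "\<dots> = (norm x)\<^sup>2 - (x \<bullet> v)\<^sup>2 / (v \<bullet> v)"
   using False by (simp add: c_def power2_eq_square field_simps)
  finally have "(x \<bullet> v)\<^sup>2 / (v \<bullet> v) \<le> 0" by simp
  moreover have "v \<bullet> v > 0" using False by simp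
  ultimately have "(x \<bullet> v)\<^sup>2 \<le> 0" by (simp add: divide_le_0_iff)
  then show ?thesis by simp
 qed simp
 moreover have "x - z \<in> V" using x(1) by (auto simp: S_def)
 ultimately show thesis by (intro that) auto
qed

text \<open>A vector orthogonal to the kernel of \<open>f\<close> determines \<open>f\<close>,
  because every \<open>w\<close> differs from a multiple of it by an element of the kernel.\<close>

lemma riesz_representation:
 fixes f :: "'a::{real_inner,banach} => real"
 assumes "bounded_linear f"
 obtains y where "\<And>x. f x = x \<bullet> y"
proof (cases "\<forall>x. f x = 0")
 case True then show thesis by (intro that[of 0]) auto
next
 case False
 then obtain z where z: "f z \<noteq> 0" by auto
 interpret f: bounded_linear f by fact
 have "closed (f -` {0})"
  by (intro continuous_closed_vimage closed_singleton f.continuous continuous_ident)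
 moreover have "subspace (f -` {0})"
  by (auto simp: subspace_def f.add f.scaleR f.zero)
 ultimately obtain x where x: "x - z \<in> f -` {0}" "\<And>v. v \<in> f -` {0} ==> x \<bullet> v = 0"
  using closed_affine_min_norm_orthogonal by blast
 have fx: "f x = f z" using x(1) by (simp add: f.diff)
 then have x0: "x \<noteq> 0" using z f.zero by auto
 have "f w = w \<bullet> ((f x / (x \<bullet> x)) *\<^sub>R x)" for w
 proof -
  have "w - (f w / f x) *\<^sub>R x \<in> f -` {0}" using z fx by (simp add: f.diff f.scaleR)
  from x(2)[OF this] have "x \<bullet> w = (f w / f x) * (x \<bullet> x)" by (simp add: inner_diff_right)
  then show ?thesis using z fx x0 by (simp add: inner_commute)
 qed
 then show thesis by (rule that)
qed

text \<open>\<open>adjoint\<close> chooses some function that satisfies the adjoint equation; the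
  Riesz theorem shows that there is one, so the choice has this property.\<close>

lemma adjoint_inner:
 fixes f :: "'a::{real_inner,banach} => 'b::real_inner"
 assumes "bounded_linear f"
 shows "f x \<bullet> y = x \<bullet> adjoint f y"
proof -
 interpret f: bounded_linear f by fact
 have "\<exists>z. \<forall>x. f x \<bullet> y = x \<bullet> z" for y
 proof -
  have "bounded_linear (\<lambda>x. f x \<bullet> y)"
   by (rule bounded_linear_compose[OF bounded_linear_inner_left assms])
  then show ?thesis using riesz_representation by metis
 qed
 then obtain g where "\<forall>y x. f x \<bullet> y = x \<bullet> g y" by metis
 then have "\<forall>x y. f x \<bullet> y = x \<bullet> adjoint f y"
  unfolding adjoint_def by (intro someI[of "\<lambda>f'. \<forall>x y. f x \<bullet> y = x \<bullet> f' y" g]) blast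
 then show ?thesis by blast
qed

lemma adjoint_linear_hilbert:
 fixes f :: "'a::{real_inner,banach} => 'b::real_inner"
 assumes "bounded_linear f"
 shows "linear (adjoint f)"
proof (rule linearI)
 have eqI: "u = v" if "\<And>x. x \<bullet> u = x \<bullet> v" for u v :: 'a
  using that by (metis inner_commute vector_eq_ldot)
 fix y z c
 show "adjoint f (y + z) = adjoint f y + adjoint f z"
  by (rule eqI) (simp add: inner_add_right flip: adjoint_inner[OF assms])
 show "adjoint f (c *\<^sub>R y) = c *\<^sub>R adjoint f y"
  by (rule eqI) (simp flip: adjoint_inner[OF assms])
qed

section \<open>Orthonormal bases\<close>

lemma subspace_closure:
 fixes V :: "'a::real_normed_vector set"
 assumes "subspace V"
 shows "subspace (closure V)"
 unfolding subspace_def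
proof (intro conjI ballI allI)
 show "0 \<in> closure V" using subspace_0[OF assms] closure_subset by blast
 fix x assume "x \<in> closure V"
 then obtain a where a: "\<And>n. a n \<in> V" "a \<longlonglongrightarrow> x" by (auto simp: closure_sequential)
 show "x + y \<in> closure V" if "y \<in> closure V" for y
 proof -
  from that obtain b where b: "\<And>n. b n \<in> V" "b \<longlonglongrightarrow> y" by (auto simp: closure_sequential)
  show ?thesis unfolding closure_sequential
   by (intro exI[of _ "\<lambda>n. a n + b n"] conjI allI tendsto_add a b subspace_add assms)
 qed
 show "c *\<^sub>R x \<in> closure V" for c
  unfolding closure_sequential
  by (intro exI[of _ "\<lambda>n. c *\<^sub>R a n"] conjI allI tendsto_intros a subspace_scale assms)
qed

text \<open>Zorn's lemma gives a maximal orthonormal set; if its closed span missed a point, a unit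
  vector orthogonal to the span would enlarge it. This gives meaning to the choice in
  \<open>some_onb\<close>.\<close>

lemma is_onb_exists: "\<exists>B :: 'a::{real_inner,banach} set. is_onb B"
proof -
 define \<A> where "\<A> = {B :: 'a set. pairwise orthogonal B \<and> (\<forall>b\<in>B. norm b = 1)}"
 have "\<exists>M\<in>\<A>. \<forall>B\<in>\<A>. M \<subseteq> B --> B = M"
 proof (rule subset_Zorn)
  fix C assume "subset.chain \<A> C"
  then have C: "C \<subseteq> \<A>" "\<And>X Y. X \<in> C ==> Y \<in> C ==> X \<subseteq> Y \<or> Y \<subseteq> X"
   by (auto simp: subset_chain_def)
  have "pairwise orthogonal (\<Union>C)"
   unfolding pairwise_def
  proof (intro ballI impI)
   fix x y assume "x \<in> \<Union>C" "y \<in> \<Union>C" "x \<noteq> y"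
   then obtain X Y where XY: "X \<in> C" "x \<in> X" "Y \<in> C" "y \<in> Y" by auto
   then obtain Z where "Z \<in> C" "x \<in> Z" "y \<in> Z" using C(2)[of X Y] by blast
   moreover then have "pairwise orthogonal Z" using C(1) by (auto simp: \<A>_def)
   ultimately show "orthogonal x y" using \<open>x \<noteq> y\<close> by (auto simp: pairwise_def)
  qed
  moreover have "\<forall>b\<in>\<Union>C. norm b = 1" using C(1) by (auto simp: \<A>_def)
  ultimately show "\<exists>U\<in>\<A>. \<forall>X\<in>C. X \<subseteq> U" by (intro bexI[of _ "\<Union>C"]) (auto simp: \<A>_def)
 qed
 then obtain B where B: "B \<in> \<A>" "\<And>B'. B' \<in> \<A> ==> B \<subseteq> B' ==> B' = B" by blast
 have "closure (span B) = UNIV"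
 proof (rule ccontr)
  assume "closure (span B) \<noteq> UNIV"
  then obtain z where z: "z \<notin> closure (span B)" by auto
  have sub: "subspace (closure (span B))" by (simp add: subspace_closure)
  obtain x where x: "x - z \<in> closure (span B)" "\<And>v. v \<in> closure (span B) ==> x \<bullet> v = 0"
   using closed_affine_min_norm_orthogonal[OF closed_closure sub] by blast
  have "x \<noteq> 0" using x(1) z subspace_neg[OF sub] by fastforce
  define u where "u = x /\<^sub>R norm x"
  have u: "norm u = 1" using \<open>x \<noteq> 0\<close> by (simp add: u_def)
  have ub: "u \<bullet> b = 0" if "b \<in> B" for b
   using x(2)[of b] that closure_subset[of "span B"] span_base[of b B] by (auto simp: u_def)
  have "insert u B \<in> \<A>" using B(1) u ub
   by (auto simp: \<A>_def pairwise_insert orthogonal_def inner_commute)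
  from B(2)[OF this] have "u \<in> B" by auto
  from ub[OF this] u show False by (simp add: norm_eq_sqrt_inner)
 qed
 with B(1) show ?thesis by (auto simp: is_onb_def \<A>_def)
qed

lemma is_onb_some_onb: "is_onb (some_onb :: 'a::{real_inner,banach} set)"
 unfolding some_onb_def by (rule someI_ex) (rule is_onb_exists)

text \<open>On finite combinations of basis vectors this is Cauchy--Schwarz for the coefficients;
  density of the span and continuity do the rest. It is how Hilbert--Schmidt convergence of
  integrands is exploited on single vectors.\<close>

lemma hs_norm_sq_bound:
 fixes B :: "'a::{real_inner,banach} => 'b::real_inner"
 assumes "bounded_linear B"
 shows "ennreal ((norm (B x))\<^sup>2) \<le> hs_norm_sq B * ennreal ((norm x)\<^sup>2)"
proof (cases "hs_norm_sq B = \<infinity>")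
 case True
 \<comment> \<open>At \<open>x = 0\<close> both sides are 0, as infinity times 0 is 0; elsewhere the
   right side is infinite.\<close>
 then show ?thesis by (cases "x = 0") (auto simp: ennreal_top_mult linear_0[OF bounded_linear.linear[OF assms]])
next
 case False
 interpret B: bounded_linear B by fact
 define \<B> where "\<B> = (some_onb :: 'a set)"
 have \<B>: "pairwise orthogonal \<B>" "\<And>b. b \<in> \<B> ==> norm b = 1" "closure (span \<B>) = UNIV"
  using is_onb_some_onb unfolding is_onb_def \<B>_def by auto
 obtain K where K: "hs_norm_sq B = ennreal K" "K \<ge> 0" using False by (cases "hs_norm_sq B") auto
 have fin: "(\<Sum>b\<in>F. (norm (B b))\<^sup>2) \<le> K" if "finite F" "F \<subseteq> \<B>" for F
 proof -
  have "ennreal (\<Sum>b\<in>F. (norm (B b))\<^sup>2) = (\<Sum>b\<in>F. ennreal ((norm (B b))\<^sup>2))" by simp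
  also have "\<dots> \<le> infsum (\<lambda>b. ennreal ((norm (B b))\<^sup>2)) \<B>"
   using that by (subst nonneg_infsum_complete) (auto intro!: SUP_upper)
  also have "\<dots> = ennreal K" using K by (simp add: hs_norm_sq_def \<B>_def)
  finally show ?thesis using K by simp
 qed
 have span: "(norm (B y))\<^sup>2 \<le> K * (norm y)\<^sup>2" if "y \<in> span \<B>" for y
 proof -
  from that obtain F r where F: "finite F" "F \<subseteq> \<B>" and y: "y = (\<Sum>b\<in>F. r b *\<^sub>R b)"
   by (auto simp: span_explicit)
  have ny: "(norm y)\<^sup>2 = (\<Sum>b\<in>F. (r b)\<^sup>2)"
  proof -
   have "(norm y)\<^sup>2 = (\<Sum>b\<in>F. (norm (r b *\<^sub>R b))\<^sup>2)"
    unfolding y using F \<B>(1)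
    by (intro norm_sum_Pythagorean) (auto simp: pairwise_def orthogonal_def)
   also have "\<dots> = (\<Sum>b\<in>F. (r b)\<^sup>2)"
    using F \<B>(2) by (intro sum.cong) (auto simp: power_mult_distrib)
   finally show ?thesis .
  qed
  have "norm (B y) \<le> (\<Sum>b\<in>F. \<bar>r b\<bar> * norm (B b))"
   unfolding y B.sum B.scaleR by (rule order_trans[OF norm_sum]) simp
  also have "\<dots> \<le> L2_set r F * L2_set (\<lambda>b. norm (B b)) F"
   using L2_set_mult_ineq[of r "\<lambda>b. norm (B b)" F] by (simp add: abs_mult)
  finally have "(norm (B y))\<^sup>2 \<le> (L2_set r F * L2_set (\<lambda>b. norm (B b)) F)\<^sup>2"
   by (intro power_mono) auto
  also have "\<dots> = (\<Sum>b\<in>F. (r b)\<^sup>2) * (\<Sum>b\<in>F. (norm (B b))\<^sup>2)"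
   by (simp add: L2_set_def power_mult_distrib sum_nonneg)
  also have "\<dots> \<le> (\<Sum>b\<in>F. (r b)\<^sup>2) * K" by (intro mult_left_mono fin F sum_nonneg) auto
  finally show ?thesis by (simp add: ny mult.commute)
 qed
 have "(norm (B x))\<^sup>2 \<le> K * (norm x)\<^sup>2"
 proof -
  have "x \<in> closure (span \<B>)" using \<B>(3) by simp
  then obtain y where y: "\<And>n. y n \<in> span \<B>" "y \<longlonglongrightarrow> x" by (auto simp: closure_sequential)
  have "(\<lambda>n. (norm (B (y n)))\<^sup>2) \<longlonglongrightarrow> (norm (B x))\<^sup>2"
   by (intro tendsto_intros B.tendsto y)
  moreover have "(\<lambda>n. K * (norm (y n))\<^sup>2) \<longlonglongrightarrow> K * (norm x)\<^sup>2"
   by (intro tendsto_intros y)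
  ultimately show ?thesis using span[OF y(1)] by (intro LIMSEQ_le) auto
 qed
 then show ?thesis using K by (simp add: K(1) flip: ennreal_mult)
qed

section \<open>Strongly continuous semigroups\<close>

text \<open>Uniform boundedness by Baire's theorem: the closed sets \<open>G n\<close> of vectors
  whose orbit is bounded by \<open>n\<close> up to time \<open>1 / (n + 1)\<close> cover the space,
  by strong continuity at 0, so one of them contains a ball.\<close>

lemma C0_semigroup_bounded_near_0:
 fixes S :: "real => 'a::banach => 'a"
 assumes "C0_semigroup S"
 obtains d M where "d > 0" "\<And>t x. 0 \<le> t ==> t \<le> d ==> norm (S t x) \<le> M * norm x"
proof -
 have S: "bounded_linear (S t)" if "t \<ge> 0" for t using assms that by (auto simp: C0_semigroup_def)
 define G where "G n = {x. \<forall>t\<in>{0..inverse (real (Suc n))}. norm (S t x) \<le> real n}" for n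
 have cl: "closed (G n)" for n
 proof -
  have "G n = (\<Inter>t\<in>{0..inverse (real (Suc n))}. {x. norm (S t x) \<le> real n})"
   by (auto simp: G_def)
  moreover have "closed {x. norm (S t x) \<le> real n}" if "t \<ge> 0" for t
   by (intro closed_Collect_le continuous_intros linear_continuous_on[OF S[OF that]])
  ultimately show ?thesis by (auto intro!: closed_INT)
 qed
 have cover: "x \<in> (\<Union>n. G n)" for x
 proof -
  have "((\<lambda>t. S t x) \<longlongrightarrow> x) (at_right 0)" using assms by (auto simp: C0_semigroup_def)
  then have "eventually (\<lambda>t. dist (S t x) x < 1) (at_right 0)" by (rule tendstoD) simp
  then obtain b where b: "b > 0" "\<And>t. 0 < t ==> t < b ==> dist (S t x) x < 1"
   by (auto simp: eventually_at_right_field)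
  have bd: "norm (S t x) \<le> norm x + 1" if "0 \<le> t" "t < b" for t
  proof (cases "t = 0")
   case True then show ?thesis using assms by (simp add: C0_semigroup_def)
  next
   case False
   then have "norm (S t x - x) < 1" using b(2)[of t] that by (simp add: dist_norm)
   then show ?thesis using norm_triangle_ineq2[of "S t x" x] by linarith
  qed
  \<comment> \<open>\<open>n1\<close> shortens the time window, \<open>n2\<close> raises the level;
    their maximum does both.\<close>
  obtain n1 where n1: "inverse (real (Suc n1)) < b" using reals_Archimedean[OF b(1)] by auto
  obtain n2 where n2: "norm x + 1 \<le> real n2" using real_arch_simple by blast
  have "x \<in> G (max n1 n2)"
   unfolding G_def
  proof (intro CollectI ballI)
   fix t assume t: "t \<in> {0..inverse (real (Suc (max n1 n2)))}"
   have "inverse (real (Suc (max n1 n2))) \<le> inverse (real (Suc n1))" by (simp add: field_simps)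
   then have "t < b" using t n1 by (meson atLeastAtMost_iff le_less_trans)
   then have "norm (S t x) \<le> norm x + 1" using t by (intro bd) auto
   also have "\<dots> \<le> real (max n1 n2)" using n2 by simp
   finally show "norm (S t x) \<le> real (max n1 n2)" .
  qed
  then show ?thesis by blast
 qed
 have "\<exists>n. interior (G n) \<noteq> {}"
 proof (rule ccontr)
  assume "\<not> ?thesis"
  then have "euclidean interior_of \<Union>(range G) = {}"
   using cl by (intro Baire_category_alt) (auto simp: completely_metrizable_space_euclidean)
  moreover have "\<Union>(range G) = UNIV" using cover by blast
  ultimately show False by simp
 qed
 then obtain n x0 where "x0 \<in> interior (G n)" by blast
 then obtain r where r: "r > 0" "cball x0 r \<subseteq> G n" by (auto simp: mem_interior_cball)
 show thesis
 proof (rule that)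
  show "inverse (real (Suc n)) > 0" by simp
  fix t x assume t: "0 \<le> t" "t \<le> inverse (real (Suc n))"
  interpret St: bounded_linear "S t" by (rule S) fact
  have Gn: "norm (S t y) \<le> real n" if "y \<in> G n" for y using that t by (auto simp: G_def)
  show "norm (S t x) \<le> (2 * real n / r) * norm x"
  proof (cases "x = 0")
   case False
   define y where "y = (r / norm x) *\<^sub>R x"
   have "norm y = r" using False r by (simp add: y_def)
   have "S t y = S t (x0 + y) - S t x0" by (simp add: St.add)
   also have "norm \<dots> \<le> real n + real n"
    using r \<open>norm y = r\<close>
    by (intro order_trans[OF norm_triangle_ineq4] add_mono Gn subsetD[OF r(2)]) (auto simp: dist_norm)
   finally have "(r / norm x) * norm (S t x) \<le> 2 * real n" using r by (simp add: y_def St.scaleR)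
   then show ?thesis using r False by (simp add: field_simps)
  qed (simp add: St.zero)
 qed
qed

text \<open>The semigroup law composes enough short steps to reach \<open>T\<close>, each of which
  costs one factor of the short-time bound.\<close>

lemma C0_semigroup_bounded:
 fixes S :: "real => 'a::banach => 'a"
 assumes "C0_semigroup S"
 obtains M where "M \<ge> 1" "\<And>t x. 0 \<le> t ==> t \<le> T ==> norm (S t x) \<le> M * norm x"
proof -
 obtain d M0 where d: "d > 0" and M0: "\<And>t x. 0 \<le> t ==> t \<le> d ==> norm (S t x) \<le> M0 * norm x"
  using C0_semigroup_bounded_near_0[OF assms] by blast
 \<comment> \<open>At least 1, so that its powers increase with the number of steps.\<close>
 define M where "M = max 1 M0"
 have M: "norm (S t x) \<le> M * norm x" if "0 \<le> t" "t \<le> d" for t x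
 proof -
  have "M0 * norm x \<le> M * norm x" by (intro mult_right_mono) (auto simp: M_def)
  with M0[OF that, of x] show ?thesis by linarith
 qed
 have pow: "norm (S t x) \<le> M ^ Suc n * norm x" if "0 \<le> t" "t \<le> real (Suc n) * d" for n t x
  using that
 proof (induction n arbitrary: t)
  case 0 then show ?case using M by simp
 next
  case (Suc n)
  have M1: "M \<ge> 1" by (simp add: M_def)
  show ?case
  proof (cases "t \<le> d")
   case True
   have "M * 1 \<le> M * M ^ Suc n" using M1 by (intro mult_left_mono one_le_power) auto
   then have "M * norm x \<le> M ^ Suc (Suc n) * norm x" by (intro mult_right_mono) auto
   with M[OF Suc.prems(1) True, of x] show ?thesis by linarith
  next
   case False
   have "S t x = S d (S (t - d) x)"
   proof -
    have "S (d + (t - d)) = S d \<circ> S (t - d)"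
     using assms False d unfolding C0_semigroup_def by (meson less_eq_real_def linorder_not_le diff_ge_0_iff_ge)
    then show ?thesis by simp
   qed
   then have "norm (S t x) \<le> M * norm (S (t - d) x)" using M[of d] d by simp
   also have "\<dots> \<le> M * (M ^ Suc n * norm x)"
    using False Suc.prems M1 by (intro mult_left_mono Suc.IH) (auto simp: algebra_simps)
   finally show ?thesis by (simp add: mult.assoc)
  qed
 qed
 obtain n where n: "T / d \<le> real n" using real_arch_simple by blast
 show thesis
 proof (rule that)
  show "M ^ Suc n \<ge> 1" by (rule one_le_power) (simp add: M_def)
  fix t x assume t: "0 \<le> t" "t \<le> T"
  have "T \<le> real n * d" using n d by (simp add: field_simps)
  also have "\<dots> \<le> real (Suc n) * d" using d by (intro mult_right_mono) auto
  finally show "norm (S t x) \<le> M ^ Suc n * norm x" using t by (intro pow) auto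
 qed
qed

text \<open>The operator of the smaller time factors out and costs \<open>M\<close>; continuity at
  any time is thereby reduced to continuity at 0.\<close>

lemma C0_semigroup_diff_le:
 assumes S: "C0_semigroup S"
  and M: "\<And>t x. 0 \<le> t ==> t \<le> T ==> norm (S t x) \<le> M * norm x"
  and "0 \<le> s" "s \<le> T" "0 \<le> t" "t \<le> T"
 shows "norm (S s x - S t x) \<le> M * norm (S \<bar>s - t\<bar> x - x)"
proof -
 have *: "norm (S (a + r) x - S a x) \<le> M * norm (S r x - x)" if "0 \<le> a" "a \<le> T" "0 \<le> r" for a r
 proof -
  have "S (a + r) x - S a x = S a (S r x - x)"
   using S that by (simp add: C0_semigroup_def linear_diff[OF bounded_linear.linear])
  then show ?thesis using M[OF that(1,2)] by simp
 qed
 show ?thesis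
 proof (cases "s \<le> t")
  case True then show ?thesis using *[of s "t - s"] assms(3-) by (simp add: norm_minus_commute)
 next
  case False then show ?thesis using *[of t "s - t"] assms(3-) by simp
 qed
qed

lemma C0_semigroup_continuous_on:
 fixes S :: "real => 'a::banach => 'a"
 assumes "C0_semigroup S"
 shows "continuous_on ({0..} \<times> UNIV) (\<lambda>(t, x). S t x)"
 unfolding continuous_on_sequentially
proof (intro allI impI ballI)
 fix u :: "nat => real \<times> 'a" and a
 assume a: "a \<in> {0..} \<times> UNIV" and u: "(\<forall>n. u n \<in> {0..} \<times> UNIV) \<and> u \<longlonglongrightarrow> a"
 obtain t x where tx: "a = (t, x)" "t \<ge> 0" using a by auto
 have lim: "(\<lambda>n. fst (u n)) \<longlonglongrightarrow> t" "(\<lambda>n. snd (u n)) \<longlonglongrightarrow> x"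
  using u tx tendsto_fst[of u a] tendsto_snd[of u a] by auto
 obtain M where M: "M \<ge> 1" "\<And>s x. 0 \<le> s ==> s \<le> t + 1 ==> norm (S s x) \<le> M * norm x"
  using C0_semigroup_bounded[OF assms, of "t + 1"] by blast
 have ev: "eventually (\<lambda>n. fst (u n) < t + 1) sequentially"
  using lim(1) by (rule order_tendstoD) simp
 have S0: "((\<lambda>r. S r x) \<longlongrightarrow> x) (at 0 within {0..})"
 proof -
  have "((\<lambda>r. S r x) \<longlongrightarrow> x) (at_right 0)" using assms by (simp add: C0_semigroup_def)
  then show ?thesis by (simp add: at_within_Ici_at_right)
 qed
 have "(\<lambda>n. S \<bar>fst (u n) - t\<bar> x) \<longlonglongrightarrow> x"
 proof -
  have c: "continuous (at 0 within {0..}) (\<lambda>r. S r x)"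
   using S0 assms by (simp add: continuous_within C0_semigroup_def)
  have "(\<lambda>n. \<bar>fst (u n) - t\<bar>) \<longlonglongrightarrow> \<bar>t - t\<bar>" by (intro tendsto_intros lim)
  then have "((\<lambda>r. S r x) \<circ> (\<lambda>n. \<bar>fst (u n) - t\<bar>)) \<longlonglongrightarrow> S 0 x"
   using c unfolding continuous_within_sequentially by auto
  then show ?thesis using assms by (simp add: o_def C0_semigroup_def)
 qed
 then have "(\<lambda>n. M * norm (S \<bar>fst (u n) - t\<bar> x - x) + M * norm (snd (u n) - x)) \<longlonglongrightarrow> M * norm (x - x) + M * norm (x - x)"
  by (intro tendsto_intros lim)
 then have "(\<lambda>n. M * norm (S \<bar>fst (u n) - t\<bar> x - x) + M * norm (snd (u n) - x)) \<longlonglongrightarrow> 0" by simp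
 then have "(\<lambda>n. S (fst (u n)) (snd (u n)) - S t x) \<longlonglongrightarrow> 0"
 proof (rule Lim_null_comparison[rotated])
  show "\<forall>\<^sub>F n in sequentially. norm (S (fst (u n)) (snd (u n)) - S t x) \<le> M * norm (S \<bar>fst (u n) - t\<bar> x - x) + M * norm (snd (u n) - x)"
   using ev
  proof eventually_elim
   case (elim n)
   have un: "0 \<le> fst (u n)" using u by (auto simp: mem_Times_iff)
   have "bounded_linear (S (fst (u n)))" using assms un by (simp add: C0_semigroup_def)
   then have "S (fst (u n)) (snd (u n)) - S t x = (S (fst (u n)) x - S t x) + S (fst (u n)) (snd (u n) - x)"
    by (simp add: linear_diff[OF bounded_linear.linear])
   also have "norm \<dots> \<le> M * norm (S \<bar>fst (u n) - t\<bar> x - x) + M * norm (snd (u n) - x)"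
    using un elim tx(2)
    by (intro order_trans[OF norm_triangle_ineq] add_mono M(2) C0_semigroup_diff_le[OF assms M(2)]) auto
   finally show ?case .
  qed
 qed
 then have "(\<lambda>n. S (fst (u n)) (snd (u n))) \<longlonglongrightarrow> S t x" by (simp add: LIM_zero_iff)
 then show "((\<lambda>(t, x). S t x) \<circ> u) \<longlonglongrightarrow> (case a of (t, x) => S t x)"
  by (simp add: o_def case_prod_beta tx(1))
qed

section \<open>Characteristic functions determine finite measures\<close>

lemma sets_Collect_mem:
 assumes "f \<in> measurable M N" "B \<in> sets N"
 shows "{x\<in>space M. f x \<in> B} \<in> sets M"
proof -
 have "{x\<in>space M. f x \<in> B} = f -` B \<inter> space M" by auto
 then show ?thesis using measurable_sets[OF assms] by simp
qed

lemma borel_measurable_cis [measurable]: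
 "f \<in> borel_measurable M ==> (\<lambda>x. cis (f x)) \<in> borel_measurable M"
 by (intro borel_measurable_continuous_on[of cis]) (auto intro!: continuous_intros)

lemma (in finite_measure) integrable_cis:
 assumes "f \<in> borel_measurable M"
 shows "integrable M (\<lambda>x. cis (f x))"
 using assms by (intro integrable_const_bound[of _ 1]) auto

text \<open>Levy's uniqueness theorem speaks about probability distributions. The value at
  \<open>t = 0\<close> shows that the total masses agree, so both measures are divided by this mass;
  if it is 0, both vanish.\<close>

lemma finite_measure_real_eqI_char:
 fixes M N :: "real measure"
 assumes M: "finite_measure M" "sets M = sets borel"
  and N: "finite_measure N" "sets N = sets borel"
  and eq: "\<And>t. (LINT x|M. cis (t * x)) = (LINT x|N. cis (t * x))"
 shows "M = N"
proof -
 interpret M: finite_measure M by fact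
 interpret N: finite_measure N by fact
 have sp: "space M = UNIV" "space N = UNIV" using M(2) N(2) by (auto dest: sets_eq_imp_space_eq)
 define c where "c = measure M UNIV"
 have cN: "measure N UNIV = c"
 proof -
  have "complex_of_real (measure M UNIV) = complex_of_real (measure N UNIV)"
   using eq[of 0] sp by (simp add: cis_zero scaleR_conv_of_real)
  then show ?thesis by (simp add: c_def)
 qed
 have emM: "emeasure M UNIV = ennreal c" and emN: "emeasure N UNIV = ennreal c"
  using M.emeasure_eq_measure[of UNIV] N.emeasure_eq_measure[of UNIV] cN by (auto simp: c_def)
 show ?thesis
 proof (cases "c = 0")
  case True
  show ?thesis
  proof (rule measure_eqI)
   show "sets M = sets N" using M N by simp
   fix A assume "A \<in> sets M"
   have "emeasure M A \<le> emeasure M UNIV" "emeasure N A \<le> emeasure N UNIV"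
    using M(2) N(2) by (auto intro!: emeasure_mono)
   then show "emeasure M A = emeasure N A" using True emM emN by simp
  qed
 next
  case False
  then have c: "c > 0" using measure_nonneg[of M UNIV] by (simp add: c_def less_le)
  have rd: "real_distribution (density K (\<lambda>_. ennreal (1/c)))"
   if "sets K = sets borel" "emeasure K UNIV = ennreal c" for K :: "real measure"
  proof -
   have spK: "space K = UNIV" using that(1) by (auto dest: sets_eq_imp_space_eq)
   have "emeasure (density K (\<lambda>_. ennreal (1/c))) UNIV = 1"
    using that c spK sets.top[of K] by (simp add: emeasure_density_const flip: ennreal_mult)
   then have "prob_space (density K (\<lambda>_. ennreal (1/c)))" using spK by (intro prob_spaceI) simp
   then show ?thesis using that(1) spK
    by (auto simp: real_distribution_def real_distribution_axioms_def)
  qed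
  have ch: "char (density K (\<lambda>_. ennreal (1/c))) t = (1/c) *\<^sub>R (LINT x|K. cis (t * x))"
   if "sets K = sets borel" "emeasure K UNIV = ennreal c" for K :: "real measure" and t
  proof -
   have [measurable_cong]: "sets K = sets borel" by fact
   have "char (density K (\<lambda>_. ennreal (1/c))) t = (LINT x|K. (1/c) *\<^sub>R cis (t * x))"
    unfolding char_def cis_conv_exp[symmetric] using c
    by (subst integral_density) auto
   then show ?thesis by simp
  qed
  have "density M (\<lambda>_. ennreal (1/c)) = density N (\<lambda>_. ennreal (1/c))"
   by (intro Levy_uniqueness rd M N emM emN ext) (simp add: ch M N emM emN eq)
  then have D: "ennreal (1/c) * emeasure M A = ennreal (1/c) * emeasure N A" if "A \<in> sets borel" for A
   using that M(2) N(2) by (metis emeasure_density_const)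
  show ?thesis
  proof (rule measure_eqI)
   show "sets M = sets N" using M N by simp
   fix A assume "A \<in> sets M"
   then have "ennreal (1/c) * emeasure M A = ennreal (1/c) * emeasure N A" using M(2) D by simp
   then have "ennreal c * (ennreal (1/c) * emeasure M A) = ennreal c * (ennreal (1/c) * emeasure N A)" by simp
   then show "emeasure M A = emeasure N A" using c
    by (simp add: mult.assoc[symmetric] ennreal_mult[symmetric])
  qed
 qed
qed

text \<open>The hypothesis says that the images under \<open>f\<close> of the two measures with
  density \<open>w\<close> have the same characteristic function. Hence these images agree and may
  be tested with any indicator.\<close>

lemma integral_indicator_eqI_char:
 fixes f w :: "'a => real"
 assumes M: "finite_measure M" and N: "finite_measure N" and sets: "sets M = sets N"
  and f: "f \<in> borel_measurable M" and w: "w \<in> borel_measurable M"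
  and w_bd: "\<And>x. 0 \<le> w x" "\<And>x. w x \<le> c" and B: "B \<in> sets borel"
  and eq: "\<And>t. (LINT x|M. w x *\<^sub>R cis (t * f x)) = (LINT x|N. w x *\<^sub>R cis (t * f x))"
 shows "(LINT x|M. indicator B (f x) * w x) = (LINT x|N. indicator B (f x) * w x)"
proof -
 define D where "D K = distr (density K (\<lambda>x. ennreal (w x))) borel f" for K
 have fin: "finite_measure (D K)"
  and int: "(\<integral>y. F y \<partial>D K) = (LINT x|K. w x *\<^sub>R F (f x))"
  if K: "finite_measure K" "sets K = sets M" and F: "F \<in> borel_measurable borel"
  for K and F :: "real => 'b::{banach,second_countable_topology}"
 proof -
  interpret K: finite_measure K by fact
  have [measurable]: "f \<in> borel_measurable K" "w \<in> borel_measurable K"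
   using f w K(2) by (auto cong: measurable_cong_sets)
  have "emeasure (D K) UNIV = (\<integral>\<^sup>+x. ennreal (w x) \<partial>K)"
   unfolding D_def by (subst emeasure_distr) (auto simp: emeasure_density intro!: nn_integral_cong)
  also have "\<dots> \<le> (\<integral>\<^sup>+x. ennreal c \<partial>K)" using w_bd by (intro nn_integral_mono) (auto intro: ennreal_leI)
  also have "\<dots> < \<infinity>" using K.emeasure_finite[of "space K"]
   by (simp add: ennreal_mult_eq_top_iff less_top[symmetric])
  finally show "finite_measure (D K)" by (intro finite_measureI) (simp add: D_def)
  show "(\<integral>y. F y \<partial>D K) = (LINT x|K. w x *\<^sub>R F (f x))"
   unfolding D_def using w_bd F by (subst integral_distr) (auto simp: integral_density)
 qed
 have "D M = D N"
 proof (rule finite_measure_real_eqI_char)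
  show "finite_measure (D M)" "finite_measure (D N)"
   using fin[of M "\<lambda>_. 0 :: real"] fin[of N "\<lambda>_. 0 :: real"] M N sets by auto
  fix t
  show "(\<integral>x. cis (t * x) \<partial>D M) = (\<integral>x. cis (t * x) \<partial>D N)"
   using int[OF M, of "\<lambda>x. cis (t * x)"] int[OF N, of "\<lambda>x. cis (t * x)"] sets eq[of t]
   by simp
 qed (auto simp: D_def)
 moreover have "indicat_real B \<in> borel_measurable borel" using B by simp
 ultimately show ?thesis using int[OF M, of "indicat_real B"] int[OF N, of "indicat_real B"] sets
  by (simp add: mult.commute)
qed

text \<open>Restriction to an event \<open>f x \<in> B\<close> must preserve equality of
  characteristic functions on \<open>V\<close>, so that events can be imposed one at a time. The
  factor \<open>cis (g x)\<close> is not a density, but \<open>1 + cos (g x)\<close> and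
  \<open>1 + sin (g x)\<close> lie between 0 and 2, and together with the constant density 1 they
  recover it.\<close>

lemma integral_restrict_eqI_char:
 fixes V :: "('a => real) set"
 assumes M: "finite_measure M" and N: "finite_measure N" and sets: "sets M = sets N"
  and V: "\<And>f. f \<in> V ==> f \<in> borel_measurable M"
  and V_add: "\<And>f g. f \<in> V ==> g \<in> V ==> (\<lambda>x. f x + g x) \<in> V"
  and V_scale: "\<And>f c. f \<in> V ==> (\<lambda>x. c * f x) \<in> V"
  and eq: "\<And>f. f \<in> V ==> (LINT x|M. cis (f x)) = (LINT x|N. cis (f x))"
  and f: "f \<in> V" and g: "g \<in> V" and B: "B \<in> sets borel"
 shows "(LINT x|M. indicator B (f x) *\<^sub>R cis (g x)) = (LINT x|N. indicator B (f x) *\<^sub>R cis (g x))"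
proof -
 interpret M: finite_measure M by fact
 interpret N: finite_measure N by fact
 have VN: "f \<in> borel_measurable N" if "f \<in> V" for f
  using V[OF that] sets by (auto cong: measurable_cong_sets)
 note [measurable] = V[OF f] V[OF g] VN[OF f] VN[OF g] B
 have comb: "(\<lambda>x. t * f x + s * g x) \<in> V" for s t by (intro V_add V_scale f g)
 have intM: "integrable M (\<lambda>x. cis (t * f x + s * g x))"
  and intN: "integrable N (\<lambda>x. cis (t * f x + s * g x))" for s t
  using M.integrable_cis[OF V[OF comb]] N.integrable_cis[OF VN[OF comb]] by auto
 \<comment> \<open>Products with \<open>cos\<close> and \<open>sin\<close> are combinations of
   characters of members of \<open>V\<close>; this is where closure of \<open>V\<close> under sums
   and multiples enters.\<close>
 have cos_eq: "complex_of_real (cos (g x)) * cis (t * f x) = (1/2) * (cis (t * f x + 1 * g x) + cis (t * f x + (-1) * g x))"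
  and sin_eq: "complex_of_real (sin (g x)) * cis (t * f x) = (1/(2*\<i>)) * (cis (t * f x + 1 * g x) - cis (t * f x + (-1) * g x))"
  for t x
  by (auto simp: complex_eq_iff cos_add sin_add cos_diff sin_diff Re_divide Im_divide power2_eq_square field_simps)
 have base: "(LINT x|M. 1 *\<^sub>R cis (t * f x)) = (LINT x|N. 1 *\<^sub>R cis (t * f x))" for t
  using eq[OF V_scale[OF f]] by simp
 have W: "(LINT x|M. (1 + u (g x)) *\<^sub>R cis (t * f x)) = (LINT x|N. (1 + u (g x)) *\<^sub>R cis (t * f x))"
  if u: "u = cos \<or> u = sin" for u t
 proof -
  obtain a b where ab: "\<And>x. complex_of_real (u (g x)) * cis (t * f x) =
    a * (cis (t * f x + 1 * g x) + b * cis (t * f x + (-1) * g x))"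
  proof (cases "u = cos")
   case True then show thesis using cos_eq by (intro that[of "1/2" 1]) simp
  next
   case False then have "u = sin" using u by simp
   then show thesis using sin_eq by (intro that[of "1/(2*\<i>)" "-1"]) simp
  qed
  have "(1 + u (g x)) *\<^sub>R cis (t * f x) = cis (t * f x + 0 * g x) +
    a * (cis (t * f x + 1 * g x) + b * cis (t * f x + (-1) * g x))" for x
   by (simp add: scaleR_conv_of_real distrib_right ab)
  then have ex: "(LINT x|K. (1 + u (g x)) *\<^sub>R cis (t * f x)) = (LINT x|K. cis (t * f x + 0 * g x)) +
    a * ((LINT x|K. cis (t * f x + 1 * g x)) + b * (LINT x|K. cis (t * f x + (-1) * g x)))"
   if K: "\<And>s. integrable K (\<lambda>x. cis (t * f x + s * g x))" for K
   using K[of 0] K[of 1] K[of "-1"]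
   by (simp only: Bochner_Integration.integral_add Bochner_Integration.integral_mult_right_zero
    integrable_mult_right Bochner_Integration.integrable_add simp_thms)
  show ?thesis unfolding ex[OF intM] ex[OF intN] eq[OF comb] ..
 qed
 have i1: "(LINT x|M. indicator B (f x) * 1) = (LINT x|N. indicator B (f x) * (1::real))"
  by (rule integral_indicator_eqI_char[OF M N sets V[OF f] _ _ _ B base, where c=1]) auto
 have ib: "integrable M (\<lambda>x. indicator B (f x) * u (g x))" "integrable N (\<lambda>x. indicator B (f x) * u (g x))"
  if "u = cos \<or> u = sin" for u :: "real => real"
  using that by (auto intro!: M.integrable_const_bound[of _ 1] N.integrable_const_bound[of _ 1] simp: abs_mult split: split_indicator)
 have I: "integrable M (\<lambda>x. indicat_real B (f x))" "integrable N (\<lambda>x. indicat_real B (f x))"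
  by (auto intro!: M.integrable_const_bound[of _ 1] N.integrable_const_bound[of _ 1] split: split_indicator)
 have i2: "(LINT x|M. indicator B (f x) * u (g x)) = (LINT x|N. indicator B (f x) * u (g x))"
  if u: "u = cos \<or> u = sin" for u :: "real => real"
 proof -
  have ub: "0 \<le> 1 + u y" "1 + u y \<le> 2" for y
   using u cos_ge_minus_one[of y] sin_ge_minus_one[of y] cos_le_one[of y] sin_le_one[of y] by (elim disjE; simp only:; linarith)+
  have [measurable]: "u \<in> borel_measurable borel" using u by auto
  have "(LINT x|M. indicator B (f x) * (1 + u (g x))) = (LINT x|N. indicator B (f x) * (1 + u (g x)))"
   by (rule integral_indicator_eqI_char[OF M N sets V[OF f] _ _ _ B W[OF u], where c=2]) (use ub in auto)
  then show ?thesis using i1 ib[OF u] I by (simp add: distrib_left)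
 qed
 have Re: "Re (LINT x|K. indicator B (f x) *\<^sub>R cis (g x)) = (LINT x|K. indicator B (f x) * cos (g x))"
  and Im: "Im (LINT x|K. indicator B (f x) *\<^sub>R cis (g x)) = (LINT x|K. indicator B (f x) * sin (g x))"
  if "integrable K (\<lambda>x. indicat_real B (f x) *\<^sub>R cis (g x))" for K
  using that by (subst integral_Re[symmetric] integral_Im[symmetric], simp, simp)+
 have "integrable M (\<lambda>x. indicat_real B (f x) *\<^sub>R cis (g x))" "integrable N (\<lambda>x. indicat_real B (f x) *\<^sub>R cis (g x))"
  by (auto intro!: M.integrable_const_bound[of _ 1] N.integrable_const_bound[of _ 1] split: split_indicator)
 then show ?thesis by (simp add: complex_eq_iff Re Im i2)
qed

text \<open>Induction on the list: restricted to the first event, both measures still have equal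
  characteristic functions on \<open>V\<close>, so the induction hypothesis applies to the
  restrictions. This is why \<open>M\<close> and \<open>N\<close> vary in the induction.\<close>

lemma emeasure_cylinder_eqI_char:
 fixes V :: "('a => real) set"
 assumes "finite_measure M" "finite_measure N" and "sets M = sets N"
  and V: "\<And>f. f \<in> V ==> f \<in> borel_measurable M"
  and V_add: "\<And>f g. f \<in> V ==> g \<in> V ==> (\<lambda>x. f x + g x) \<in> V"
  and V_scale: "\<And>f c. f \<in> V ==> (\<lambda>x. c * f x) \<in> V"
  and V0: "V \<noteq> {}"
  and "\<And>f. f \<in> V ==> (LINT x|M. cis (f x)) = (LINT x|N. cis (f x))"
  and "\<And>f B. (f, B) \<in> set fs ==> f \<in> V \<and> B \<in> sets borel"
 shows "emeasure M {x\<in>space M. \<forall>(f, B)\<in>set fs. f x \<in> B} = emeasure N {x\<in>space M. \<forall>(f, B)\<in>set fs. f x \<in> B}"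
 using assms
proof (induction fs arbitrary: M N)
 case Nil
 interpret M: finite_measure M by fact
 interpret N: finite_measure N by fact
 have "space M = space N" using Nil.prems(3) by (rule sets_eq_imp_space_eq)
 obtain f where "f \<in> V" using V0 by auto
 from Nil.prems(8)[OF Nil.prems(6)[OF this, of 0]]
 have "complex_of_real (measure M (space M)) = complex_of_real (measure N (space N))"
  by (simp add: cis_zero scaleR_conv_of_real)
 then show ?case using \<open>space M = space N\<close>
  by (simp add: M.emeasure_eq_measure N.emeasure_eq_measure)
next
 case (Cons fB fs)
 obtain f B where fB: "fB = (f, B)" by force
 interpret M: finite_measure M by fact
 interpret N: finite_measure N by fact
 have f: "f \<in> V" and B [measurable]: "B \<in> sets borel" using Cons.prems(9)[of f B] fB by auto
 have sp: "space M = space N" using Cons.prems(3) by (rule sets_eq_imp_space_eq)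
 define D where "D K = density K (\<lambda>x. ennreal (indicator B (f x)))" for K
 have bm: "g \<in> borel_measurable K" if "g \<in> V" "sets K = sets M" for g K
  using Cons.prems(4)[OF that(1)] that(2) by (auto cong: measurable_cong_sets)
 have D: "finite_measure (D K)" if "finite_measure K" "sets K = sets M" for K
 proof -
  interpret K: finite_measure K by fact
  note [measurable] = bm[OF f that(2)]
  have "emeasure (D K) (space K) \<le> (\<integral>\<^sup>+x. 1 \<partial>K)"
   unfolding D_def by (subst emeasure_density) (auto intro!: nn_integral_mono simp del: nn_integral_const split: split_indicator)
  also have "\<dots> < \<infinity>" using K.emeasure_finite[of "space K"] by (simp add: less_top[symmetric])
  finally show ?thesis by (intro finite_measureI) (simp add: D_def)
 qed
 have DI: "(\<integral>x. cis (g x) \<partial>D K) = (LINT x|K. indicator B (f x) *\<^sub>R cis (g x))"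
  if "sets K = sets M" "g \<in> V" for K g
 proof -
  note [measurable] = bm[OF f that(1)] bm[OF that(2,1)]
  show ?thesis unfolding D_def by (subst integral_density) auto
 qed
 have D_em: "emeasure (D K) {x\<in>space M. \<forall>(f, B)\<in>set fs. f x \<in> B} = emeasure K {x\<in>space M. \<forall>(f, B)\<in>set (fB # fs). f x \<in> B}"
  if "sets K = sets M" for K
 proof -
  note [measurable] = bm[OF f that(1)]
  have m: "{x\<in>space M. \<forall>(f, B)\<in>set fs. f x \<in> B} \<in> sets K"
  proof -
   have "{x\<in>space M. \<forall>(f, B)\<in>set fs. f x \<in> B} = {x\<in>space K. \<forall>p\<in>set fs. fst p x \<in> snd p}"
    using sets_eq_imp_space_eq[OF that] by (auto simp: split_beta)
   also have "\<dots> \<in> sets K"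
   proof (intro sets.sets_Collect_finite_All)
    fix p assume p: "p \<in> set fs"
    have "fst p \<in> borel_measurable K" "snd p \<in> sets borel"
     using Cons.prems(9)[of "fst p" "snd p"] p bm[OF _ that(1)] by auto
    then show "{x \<in> space K. fst p x \<in> snd p} \<in> sets K" by (rule sets_Collect_mem)
   qed auto
   finally show ?thesis .
  qed
  have m': "{x\<in>space M. \<forall>(f, B)\<in>set (fB # fs). f x \<in> B} \<in> sets K"
  proof -
   have "{x\<in>space M. \<forall>(f, B)\<in>set (fB # fs). f x \<in> B} = {x\<in>space M. \<forall>(f, B)\<in>set fs. f x \<in> B} \<inter> {x\<in>space K. f x \<in> B}"
    using sets_eq_imp_space_eq[OF that] by (auto simp: fB)
   then show ?thesis using m by simp
  qed
  have "emeasure (D K) {x\<in>space M. \<forall>(f, B)\<in>set fs. f x \<in> B} = (\<integral>\<^sup>+x. indicator {x\<in>space M. \<forall>(f, B)\<in>set (fB # fs). f x \<in> B} x \<partial>K)"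
   unfolding D_def using m
   by (subst emeasure_density) (auto intro!: nn_integral_cong simp: fB indicator_def)
  also have "\<dots> = emeasure K {x\<in>space M. \<forall>(f, B)\<in>set (fB # fs). f x \<in> B}"
   using m' by (rule nn_integral_indicator)
  finally show ?thesis .
 qed
 have "emeasure (D M) {x\<in>space (D M). \<forall>(f, B)\<in>set fs. f x \<in> B} = emeasure (D N) {x\<in>space (D M). \<forall>(f, B)\<in>set fs. f x \<in> B}"
 proof (rule Cons.IH)
  show "finite_measure (D M)" "finite_measure (D N)" using D Cons.prems by auto
  show "sets (D M) = sets (D N)" using Cons.prems(3) by (simp add: D_def)
  show "g \<in> borel_measurable (D M)" if "g \<in> V" for g using Cons.prems(4)[OF that] by (simp add: D_def)
  show "(\<integral>x. cis (g x) \<partial>D M) = (\<integral>x. cis (g x) \<partial>D N)" if "g \<in> V" for g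
   unfolding DI[OF refl that] DI[OF Cons.prems(3)[symmetric] that]
   by (rule integral_restrict_eqI_char[OF Cons.prems(1-6,8) f that B])
  show "f \<in> V \<and> B \<in> sets borel" if "(f, B) \<in> set fs" for f B
   using that by (intro Cons.prems(9)) simp
 qed (fact Cons.prems)+
 then show ?case using D_em[of M] D_em[of N] Cons.prems(3) by (simp add: D_def)
qed

text \<open>The cylinders over finitely many members of \<open>V\<close> are a generator that is
  stable under intersection and contains the whole space. \<open>V\<close> will consist of inner
  products with vectors, or of finite linear functionals of a path.\<close>

lemma finite_measure_eqI_char:
 fixes V :: "('a => real) set"
 assumes M: "finite_measure M" and N: "finite_measure N"
  and setsM: "sets M = sigma_sets \<Omega> {{x\<in>\<Omega>. f x \<in> B} | f B. f \<in> V \<and> B \<in> sets borel}"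
  and setsN: "sets N = sets M"
  and V_add: "\<And>f g. f \<in> V ==> g \<in> V ==> (\<lambda>x. f x + g x) \<in> V"
  and V_scale: "\<And>f c. f \<in> V ==> (\<lambda>x. c * f x) \<in> V"
  and V0: "V \<noteq> {}"
  and eq: "\<And>f. f \<in> V ==> (LINT x|M. cis (f x)) = (LINT x|N. cis (f x))"
 shows "M = N"
proof -
 interpret M: finite_measure M by fact
 define G where "G = {{x\<in>\<Omega>. f x \<in> B} | f B. f \<in> V \<and> B \<in> sets (borel :: real measure)}"
 define E where "E = {{x\<in>\<Omega>. \<forall>(f, B)\<in>set fs. f x \<in> B} | fs. \<forall>(f, B)\<in>set fs. f \<in> V \<and> B \<in> sets (borel :: real measure)}"
 have GP: "G \<subseteq> Pow \<Omega>" by (auto simp: G_def)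
 have sp: "space M = \<Omega>"
  using setsM GP by (metis G_def sets_measure_of sets_eq_imp_space_eq space_measure_of)
 have Vm: "f \<in> borel_measurable M" if "f \<in> V" for f
 proof (rule measurableI)
  fix B :: "real set" assume "B \<in> sets borel"
  then have "{x\<in>\<Omega>. f x \<in> B} \<in> sets M" unfolding setsM using that by (intro sigma_sets.Basic) blast
  moreover have "f -` B \<inter> space M = {x\<in>\<Omega>. f x \<in> B}" using sp by auto
  ultimately show "f -` B \<inter> space M \<in> sets M" by simp
 qed auto
 have EM: "E \<subseteq> sets M"
 proof
  fix A assume "A \<in> E"
  then obtain fs where fs: "A = {x\<in>\<Omega>. \<forall>(f, B)\<in>set fs. f x \<in> B}" "\<forall>(f, B)\<in>set fs. f \<in> V \<and> B \<in> sets borel"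
   by (auto simp: E_def)
  have "A = {x\<in>space M. \<forall>p\<in>set fs. fst p x \<in> snd p}" using sp fs(1) by (auto simp: split_beta)
  also have "\<dots> \<in> sets M"
  proof (intro sets.sets_Collect_finite_All)
   fix p assume p: "p \<in> set fs"
   have "fst p \<in> borel_measurable M" "snd p \<in> sets borel" using fs(2) p Vm by auto
   then show "{x \<in> space M. fst p x \<in> snd p} \<in> sets M" by (rule sets_Collect_mem)
  qed auto
  finally show "A \<in> sets M" .
 qed
 have GE: "G \<subseteq> E"
 proof
  fix A assume "A \<in> G"
  then obtain f B where "A = {x\<in>\<Omega>. f x \<in> B}" "f \<in> V" "B \<in> sets borel" by (auto simp: G_def)
  then show "A \<in> E" unfolding E_def by (intro CollectI exI[of _ "[(f, B)]"]) auto
 qed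
 have ss: "sigma_sets \<Omega> E = sets M"
 proof
  show "sigma_sets \<Omega> E \<subseteq> sets M" using sets.sigma_sets_subset[of E M] EM sp by auto
  show "sets M \<subseteq> sigma_sets \<Omega> E" unfolding setsM using GE G_def by (intro sigma_sets_mono') auto
 qed
 show ?thesis
 proof (rule measure_eqI_generator_eq)
  show "Int_stable E"
  proof (rule Int_stableI)
   fix a b assume "a \<in> E" "b \<in> E"
   then obtain fs gs where
    "a = {x\<in>\<Omega>. \<forall>(f, B)\<in>set fs. f x \<in> B}" "\<forall>(f, B)\<in>set fs. f \<in> V \<and> B \<in> sets (borel :: real measure)"
    "b = {x\<in>\<Omega>. \<forall>(f, B)\<in>set gs. f x \<in> B}" "\<forall>(f, B)\<in>set gs. f \<in> V \<and> B \<in> sets (borel :: real measure)"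
    by (auto simp: E_def)
   then show "a \<inter> b \<in> E" unfolding E_def by (intro CollectI exI[of _ "fs @ gs"]) auto
  qed
  show "E \<subseteq> Pow \<Omega>" using EM sets.sets_into_space sp by blast
  fix X assume "X \<in> E"
  then obtain fs where fs: "X = {x\<in>\<Omega>. \<forall>(f, B)\<in>set fs. f x \<in> B}" "\<forall>(f, B)\<in>set fs. f \<in> V \<and> B \<in> sets borel"
   by (auto simp: E_def)
  have fsV: "\<And>f B. (f, B) \<in> set fs ==> f \<in> V \<and> B \<in> sets borel" using fs(2) by blast
  have "emeasure M {x\<in>space M. \<forall>(f, B)\<in>set fs. f x \<in> B} = emeasure N {x\<in>space M. \<forall>(f, B)\<in>set fs. f x \<in> B}"
   by (rule emeasure_cylinder_eqI_char[where V = V]; (rule M N setsN[symmetric] V0 | erule Vm | erule eq | erule fsV | erule (1) V_add | erule V_scale))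
  then show "emeasure M X = emeasure N X" using fs(1) sp by simp
 next
  show "range (\<lambda>_::nat. \<Omega>) \<subseteq> E" unfolding E_def by (auto intro!: exI[of _ "[]"])
  show "sets M = sigma_sets \<Omega> E" "sets N = sigma_sets \<Omega> E" using ss setsN by simp_all
 qed auto
qed

section \<open>Borel sets of a separable inner product space\<close>

text \<open>By separability a closed ball is a countable intersection of half-spaces, and an open
  set is a countable union of closed balls.\<close>

lemma borel_eq_sigma_inner:
 "sets (borel :: 'a::{real_inner,second_countable_topology} measure) =
   sigma_sets UNIV {{x. x \<bullet> k \<in> B} | k B. B \<in> sets borel}" (is "_ = sigma_sets UNIV ?G")
proof
 show "sigma_sets UNIV ?G \<subseteq> sets (borel :: 'a measure)"
 proof -
  have "?G \<subseteq> sets (borel :: 'a measure)"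
  proof
   fix A assume "A \<in> ?G"
   then obtain k B where "A = {x::'a. x \<bullet> k \<in> B}" "B \<in> sets borel" by blast
   then show "A \<in> sets borel"
    using sets_Collect_mem[of "\<lambda>x::'a. x \<bullet> k" borel borel B] by simp
  qed
  then show ?thesis using sets.sigma_sets_subset[of ?G "borel :: 'a measure"] by simp
 qed
 interpret S: sigma_algebra UNIV "sigma_sets UNIV ?G" by (rule sigma_algebra_sigma_sets) auto
 obtain D :: "'a set" where D: "countable D" "\<And>X. open X ==> X \<noteq> {} ==> \<exists>d\<in>D. d \<in> X"
  using countable_dense_setE by blast
 have cball: "cball a r \<in> sigma_sets UNIV ?G" if "r \<ge> 0" for a :: 'a and r
 proof -
  have "cball a r = (\<Inter>d\<in>D. {x. x \<bullet> d \<in> {..a \<bullet> d + r * norm d}})"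
  proof (intro set_eqI iffI)
   fix x assume x: "x \<in> cball a r"
   have "(x - a) \<bullet> d \<le> r * norm d" for d
   proof -
    have "(x - a) \<bullet> d \<le> norm (x - a) * norm d" by (rule norm_cauchy_schwarz)
    also have "\<dots> \<le> r * norm d" using x by (intro mult_right_mono) (auto simp: dist_norm norm_minus_commute)
    finally show ?thesis .
   qed
   then show "x \<in> (\<Inter>d\<in>D. {x. x \<bullet> d \<in> {..a \<bullet> d + r * norm d}})"
    by (auto simp: inner_diff_left algebra_simps)
  next
   fix x assume x: "x \<in> (\<Inter>d\<in>D. {x. x \<bullet> d \<in> {..a \<bullet> d + r * norm d}})"
   show "x \<in> cball a r"
   proof (rule ccontr)
    assume "x \<notin> cball a r"
    then have r: "norm (x - a) > r" by (simp add: dist_norm norm_minus_commute)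
    \<comment> \<open>A strict inequality between continuous functions of \<open>d\<close>, true at
      \<open>d = x - a\<close>; so it is also true at some point of the dense set.\<close>
    define X where "X = {d. (x - a) \<bullet> d > r * norm d}"
    show False
    proof -
     have False: "x \<noteq> a" using r that by auto
     have "open X" unfolding X_def by (intro open_Collect_less continuous_intros)
     moreover have "x - a \<in> X" using False r
      by (auto simp: X_def power2_norm_eq_inner[symmetric] power2_eq_square)
     ultimately obtain d where "d \<in> D" "d \<in> X" using D(2) by blast
     then show False using x by (auto simp: X_def inner_diff_left)
    qed
   qed
  qed
  also have "\<dots> \<in> sigma_sets UNIV ?G"
  proof (intro S.countable_INT'')
   fix d
   show "{x. x \<bullet> d \<in> {..a \<bullet> d + r * norm d}} \<in> sigma_sets UNIV ?G"
    by (intro sigma_sets.Basic CollectI exI[of _ d] exI[of _ "{..a \<bullet> d + r * norm d}"]) simp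
   show "UNIV \<in> sigma_sets UNIV ?G" by (rule S.top)
  qed (rule D(1))
  finally show ?thesis .
 qed
 have opn: "open U ==> U \<in> sigma_sets UNIV ?G" for U :: "'a set"
 proof -
  assume U: "open U"
  have "U = (\<Union>(d, n)\<in>{(d, n). d \<in> D \<and> cball d (inverse (real (Suc n))) \<subseteq> U}. cball d (inverse (real (Suc n))))"
  proof (intro set_eqI iffI)
   fix x assume "x \<in> U"
   then obtain e where e: "e > 0" "ball x e \<subseteq> U" using U by (auto simp: open_contains_ball)
   obtain n where n: "inverse (real (Suc n)) < e / 2" using reals_Archimedean[of "e/2"] e by auto
   obtain d where d: "d \<in> D" "d \<in> ball x (inverse (real (Suc n)))"
    using D(2)[of "ball x (inverse (real (Suc n)))"] by auto
   have "cball d (inverse (real (Suc n))) \<subseteq> ball x e"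
   proof
    fix y assume "y \<in> cball d (inverse (real (Suc n)))"
    then have "dist x y < inverse (real (Suc n)) + inverse (real (Suc n))"
     using d(2) dist_triangle[of x y d] by simp
    then show "y \<in> ball x e" using n by simp
   qed
   then show "x \<in> (\<Union>(d, n)\<in>{(d, n). d \<in> D \<and> cball d (inverse (real (Suc n))) \<subseteq> U}. cball d (inverse (real (Suc n))))"
    using d e(2) by (intro UN_I[of "(d, n)"]) (auto simp: dist_commute)
  next
   fix x assume "x \<in> (\<Union>(d, n)\<in>{(d, n). d \<in> D \<and> cball d (inverse (real (Suc n))) \<subseteq> U}. cball d (inverse (real (Suc n))))"
   then show "x \<in> U" by blast
  qed
  also have "\<dots> \<in> sigma_sets UNIV ?G"
  proof (rule S.countable_UN', goal_cases)
   case 1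
   have "{(d, n). d \<in> D \<and> cball d (inverse (real (Suc n))) \<subseteq> U} \<subseteq> D \<times> UNIV" by auto
   then show ?case
    by (rule countable_subset) (intro countable_SIGMA D(1) countableI_type)
  next
   case 2
   show ?case unfolding split_beta by (rule image_subsetI, rule cball) simp
  qed
  finally show ?thesis .
 qed
 show "sets (borel :: 'a measure) \<subseteq> sigma_sets UNIV ?G"
 proof -
  have "Collect open \<subseteq> sigma_sets UNIV ?G" using opn by (intro subsetI) simp
  from sigma_sets_mono[OF this] show ?thesis unfolding sets_borel[where 'a='a] .
 qed
qed


lemma borel_measurable_innerI:
 fixes f :: "'a => 'b::{real_inner,second_countable_topology}"
 assumes "\<And>k. (\<lambda>x. f x \<bullet> k) \<in> borel_measurable M"
 shows "f \<in> borel_measurable M"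
proof (rule measurable_sigma_sets[OF borel_eq_sigma_inner], goal_cases)
 case 1 show ?case by (simp only: Pow_UNIV subset_UNIV)
next
 case 2 show ?case by (simp only: Pi_UNIV UNIV_I)
next
 case (3 A)
 then obtain k B where "A = {x. x \<bullet> k \<in> B}" and B: "B \<in> sets borel" by blast
 then have "f -` A \<inter> space M = {x\<in>space M. f x \<bullet> k \<in> B}" by auto
 then show ?case using sets_Collect_mem[OF assms B] by simp
qed

lemma finite_borel_measure_eqI_char:
 fixes M N :: "'a::{real_inner,second_countable_topology} measure"
 assumes M: "finite_measure M" "sets M = sets borel" and N: "finite_measure N" "sets N = sets borel"
  and eq: "\<And>k. (LINT x|M. cis (x \<bullet> k)) = (LINT x|N. cis (x \<bullet> k))"
 shows "M = N"
proof -
 define g where "g k = (\<lambda>x. x \<bullet> k)" for k :: 'a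
 have g_add: "(\<lambda>x. g k x + g l x) = g (k + l)" and g_scale: "(\<lambda>x. c * g k x) = g (c *\<^sub>R k)" for k l c
  by (simp_all add: g_def inner_add_right)
 show ?thesis
 proof (rule finite_measure_eqI_char[of M N UNIV "range g"])
  have "{{x. x \<bullet> k \<in> B} | k B. B \<in> sets borel} = {{x \<in> UNIV. f x \<in> B} |f B. f \<in> range g \<and> B \<in> sets borel}"
   (is "?A = ?B")
  proof (rule subset_antisym; rule subsetI)
   fix X assume "X \<in> ?A"
   then obtain k B where "X = {x. x \<bullet> k \<in> B}" "B \<in> sets borel" by blast
   then show "X \<in> ?B" by (intro CollectI exI[of _ "g k"] exI[of _ B]) (simp add: g_def)
  next
   fix X assume "X \<in> ?B"
   then obtain k B where "X = {x. g k x \<in> B}" "B \<in> sets borel" by auto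
   then show "X \<in> ?A" unfolding g_def by blast
  qed
  then show "sets M = sigma_sets UNIV {{x \<in> UNIV. f x \<in> B} |f B. f \<in> range g \<and> B \<in> sets borel}"
   unfolding M(2) borel_eq_sigma_inner[where 'a='a] by simp
  show "(\<lambda>x. f x + h x) \<in> range g" if "f \<in> range g" "h \<in> range g" for f h
   using that by (elim rangeE) (simp add: g_add)
  show "(\<lambda>x. c * f x) \<in> range g" if "f \<in> range g" for f c
   using that by (elim rangeE) (simp add: g_scale)
  show "(LINT x|M. cis (f x)) = (LINT x|N. cis (f x))" if "f \<in> range g" for f
   using that eq by (elim rangeE) (simp add: g_def)
 qed (use M N in simp_all)
qed

section \<open>Independence\<close>

lemma emeasure_density_indicator_less_top:
 assumes "finite_measure M" "A \<in> sets M"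
 shows "finite_measure (density M (indicator A))"
proof (rule finite_measureI)
 interpret finite_measure M by fact
 have "emeasure (density M (indicator A)) (space M) = emeasure M A"
  using assms(2) sets.sets_into_space[OF assms(2)]
  by (subst emeasure_density) (auto simp: Int_absorb2 simp flip: indicator_inter_arith)
 then show "emeasure (density M (indicator A)) (space (density M (indicator A))) \<noteq> \<infinity>"
  using emeasure_finite[of A] by simp
qed

text \<open>Independence says that the law of \<open>Y\<close> on the event \<open>A\<close> is
  \<open>prob A\<close> times its law; an identity of measures carries over to integrals.\<close>

lemma (in prob_space) indep_set_integral_indicator:
 fixes F :: "'b => 'c::{banach,second_countable_topology}"
 assumes ind: "indep_set \<A> {Y -` B \<inter> space M | B. B \<in> sets N}"
  and Y [measurable]: "Y \<in> measurable M N" and F [measurable]: "F \<in> borel_measurable N" and A: "A \<in> \<A>"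
 shows "(LINT x|M. indicator A x *\<^sub>R F (Y x)) = prob A *\<^sub>R (LINT x|M. F (Y x))"
proof -
 have A' [measurable]: "A \<in> events" using indep_setD_ev1[OF ind] A by auto
 have "distr (density M (indicator A)) N Y = density (distr M N Y) (\<lambda>_. ennreal (prob A))"
 proof (rule measure_eqI)
  fix B assume "B \<in> sets (distr (density M (indicator A)) N Y)"
  then have B [measurable]: "B \<in> sets N" by simp
  have "emeasure (distr (density M (indicator A)) N Y) B = emeasure M (A \<inter> (Y -` B \<inter> space M))"
   by (simp add: emeasure_distr emeasure_density flip: indicator_inter_arith)
  also have "\<dots> = ennreal (prob A * prob (Y -` B \<inter> space M))"
  proof -
   have "Y -` B \<inter> space M \<in> {Y -` B \<inter> space M | B. B \<in> sets N}" using B by blast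
   from indep_setD[OF ind A this] show ?thesis by (simp add: emeasure_eq_measure)
  qed
  also have "\<dots> = emeasure (density (distr M N Y) (\<lambda>_. ennreal (prob A))) B"
   by (simp add: emeasure_density_const emeasure_distr emeasure_eq_measure ennreal_mult)
  finally show "emeasure (distr (density M (indicator A)) N Y) B = emeasure (density (distr M N Y) (\<lambda>_. ennreal (prob A))) B" .
 qed simp
 then have "(\<integral>y. F y \<partial>distr (density M (indicator A)) N Y) = (\<integral>y. F y \<partial>density (distr M N Y) (\<lambda>_. ennreal (prob A)))"
  by simp
 moreover have "(\<integral>y. F y \<partial>distr (density M (indicator A)) N Y) = (LINT x|M. indicator A x *\<^sub>R F (Y x))"
 proof -
  have "density M (indicator A) = density M (\<lambda>x. ennreal (indicator A x))"
   by (simp add: ennreal_indicator)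
  then show ?thesis by (simp add: integral_distr integral_density)
 qed
 moreover have "(\<integral>y. F y \<partial>density (distr M N Y) (\<lambda>_. ennreal (prob A))) = prob A *\<^sub>R (LINT x|M. F (Y x))"
  by (simp add: integral_distr integral_density)
 ultimately show ?thesis by simp
qed

text \<open>For fixed \<open>A\<close>, the law of \<open>Y\<close> on \<open>A\<close> and
  \<open>prob A\<close> times the law of \<open>Y\<close> are finite measures with equal
  characteristic functions, hence equal.\<close>

lemma (in prob_space) indep_setI_char:
 fixes Y :: "'a => 'b::{real_inner,second_countable_topology}"
 assumes A: "\<A> \<subseteq> events" and Y [measurable]: "Y \<in> borel_measurable M"
  and eq: "\<And>A k. A \<in> \<A> ==> (LINT x|M. indicator A x *\<^sub>R cis (Y x \<bullet> k)) = prob A *\<^sub>R (LINT x|M. cis (Y x \<bullet> k))"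
 shows "indep_set \<A> {Y -` B \<inter> space M | B. B \<in> sets borel}"
proof (rule indep_setI)
 show "\<A> \<subseteq> events" by fact
 show "{Y -` B \<inter> space M | B. B \<in> sets borel} \<subseteq> events" using measurable_sets[OF Y] by blast
 fix a b assume a: "a \<in> \<A>" and "b \<in> {Y -` B \<inter> space M | B. B \<in> sets borel}"
 then obtain B where B [measurable]: "B \<in> sets borel" and b: "b = Y -` B \<inter> space M" by blast
 have a' [measurable]: "a \<in> events" using a A by auto
 have "distr (density M (\<lambda>x. ennreal (indicator a x))) borel Y = density (distr M borel Y) (\<lambda>_. ennreal (prob a))"
 proof (rule finite_borel_measure_eqI_char)
  have "finite_measure (density M (indicator a))"
   by (intro emeasure_density_indicator_less_top finite_measure_axioms a')
  then show "finite_measure (distr (density M (\<lambda>x. ennreal (indicator a x))) borel Y)"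
   by (intro finite_measure.finite_measure_distr) (simp_all add: ennreal_indicator)
  show "finite_measure (density (distr M borel Y) (\<lambda>_. ennreal (prob a)))"
   by (rule finite_measureI) (simp add: emeasure_density_const emeasure_distr ennreal_mult_eq_top_iff emeasure_eq_measure)
  fix k
  show "(\<integral>x. cis (x \<bullet> k) \<partial>distr (density M (\<lambda>x. ennreal (indicator a x))) borel Y) =
    (\<integral>x. cis (x \<bullet> k) \<partial>density (distr M borel Y) (\<lambda>_. ennreal (prob a)))"
   using eq[OF a, of k] by (simp add: integral_distr integral_density)
 qed simp_all
 then have "emeasure (distr (density M (\<lambda>x. ennreal (indicator a x))) borel Y) B = emeasure (density (distr M borel Y) (\<lambda>_. ennreal (prob a))) B"
  by simp
 moreover have "emeasure (distr (density M (\<lambda>x. ennreal (indicator a x))) borel Y) B = emeasure M (a \<inter> b)"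
  by (simp add: emeasure_distr emeasure_density b ennreal_indicator flip: indicator_inter_arith)
 moreover have "emeasure (density (distr M borel Y) (\<lambda>_. ennreal (prob a))) B = ennreal (prob a * prob b)"
  by (simp add: emeasure_density_const emeasure_distr emeasure_eq_measure ennreal_mult b)
 ultimately show "prob (a \<inter> b) = prob a * prob b" by (simp add: emeasure_eq_measure)
qed

text \<open>The sigma-algebra of \<open>H\<close> lies in \<open>G\<close> and that of
  \<open>F (Y x)\<close> in the preimages under \<open>Y\<close>, so the product rule for
  independent variables applies. \<open>G\<close> will be the past and \<open>Y\<close> an
  increment.\<close>

lemma (in prob_space) indep_set_integral_mult:
 fixes H :: "'a => 'c::{real_normed_field,banach,second_countable_topology}"
 assumes sub: "subalgebra M G"
  and ind: "indep_set (sets G) {Y -` B \<inter> space M | B. B \<in> sets N}"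
  and Y: "Y \<in> measurable M N" and H: "H \<in> borel_measurable G" "integrable M H"
  and F: "F \<in> borel_measurable N" "integrable M (\<lambda>x. F (Y x))"
 shows "integrable M (\<lambda>x. H x * F (Y x))"
  and "(LINT x|M. H x * F (Y x)) = (LINT x|M. H x) * (LINT x|M. F (Y x))"
proof -
 have spG: "space G = space M" and sG: "sets G \<subseteq> sets M" using sub by (auto simp: subalgebra_def)
 have S: "sigma_sets (space M) {Y -` B \<inter> space M | B. B \<in> sets N} = {Y -` B \<inter> space M | B. B \<in> sets N}"
  using sigma_sets_vimage_commute[of Y "space M" "space N" "sets N"] Y
  by (simp add: measurable_space sets.sigma_sets_eq)
 have FY: "sigma_sets (space M) {(\<lambda>x. F (Y x)) -` A \<inter> space M | A. A \<in> sets borel} \<subseteq> {Y -` B \<inter> space M | B. B \<in> sets N}"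
 proof -
  have "{(\<lambda>x. F (Y x)) -` A \<inter> space M | A. A \<in> sets borel} \<subseteq> {Y -` B \<inter> space M | B. B \<in> sets N}"
  proof
   fix Z assume "Z \<in> {(\<lambda>x. F (Y x)) -` A \<inter> space M | A. A \<in> sets borel}"
   then obtain A where A: "A \<in> sets borel" and Z: "Z = (\<lambda>x. F (Y x)) -` A \<inter> space M" by blast
   have "F -` A \<inter> space N \<in> sets N" using A F(1) by (rule measurable_sets[rotated])
   moreover have "Z = Y -` (F -` A \<inter> space N) \<inter> space M" using measurable_space[OF Y] Z by auto
   ultimately show "Z \<in> {Y -` B \<inter> space M | B. B \<in> sets N}" by blast
  qed
  from sigma_sets_mono'[OF this, of "space M"] show ?thesis unfolding S .
 qed
 have "indep_var borel H borel (\<lambda>x. F (Y x))"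
  unfolding indep_var_eq
 proof (intro conjI)
  show "random_variable borel H" using H(2) by auto
  show "random_variable borel (\<lambda>x. F (Y x))" using Y F(1) by simp
  have "sigma_sets (space M) {H -` A \<inter> space M | A. A \<in> sets borel} \<subseteq> sets G"
   using sets.sigma_sets_subset[of "{H -` A \<inter> space M | A. A \<in> sets borel}" G] measurable_sets[OF H(1)] spG
   by auto
  then show "indep_set (sigma_sets (space M) {H -` A \<inter> space M | A. A \<in> sets borel})
    (sigma_sets (space M) {(\<lambda>x. F (Y x)) -` A \<inter> space M | A. A \<in> sets borel})"
   using ind FY unfolding indep_set_def
   by (elim indep_sets_mono_sets) (auto split: bool.split)
 qed
 from indep_var_lebesgue_integral[OF this H(2) F(2)] indep_var_integrable[OF this H(2) F(2)]
 show "integrable M (\<lambda>x. H x * F (Y x))" "(LINT x|M. H x * F (Y x)) = (LINT x|M. H x) * (LINT x|M. F (Y x))"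
  by auto
qed

text \<open>Kac's criterion: a joint characteristic function that factorises is that of the product
  of the marginal laws.\<close>

lemma (in prob_space) indep_varI_char:
 fixes X Y :: "'a => real"
 assumes X [measurable]: "X \<in> borel_measurable M" and Y [measurable]: "Y \<in> borel_measurable M"
  and eq: "\<And>a b. (LINT x|M. cis (a * X x + b * Y x)) = (LINT x|M. cis (a * X x)) * (LINT x|M. cis (b * Y x))"
 shows "indep_var borel X borel Y"
 unfolding indep_var_distribution_eq
proof (intro conjI X Y)
 interpret X: prob_space "distr M borel X" by (rule prob_space_distr) fact
 interpret Y: prob_space "distr M borel Y" by (rule prob_space_distr) fact
 interpret XY: pair_prob_space "distr M borel X" "distr M borel Y" ..
 show "distr M borel X \<Otimes>\<^sub>M distr M borel Y = distr M (borel \<Otimes>\<^sub>M borel) (\<lambda>x. (X x, Y x))"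
 proof (rule finite_borel_measure_eqI_char)
  show "finite_measure (distr M borel X \<Otimes>\<^sub>M distr M borel Y)" by (rule XY.P.finite_measure_axioms)
  show "finite_measure (distr M (borel \<Otimes>\<^sub>M borel) (\<lambda>x. (X x, Y x)))"
   by (intro finite_measure_distr) simp
  show "sets (distr M borel X \<Otimes>\<^sub>M distr M borel Y) = sets (borel :: (real \<times> real) measure)"
   by (subst sets_pair_measure_cong[of _ borel _ borel]) (simp_all flip: borel_prod)
  show "sets (distr M (borel \<Otimes>\<^sub>M borel) (\<lambda>x. (X x, Y x))) = sets (borel :: (real \<times> real) measure)"
   by (simp flip: borel_prod)
  fix k :: "real \<times> real"
  obtain a b where k: "k = (a, b)" by force
  have m: "(\<lambda>z. cis (z \<bullet> k)) \<in> borel_measurable (distr M borel X \<Otimes>\<^sub>M distr M borel Y)"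
   unfolding k by (simp add: split_beta inner_prod_def)
  have "(\<integral>z. cis (z \<bullet> k) \<partial>(distr M borel X \<Otimes>\<^sub>M distr M borel Y)) =
    (\<integral>x. (\<integral>y. cis ((x, y) \<bullet> k) \<partial>distr M borel Y) \<partial>distr M borel X)"
   using m by (intro XY.integral_fst'[symmetric] XY.P.integrable_const_bound[of _ 1]) auto
  also have "\<dots> = (\<integral>x. (\<integral>y. cis (a * x) * cis (b * y) \<partial>distr M borel Y) \<partial>distr M borel X)"
   by (simp add: k inner_prod_def cis_mult mult.commute)
  also have "\<dots> = (LINT x|M. cis (a * X x)) * (LINT y|M. cis (b * Y y))"
   by (simp add: integral_distr)
  also have "\<dots> = (LINT x|M. cis (a * X x + b * Y x))" by (rule eq[symmetric])
  also have "\<dots> = (\<integral>z. cis (z \<bullet> k) \<partial>distr M (borel \<Otimes>\<^sub>M borel) (\<lambda>x. (X x, Y x)))"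
   by (subst integral_distr) (simp_all add: k inner_prod_def split_beta mult.commute)
  finally show "(\<integral>z. cis (z \<bullet> k) \<partial>(distr M borel X \<Otimes>\<^sub>M distr M borel Y)) =
   (\<integral>z. cis (z \<bullet> k) \<partial>distr M (borel \<Otimes>\<^sub>M borel) (\<lambda>x. (X x, Y x)))" .
 qed
qed

section \<open>Gaussian integrals\<close>

lemma sets_real_gaussian [simp, measurable_cong]: "sets (real_gaussian v) = sets borel"
 by (simp add: real_gaussian_def)

text \<open>Unlike the definition, this form treats \<open>v = 0\<close> uniformly; that case occurs
  for directions in the kernel of \<open>adjoint J\<close>.\<close>

lemma real_gaussian_eq_distr:
 assumes "v \<ge> 0"
 shows "real_gaussian v = distr std_normal_distribution borel (\<lambda>z. sqrt v * z)"
proof (cases "v = 0")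
 case True
 interpret prob_space std_normal_distribution by (rule prob_space_normal_density) simp
 have "distr std_normal_distribution borel (\<lambda>z. 0 :: real) = return borel 0" by (simp add: distr_const)
 then show ?thesis using True by (simp add: real_gaussian_def)
next
 case False
 then have v: "sqrt v > 0" using assms by simp
 interpret prob_space std_normal_distribution by (rule prob_space_normal_density) simp
 have "distributed std_normal_distribution lborel (\<lambda>z. z) (normal_density 0 1)"
  unfolding distributed_def by (auto simp: distr_id2)
 from normal_density_affine[OF this, of "sqrt v" 0] v
 have "distributed std_normal_distribution lborel (\<lambda>z. sqrt v * z) (normal_density 0 (sqrt v))" by simp
 then have "distr std_normal_distribution lborel (\<lambda>z. sqrt v * z) = density lborel (normal_density 0 (sqrt v))"
  by (simp add: distributed_def)
 moreover have "distr std_normal_distribution lborel (\<lambda>z. sqrt v * z) = distr std_normal_distribution borel (\<lambda>z. sqrt v * z)"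
  by (rule distr_cong) simp_all
 ultimately show ?thesis using False by (simp add: real_gaussian_def)
qed

lemma prob_space_real_gaussian: "v \<ge> 0 ==> prob_space (real_gaussian v)"
 unfolding real_gaussian_eq_distr
 by (intro prob_space.prob_space_distr prob_space_normal_density) simp_all

lemma integral_cis_real_gaussian:
 assumes "v \<ge> 0"
 shows "(\<integral>x. cis (u * x) \<partial>real_gaussian v) = of_real (exp (- (v * u\<^sup>2) / 2))"
proof -
 have "(\<integral>x. cis (u * x) \<partial>real_gaussian v) = (LINT z|std_normal_distribution. cis (u * (sqrt v * z)))"
  unfolding real_gaussian_eq_distr[OF assms] by (subst integral_distr) simp_all
 also have "\<dots> = char std_normal_distribution (u * sqrt v)"
  by (simp add: char_def cis_conv_exp mult.assoc)
 finally show ?thesis using assms by (simp add: char_std_normal_distribution power_mult_distrib mult.commute)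
qed

text \<open>Completing the square: the exponential tilt of a centred Gaussian is a shifted Gaussian.\<close>

lemma integral_exp_cis_real_gaussian:
 assumes "v \<ge> 0"
 shows "integrable (real_gaussian v) (\<lambda>x. exp (a * x - a\<^sup>2 * v / 2))" (is ?I)
  and "(\<integral>x. exp (a * x - a\<^sup>2 * v / 2) *\<^sub>R cis (c * x) \<partial>real_gaussian v) = cis (c * a * v) * of_real (exp (- (v * c\<^sup>2) / 2))" (is ?E)
proof -
 interpret N: prob_space std_normal_distribution by (rule prob_space_normal_density) simp
 define b where "b = a * sqrt v"
 have b2: "b\<^sup>2 = a\<^sup>2 * v" using assms by (simp add: b_def power_mult_distrib)
 have dens: "normal_density 0 1 z * exp (b * z - b\<^sup>2 / 2) = normal_density 0 1 (- b + z)" for z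
  by (simp add: normal_density_def exp_add[symmetric] power2_eq_square field_simps exp_diff[symmetric])
 have shift: "(LINT z|std_normal_distribution. exp (b * z - b\<^sup>2 / 2) *\<^sub>R f z) = (LINT z|std_normal_distribution. f (b + z))"
  if [measurable]: "f \<in> borel_measurable borel" for f :: "real => complex"
 proof -
  have "(LINT z|std_normal_distribution. exp (b * z - b\<^sup>2 / 2) *\<^sub>R f z) = (LINT z|lborel. normal_density 0 1 (- b + z) *\<^sub>R f z)"
   by (subst integral_density) (auto simp: dens simp flip: scaleR_scaleR simp del: scaleR_scaleR intro!: Bochner_Integration.integral_cong simp: scaleR_scaleR dens)
  also have "\<dots> = (LINT z|lborel. normal_density 0 1 z *\<^sub>R f (b + z))"
   by (subst lborel_integral_real_affine[where c=1 and t=b]) simp_all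
  also have "\<dots> = (LINT z|std_normal_distribution. f (b + z))"
   by (subst integral_density) auto
  finally show ?thesis .
 qed
 have "integrable lborel (\<lambda>z. normal_density 0 1 (- b + z))"
  using lborel_integrable_real_affine[of "normal_density 0 1" 1 "-b"] by simp
 then have "integrable std_normal_distribution (\<lambda>z. exp (b * z - b\<^sup>2 / 2))"
  by (subst integrable_density) (simp_all add: dens)
 then show ?I
  unfolding real_gaussian_eq_distr[OF assms]
  by (subst integrable_distr_eq) (simp_all add: b_def b2[unfolded b_def] mult.assoc)
 have "(\<integral>x. exp (a * x - a\<^sup>2 * v / 2) *\<^sub>R cis (c * x) \<partial>real_gaussian v) =
   (LINT z|std_normal_distribution. exp (b * z - b\<^sup>2 / 2) *\<^sub>R cis (c * (sqrt v * z)))"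
  unfolding real_gaussian_eq_distr[OF assms] by (subst integral_distr) (simp_all add: b_def b2[unfolded b_def] mult.assoc)
 also have "\<dots> = (LINT z|std_normal_distribution. cis (c * (sqrt v * (b + z))))"
  by (rule shift) simp
 also have "\<dots> = (LINT z|std_normal_distribution. cis (c * a * v) * cis (c * (sqrt v * z)))"
  using assms by (simp add: b_def cis_mult distrib_left mult_ac)
 also have "\<dots> = cis (c * a * v) * (\<integral>x. cis (c * x) \<partial>real_gaussian v)"
  unfolding real_gaussian_eq_distr[OF assms] by (simp add: integral_distr)
 finally show ?E by (simp add: integral_cis_real_gaussian[OF assms])
qed

section \<open>Filtrations on the path space\<close>

lemma space_natural_filtration [simp]: "space (natural_filtration t) = path_space"
 unfolding natural_filtration_def by (rule space_measure_of) auto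

lemma sets_natural_filtration:
 "sets (natural_filtration t) =
   sigma_sets path_space {coord s -` B \<inter> path_space | s B. 0 \<le> s \<and> s \<le> t \<and> B \<in> sets borel}"
 unfolding natural_filtration_def by (rule sets_measure_of) auto

lemma space_path_borel [simp]: "space path_borel = path_space"
 unfolding path_borel_def by (rule space_measure_of) (auto simp: path_open_def)

lemma coord_measurable_natural:
 assumes "0 \<le> s" "s \<le> t"
 shows "(\<lambda>w. w s) \<in> borel_measurable (natural_filtration t)"
proof (rule measurableI)
 fix B :: "'a set" assume "B \<in> sets borel"
 then have "coord s -` B \<inter> path_space \<in> sets (natural_filtration t)"
  unfolding sets_natural_filtration using assms by (intro sigma_sets.Basic) blast
 moreover have "coord s -` B \<inter> path_space = (\<lambda>w. w s) -` B \<inter> space (natural_filtration t)"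
  by (auto simp: coord_def)
 ultimately show "(\<lambda>w. w s) -` B \<inter> space (natural_filtration t) \<in> sets (natural_filtration t)" by simp
qed simp

lemma sets_natural_filtration_leI:
 fixes N :: "(real => 'k::metric_space) measure"
 assumes "space N = path_space" "\<And>s. 0 \<le> s ==> s \<le> t ==> (\<lambda>w. w s) \<in> borel_measurable N"
 shows "sets (natural_filtration t) \<subseteq> sets N"
proof -
 have "{coord s -` B \<inter> path_space | s B. 0 \<le> s \<and> s \<le> t \<and> B \<in> sets borel} \<subseteq> sets N"
 proof
  fix A :: "(real => 'k) set" assume "A \<in> {coord s -` B \<inter> path_space | s B. 0 \<le> s \<and> s \<le> t \<and> B \<in> sets borel}"
  then obtain s B where "A = coord s -` B \<inter> path_space" "0 \<le> s" "s \<le> t" "B \<in> sets borel" by blast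
  moreover then have "(\<lambda>w. w s) -` B \<inter> space N \<in> sets N"
   using assms(2) by (intro measurable_sets[of _ N borel])
  moreover have "(\<lambda>w. w s) -` B = (coord s -` B :: (real => 'k) set)" by (auto simp: coord_def)
  ultimately show "A \<in> sets N" using assms(1) by simp
 qed
 from sets.sigma_sets_subset[OF this] show ?thesis unfolding sets_natural_filtration assms(1) .
qed

lemma natural_filtration_mono: "s \<le> t ==> sets (natural_filtration s) \<subseteq> sets (natural_filtration t)"
 by (intro sets_natural_filtration_leI coord_measurable_natural) auto

lemma coord_measurable_path_borel:
 fixes s :: real
 assumes "0 \<le> s"
 shows "(\<lambda>w. w s) \<in> borel_measurable (path_borel :: (real => 'k::metric_space) measure)"
proof (rule borel_measurableI)
 fix U :: "'k set" assume U: "open U"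
 have "path_open ((\<lambda>w. w s) -` U \<inter> path_space)"
  unfolding path_open_def
 proof (intro conjI ballI)
  fix w assume "w \<in> (\<lambda>w. w s) -` U \<inter> path_space"
  then obtain e where e: "e > 0" "\<And>y. dist y (w s) < e ==> y \<in> U"
   using U unfolding open_dist by blast
  show "\<exists>b>0. \<exists>\<epsilon>>0. \<forall>w'\<in>path_space. (\<forall>t\<in>{0..b}. dist (w' t) (w t) < \<epsilon>) --> w' \<in> (\<lambda>w. w s) -` U \<inter> path_space"
   using e assms by (intro exI[of _ "s + 1"] exI[of _ e] conjI) auto
 qed simp
 then show "(\<lambda>w. w s) -` U \<inter> space path_borel \<in> sets path_borel"
  unfolding space_path_borel unfolding path_borel_def
  by (subst sets_measure_of) (auto simp: path_open_def intro!: sigma_sets.Basic)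
qed

lemma natural_filtration_path_borel: "sets (natural_filtration t) \<subseteq> sets path_borel"
 by (intro sets_natural_filtration_leI coord_measurable_path_borel) auto

text \<open>The intersection is itself a sigma-algebra, hence equal to the one that it
  generates.\<close>

lemma sets_canonical_filtration:
 "sets (\<F> t) = (\<Inter>\<epsilon>\<in>{0<..}. sets (natural_filtration (t + \<epsilon>)))"
 (is "_ = ?I")
proof -
 have "?I \<subseteq> sets (natural_filtration (t + 1))" by (rule INT_lower) simp
 also have "\<dots> \<subseteq> Pow path_space" using sets.space_closed[of "natural_filtration (t + 1)"] by simp
 finally have P: "?I \<subseteq> Pow path_space" .
 have "sigma_algebra path_space ?I"
  unfolding sigma_algebra_iff2
 proof (intro conjI ballI allI impI P)
  show "{} \<in> ?I" by auto
  show "path_space - A \<in> ?I" if "A \<in> ?I" for A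
   using that sets.compl_sets[of A "natural_filtration (t + e)" for e] by auto
  show "(\<Union>i. A i) \<in> ?I" if "range A \<subseteq> ?I" for A :: "nat => _"
  proof (intro INT_I)
   fix e :: real assume "e \<in> {0<..}"
   then have "range A \<subseteq> sets (natural_filtration (t + e))" using that by blast
   then show "(\<Union>i. A i) \<in> sets (natural_filtration (t + e))" by auto
  qed
 qed
 then show ?thesis unfolding canonical_filtration_def
  using P by (simp add: sigma_algebra.sigma_sets_eq)
qed

lemma space_canonical_filtration [simp]: "space (\<F> t) = path_space"
 unfolding canonical_filtration_def
proof (rule space_measure_of)
 have "(\<Inter>\<epsilon>\<in>{0<..}. sets (natural_filtration (t + \<epsilon>))) \<subseteq> sets (natural_filtration (t + 1))"
  by (rule INT_lower) simp
 also have "\<dots> \<subseteq> Pow path_space" using sets.space_closed[of "natural_filtration (t + 1)"] by simp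
 finally show "(\<Inter>\<epsilon>\<in>{0<..}. sets (natural_filtration (t + \<epsilon>))) \<subseteq> Pow path_space" .
qed

text \<open>At the price of a positive amount of time, an event of the right-continuous filtration
  becomes an event about coordinates, for which the shift formulas are proved.\<close>

lemma canonical_filtration_natural: "s < t ==> sets (\<F> s) \<subseteq> sets (natural_filtration t)"
proof -
 assume "s < t"
 then have "t - s \<in> {0<..}" by simp
 then have "sets (\<F> s) \<subseteq> sets (natural_filtration (s + (t - s)))"
  unfolding sets_canonical_filtration by (rule INT_lower)
 then show ?thesis by simp
qed

lemma natural_filtration_canonical: "sets (natural_filtration t) \<subseteq> sets (\<F> t)"
 unfolding sets_canonical_filtration by (intro INT_greatest natural_filtration_mono) auto

lemma canonical_filtration_mono: "s \<le> t ==> sets (\<F> s) \<subseteq> sets (\<F> t)"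
 unfolding sets_canonical_filtration
proof (rule INT_greatest)
 fix e :: real assume "s \<le> t" "e \<in> {0<..}"
 then have "sets (natural_filtration (s + e)) \<subseteq> sets (natural_filtration (t + e))"
  by (intro natural_filtration_mono) simp
 then show "(\<Inter>\<epsilon>\<in>{0<..}. sets (natural_filtration (s + \<epsilon>))) \<subseteq> sets (natural_filtration (t + e))"
  using \<open>e \<in> {0<..}\<close> by (meson INT_lower order_trans)
qed

lemma canonical_filtration_path_borel: "sets (\<F> t) \<subseteq> sets path_borel"
 by (rule order_trans[OF canonical_filtration_natural[of t "t + 1"] natural_filtration_path_borel]) simp

lemma measurable_filtration_mono:
 assumes "f \<in> measurable M N" "space M = space M'" "sets M \<subseteq> sets M'"
 shows "f \<in> measurable M' N"
 using assms by (auto simp: measurable_def)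

lemma coord_measurable_canonical:
 assumes "0 \<le> s" "s \<le> t"
 shows "(\<lambda>w. w s) \<in> borel_measurable (\<F> t)"
 by (rule measurable_filtration_mono[OF coord_measurable_natural[OF assms]])
   (simp_all add: natural_filtration_canonical)

lemma path_space_continuous: "w \<in> path_space ==> continuous_on {0..} w"
 by (simp add: path_space_def)

section \<open>Cylindrical Wiener measure on the path space\<close>

locale cylindrical_wiener_path_space =
 fixes J :: "'h::{real_inner, banach, second_countable_topology}
        => 'k::{real_inner, banach, second_countable_topology}"
  and P :: "(real => 'k) measure"
 assumes J: "bounded_linear J"
  and P_sets: "sets P = sets path_borel"
  and P_wiener: "cylindrical_wiener P natural_filtration J {0..} coord"
begin

text \<open>The variance per unit of time of the coordinate \<open>k\<close> of the Wiener process,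
  that is \<open>J (adjoint J k) \<bullet> k\<close>.\<close>

abbreviation \<kappa> :: "'k => real" where "\<kappa> k \<equiv> (norm (adjoint J k))\<^sup>2"

sublocale prob_space P
 using P_wiener by (simp add: cylindrical_wiener_def wiener_process_def)

lemma space_P [simp]: "space P = path_space"
 using sets_eq_imp_space_eq[OF P_sets] by simp

lemma subalgebra_natural: "subalgebra P (natural_filtration t)"
 using natural_filtration_path_borel P_sets by (auto simp: subalgebra_def)

lemma subalgebra_canonical: "subalgebra P (\<F> t)"
 using canonical_filtration_path_borel P_sets by (auto simp: subalgebra_def)

lemmas measurable_canonical_P = measurable_from_subalg[OF subalgebra_canonical]

lemma coord_measurable [measurable]: "0 \<le> s ==> (\<lambda>w. w s) \<in> borel_measurable P"
 using measurable_from_subalg[OF subalgebra_natural coord_measurable_natural[of s s]] by simp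

lemma inner_adjoint_J: "J (adjoint J k) \<bullet> l = adjoint J k \<bullet> adjoint J l"
 by (rule adjoint_inner[OF J])

lemma distr_increment:
 assumes "0 \<le> s" "s \<le> t"
 shows "distr P borel (\<lambda>w. (w t - w s) \<bullet> k) = real_gaussian ((t - s) * \<kappa> k)"
proof (cases "s = t")
 case True
 then show ?thesis by (simp add: distr_const real_gaussian_def)
next
 case False
 then have "centered_gaussian P (\<lambda>k. (t - s) *\<^sub>R (J \<circ> adjoint J) k) (\<lambda>w. coord t w - coord s w)"
  using P_wiener assms unfolding cylindrical_wiener_def wiener_process_def by auto
 then show ?thesis
  by (simp add: centered_gaussian_def coord_def inner_adjoint_J power2_norm_eq_inner)
qed

lemma integral_cis_increment:
 assumes "0 \<le> s" "s \<le> t"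
 shows "(LINT w|P. cis ((w t - w s) \<bullet> k)) = of_real (exp (- ((t - s) * \<kappa> k) / 2))"
proof -
 have "(LINT w|P. cis ((w t - w s) \<bullet> k)) = (\<integral>x. cis (1 * x) \<partial>distr P borel (\<lambda>w. (w t - w s) \<bullet> k))"
  using assms by (subst integral_distr) auto
 also have "\<dots> = of_real (exp (- ((t - s) * \<kappa> k) / 2))"
  unfolding distr_increment[OF assms] using assms by (subst integral_cis_real_gaussian) auto
 finally show ?thesis .
qed

lemma indep_natural:
 assumes "0 \<le> s" "s < t"
 shows "indep_set (sets (natural_filtration s)) {(\<lambda>w. w t - w s) -` B \<inter> space P | B. B \<in> sets borel}"
proof -
 have "indep_set (sets (natural_filtration s)) {(\<lambda>w. coord t w - coord s w) -` B \<inter> space P | B. B \<in> sets borel}"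
  using P_wiener assms unfolding cylindrical_wiener_def wiener_process_def by auto
 then show ?thesis by (simp add: coord_def)
qed

text \<open>Independence is given with respect to the natural filtration. An event of
  \<open>\<F> s\<close> belongs to the natural filtration at every later \<open>u\<close>, so it is
  independent of the increment from \<open>u\<close> to \<open>t\<close>; continuity of the paths
  lets \<open>u\<close> decrease to \<open>s\<close>.\<close>

lemma integral_indicator_cis_canonical:
 assumes "0 \<le> s" "s < t" and A: "A \<in> sets (\<F> s)"
 shows "(LINT y|P. indicator A y *\<^sub>R cis ((y t - y s) \<bullet> k)) = prob A *\<^sub>R of_real (exp (- ((t - s) * \<kappa> k) / 2))"
proof -
 have A' [measurable]: "A \<in> events"
  using A subalgebra_canonical by (auto simp: subalgebra_def)
 \<comment> \<open>The double successor keeps \<open>u n\<close> strictly below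
   \<open>t\<close>.\<close>
 define u where "u n = s + (t - s) * inverse (real (Suc (Suc n)))" for n
 have inv: "inverse (real (Suc (Suc n))) < 1" for n by (simp add: field_simps)
 have u: "s < u n" "u n < t" for n
 proof -
  show "s < u n" using assms by (simp add: u_def)
  have "(t - s) * inverse (real (Suc (Suc n))) < (t - s) * 1"
   using assms inv by (intro mult_strict_left_mono) auto
  then show "u n < t" by (simp add: u_def)
 qed
 have u0: "0 \<le> u n" for n using u(1)[of n] assms(1) by simp
 have lim: "u \<longlonglongrightarrow> s"
 proof -
  have "(\<lambda>n. s + (t - s) * inverse (real (Suc (Suc n)))) \<longlonglongrightarrow> s + (t - s) * 0"
   by (intro tendsto_intros filterlim_compose[OF LIMSEQ_inverse_real_of_nat filterlim_Suc])
  then show ?thesis unfolding u_def by simp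
 qed
 have "(LINT y|P. indicator A y *\<^sub>R cis ((y t - y (u n)) \<bullet> k)) = prob A *\<^sub>R of_real (exp (- ((t - u n) * \<kappa> k) / 2))" for n
 proof -
  have "A \<in> sets (natural_filtration (u n))" using canonical_filtration_natural[OF u(1)] A by blast
  then have "(LINT y|P. indicator A y *\<^sub>R cis ((y t - y (u n)) \<bullet> k)) = prob A *\<^sub>R (LINT y|P. cis ((y t - y (u n)) \<bullet> k))"
   using u0 u assms
   by (intro indep_set_integral_indicator[OF indep_natural, where F="\<lambda>x. cis (x \<bullet> k)"]) auto
  then show ?thesis using integral_cis_increment[OF u0 less_imp_le[OF u(2)]] by simp
 qed
 moreover have "(\<lambda>n. \<integral>y. indicator A y *\<^sub>R cis ((y t - y (u n)) \<bullet> k) \<partial>P) \<longlonglongrightarrow> (LINT y|P. indicator A y *\<^sub>R cis ((y t - y s) \<bullet> k))"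
 proof (rule integral_dominated_convergence[where w="\<lambda>_. 1"])
  show "AE y in P. (\<lambda>n. indicat_real A y *\<^sub>R cis ((y t - y (u n)) \<bullet> k)) \<longlonglongrightarrow> indicator A y *\<^sub>R cis ((y t - y s) \<bullet> k)"
  proof (rule AE_I2)
   fix y assume "y \<in> space P"
   then have "continuous_on {0..} y" by (simp add: path_space_continuous)
   then have "(\<lambda>n. y (u n)) \<longlonglongrightarrow> y s"
    using lim u0 assms(1) by (auto simp: continuous_on_sequentially o_def)
   then show "(\<lambda>n. indicat_real A y *\<^sub>R cis ((y t - y (u n)) \<bullet> k)) \<longlonglongrightarrow> indicator A y *\<^sub>R cis ((y t - y s) \<bullet> k)"
    by (intro tendsto_intros)
  qed
 qed (use assms u0 in \<open>auto split: split_indicator\<close>)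
 moreover have "(\<lambda>n. prob A *\<^sub>R complex_of_real (exp (- ((t - u n) * \<kappa> k) / 2))) \<longlonglongrightarrow> prob A *\<^sub>R of_real (exp (- ((t - s) * \<kappa> k) / 2))"
  by (intro tendsto_intros lim) auto
 ultimately show ?thesis by (simp add: LIMSEQ_unique)
qed

lemma indep_canonical:
 assumes "0 \<le> s" "s \<le> t"
 shows "indep_set (sets (\<F> s)) {(\<lambda>w. w t - w s) -` B \<inter> space P | B. B \<in> sets borel}"
proof (rule indep_setI_char)
 show "sets (\<F> s) \<subseteq> events" using subalgebra_canonical by (auto simp: subalgebra_def)
 show "(\<lambda>w. w t - w s) \<in> borel_measurable P" using assms by simp
 fix A :: "(real => 'k) set" and k assume A: "A \<in> sets (\<F> s)"
 then have [measurable]: "A \<in> events" using subalgebra_canonical by (auto simp: subalgebra_def)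
 show "(LINT w|P. indicator A w *\<^sub>R cis ((w t - w s) \<bullet> k)) = prob A *\<^sub>R (LINT w|P. cis ((w t - w s) \<bullet> k))"
 proof (cases "s = t")
  case True
  then show ?thesis using prob_space sets.sets_into_space[OF A]
   by (simp add: cis_zero scaleR_conv_of_real Int_absorb2)
 next
  case False
  then show ?thesis
   using integral_indicator_cis_canonical[OF assms(1) _ A] integral_cis_increment[OF assms] assms by simp
 qed
qed

text \<open>The Cameron--Martin density that belongs to adding the slope
  \<open>a *\<^sub>R J (adjoint J k)\<close> to the path on the interval from \<open>s\<close> to
  \<open>t\<close>.\<close>

abbreviation tilt :: "real => 'k => real => real => (real => 'k) => real" where
 "tilt a k s t w \<equiv> exp (a * ((w t - w s) \<bullet> k) - a\<^sup>2 * ((t - s) * \<kappa> k) / 2)"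

text \<open>Split \<open>l\<close> into a multiple of \<open>k\<close> and a rest \<open>l'\<close>
  such that \<open>adjoint J l'\<close> is orthogonal to \<open>adjoint J k\<close>. The
  corresponding coordinates of the increment have a factorising characteristic function, hence are
  independent, and the one-dimensional tilted integral handles the first of them.\<close>

lemma integral_tilt_cis:
 assumes st: "0 \<le> s" "s \<le> t"
 shows "integrable P (tilt a k s t)"
  and "(LINT w|P. tilt a k s t w *\<^sub>R cis ((w t - w s) \<bullet> l)) =
   cis ((t - s) * (a * (adjoint J k \<bullet> adjoint J l))) * of_real (exp (- ((t - s) * \<kappa> l) / 2))"
proof -
 define v where "v = (t - s) * \<kappa> k"
 have v: "v \<ge> 0" using assms by (simp add: v_def)
 have "integrable (distr P borel (\<lambda>w. (w t - w s) \<bullet> k)) (\<lambda>x. exp (a * x - a\<^sup>2 * v / 2))"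
  unfolding distr_increment[OF assms] v_def[symmetric] by (rule integral_exp_cis_real_gaussian(1)[OF v])
 then show int: "integrable P (tilt a k s t)"
  using assms by (subst (asm) integrable_distr_eq) (simp_all add: v_def)
 interpret adj: linear "adjoint J" by (rule adjoint_linear_hilbert[OF J])
 \<comment> \<open>The projection coefficient. If \<open>adjoint J k = 0\<close>, the coordinate
   \<open>k\<close> is degenerate and 0 is a valid choice.\<close>
 define c where "c = (if adjoint J k = 0 then 0 else (adjoint J k \<bullet> adjoint J l) / \<kappa> k)"
 define l' where "l' = l - c *\<^sub>R k"
 have orth: "adjoint J k \<bullet> adjoint J l' = 0"
  by (auto simp: l'_def c_def adj.diff adj.scale inner_diff_right power2_norm_eq_inner)
 have ckl: "c * \<kappa> k = adjoint J k \<bullet> adjoint J l"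
  by (auto simp: c_def)
 have kl: "\<kappa> (p *\<^sub>R k + q *\<^sub>R l') = p\<^sup>2 * \<kappa> k + q\<^sup>2 * \<kappa> l'" for p q
  using orth unfolding power2_norm_eq_inner
  by (simp add: adj.add adj.scale inner_add_left inner_add_right inner_commute power2_eq_square)
 have l: "l = c *\<^sub>R k + 1 *\<^sub>R l'" by (simp add: l'_def)
 have ind: "indep_var borel (\<lambda>w. (w t - w s) \<bullet> k) borel (\<lambda>w. (w t - w s) \<bullet> l')"
 proof (rule indep_varI_char)
  fix p q
  have "(LINT w|P. cis (p * ((w t - w s) \<bullet> k) + q * ((w t - w s) \<bullet> l'))) =
    (LINT w|P. cis ((w t - w s) \<bullet> (p *\<^sub>R k + q *\<^sub>R l')))"
   by (simp add: inner_add_right)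
  also have "\<dots> = of_real (exp (- ((t - s) * (p\<^sup>2 * \<kappa> k)) / 2)) * of_real (exp (- ((t - s) * (q\<^sup>2 * \<kappa> l')) / 2))"
   unfolding integral_cis_increment[OF assms] kl by (simp add: distrib_left add_divide_distrib exp_add[symmetric] flip: of_real_mult)
  also have "\<dots> = (LINT w|P. cis ((w t - w s) \<bullet> (p *\<^sub>R k))) * (LINT w|P. cis ((w t - w s) \<bullet> (q *\<^sub>R l')))"
   unfolding integral_cis_increment[OF assms] by (simp add: adj.scale power_mult_distrib)
  finally show "(LINT w|P. cis (p * ((w t - w s) \<bullet> k) + q * ((w t - w s) \<bullet> l'))) =
    (LINT w|P. cis (p * ((w t - w s) \<bullet> k))) * (LINT w|P. cis (q * ((w t - w s) \<bullet> l')))"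
   by simp
 qed (use assms in simp_all)
 let ?f = "\<lambda>x. exp (a * x - a\<^sup>2 * v / 2) *\<^sub>R cis (c * x)"
 have "indep_var borel (?f \<circ> (\<lambda>w. (w t - w s) \<bullet> k)) borel (cis \<circ> (\<lambda>w. (w t - w s) \<bullet> l'))"
  by (rule indep_var_compose[OF ind]) simp_all
 then have ind': "indep_var borel (\<lambda>w. ?f ((w t - w s) \<bullet> k)) borel (\<lambda>w. cis ((w t - w s) \<bullet> l'))"
  by (simp add: o_def)
 have i1: "integrable P (\<lambda>w. ?f ((w t - w s) \<bullet> k))"
  by (rule Bochner_Integration.integrable_bound[OF int]) (use assms in \<open>auto simp: v_def\<close>)
 have i2: "integrable P (\<lambda>w. cis ((w t - w s) \<bullet> l'))"
  using assms by (intro integrable_cis) simp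
 have "(LINT w|P. tilt a k s t w *\<^sub>R cis ((w t - w s) \<bullet> l)) =
   (LINT w|P. ?f ((w t - w s) \<bullet> k) * cis ((w t - w s) \<bullet> l'))"
  by (subst l) (simp add: inner_add_right cis_mult v_def)
 also have "\<dots> = (LINT w|P. ?f ((w t - w s) \<bullet> k)) * (LINT w|P. cis ((w t - w s) \<bullet> l'))"
  by (rule indep_var_lebesgue_integral[OF ind' i1 i2])
 also have "(LINT w|P. ?f ((w t - w s) \<bullet> k)) = (\<integral>x. ?f x \<partial>distr P borel (\<lambda>w. (w t - w s) \<bullet> k))"
  using assms by (subst integral_distr) simp_all
 also have "\<dots> = cis (c * a * v) * of_real (exp (- (v * c\<^sup>2) / 2))"
  unfolding distr_increment[OF assms] v_def[symmetric] by (rule integral_exp_cis_real_gaussian(2)[OF v])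
 also have "(LINT w|P. cis ((w t - w s) \<bullet> l')) = of_real (exp (- ((t - s) * \<kappa> l') / 2))"
  by (rule integral_cis_increment[OF assms])
 also have "c * a * v = (t - s) * (a * (adjoint J k \<bullet> adjoint J l))"
  unfolding ckl[symmetric] v_def by simp
 also have "cis ((t - s) * (a * (adjoint J k \<bullet> adjoint J l))) * of_real (exp (- (v * c\<^sup>2) / 2)) * of_real (exp (- ((t - s) * \<kappa> l') / 2)) =
   cis ((t - s) * (a * (adjoint J k \<bullet> adjoint J l))) * of_real (exp (- ((t - s) * \<kappa> l) / 2))"
 proof -
  have "\<kappa> l = c\<^sup>2 * \<kappa> k + 1\<^sup>2 * \<kappa> l'" by (subst l) (rule kl)
  then have "exp (- (v * c\<^sup>2) / 2) * exp (- ((t - s) * \<kappa> l') / 2) = exp (- ((t - s) * \<kappa> l) / 2)"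
   by (simp add: v_def exp_add[symmetric] field_simps)
  then show ?thesis by (simp flip: of_real_mult add: mult.assoc)
 qed
 finally show "(LINT w|P. tilt a k s t w *\<^sub>R cis ((w t - w s) \<bullet> l)) =
   cis ((t - s) * (a * (adjoint J k \<bullet> adjoint J l))) * of_real (exp (- ((t - s) * \<kappa> l) / 2))" .
qed

lemma integral_mult_tilt_cis:
 fixes H :: "_ => complex"
 assumes st: "0 \<le> s" "s \<le> t" and H: "H \<in> borel_measurable (\<F> s)" "integrable P H"
 shows "integrable P (\<lambda>w. H w * (tilt a k s t w *\<^sub>R cis ((w t - w s) \<bullet> l)))"
  and "(LINT w|P. H w * (tilt a k s t w *\<^sub>R cis ((w t - w s) \<bullet> l))) = (LINT w|P. H w) *
   (cis ((t - s) * (a * (adjoint J k \<bullet> adjoint J l))) * of_real (exp (- ((t - s) * \<kappa> l) / 2)))"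
proof -
 let ?F = "\<lambda>x. exp (a * (x \<bullet> k) - a\<^sup>2 * ((t - s) * \<kappa> k) / 2) *\<^sub>R cis (x \<bullet> l)"
 have F: "integrable P (\<lambda>w. ?F (w t - w s))"
  by (rule Bochner_Integration.integrable_bound[OF integral_tilt_cis(1)[OF st, of a k]]) (use st in auto)
 have Y: "(\<lambda>w. w t - w s) \<in> borel_measurable P" using st by simp
 have Fm: "?F \<in> borel_measurable borel" by simp
 note R = indep_set_integral_mult[OF subalgebra_canonical indep_canonical[OF st] Y H Fm F]
 show "integrable P (\<lambda>w. H w * (tilt a k s t w *\<^sub>R cis ((w t - w s) \<bullet> l)))" by (rule R(1))
 show "(LINT w|P. H w * (tilt a k s t w *\<^sub>R cis ((w t - w s) \<bullet> l))) = (LINT w|P. H w) *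
   (cis ((t - s) * (a * (adjoint J k \<bullet> adjoint J l))) * of_real (exp (- ((t - s) * \<kappa> l) / 2)))"
  unfolding R(2) integral_tilt_cis(2)[OF st] ..
qed

end

section \<open>The Cameron--Martin formula\<close>

text \<open>\<open>restrict\<close> returns to the representation of paths that are
  \<open>undefined\<close> before time 0. The slope acts from \<open>s\<close> on without end, so
  that one shift serves every later horizon.\<close>

definition path_shift :: "real => 'k::real_normed_vector => (real => 'k) => real => 'k" where
 "path_shift s w x = restrict (\<lambda>u. x u + max 0 (u - s) *\<^sub>R w) {0..}"

lemma path_shift_apply: "u \<ge> 0 ==> path_shift s w x u = x u + max 0 (u - s) *\<^sub>R w"
 by (simp add: path_shift_def)

lemma path_shift_in_path_space:
 assumes "x \<in> path_space"
 shows "path_shift s w x \<in> path_space"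
proof -
 have "continuous_on {0..} (\<lambda>u. x u + max 0 (u - s) *\<^sub>R w)"
  by (intro continuous_intros path_space_continuous assms)
 then have "continuous_on {0..} (path_shift s w x)"
  by (rule continuous_on_eq) (simp add: path_shift_def)
 then show ?thesis by (simp add: path_space_def path_shift_def)
qed

lemma path_shift_measurable:
 fixes w :: "'k::{real_normed_vector,second_countable_topology}"
 shows "path_shift s w \<in> measurable (natural_filtration r) (natural_filtration r)"
proof (rule measurable_sigma_sets[OF sets_natural_filtration], goal_cases)
 case 1 show ?case by auto
next
 case 2 show ?case by (auto intro: path_shift_in_path_space)
next
 case (3 A)
 then obtain u B where A: "A = coord u -` B \<inter> path_space" and u: "0 \<le> u" "u \<le> r" and B: "B \<in> sets borel"
  by blast
 have "(\<lambda>x. x u + max 0 (u - s) *\<^sub>R w) \<in> borel_measurable (natural_filtration r)"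
  by (intro borel_measurable_add coord_measurable_natural u borel_measurable_const)
 from sets_Collect_mem[OF this B]
 have "{x \<in> path_space. x u + max 0 (u - s) *\<^sub>R w \<in> B} \<in> sets (natural_filtration r)" by simp
 moreover have "path_shift s w -` A \<inter> space (natural_filtration r) = {x \<in> path_space. x u + max 0 (u - s) *\<^sub>R w \<in> B}"
  using u by (auto simp: A coord_def path_shift_apply path_shift_in_path_space)
 ultimately show ?case by simp
qed

text \<open>The conditional characteristic functions of increments determine all finite-dimensional
  ones: the latest time is peeled off and its weight moved to the preceding time. The factors
  \<open>h1\<close> and \<open>h2\<close> are complex, so that they can carry a density together
  with a bounded function of the past. It serves both the Cameron--Martin formula and the comparison
  of laws under \<open>P\<close> and \<open>Ph\<close>.\<close>

lemma increments_char_eq: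
 fixes W1 :: "real => 'w1 => 'k::{real_inner,second_countable_topology}" and W2 :: "real => 'w2 => 'k"
 assumes inc1: "\<And>p t f k. s \<le> p ==> p < t ==> t \<le> r ==> f \<in> borel_measurable (G1 p) ==> (\<And>w. norm (f w) \<le> 1) ==>
   (LINT w|M1. h1 w * (f w * cis ((W1 t w - W1 p w) \<bullet> k))) = \<phi> p t k * (LINT w|M1. h1 w * f w)"
  and inc2: "\<And>p t f k. s \<le> p ==> p < t ==> t \<le> r ==> f \<in> borel_measurable (G2 p) ==> (\<And>w. norm (f w) \<le> 1) ==>
   (LINT w|M2. h2 w * (f w * cis ((W2 t w - W2 p w) \<bullet> k))) = \<phi> p t k * (LINT w|M2. h2 w * f w)"
  and W1: "\<And>u p. s \<le> u ==> u \<le> p ==> p \<le> r ==> W1 u \<in> borel_measurable (G1 p)"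
  and W2: "\<And>u p. s \<le> u ==> u \<le> p ==> p \<le> r ==> W2 u \<in> borel_measurable (G2 p)"
  and base: "(LINT w|M1. h1 w) = (LINT w|M2. h2 w)"
  and D: "finite D" "D \<subseteq> {s<..r}"
 shows "(LINT w|M1. h1 w * cis (\<Sum>u\<in>D. (W1 u w - W1 s w) \<bullet> k u)) = (LINT w|M2. h2 w * cis (\<Sum>u\<in>D. (W2 u w - W2 s w) \<bullet> k u))"
 using D
proof (induction D arbitrary: k rule: finite_linorder_max_induct)
 case empty
 show ?case using base by (simp add: cis_zero)
next
 case (insert t D)
 \<comment> \<open>The preceding time, or \<open>s\<close> itself if \<open>D\<close> is empty; then
   the weight moved to it belongs to an increment that vanishes.\<close>
 define p where "p = Max (insert s D)"
 have "finite (insert s D)" using insert(1) by simp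
 then have p: "p \<in> insert s D" "\<And>u. u \<in> insert s D ==> u \<le> p"
  unfolding p_def by (rule Max_in, simp, rule Max_ge)
 have t: "s < t" "t \<le> r" and D: "D \<subseteq> {s<..r}" using insert.prems by auto
 have sp: "s \<le> p" "p < t" "p \<le> r" using p insert(2) t by auto
 define k' where "k' = k(p := k p + k t)"
 have *: "(\<Sum>u\<in>insert t D. (W u w - W s w) \<bullet> k u) = (\<Sum>u\<in>D. (W u w - W s w) \<bullet> k' u) + (W t w - W p w) \<bullet> k t"
  for W :: "real => 'w => 'k" and w
 proof -
  have "(\<Sum>u\<in>D. (W u w - W s w) \<bullet> k' u) = (\<Sum>u\<in>D. (W u w - W s w) \<bullet> k u + (if u = p then (W p w - W s w) \<bullet> k t else 0))"
   by (rule sum.cong) (auto simp: k'_def inner_add_right)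
  also have "\<dots> = (\<Sum>u\<in>D. (W u w - W s w) \<bullet> k u) + (W p w - W s w) \<bullet> k t"
   unfolding sum.distrib using insert(1) p(1) D by (auto simp: sum.delta)
  finally show ?thesis using insert(1,2) by (auto simp: inner_diff_left)
 qed
 have m: "(\<lambda>w. cis (\<Sum>u\<in>D. (W u w - W s w) \<bullet> k' u)) \<in> borel_measurable (G p)"
  if "\<And>u p. s \<le> u ==> u \<le> p ==> p \<le> r ==> W u \<in> borel_measurable (G p)" for W :: "real => 'w => 'k" and G
 proof -
  have "(\<lambda>w. \<Sum>u\<in>D. (W u w - W s w) \<bullet> k' u) \<in> borel_measurable (G p)"
   using D p(2) sp by (intro borel_measurable_sum borel_measurable_inner borel_measurable_diff borel_measurable_const that) auto
  then show ?thesis by measurable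
 qed
 have m1: "(\<lambda>w. cis (\<Sum>u\<in>D. (W1 u w - W1 s w) \<bullet> k' u)) \<in> borel_measurable (G1 p)" by (rule m) (rule W1)
 have m2: "(\<lambda>w. cis (\<Sum>u\<in>D. (W2 u w - W2 s w) \<bullet> k' u)) \<in> borel_measurable (G2 p)" by (rule m) (rule W2)
 have n: "norm (cis y) \<le> 1" for y by simp
 show ?case
  unfolding * cis_mult[symmetric] using inc1[OF sp(1,2) t(2) m1 n, of "k t"] inc2[OF sp(1,2) t(2) m2 n, of "k t"]
   insert.IH[OF D, of k'] by simp
qed

context cylindrical_wiener_path_space
begin

lemma measurable_canonical_mono:
 assumes "f \<in> measurable (\<F> s) N" "s \<le> t"
 shows "f \<in> measurable (\<F> t) N"
 by (rule measurable_filtration_mono[OF assms(1)]) (simp_all add: canonical_filtration_mono assms)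

text \<open>Under the tilt, increments after \<open>s\<close> have the conditional characteristic
  functions of increments with the drift \<open>a *\<^sub>R J (adjoint J k)\<close> added;
  \<open>increments_char_eq\<close> compares the tilted process with the drifted one.\<close>

lemma integral_tilt_cis_sum:
 fixes H :: "_ => complex"
 assumes s: "0 \<le> s" and H: "H \<in> borel_measurable (\<F> s)" "\<And>w. norm (H w) \<le> b"
  and I: "finite I" "I \<subseteq> {s<..r}" and sr: "s \<le> r"
 shows "(LINT w|P. H w * tilt a k s r w * cis (\<Sum>u\<in>I. (w u - w s) \<bullet> l u)) =
  (LINT w|P. H w * cis (\<Sum>u\<in>I. (w u - w s + (u - s) *\<^sub>R a *\<^sub>R J (adjoint J k)) \<bullet> l u))"
proof -
 interpret adj: linear "adjoint J" by (rule adjoint_linear_hilbert[OF J])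
 define v where "v = a *\<^sub>R J (adjoint J k)"
 define \<phi> where "\<phi> p t l = cis ((t - p) * (a * (adjoint J k \<bullet> adjoint J l))) * of_real (exp (- ((t - p) * \<kappa> l) / 2))" for p t l
 have A: "(\<lambda>w. H w * f w * tilt a k s p w) \<in> borel_measurable (\<F> p)" "integrable P (\<lambda>w. H w * f w * tilt a k s p w)"
  if p: "s \<le> p" and f: "f \<in> borel_measurable (\<F> p)" "\<And>w. norm (f w) \<le> 1" for p f
 proof -
  have [measurable]: "(\<lambda>w. w p) \<in> borel_measurable (\<F> p)" "(\<lambda>w. w s) \<in> borel_measurable (\<F> p)"
   using s p by (intro coord_measurable_canonical; simp)+
  note [measurable] = measurable_canonical_mono[OF H(1) p] f(1)
  show m: "(\<lambda>w. H w * f w * tilt a k s p w) \<in> borel_measurable (\<F> p)" by measurable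
  show "integrable P (\<lambda>w. H w * f w * tilt a k s p w)"
  proof (rule Bochner_Integration.integrable_bound)
   show "integrable P (\<lambda>w. b * tilt a k s p w)" by (intro integrable_mult_right integral_tilt_cis(1) s p)
   have "norm (H w * f w) \<le> \<bar>b\<bar>" for w
    unfolding norm_mult using mult_mono[OF H(2) f(2), of w w] order_trans[OF norm_ge_zero H(2)] by simp
   then show "AE w in P. norm (H w * f w * tilt a k s p w) \<le> norm (b * tilt a k s p w)"
    by (intro AE_I2) (simp add: norm_mult[of "H _ * f _"] abs_mult mult_right_mono)
  qed (rule measurable_canonical_P[OF m])
 qed
 \<comment> \<open>Given \<open>\<F> p\<close>, the factor of the tilt that belongs to the time
   after \<open>p\<close> has mean one.\<close>
 have tilt0: "(LINT w|P. H w * tilt a k s r w * f w) = (LINT w|P. H w * f w * tilt a k s p w)"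
  if p: "s \<le> p" "p \<le> r" and f: "f \<in> borel_measurable (\<F> p)" "\<And>w. norm (f w) \<le> 1" for p f
 proof -
  have "tilt a k s r w = tilt a k s p w * tilt a k p r w" for w
   unfolding exp_add[symmetric] by (rule arg_cong[of _ _ exp]) (simp add: inner_diff_left field_simps)
  then show ?thesis
   using integral_mult_tilt_cis(2)[OF order_trans[OF s p(1)] p(2) A[OF p(1) f], of a k 0]
   by (simp add: adj.zero cis_zero scaleR_conv_of_real mult_ac)
 qed
 have "(LINT w|P. H w * tilt a k s r w * cis (\<Sum>u\<in>I. (w u - w s) \<bullet> l u)) =
  (LINT w|P. H w * cis (\<Sum>u\<in>I. ((w u + (u - s) *\<^sub>R v) - (w s + (s - s) *\<^sub>R v)) \<bullet> l u))"
 proof (rule increments_char_eq[where ?G1.0=\<F> and ?G2.0=\<F> and \<phi>=\<phi> and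
    ?W1.0="\<lambda>u w. w u" and ?W2.0="\<lambda>u w. w u + (u - s) *\<^sub>R v" and ?h1.0="\<lambda>w. H w * tilt a k s r w" and ?h2.0=H])
  show "(LINT w|P. H w * tilt a k s r w * (f w * cis ((w t - w p) \<bullet> l))) = \<phi> p t l * (LINT w|P. H w * tilt a k s r w * f w)"
   if st: "s \<le> p" "p < t" "t \<le> r" and f: "f \<in> borel_measurable (\<F> p)" "\<And>w. norm (f w) \<le> 1" for p t f l
  proof -
   have p0: "0 \<le> p" and pt: "p \<le> t" and sT: "s \<le> t" and pr: "p \<le> r" using s st by auto
   have [measurable]: "(\<lambda>w. w t) \<in> borel_measurable (\<F> t)" "(\<lambda>w. w p) \<in> borel_measurable (\<F> t)"
    using p0 pt by (intro coord_measurable_canonical; simp)+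
   note [measurable] = measurable_canonical_mono[OF f(1) pt]
   have fm: "(\<lambda>w. f w * cis ((w t - w p) \<bullet> l)) \<in> borel_measurable (\<F> t)" by measurable
   have "tilt a k s t w = tilt a k s p w * tilt a k p t w" for w
    unfolding exp_add[symmetric] by (rule arg_cong[of _ _ exp]) (simp add: inner_diff_left field_simps)
   then show ?thesis
    using integral_mult_tilt_cis(2)[OF p0 pt A[OF st(1) f], of a k l] tilt0[OF sT st(3) fm] tilt0[OF st(1) pr f] f(2)
    by (simp add: \<phi>_def norm_mult scaleR_conv_of_real mult_ac)
  qed
  show "(LINT w|P. H w * (f w * cis (((w t + (t - s) *\<^sub>R v) - (w p + (p - s) *\<^sub>R v)) \<bullet> l))) = \<phi> p t l * (LINT w|P. H w * f w)"
   if st: "s \<le> p" "p < t" "t \<le> r" and f: "f \<in> borel_measurable (\<F> p)" "\<And>w. norm (f w) \<le> 1" for p t f l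
  proof -
   have p0: "0 \<le> p" using s st by simp
   note [measurable] = measurable_canonical_mono[OF H(1) st(1)] f(1)
   have m: "(\<lambda>w. H w * f w) \<in> borel_measurable (\<F> p)" by measurable
   have i: "integrable P (\<lambda>w. H w * f w)"
    by (rule integrable_const_bound[of _ b])
     (use mult_mono[OF H(2) f(2)] order_trans[OF norm_ge_zero H(2)] measurable_canonical_P[OF m] in \<open>auto simp: norm_mult\<close>)
   have "v \<bullet> l = a * (adjoint J k \<bullet> adjoint J l)" by (simp add: v_def inner_adjoint_J)
   then have "((w t + (t - s) *\<^sub>R v) - (w p + (p - s) *\<^sub>R v)) \<bullet> l = (w t - w p) \<bullet> l + (t - p) * (a * (adjoint J k \<bullet> adjoint J l))" for w
    by (simp add: inner_diff_left inner_add_left algebra_simps)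
   then have "(LINT w|P. H w * (f w * cis (((w t + (t - s) *\<^sub>R v) - (w p + (p - s) *\<^sub>R v)) \<bullet> l))) =
     (LINT w|P. cis ((t - p) * (a * (adjoint J k \<bullet> adjoint J l))) * (H w * f w * (tilt 0 k p t w *\<^sub>R cis ((w t - w p) \<bullet> l))))"
    by (simp add: mult_ac flip: cis_mult)
   then show ?thesis
    using integral_mult_tilt_cis(2)[OF p0 less_imp_le[OF st(2)] m i, of 0 k l]
    unfolding Bochner_Integration.integral_mult_right_zero by (simp add: \<phi>_def cis_zero mult_ac)
  qed
  show "(\<lambda>w :: real => 'k. w u) \<in> borel_measurable (\<F> p)" if "s \<le> u" "u \<le> p" for u p
   using s that by (intro coord_measurable_canonical) auto
  then show "(\<lambda>w :: real => 'k. w u + (u - s) *\<^sub>R v) \<in> borel_measurable (\<F> p)" if "s \<le> u" "u \<le> p" for u p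
   using that by (intro borel_measurable_add borel_measurable_const)
  show "finite I" "I \<subseteq> {s<..r}" by (fact I)+
  show "(LINT w|P. H w * tilt a k s r w) = (LINT w|P. H w)"
   using tilt0[OF order_refl sr, of "\<lambda>_. 1"] by simp
 qed
 then show ?thesis by (simp add: v_def add_diff_eq diff_add_eq)
qed

text \<open>Both sides are finite measures on the path up to \<open>r\<close>, so it is enough to
  test them with characters of finite linear functionals of the path.\<close>

lemma cameron_martin_measure:
 fixes H :: "_ => real"
 assumes sr: "0 \<le> s" "s \<le> r" and H: "H \<in> borel_measurable (\<F> s)"
  and H_bd: "\<And>y. 0 \<le> H y" "\<And>y. H y \<le> b"
 shows "distr (density P (\<lambda>y. ennreal (H y * tilt a k s r y))) (natural_filtration r) (\<lambda>y. y) =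
  distr (density P (\<lambda>y. ennreal (H y))) (natural_filtration r) (path_shift s (a *\<^sub>R J (adjoint J k)))"
  (is "?M = ?N")
proof -
 define V :: "((real => 'k) => real) set"
  where "V = {f. \<exists>I l. finite I \<and> I \<subseteq> {0..r} \<and> f = (\<lambda>y. \<Sum>u\<in>I. y u \<bullet> l u)}"
 have HP [measurable]: "H \<in> borel_measurable P"
  by (rule measurable_canonical_P[OF H])
 have [measurable]: "(\<lambda>y. y s) \<in> borel_measurable P" "(\<lambda>y. y r) \<in> borel_measurable P"
  using sr by auto
 have id: "(\<lambda>y. y) \<in> measurable P (natural_filtration r)"
  using measurable_from_subalg[OF subalgebra_natural measurable_ident] by (simp add: id_def)
 have sh: "path_shift s w \<in> measurable P (natural_filtration r)" for w
  by (rule measurable_from_subalg[OF subalgebra_natural path_shift_measurable])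
 have Hint: "integrable P H"
  using H_bd by (intro integrable_const_bound[of _ b]) auto
 have tint: "integrable P (\<lambda>y. H y * tilt a k s r y)"
 proof (rule Bochner_Integration.integrable_bound)
  show "integrable P (\<lambda>y. b * tilt a k s r y)"
   by (intro integrable_mult_right integral_tilt_cis(1) sr)
  show "AE y in P. norm (H y * tilt a k s r y) \<le> norm (b * tilt a k s r y)"
   using H_bd order_trans[OF H_bd] by (intro AE_I2) (auto simp: abs_mult intro!: mult_right_mono)
 qed simp
 have fin: "finite_measure (distr (density P (\<lambda>y. ennreal (G y))) (natural_filtration r) f)"
  if "integrable P G" "\<And>y. 0 \<le> G y" "f \<in> measurable P (natural_filtration r)" for G f
 proof -
  have "(\<integral>\<^sup>+y. ennreal (G y) \<partial>P) < \<infinity>" using that(1,2)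
   by (simp add: integrable_iff_bounded)
  then have "finite_measure (density P (\<lambda>y. ennreal (G y)))"
  proof (intro finite_measureI)
   have "emeasure (density P (\<lambda>y. ennreal (G y))) (space P) = (\<integral>\<^sup>+y. ennreal (G y) \<partial>P)"
    using that(1) sets.top[of P] by (subst emeasure_density) (auto intro!: nn_integral_cong)
   then show "(\<integral>\<^sup>+y. ennreal (G y) \<partial>P) < \<infinity> ==>
     emeasure (density P (\<lambda>y. ennreal (G y))) (space (density P (\<lambda>y. ennreal (G y)))) \<noteq> \<infinity>"
    by simp
  qed
  then show ?thesis using that(3) by (intro finite_measure.finite_measure_distr) simp_all
 qed
 show ?thesis
 proof (rule finite_measure_eqI_char[of ?M ?N path_space V])
  show "finite_measure ?M" using tint H_bd by (intro fin id) auto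
  show "finite_measure ?N" using Hint H_bd by (intro fin sh) auto
  show "sets ?N = sets ?M" by simp
  show "V \<noteq> {}" unfolding V_def by blast
  have Vm: "f \<in> borel_measurable (natural_filtration r)" if "f \<in> V" for f
  proof -
   obtain I l where I: "finite I" "I \<subseteq> {0..r}" and f: "f = (\<lambda>y. \<Sum>u\<in>I. y u \<bullet> l u)"
    using \<open>f \<in> V\<close> unfolding V_def by blast
   show ?thesis unfolding f
    using I by (intro borel_measurable_sum borel_measurable_inner coord_measurable_natural borel_measurable_const) auto
  qed
  show "sets ?M = sigma_sets path_space {{x \<in> path_space. f x \<in> B} |f B. f \<in> V \<and> B \<in> sets borel}" (is "_ = sigma_sets _ ?G")
  proof -
   have GP: "?G \<subseteq> Pow path_space" by auto
   define N where "N = sigma path_space ?G"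
   have N: "space N = path_space" "sets N = sigma_sets path_space ?G"
    unfolding N_def by (rule space_measure_of[OF GP], rule sets_measure_of[OF GP])
   have "sigma_sets path_space ?G \<subseteq> sets (natural_filtration r)"
   proof -
    have "?G \<subseteq> sets (natural_filtration r)"
    proof
     fix X assume "X \<in> ?G"
     then obtain f B where X: "X = {x \<in> path_space. f x \<in> B}" and "f \<in> V" "B \<in> sets borel" by blast
     from sets_Collect_mem[OF Vm[OF this(2)] this(3)] show "X \<in> sets (natural_filtration r)" by (simp add: X)
    qed
    from sets.sigma_sets_subset[OF this] show ?thesis by simp
   qed
   moreover have "sets (natural_filtration r) \<subseteq> sets N"
   proof (rule sets_natural_filtration_leI[OF N(1)], rule borel_measurable_innerI, rule measurableI)
    fix u k and B :: "real set" assume u: "0 \<le> u" "u \<le> r" and B: "B \<in> sets borel"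
    have "(\<lambda>y. y u \<bullet> k) \<in> V" unfolding V_def
     using u by (intro CollectI exI[of _ "{u}"] exI[of _ "\<lambda>_. k"]) simp
    then have "{x \<in> path_space. x u \<bullet> k \<in> B} \<in> ?G"
     using B by (intro CollectI exI[of _ "\<lambda>y. y u \<bullet> k"] exI[of _ B] conjI refl)
    then have "{x \<in> path_space. x u \<bullet> k \<in> B} \<in> sets N" unfolding N by (rule sigma_sets.Basic)
    moreover have "(\<lambda>x. x u \<bullet> k) -` B \<inter> space N = {x \<in> path_space. x u \<bullet> k \<in> B}" using N(1) by auto
    ultimately show "(\<lambda>x. x u \<bullet> k) -` B \<inter> space N \<in> sets N" by simp
   qed simp
   ultimately show ?thesis unfolding N(2) sets_distr by (intro subset_antisym)
  qed
  show "(\<lambda>y. c * f y) \<in> V" if "f \<in> V" for f c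
  proof -
   obtain I l where I: "finite I" "I \<subseteq> {0..r}" and f: "f = (\<lambda>y. \<Sum>u\<in>I. y u \<bullet> l u)"
    using \<open>f \<in> V\<close> unfolding V_def by blast
   show ?thesis unfolding V_def f
    using I by (intro CollectI exI[of _ I] exI[of _ "\<lambda>u. c *\<^sub>R l u"]) (simp add: sum_distrib_left)
  qed
  show "(\<lambda>y. f y + g y) \<in> V" if "f \<in> V" "g \<in> V" for f g
  proof -
   obtain I l where I: "finite I" "I \<subseteq> {0..r}" and f: "f = (\<lambda>y. \<Sum>u\<in>I. y u \<bullet> l u)"
    using \<open>f \<in> V\<close> unfolding V_def by blast
   obtain I' l' where I': "finite I'" "I' \<subseteq> {0..r}" and g: "g = (\<lambda>y. \<Sum>u\<in>I'. y u \<bullet> l' u)"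
    using \<open>g \<in> V\<close> unfolding V_def by blast
   have "f y + g y = (\<Sum>u\<in>I \<union> I'. y u \<bullet> ((if u \<in> I then l u else 0) + (if u \<in> I' then l' u else 0)))" for y
   proof -
    have "f y = (\<Sum>u\<in>I \<union> I'. y u \<bullet> (if u \<in> I then l u else 0))"
     unfolding f using I I' by (intro sum.mono_neutral_cong_left) auto
    moreover have "g y = (\<Sum>u\<in>I \<union> I'. y u \<bullet> (if u \<in> I' then l' u else 0))"
     unfolding g using I I' by (intro sum.mono_neutral_cong_left) auto
    ultimately show ?thesis by (simp add: inner_add_right sum.distrib)
   qed
   then show ?thesis unfolding V_def
    using I I' by (intro CollectI exI[of _ "I \<union> I'"] exI[of _ "\<lambda>u. (if u \<in> I then l u else 0) + (if u \<in> I' then l' u else 0)"]) auto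
  qed
  show "(LINT y|?M. cis (f y)) = (LINT y|?N. cis (f y))" if "f \<in> V" for f
  proof -
   obtain I l where I: "finite I" "I \<subseteq> {0..r}" and f: "f = (\<lambda>y. \<Sum>u\<in>I. y u \<bullet> l u)"
    using \<open>f \<in> V\<close> unfolding V_def by blast
   define w where "w = a *\<^sub>R J (adjoint J k)"
   \<comment> \<open>Values at times up to \<open>s\<close> are known at \<open>s\<close> and are
     not moved by the shift; they are absorbed into the factor \<open>H'\<close>. The later values
     are written as increments from \<open>s\<close>.\<close>
   define I1 where "I1 = I \<inter> {..s}"
   define I2 where "I2 = I \<inter> {s<..}"
   have I12: "I = I1 \<union> I2" "I1 \<inter> I2 = {}" "finite I1" "finite I2" "I1 \<subseteq> {0..s}" "I2 \<subseteq> {s<..r}"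
    using I by (auto simp: I1_def I2_def)
   define g where "g y = (\<Sum>u\<in>I1. y u \<bullet> l u) + y s \<bullet> (\<Sum>u\<in>I2. l u)" for y :: "real => 'k"
   define H' where "H' y = complex_of_real (H y) * cis (g y)" for y
   have f_split: "f y = g y + (\<Sum>u\<in>I2. (y u - y s) \<bullet> l u)" for y
    unfolding f g_def using I12 by (simp add: sum.union_disjoint inner_diff_left sum_subtractf inner_sum_right)
   have f_shift: "f (path_shift s w y) = g y + (\<Sum>u\<in>I2. (y u - y s + (u - s) *\<^sub>R w) \<bullet> l u)" for y
   proof -
    have "(\<Sum>u\<in>I1. path_shift s w y u \<bullet> l u) = (\<Sum>u\<in>I1. y u \<bullet> l u)"
     using I12(5) by (intro sum.cong) (auto simp: path_shift_apply)
    moreover have "path_shift s w y s = y s" using sr by (simp add: path_shift_apply)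
    moreover have "(\<Sum>u\<in>I2. (path_shift s w y u - y s) \<bullet> l u) = (\<Sum>u\<in>I2. (y u - y s + (u - s) *\<^sub>R w) \<bullet> l u)"
    proof (intro sum.cong refl)
     fix u assume "u \<in> I2"
     then have "s < u" using I12(6) by auto
     then show "(path_shift s w y u - y s) \<bullet> l u = (y u - y s + (u - s) *\<^sub>R w) \<bullet> l u"
      using sr(1) by (simp add: path_shift_apply max_def diff_add_eq)
    qed
    ultimately show ?thesis unfolding f_split[of "path_shift s w y"] by (simp add: g_def)
   qed
   have gm: "g \<in> borel_measurable (\<F> s)"
    unfolding g_def using I12 sr
    by (intro borel_measurable_add borel_measurable_sum borel_measurable_inner coord_measurable_canonical borel_measurable_const) auto
   have H'm: "H' \<in> borel_measurable (\<F> s)"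
    unfolding H'_def using H gm by measurable
   have H'b: "norm (H' y) \<le> b" for y using H_bd by (simp add: H'_def norm_mult)
   have fm: "(\<lambda>y. cis (f y)) \<in> borel_measurable (natural_filtration r)" using Vm[OF that] by measurable
   note S = integral_tilt_cis_sum[OF sr(1) H'm H'b I12(4) I12(6) sr(2), of a k l, folded w_def]
   have "(LINT y|?M. cis (f y)) = (LINT y|P. (H y * tilt a k s r y) *\<^sub>R cis (f y))"
    using H_bd Vm[OF that] id fm measurable_from_subalg[OF subalgebra_natural fm]
    by (subst integral_distr) (simp_all add: integral_density)
   also have "\<dots> = (LINT y|P. H' y * tilt a k s r y * cis (\<Sum>u\<in>I2. (y u - y s) \<bullet> l u))"
    unfolding f_split by (simp add: H'_def cis_mult[symmetric] scaleR_conv_of_real mult_ac)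
   also have "\<dots> = (LINT y|P. H' y * cis (\<Sum>u\<in>I2. (y u - y s + (u - s) *\<^sub>R w) \<bullet> l u))"
    by (rule S)
   also have "\<dots> = (LINT y|P. H y *\<^sub>R cis (f (path_shift s w y)))"
    unfolding f_shift by (simp add: H'_def cis_mult[symmetric] scaleR_conv_of_real mult_ac)
   also have "\<dots> = (LINT y|?N. cis (f y))"
    using H_bd fm sh[of w] measurable_compose[OF sh[of w] fm]
    by (subst integral_distr) (simp_all add: integral_density w_def)
   finally show ?thesis .
  qed
 qed
qed

lemma cameron_martin_nonneg:
 fixes H F :: "_ => real"
 assumes sr: "0 \<le> s" "s \<le> r" and H: "H \<in> borel_measurable (\<F> s)"
  and H_bd: "\<And>w. 0 \<le> H w" "\<And>w. H w \<le> b" and F: "F \<in> borel_measurable (natural_filtration r)"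
 shows "(LINT w|P. H w * tilt a k s r w * F w) =
  (LINT w|P. H w * F (path_shift s (a *\<^sub>R J (adjoint J k)) w))"
proof -
 let ?sh = "path_shift s (a *\<^sub>R J (adjoint J k))"
 have HP [measurable]: "H \<in> borel_measurable P"
  by (rule measurable_canonical_P[OF H])
 have FP [measurable]: "F \<in> borel_measurable P"
  by (rule measurable_from_subalg[OF subalgebra_natural F])
 have [measurable]: "(\<lambda>w. w s) \<in> borel_measurable P" "(\<lambda>w. w r) \<in> borel_measurable P"
  using sr by auto
 have id: "(\<lambda>w. w) \<in> measurable P (natural_filtration r)"
  using measurable_from_subalg[OF subalgebra_natural measurable_ident] by (simp add: id_def)
 have sh: "?sh \<in> measurable P (natural_filtration r)"
  by (rule measurable_from_subalg[OF subalgebra_natural path_shift_measurable])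
 have "(LINT w|P. H w * tilt a k s r w * F w) =
   (\<integral>w. F w \<partial>distr (density P (\<lambda>w. ennreal (H w * tilt a k s r w))) (natural_filtration r) (\<lambda>w. w))"
  using H_bd id F by (subst integral_distr) (simp_all add: integral_density)
 also have "\<dots> = (\<integral>w. F w \<partial>distr (density P (\<lambda>w. ennreal (H w))) (natural_filtration r) ?sh)"
  by (simp only: cameron_martin_measure[OF sr H H_bd])
 also have "\<dots> = (LINT w|P. H w * F (?sh w))"
  using H_bd sh F measurable_compose[OF sh F] by (subst integral_distr) (simp_all add: integral_density)
 finally show ?thesis .
qed

text \<open>\<open>H\<close> is the difference of the nonnegative functions \<open>H + b\<close> and
  \<open>b\<close>, each of which can serve as a density.\<close>

lemma cameron_martin_real:
 fixes H F :: "_ => real"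
 assumes sr: "0 \<le> s" "s \<le> r" and H: "H \<in> borel_measurable (\<F> s)"
  and H_bd: "\<And>w. \<bar>H w\<bar> \<le> b" and F: "F \<in> borel_measurable (natural_filtration r)" "\<And>w. \<bar>F w\<bar> \<le> c"
 shows "integrable P (\<lambda>w. H w * tilt a k s r w * F w)"
  and "(LINT w|P. H w * tilt a k s r w * F w) =
  (LINT w|P. H w * F (path_shift s (a *\<^sub>R J (adjoint J k)) w))"
proof -
 let ?sh = "path_shift s (a *\<^sub>R J (adjoint J k))"
 have HP [measurable]: "H \<in> borel_measurable P"
  by (rule measurable_canonical_P[OF H])
 have FP [measurable]: "F \<in> borel_measurable P"
  by (rule measurable_from_subalg[OF subalgebra_natural F(1)])
 have sh: "?sh \<in> measurable P (natural_filtration r)"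
  by (rule measurable_from_subalg[OF subalgebra_natural path_shift_measurable])
 have [measurable]: "(\<lambda>w. F (?sh w)) \<in> borel_measurable P" by (rule measurable_compose[OF sh F(1)])
 have [measurable]: "(\<lambda>w. w s) \<in> borel_measurable P" "(\<lambda>w. w r) \<in> borel_measurable P"
  using sr by auto
 have b: "0 \<le> b" using H_bd[of "\<lambda>_. 0"] by simp
 have int: "integrable P (\<lambda>w. G w * tilt a k s r w * F w)" "integrable P (\<lambda>w. G w * F (?sh w))"
  if [measurable]: "G \<in> borel_measurable P" and G: "\<And>w. \<bar>G w\<bar> \<le> b" for G
 proof -
  show "integrable P (\<lambda>w. G w * tilt a k s r w * F w)"
  proof (rule Bochner_Integration.integrable_bound)
   show "integrable P (\<lambda>w. (b * c) * tilt a k s r w)"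
    by (intro integrable_mult_right integral_tilt_cis(1) sr)
   show "AE w in P. norm (G w * tilt a k s r w * F w) \<le> norm ((b * c) * tilt a k s r w)"
   proof (rule AE_I2)
    fix w
    have "\<bar>G w\<bar> * \<bar>F w\<bar> \<le> b * c" using G F(2) b by (intro mult_mono) auto
    then have "(\<bar>G w\<bar> * \<bar>F w\<bar>) * tilt a k s r w \<le> \<bar>b * c\<bar> * tilt a k s r w"
     by (intro mult_right_mono) auto
    then show "norm (G w * tilt a k s r w * F w) \<le> norm ((b * c) * tilt a k s r w)"
     by (simp add: abs_mult mult_ac)
   qed
  qed simp
  show "integrable P (\<lambda>w. G w * F (?sh w))"
  proof (rule integrable_const_bound[of _ "b * c"], rule AE_I2)
   fix w show "norm (G w * F (?sh w)) \<le> b * c"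
    unfolding real_norm_def abs_mult using G F(2) b by (intro mult_mono) auto
  qed simp
 qed
 show "integrable P (\<lambda>w. H w * tilt a k s r w * F w)" by (rule int(1)[OF HP H_bd])
 have 1: "(LINT w|P. (H w + b) * tilt a k s r w * F w) = (LINT w|P. (H w + b) * F (?sh w))"
 proof (rule cameron_martin_nonneg[OF sr _ _ _ F(1)])
  show "(\<lambda>w. H w + b) \<in> borel_measurable (\<F> s)" using H by measurable
  fix w show "0 \<le> H w + b" "H w + b \<le> 2 * b" using H_bd[of w] by auto
 qed
 have 2: "(LINT w|P. b * tilt a k s r w * F w) = (LINT w|P. b * F (?sh w))"
  using b by (intro cameron_martin_nonneg[OF sr _ _ _ F(1)]) auto
 have b': "\<bar>b\<bar> \<le> b" using b by simp
 note i1 = int[OF HP H_bd] and i2 = int[of "\<lambda>_. b", OF _ b']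
 show "(LINT w|P. H w * tilt a k s r w * F w) = (LINT w|P. H w * F (?sh w))"
  using 1 2 i1 i2 by (simp add: distrib_right)
qed

theorem cameron_martin:
 fixes H :: "_ => complex" and F :: "_ => real"
 assumes sr: "0 \<le> s" "s \<le> r" and H: "H \<in> borel_measurable (\<F> s)"
  and H_bd: "\<And>w. norm (H w) \<le> b" and F: "F \<in> borel_measurable (natural_filtration r)" "\<And>w. \<bar>F w\<bar> \<le> c"
 shows "(LINT w|P. (F w * tilt a k s r w) *\<^sub>R H w) =
  (LINT w|P. F (path_shift s (a *\<^sub>R J (adjoint J k)) w) *\<^sub>R H w)"
proof -
 let ?sh = "path_shift s (a *\<^sub>R J (adjoint J k))"
 have R: "(\<lambda>w. Re (H w)) \<in> borel_measurable (\<F> s)" "\<bar>Re (H w)\<bar> \<le> b" for w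
  using H abs_Re_le_cmod[of "H w"] H_bd[of w] by auto
 have I: "(\<lambda>w. Im (H w)) \<in> borel_measurable (\<F> s)" "\<bar>Im (H w)\<bar> \<le> b" for w
  using H abs_Im_le_cmod[of "H w"] H_bd[of w] by auto
 have HP [measurable]: "H \<in> borel_measurable P"
  by (rule measurable_canonical_P[OF H])
 have FP [measurable]: "F \<in> borel_measurable P"
  by (rule measurable_from_subalg[OF subalgebra_natural F(1)])
 have sh: "?sh \<in> measurable P (natural_filtration r)"
  by (rule measurable_from_subalg[OF subalgebra_natural path_shift_measurable])
 have [measurable]: "(\<lambda>w. F (?sh w)) \<in> borel_measurable P" by (rule measurable_compose[OF sh F(1)])
 have [measurable]: "(\<lambda>w. w s) \<in> borel_measurable P" "(\<lambda>w. w r) \<in> borel_measurable P"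
  using sr by auto
 have i1: "integrable P (\<lambda>w. (F w * tilt a k s r w) *\<^sub>R H w)"
 proof (rule Bochner_Integration.integrable_bound)
  show "integrable P (\<lambda>w. (c * b) * tilt a k s r w)"
   by (intro integrable_mult_right integral_tilt_cis(1) sr)
  show "AE w in P. norm ((F w * tilt a k s r w) *\<^sub>R H w) \<le> norm ((c * b) * tilt a k s r w)"
  proof (rule AE_I2)
   fix w
   have "\<bar>F w\<bar> * norm (H w) \<le> c * b" using F(2)[of w] H_bd[of w] by (intro mult_mono) auto
   then have "(\<bar>F w\<bar> * norm (H w)) * tilt a k s r w \<le> \<bar>c * b\<bar> * tilt a k s r w"
    by (intro mult_right_mono) auto
   then show "norm ((F w * tilt a k s r w) *\<^sub>R H w) \<le> norm ((c * b) * tilt a k s r w)"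
    by (simp add: abs_mult mult_ac)
  qed
 qed simp
 have i2: "integrable P (\<lambda>w. F (?sh w) *\<^sub>R H w)"
 proof (rule integrable_const_bound[of _ "c * b"], rule AE_I2)
  fix w show "norm (F (?sh w) *\<^sub>R H w) \<le> c * b"
   unfolding norm_scaleR using F(2)[of "?sh w"] H_bd[of w] by (intro mult_mono) auto
 qed simp
 show ?thesis
 proof (rule complex_eqI)
  show "Re (LINT w|P. (F w * tilt a k s r w) *\<^sub>R H w) = Re (LINT w|P. F (?sh w) *\<^sub>R H w)"
   unfolding integral_Re[OF i1, symmetric] integral_Re[OF i2, symmetric]
   using cameron_martin_real(2)[OF sr R F, of a k] by (simp add: mult_ac)
  show "Im (LINT w|P. (F w * tilt a k s r w) *\<^sub>R H w) = Im (LINT w|P. F (?sh w) *\<^sub>R H w)"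
   unfolding integral_Im[OF i1, symmetric] integral_Im[OF i2, symmetric]
   using cameron_martin_real(2)[OF sr I F, of a k] by (simp add: mult_ac)
 qed
qed

text \<open>Quasi-invariance: on \<open>natural_filtration r\<close> the law of the shifted path has
  a density, namely the tilt. It allows almost sure identities to be evaluated at shifted
  paths.\<close>

lemma null_set_path_shift:
 assumes sr: "0 \<le> s" "s \<le> r" and N: "N \<in> sets (natural_filtration r)" "emeasure P N = 0"
 shows "AE w in P. path_shift s (a *\<^sub>R J (adjoint J k)) w \<notin> N"
proof -
 let ?sh = "path_shift s (a *\<^sub>R J (adjoint J k))"
 have NP: "N \<in> events" using N(1) subalgebra_natural by (auto simp: subalgebra_def)
 then have N0: "AE w in P. w \<notin> N" using N(2) by (auto intro: AE_not_in simp: null_sets_def)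
 have sh: "?sh \<in> measurable P (natural_filtration r)"
  by (rule measurable_from_subalg[OF subalgebra_natural path_shift_measurable])
 have m: "{w \<in> space P. ?sh w \<in> N} \<in> events" by (rule sets_Collect_mem[OF sh N(1)])
 have "(LINT w|P. 1 * tilt a k s r w * indicat_real N w) = (LINT w|P. 1 * indicat_real N (?sh w))"
  by (rule cameron_martin_nonneg[OF sr, of _ 1]) (use N in auto)
 moreover have "(LINT w|P. 1 * tilt a k s r w * indicat_real N w) = (LINT w|P. (0::real))"
  using N0 by (intro integral_cong_AE) (use sr NP in \<open>auto simp: indicator_def elim!: eventually_mono\<close>)
 moreover have "(LINT w|P. 1 * indicat_real N (?sh w)) = (LINT w|P. indicat_real {w \<in> space P. ?sh w \<in> N} w)"
  by (intro Bochner_Integration.integral_cong) (auto simp: indicator_def)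
 moreover have "\<dots> = prob {w \<in> space P. ?sh w \<in> N}"
  using m sets.sets_into_space[OF m] by (simp add: Int_absorb2)
 ultimately have "prob {w \<in> space P. ?sh w \<in> N} = 0" by simp
 then show ?thesis using m by (intro AE_I[of _ _ "{w \<in> space P. ?sh w \<in> N}"]) (auto simp: emeasure_eq_measure)
qed

end

section \<open>Stochastic integrals along absolutely continuous perturbations\<close>

lemma set_integral_Icc_diff:
 fixes v :: "real => 'a::{banach,second_countable_topology}"
 assumes "0 \<le> a" "a \<le> b" and v: "set_integrable lborel {0..b} v"
 shows "(LINT u:{0..b}|lborel. v u) - (LINT u:{0..a}|lborel. v u) = (LINT u:{a<..b}|lborel. v u)"
proof -
 have eq: "{0..b} = {0..a} \<union> {a<..b}" using assms by auto
 have "set_integrable lborel {0..a} v" "set_integrable lborel {a<..b} v"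
  using assms by (auto intro!: set_integrable_subset[OF v])
 then show ?thesis unfolding eq by (subst set_integral_Un) auto
qed

text \<open>The Hilbert--Schmidt norm dominates the operator norm and \<open>v\<close> is bounded,
  so the integrands converge in mean square over a bounded interval, hence in mean.\<close>

lemma tendsto_set_integral_hs_norm:
 fixes L :: "nat => real => 'h => 'h::{real_inner,banach,second_countable_topology}"
 assumes \<Phi>: "\<And>u. u \<in> {0..t} ==> bounded_linear (\<Phi> u)"
  and L: "\<And>n u. u \<in> {0..t} ==> bounded_linear (L n u)"
  and lim: "(\<lambda>n. \<integral>\<^sup>+u\<in>{0..t}. hs_norm_sq (\<lambda>x. \<Phi> u x - L n u x) \<partial>lborel) \<longlonglongrightarrow> 0"
  and v: "\<And>u. u \<in> {0..t} ==> norm (v u) \<le> c"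
  and f: "set_integrable lborel {0..t} (\<lambda>u. \<Phi> u (v u))"
  and g: "\<And>n. set_integrable lborel {0..t} (\<lambda>u. L n u (v u))"
 shows "(\<lambda>n. LINT u:{0..t}|lborel. L n u (v u)) \<longlonglongrightarrow> (LINT u:{0..t}|lborel. \<Phi> u (v u))"
proof -
 \<comment> \<open>The added 1 makes it positive; the estimates divide by its square.\<close>
 define C where "C = \<bar>c\<bar> + 1"
 have C: "C > 0" and vC: "norm (v u) \<le> C" if "u \<in> {0..t}" for u
  using v[OF that] by (auto simp: C_def)
 have C0: "C > 0" by (simp add: C_def)
 define a where "a n = (\<integral>\<^sup>+u\<in>{0..t}. hs_norm_sq (\<lambda>x. \<Phi> u x - L n u x) \<partial>lborel)" for n
 define d where "d n u = indicator {0..t} u * norm (\<Phi> u (v u) - L n u (v u))" for n u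
 have int: "set_integrable lborel {0..t} (\<lambda>u. \<Phi> u (v u) - L n u (v u))" for n
  using f g by (intro set_integral_diff(1))
 have d_eq: "d n u = norm (indicator {0..t} u *\<^sub>R (\<Phi> u (v u) - L n u (v u)))" for n u
  by (simp add: d_def)
 have dm [measurable]: "d n \<in> borel_measurable lborel" for n
  unfolding d_eq[abs_def]
  by (rule measurable_compose[OF borel_measurable_integrable[OF int[of n, unfolded set_integrable_def]] borel_measurable_norm])
 have hs: "(\<integral>\<^sup>+u. ennreal ((d n u)\<^sup>2 / C\<^sup>2) \<partial>lborel) \<le> a n" for n
  unfolding a_def
 proof (intro nn_integral_mono)
  fix u :: real
  show "ennreal ((d n u)\<^sup>2 / C\<^sup>2) \<le> hs_norm_sq (\<lambda>x. \<Phi> u x - L n u x) * indicator {0..t} u"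
  proof (cases "u \<in> {0..t}")
   case True
   let ?hs = "hs_norm_sq (\<lambda>x. \<Phi> u x - L n u x)"
   have "bounded_linear (\<lambda>x. \<Phi> u x - L n u x)"
    by (intro bounded_linear_sub \<Phi> L True)
   from hs_norm_sq_bound[OF this, of "v u"]
   have "ennreal ((d n u)\<^sup>2) \<le> ?hs * ennreal ((norm (v u))\<^sup>2)" using True by (simp add: d_def)
   also have "\<dots> \<le> ?hs * ennreal (C\<^sup>2)"
    using vC[OF True] by (intro mult_left_mono ennreal_leI power_mono) auto
   finally have "ennreal (1 / C\<^sup>2) * ennreal ((d n u)\<^sup>2) \<le> ennreal (1 / C\<^sup>2) * (?hs * ennreal (C\<^sup>2))"
    by (rule mult_left_mono) simp
   also have "\<dots> = ?hs * (ennreal (1 / C\<^sup>2) * ennreal (C\<^sup>2))" by (simp only: mult_ac)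
   also have "ennreal (1 / C\<^sup>2) * ennreal (C\<^sup>2) = 1"
    using C0 by (simp add: ennreal_mult[symmetric])
   finally show ?thesis using True by (simp add: ennreal_mult[symmetric])
  qed (simp add: d_def)
 qed
 have bound: "ennreal (norm ((LINT u:{0..t}|lborel. L n u (v u)) - (LINT u:{0..t}|lborel. \<Phi> u (v u)))) \<le>
   ennreal (\<eta> * \<bar>t\<bar>) + ennreal (C\<^sup>2 / (4 * \<eta>)) * a n" if "\<eta> > 0" for n \<eta>
 proof -
  have "(LINT u:{0..t}|lborel. \<Phi> u (v u)) - (LINT u:{0..t}|lborel. L n u (v u)) =
    (LINT u:{0..t}|lborel. \<Phi> u (v u) - L n u (v u))"
   by (rule set_integral_diff(2)[OF f g, symmetric])
  then have "ennreal (norm ((LINT u:{0..t}|lborel. L n u (v u)) - (LINT u:{0..t}|lborel. \<Phi> u (v u)))) =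
    ennreal (norm (LINT u:{0..t}|lborel. \<Phi> u (v u) - L n u (v u)))"
   by (simp add: norm_minus_commute)
  also have "\<dots> \<le> (\<integral>\<^sup>+u. ennreal (d n u) \<partial>lborel)"
   unfolding set_lebesgue_integral_def d_eq
   using int[of n] by (intro integral_norm_bound_ennreal) (simp add: set_integrable_def)
  also have "\<dots> \<le> (\<integral>\<^sup>+u. ennreal \<eta> * indicator {0..t} u + ennreal (C\<^sup>2 / (4 * \<eta>)) * ennreal ((d n u)\<^sup>2 / C\<^sup>2) \<partial>lborel)"
  proof (intro nn_integral_mono)
   fix u :: real
   show "ennreal (d n u) \<le> ennreal \<eta> * indicator {0..t} u + ennreal (C\<^sup>2 / (4 * \<eta>)) * ennreal ((d n u)\<^sup>2 / C\<^sup>2)"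
   proof (cases "u \<in> {0..t}")
    case True
    \<comment> \<open>Young's inequality in place of Cauchy--Schwarz: \<eta> is fixed first, and the
      square is then controlled by the quantity \<open>a n\<close>, which tends to 0.\<close>
    have "0 \<le> (d n u - 2 * \<eta>)\<^sup>2" by simp
    then have "4 * \<eta> * d n u \<le> 4 * \<eta> * \<eta> + (d n u)\<^sup>2"
     by (simp add: power2_eq_square algebra_simps)
    then have "d n u \<le> \<eta> + (d n u)\<^sup>2 / (4 * \<eta>)" using that by (simp add: field_simps)
    also have "(d n u)\<^sup>2 / (4 * \<eta>) = C\<^sup>2 / (4 * \<eta>) * ((d n u)\<^sup>2 / C\<^sup>2)" using C0 by simp
    finally have "ennreal (d n u) \<le> ennreal (\<eta> + C\<^sup>2 / (4 * \<eta>) * ((d n u)\<^sup>2 / C\<^sup>2))" by (rule ennreal_leI)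
    then show ?thesis using that True by (simp add: ennreal_mult[symmetric] ennreal_plus[symmetric] del: ennreal_plus)
   qed (simp add: d_def)
  qed
  also have "\<dots> = ennreal \<eta> * emeasure lborel {0..t} + ennreal (C\<^sup>2 / (4 * \<eta>)) * (\<integral>\<^sup>+u. ennreal ((d n u)\<^sup>2 / C\<^sup>2) \<partial>lborel)"
   by (subst nn_integral_add) (simp_all add: nn_integral_cmult)
  also have "\<dots> \<le> ennreal (\<eta> * \<bar>t\<bar>) + ennreal (C\<^sup>2 / (4 * \<eta>)) * a n"
   using that by (intro add_mono mult_left_mono hs) (auto simp: ennreal_mult' emeasure_lborel_Icc_eq intro!: mult_left_mono ennreal_leI)
  finally show ?thesis .
 qed
 show ?thesis
 proof (rule tendstoI)
  fix e :: real assume e: "e > 0"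
  define \<eta> where "\<eta> = e / (2 * (\<bar>t\<bar> + 1))"
  have \<eta>: "\<eta> > 0" using e by (simp add: \<eta>_def)
  have "\<eta> * \<bar>t\<bar> < \<eta> * (\<bar>t\<bar> + 1)" using \<eta> by simp
  also have "\<dots> = e / 2"
  proof -
   have "e / (2 * x) * x = e / 2" if "x > 0" for x using that by simp
   from this[of "\<bar>t\<bar> + 1"] show ?thesis by (simp add: \<eta>_def)
  qed
  finally have small: "\<eta> * \<bar>t\<bar> < e / 2" .
  have "(\<lambda>n. ennreal (C\<^sup>2 / (4 * \<eta>)) * a n) \<longlonglongrightarrow> ennreal (C\<^sup>2 / (4 * \<eta>)) * 0"
   using lim unfolding a_def by (intro ennreal_tendsto_cmult) simp_all
  then have "(\<lambda>n. ennreal (C\<^sup>2 / (4 * \<eta>)) * a n) \<longlonglongrightarrow> 0" by simp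
  then have "\<forall>\<^sub>F n in sequentially. ennreal (C\<^sup>2 / (4 * \<eta>)) * a n < ennreal (e / 2)"
   using e by (intro order_tendstoD(2)) auto
  then show "\<forall>\<^sub>F n in sequentially. dist (LINT u:{0..t}|lborel. L n u (v u)) (LINT u:{0..t}|lborel. \<Phi> u (v u)) < e"
  proof eventually_elim
   case (elim n)
   have "ennreal (\<eta> * \<bar>t\<bar>) + ennreal (C\<^sup>2 / (4 * \<eta>)) * a n < ennreal (e / 2) + ennreal (e / 2)"
    using small \<eta> elim e by (intro add_strict_mono) (auto simp: ennreal_less_iff)
   also have "\<dots> = ennreal e" using e by (simp add: ennreal_plus[symmetric] del: ennreal_plus)
   finally have "ennreal (norm ((LINT u:{0..t}|lborel. L n u (v u)) - (LINT u:{0..t}|lborel. \<Phi> u (v u)))) < ennreal e"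
    by (rule le_less_trans[OF bound[OF \<eta>]])
   then show ?case by (simp add: dist_norm ennreal_less_iff)
  qed
 qed
qed

lemma bounded_linear_elem_op:
 assumes "bounded_linear J" "\<And>i. i < N ==> bounded_linear (B i)"
 shows "bounded_linear (\<lambda>x. elem_op N p B u (J x))"
 unfolding elem_op_def
 using assms by (intro bounded_linear_sum bounded_linear_compose[OF bounded_linear_scaleR_right]
  bounded_linear_compose[OF _ assms(1)]) auto

text \<open>The integral of a step function against an absolutely continuous path is a Lebesgue
  integral. It is the change of an elementary integral when its integrator is perturbed by such a
  path, as by a shift or in \<open>Wh\<close>.\<close>

lemma elem_integral_drift:
 fixes J :: "'h::{real_inner,banach,second_countable_topology} => 'k::{real_inner,banach,second_countable_topology}"
  and B :: "nat => 'k => 'h"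
 assumes J: "bounded_linear J" and B: "\<And>i. i < N ==> bounded_linear (B i)"
  and p: "0 \<le> p 0" "p N \<le> t" "\<And>i. i < N ==> p i \<le> p (Suc i)"
  and v: "set_integrable lborel {0..t} v"
 shows "set_integrable lborel {0..t} (\<lambda>u. elem_op N p B u (J (v u)))"
  and "(LINT u:{0..t}|lborel. elem_op N p B u (J (v u))) =
   (\<Sum>i<N. B i (J (LINT u:{0..p (Suc i)}|lborel. v u) - J (LINT u:{0..p i}|lborel. v u)))"
proof -
 have mono: "p i \<le> p j" if "i \<le> j" "j \<le> N" for i j
  using that p(3) by (induction j rule: dec_induct) (auto intro: order_trans)
 have pr: "0 \<le> p i" "p i \<le> t" if "i \<le> N" for i
  using mono[of 0 i] mono[of i N] that p by auto
 have bl: "bounded_linear (\<lambda>x. B i (J x))" if "i < N" for i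
  by (rule bounded_linear_compose[OF B[OF that] J])
 have vi: "set_integrable lborel {p i<..p (Suc i)} v" if "i < N" for i
  using that pr[of i] pr[of "Suc i"] by (intro set_integrable_subset[OF v]) auto
 have eq: "indicator {0..t} u *\<^sub>R elem_op N p B u (J (v u)) =
   (\<Sum>i<N. B i (J (indicator {p i<..p (Suc i)} u *\<^sub>R v u)))" for u
 proof -
  have "indicator {0..t} u *\<^sub>R (indicator {p i<..p (Suc i)} u *\<^sub>R B i (J (v u))) =
    B i (J (indicator {p i<..p (Suc i)} u *\<^sub>R v u))" if "i < N" for i
  proof -
   have "indicat_real {0..t} u * indicator {p i<..p (Suc i)} u = indicator {p i<..p (Suc i)} u"
    using pr[of i] pr[of "Suc i"] that by (auto simp: indicator_def)
   then show ?thesis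
    using linear_scale[OF bounded_linear.linear[OF bl[OF that]]] by simp
  qed
  then show ?thesis unfolding elem_op_def scaleR_sum_right by (intro sum.cong) auto
 qed
 have int: "integrable lborel (\<lambda>u. B i (J (indicator {p i<..p (Suc i)} u *\<^sub>R v u)))" if "i < N" for i
  using integrable_bounded_linear[OF bl[OF that]] vi[OF that] by (simp add: set_integrable_def)
 show "set_integrable lborel {0..t} (\<lambda>u. elem_op N p B u (J (v u)))"
  unfolding set_integrable_def eq by (intro Bochner_Integration.integrable_sum int) simp
 have "(LINT u:{0..t}|lborel. elem_op N p B u (J (v u))) =
   (\<Sum>i<N. \<integral>u. B i (J (indicator {p i<..p (Suc i)} u *\<^sub>R v u)) \<partial>lborel)"
  unfolding set_lebesgue_integral_def eq by (intro Bochner_Integration.integral_sum int) simp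
 also have "\<dots> = (\<Sum>i<N. B i (J (LINT u:{p i<..p (Suc i)}|lborel. v u)))"
 proof (intro sum.cong refl)
  fix i assume "i \<in> {..<N}"
  then show "(LINT u|lborel. B i (J (indicator {p i<..p (Suc i)} u *\<^sub>R v u))) = B i (J (LINT u:{p i<..p (Suc i)}|lborel. v u))"
   using integral_bounded_linear[OF bl[of i]] vi[of i] by (simp add: set_integrable_def set_lebesgue_integral_def)
 qed
 also have "\<dots> = (\<Sum>i<N. B i (J (LINT u:{0..p (Suc i)}|lborel. v u) - J (LINT u:{0..p i}|lborel. v u)))"
 proof (intro sum.cong refl)
  fix i assume i: "i \<in> {..<N}"
  have "(LINT u:{0..p (Suc i)}|lborel. v u) - (LINT u:{0..p i}|lborel. v u) = (LINT u:{p i<..p (Suc i)}|lborel. v u)"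
   using i pr[of i] pr[of "Suc i"] p(3)[of i]
   by (intro set_integral_Icc_diff set_integrable_subset[OF v]) auto
  from this[symmetric] show "B i (J (LINT u:{p i<..p (Suc i)}|lborel. v u)) =
    B i (J (LINT u:{0..p (Suc i)}|lborel. v u) - J (LINT u:{0..p i}|lborel. v u))"
   by (simp add: linear_diff[OF bounded_linear.linear[OF J]])
 qed
 finally show "(LINT u:{0..t}|lborel. elem_op N p B u (J (v u))) =
   (\<Sum>i<N. B i (J (LINT u:{0..p (Suc i)}|lborel. v u) - J (LINT u:{0..p i}|lborel. v u)))" .
qed

lemma nn_integral_norm_sq_tendsto_AE_subseq:
 fixes f :: "nat => 'a => 'b::{banach,second_countable_topology}"
 assumes [measurable]: "\<And>n. f n \<in> borel_measurable M"
  and lim: "(\<lambda>n. \<integral>\<^sup>+x. ennreal ((norm (f n x))\<^sup>2) \<partial>M) \<longlonglongrightarrow> 0"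
 obtains r where "strict_mono (r :: nat => nat)" "AE x in M. (\<lambda>n. f (r n) x) \<longlonglongrightarrow> 0"
proof -
 have "\<forall>\<^sub>F n in sequentially. (\<integral>\<^sup>+x. ennreal ((norm (f n x))\<^sup>2) \<partial>M) < 1"
  using lim by (intro order_tendstoD(2)) auto
 then obtain m where m: "\<And>n. n \<ge> m ==> (\<integral>\<^sup>+x. ennreal ((norm (f n x))\<^sup>2) \<partial>M) < 1"
  by (auto simp: eventually_sequentially)
 \<comment> \<open>The first \<open>m\<close> terms may have infinite second moment, so the sequence
   starts after them.\<close>
 define u where "u n x = (norm (f (n + m) x))\<^sup>2" for n x
 have int: "integrable M (u n)" for n
  unfolding u_def using m[of "n + m"] by (intro integrableI_bounded) (auto intro: less_trans)
 have "(\<lambda>n. \<integral>x. norm (u n x) \<partial>M) \<longlonglongrightarrow> 0"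
 proof -
  have "(LINT x|M. norm (u n x)) = enn2real (\<integral>\<^sup>+x. ennreal ((norm (f (n + m) x))\<^sup>2) \<partial>M)" for n
   unfolding u_def by (subst integral_eq_nn_integral) auto
  moreover have "(\<lambda>n. enn2real (\<integral>\<^sup>+x. ennreal ((norm (f (n + m) x))\<^sup>2) \<partial>M)) \<longlonglongrightarrow> enn2real 0"
   using LIMSEQ_ignore_initial_segment[OF lim, of m] by (intro tendsto_enn2real) simp_all
  ultimately show ?thesis by simp
 qed
 from tendsto_L1_AE_subseq[OF int this] obtain r where r: "strict_mono r" "AE x in M. (\<lambda>n. u (r n) x) \<longlonglongrightarrow> 0"
  by blast
 show thesis
 proof (rule that[of "\<lambda>n. r n + m"])
  show "strict_mono (\<lambda>n. r n + m)" using r(1) by (simp add: strict_mono_def)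
  show "AE x in M. (\<lambda>n. f (r n + m) x) \<longlonglongrightarrow> 0"
   using r(2)
  proof eventually_elim
   case (elim x)
   then have "(\<lambda>n. sqrt (u (r n) x)) \<longlonglongrightarrow> sqrt 0" by (intro tendsto_real_sqrt)
   then have "(\<lambda>n. norm (f (r n + m) x)) \<longlonglongrightarrow> 0" by (simp add: u_def)
   then show ?case by (rule tendsto_norm_zero_cancel)
  qed
 qed
qed

text \<open>Passing to a subsequence keeps both limits of the definition and adds almost sure
  convergence, so that the stochastic integral can be handled path by path.\<close>

lemma has_stoch_integral_AE:
 fixes J :: "'h::{real_inner,banach,second_countable_topology} => 'k::{real_inner,banach,second_countable_topology}"
 assumes Z: "has_stoch_integral M J W \<Phi> s t Z" and W: "\<And>u. s \<le> u ==> u \<le> t ==> W u \<in> borel_measurable M"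
 obtains N p B where
  "\<And>n. s \<le> p n 0" "\<And>n. p n (N n) \<le> t" "\<And>n i. i < N n ==> p n i \<le> p n (Suc i)"
  "\<And>n i. i < N n ==> bounded_linear (B n i)"
  "(\<lambda>n. \<integral>\<^sup>+u\<in>{s..t}. hs_norm_sq (\<lambda>v. \<Phi> u v - elem_op (N n) (p n) (B n) u (J v)) \<partial>lborel) \<longlonglongrightarrow> 0"
  "(\<lambda>n. \<integral>\<^sup>+w. ennreal ((norm (Z w - elem_integral W (N n) (p n) (B n) w))\<^sup>2) \<partial>M) \<longlonglongrightarrow> 0"
  "AE w in M. (\<lambda>n. elem_integral W (N n) (p n) (B n) w) \<longlonglongrightarrow> Z w"
  "\<And>n. elem_integral W (N n) (p n) (B n) \<in> borel_measurable M"
proof -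
 have [measurable]: "Z \<in> borel_measurable M" using Z by (simp add: has_stoch_integral_def)
 obtain N p B where p: "\<And>n. s \<le> p n 0" "\<And>n. p n (N n) \<le> t" "\<And>n i. i < N n ==> p n i \<le> p n (Suc i)"
  and B: "\<And>n i. i < N n ==> bounded_linear (B n i)"
  and hs: "(\<lambda>n. \<integral>\<^sup>+u\<in>{s..t}. hs_norm_sq (\<lambda>v. \<Phi> u v - elem_op (N n) (p n) (B n) u (J v)) \<partial>lborel) \<longlonglongrightarrow> 0"
  and L2: "(\<lambda>n. \<integral>\<^sup>+w. ennreal ((norm (Z w - elem_integral W (N n) (p n) (B n) w))\<^sup>2) \<partial>M) \<longlonglongrightarrow> 0"
  using Z unfolding has_stoch_integral_def by blast
 have el [measurable]: "elem_integral W (N n) (p n) (B n) \<in> borel_measurable M" for n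
 proof -
  have mono: "p n i \<le> p n j" if "i \<le> j" "j \<le> N n" for i j
   using that p(3) by (induction j rule: dec_induct) (auto intro: order_trans)
  have Wp: "W (p n i) \<in> borel_measurable M" if "i \<le> N n" for i
   using mono[of 0 i] mono[of i "N n"] that p(1,2)[of n] by (intro W) auto
  have "(\<lambda>w. B n i (W (p n (Suc i)) w - W (p n i) w)) \<in> borel_measurable M" if "i < N n" for i
  proof -
   have "continuous_on UNIV (B n i)" by (rule linear_continuous_on[OF B[OF that]])
   moreover have "(\<lambda>w. W (p n (Suc i)) w - W (p n i) w) \<in> borel_measurable M"
    using that by (intro borel_measurable_diff Wp) auto
   ultimately show ?thesis by (rule borel_measurable_continuous_on)
  qed
  then show ?thesis unfolding elem_integral_def by (intro borel_measurable_sum) auto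
 qed
 obtain r where r: "strict_mono (r :: nat => nat)"
   "AE w in M. (\<lambda>n. Z w - elem_integral W (N (r n)) (p (r n)) (B (r n)) w) \<longlonglongrightarrow> 0"
  by (rule nn_integral_norm_sq_tendsto_AE_subseq[OF _ L2]) simp_all
 show thesis
 proof (rule that[of "\<lambda>n. p (r n)" "\<lambda>n. N (r n)" "\<lambda>n. B (r n)"])
  show "(\<lambda>n. \<integral>\<^sup>+u\<in>{s..t}. hs_norm_sq (\<lambda>v. \<Phi> u v - elem_op (N (r n)) (p (r n)) (B (r n)) u (J v)) \<partial>lborel) \<longlonglongrightarrow> 0"
   using LIMSEQ_subseq_LIMSEQ[OF hs r(1)] by (simp add: o_def)
  show "(\<lambda>n. \<integral>\<^sup>+w. ennreal ((norm (Z w - elem_integral W (N (r n)) (p (r n)) (B (r n)) w))\<^sup>2) \<partial>M) \<longlonglongrightarrow> 0"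
   using LIMSEQ_subseq_LIMSEQ[OF L2 r(1)] by (simp add: o_def)
  show "AE w in M. (\<lambda>n. elem_integral W (N (r n)) (p (r n)) (B (r n)) w) \<longlonglongrightarrow> Z w"
   using r(2)
  proof eventually_elim
   case (elim w)
   from tendsto_diff[OF tendsto_const[of "Z w"] this] show ?case by simp
  qed
 qed (use p B el in auto)
qed

section \<open>Mild solutions along shifted paths\<close>

lemma AE_restr_to_subalgE:
 assumes "subalgebra M G" "AE x in restr_to_subalg M G. Q x"
 obtains N where "N \<in> sets G" "emeasure M N = 0" "\<And>x. x \<in> space M ==> x \<notin> N ==> Q x"
proof -
 from AE_E[OF assms(2)] obtain N where "{x \<in> space (restr_to_subalg M G). \<not> Q x} \<subseteq> N"
  "emeasure (restr_to_subalg M G) N = 0" "N \<in> sets (restr_to_subalg M G)" by blast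
 then show thesis
  using assms(1) by (intro that[of N])
   (auto simp: space_restr_to_subalg sets_restr_to_subalg emeasure_restr_to_subalg)
qed

text \<open>Coordinates up to \<open>s\<close> cannot distinguish a path from its shift, and this
  passes from generators to the generated sigma-algebra.\<close>

lemma natural_filtration_path_shift_invariant:
 fixes A :: "(real => 'k::real_normed_vector) set"
 assumes "A \<in> sets (natural_filtration s)" "x \<in> path_space"
 shows "path_shift s w x \<in> A \<longleftrightarrow> x \<in> A"
 using assms(1) unfolding sets_natural_filtration
proof (induction A rule: sigma_sets.induct)
 case (Basic A)
 then obtain u B where "A = coord u -` B \<inter> path_space" "0 \<le> u" "u \<le> s" by blast
 then show ?case using assms(2) by (simp add: coord_def path_shift_apply path_shift_in_path_space)
qed (use assms(2) in \<open>auto simp: path_shift_in_path_space\<close>)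

lemma measurable_natural_path_shift:
 fixes f :: "(real => 'k::real_normed_vector) => 'b::{second_countable_topology,t2_space}"
 assumes f: "f \<in> borel_measurable (natural_filtration s)" and x: "x \<in> path_space"
 shows "f (path_shift s w x) = f x"
proof -
 have "f -` {f x} \<inter> space (natural_filtration s) \<in> sets (natural_filtration s)"
  by (rule measurable_sets[OF f]) simp
 from natural_filtration_path_shift_invariant[OF this x, of w] x show ?thesis
  by (simp add: path_shift_in_path_space)
qed

locale wiener_mild_solution = cylindrical_wiener_path_space J P
 for J :: "'h::{real_inner, banach, second_countable_topology}
        => 'k::{real_inner, banach, second_countable_topology}" and P +
 fixes S :: "real => 'h => 'h" and R :: "'h => 'h" and F :: "real => 'h => 'h" and c\<^sub>F :: real
  and x\<^sub>0 :: 'h and X :: "real => (real => 'k) => 'h"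
 assumes S: "C0_semigroup S" and R: "bounded_linear R"
  and c\<^sub>F: "c\<^sub>F > 0" and F_Lipschitz: "\<And>t x y. t \<ge> 0 ==> norm (F t x - F t y) \<le> c\<^sub>F * norm (x - y)"
  and X: "mild_solution P \<F> J coord S F R 0 x\<^sub>0 {0..} X"
begin

lemma AE_restr_P:
 assumes "AE w in restr_to_subalg P (\<F> t). Q w"
 shows "AE w in P. Q w"
 by (rule AE_restr_to_subalg[OF subalgebra_canonical assms])

text \<open>The exceptional set lies in \<open>\<F> t\<close>, hence in the natural filtration at a
  slightly later time, where a shift does not charge null sets.\<close>

lemma AE_restr_path_shift:
 assumes s: "0 \<le> s" and Q: "AE w in restr_to_subalg P (\<F> t). Q w"
 shows "AE w in P. Q (path_shift s (a *\<^sub>R J (adjoint J k)) w)"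
proof -
 obtain N where N: "N \<in> sets (\<F> t)" "emeasure P N = 0" "\<And>x. x \<in> space P ==> x \<notin> N ==> Q x"
  using AE_restr_to_subalgE[OF subalgebra_canonical Q] by blast
 \<comment> \<open>Not before \<open>s\<close>, for the Cameron--Martin formula, and strictly after
   \<open>t\<close>, to pass from \<open>\<F> t\<close> to the natural filtration.\<close>
 define r where "r = max s (t + 1)"
 have "N \<in> sets (natural_filtration r)"
  using N(1) canonical_filtration_natural[of t r] by (auto simp: r_def less_max_iff_disj)
 then have "AE w in P. path_shift s (a *\<^sub>R J (adjoint J k)) w \<notin> N"
  using s N(2) by (intro null_set_path_shift) (auto simp: r_def)
 moreover have "AE w in P. w \<in> path_space" by (rule AE_I2) simp
 ultimately show ?thesis
  by eventually_elim (auto intro!: N(3) path_shift_in_path_space)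
qed

lemma X_canonical: "0 \<le> t ==> X t \<in> borel_measurable (\<F> t)"
proof -
 assume t: "0 \<le> t"
 then have m: "(\<lambda>(r, w). X r w) \<in> borel_measurable (restrict_space borel {0..t} \<Otimes>\<^sub>M \<F> t)"
  using X unfolding mild_solution_def by auto
 have "(\<lambda>w. (t, w)) \<in> measurable (\<F> t) (restrict_space borel {0..t} \<Otimes>\<^sub>M \<F> t)"
  using t by (intro measurable_Pair1') (simp add: space_restrict_space)
 from measurable_compose[OF this m] show ?thesis by simp
qed

lemma X_continuous: "0 \<le> t ==> AE w in restr_to_subalg P (\<F> t). continuous_on {0..t} (\<lambda>r. X r w)"
 using X unfolding mild_solution_def by auto

text \<open>Strictly before \<open>s\<close>, because \<open>\<F> r\<close> looks infinitesimally
  beyond \<open>r\<close>.\<close>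

lemma X_path_shift_before:
 assumes "0 \<le> r" "r < s" "x \<in> path_space"
 shows "X r (path_shift s w x) = X r x"
proof (rule measurable_natural_path_shift[OF _ assms(3)])
 show "X r \<in> borel_measurable (natural_filtration s)"
  by (rule measurable_filtration_mono[OF X_canonical[OF assms(1)]]) (simp_all add: canonical_filtration_natural assms)
qed

lemma elem_integral_natural:
 fixes p :: "nat => real" and B :: "nat => 'k => 'h"
 assumes p: "0 \<le> p 0" "p N \<le> t" "\<And>i. i < N ==> p i \<le> p (Suc i)" and B: "\<And>i. i < N ==> bounded_linear (B i)"
 shows "elem_integral coord N p B \<in> borel_measurable (natural_filtration t)"
proof -
 have mono: "p i \<le> p j" if "i \<le> j" "j \<le> N" for i j
  using that p(3) by (induction j rule: dec_induct) (auto intro: order_trans)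
 have pr: "0 \<le> p i" "p i \<le> t" if "i \<le> N" for i using mono[of 0 i] mono[of i N] that p by auto
 have "(\<lambda>w. B i (coord (p (Suc i)) w - coord (p i) w)) \<in> borel_measurable (natural_filtration t)" if "i < N" for i
 proof -
  have "continuous_on UNIV (B i)" by (rule linear_continuous_on[OF B[OF that]])
  moreover have "(\<lambda>w :: real => 'k. coord (p (Suc i)) w - coord (p i) w) \<in> borel_measurable (natural_filtration t)"
   unfolding coord_def using that pr[of i] pr[of "Suc i"]
   by (intro borel_measurable_diff coord_measurable_natural) auto
  ultimately show ?thesis by (rule borel_measurable_continuous_on)
 qed
 then show ?thesis unfolding elem_integral_def by (intro borel_measurable_sum) auto
qed

text \<open>For elementary integrands the change under the shift is given by
  \<open>elem_integral_drift\<close>. The formula passes to the limit along a sequence that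
  converges both at the path and at its shift.\<close>

lemma stoch_integral_path_shift:
 fixes \<Phi> :: "real => 'h => 'h"
 assumes st: "0 \<le> s" "0 \<le> t" and Z: "has_stoch_integral P J coord \<Phi> 0 t Z" "Z \<in> borel_measurable (\<F> t)"
  and \<Phi>: "\<And>u. u \<in> {0..t} ==> bounded_linear (\<Phi> u)"
  and int: "set_integrable lborel {0..t} (\<lambda>u. \<Phi> u (adjoint J k))"
 shows "AE w in P. Z (path_shift s (a *\<^sub>R J (adjoint J k)) w) =
  Z w + (LINT u:{0..t}|lborel. indicator {s..} u *\<^sub>R a *\<^sub>R \<Phi> u (adjoint J k))"
proof -
 define e where "e = adjoint J k"
 let ?sh = "path_shift s (a *\<^sub>R J e)"
 obtain N p B where p: "\<And>n. 0 \<le> p n 0" "\<And>n. p n (N n) \<le> t" "\<And>n i. i < N n ==> p n i \<le> p n (Suc i)"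
  and B: "\<And>n i. i < N n ==> bounded_linear (B n i)"
  and hs: "(\<lambda>n. \<integral>\<^sup>+u\<in>{0..t}. hs_norm_sq (\<lambda>v. \<Phi> u v - elem_op (N n) (p n) (B n) u (J v)) \<partial>lborel) \<longlonglongrightarrow> 0"
  and AE: "AE w in P. (\<lambda>n. elem_integral coord (N n) (p n) (B n) w) \<longlonglongrightarrow> Z w"
 proof (rule has_stoch_integral_AE[OF Z(1)])
  show "coord u \<in> borel_measurable P" if "0 \<le> u" "u \<le> t" for u
   using coord_measurable[OF that(1)] by (simp add: coord_def[abs_def])
 qed blast
 let ?el = "\<lambda>n. elem_integral coord (N n) (p n) (B n)"
 \<comment> \<open>The time derivative of the shift before applying \<open>J\<close>: the image
   under \<open>J\<close> of its integral is the shift.\<close>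
 define v where "v u = indicat_real {s..} u *\<^sub>R a *\<^sub>R e" for u
 have v_int: "set_integrable lborel {0..r} v" for r
 proof -
  have "set_integrable lborel {0..r} (\<lambda>u. a *\<^sub>R e)"
   unfolding set_integrable_def
   by (rule integrable_scaleR_left, rule integrable_real_indicator) (simp_all add: emeasure_lborel_Icc_eq)
  then have "set_integrable lborel ({0..r} \<inter> {s..}) (\<lambda>u. a *\<^sub>R e)" by (rule set_integrable_subset) auto
  then show ?thesis unfolding set_integrable_def v_def
   by (simp only: indicator_inter_arith scaleR_scaleR mult.assoc)
 qed
 have v_val: "J (LINT u:{0..r}|lborel. v u) = max 0 (r - s) *\<^sub>R a *\<^sub>R J e" if "0 \<le> r" for r
 proof -
  have "(LINT u:{0..r}|lborel. v u) = (LINT u|lborel. indicat_real {s..r} u *\<^sub>R (a *\<^sub>R e))"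
   unfolding set_lebesgue_integral_def v_def using st
   by (intro Bochner_Integration.integral_cong) (auto simp: indicator_def)
  also have "\<dots> = max 0 (r - s) *\<^sub>R a *\<^sub>R e"
   by (cases "s \<le> r") (auto simp: max_def)
  finally show ?thesis by (simp add: linear_scale[OF bounded_linear.linear[OF J]])
 qed
 have \<Phi>v: "\<Phi> u (v u) = indicator {s..} u *\<^sub>R a *\<^sub>R \<Phi> u e" if "u \<in> {0..t}" for u
  using linear_scale[OF bounded_linear.linear[OF \<Phi>[OF that]]] by (simp add: v_def)
 have \<Phi>v_int: "set_integrable lborel {0..t} (\<lambda>u. \<Phi> u (v u))"
 proof -
  have "set_integrable lborel ({0..t} \<inter> {s..}) (\<lambda>u. a *\<^sub>R \<Phi> u e)"
   using int unfolding e_def by (intro set_integrable_subset[OF set_integrable_scaleR_right]) auto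
  then have "set_integrable lborel {0..t} (\<lambda>u. indicator {s..} u *\<^sub>R a *\<^sub>R \<Phi> u e)"
   unfolding set_integrable_def by (simp only: indicator_inter_arith scaleR_scaleR mult.assoc)
  then show ?thesis by (rule set_integrable_cong[THEN iffD1, rotated -1]) (simp_all add: \<Phi>v)
 qed
 have drift: "set_integrable lborel {0..t} (\<lambda>u. elem_op (N n) (p n) (B n) u (J (v u)))"
   "(LINT u:{0..t}|lborel. elem_op (N n) (p n) (B n) u (J (v u))) =
    (\<Sum>i<N n. B n i (J (LINT u:{0..p n (Suc i)}|lborel. v u) - J (LINT u:{0..p n i}|lborel. v u)))" for n
  by (rule elem_integral_drift[OF J B p(1,2,3) v_int]; assumption)+
 have v_bd: "norm (v u) \<le> norm (a *\<^sub>R e)" for u by (simp add: v_def indicator_def)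
 have lim: "(\<lambda>n. LINT u:{0..t}|lborel. elem_op (N n) (p n) (B n) u (J (v u))) \<longlonglongrightarrow> (LINT u:{0..t}|lborel. \<Phi> u (v u))"
  by (rule tendsto_set_integral_hs_norm[OF \<Phi> bounded_linear_elem_op[OF J B] hs v_bd \<Phi>v_int drift(1)])
 have el_sh: "?el n (?sh w) = ?el n w + (LINT u:{0..t}|lborel. elem_op (N n) (p n) (B n) u (J (v u)))" for n w
 proof -
  have mono: "p n i \<le> p n j" if "i \<le> j" "j \<le> N n" for i j
   using that p(3) by (induction j rule: dec_induct) (auto intro: order_trans)
  have p0: "0 \<le> p n i" if "i \<le> N n" for i using mono[of 0 i] that p(1)[of n] by auto
  have "?sh w (p n i) = w (p n i) + J (LINT u:{0..p n i}|lborel. v u)" if "i \<le> N n" for i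
   using p0[OF that] by (simp add: path_shift_apply v_val)
  then have "B n i (?sh w (p n (Suc i)) - ?sh w (p n i)) = B n i (w (p n (Suc i)) - w (p n i)) +
    B n i (J (LINT u:{0..p n (Suc i)}|lborel. v u) - J (LINT u:{0..p n i}|lborel. v u))" if "i < N n" for i
   using that by (simp add: linear_add[OF bounded_linear.linear[OF B[OF that]], symmetric] algebra_simps)
  then show ?thesis unfolding drift(2) elem_integral_def coord_def sum.distrib[symmetric]
   by (intro sum.cong) auto
 qed
 define r where "r = max s (t + 1)"
 \<comment> \<open>Divergence has to be an event of the natural filtration, so that quasi-invariance
   excludes it at the shifted path as well.\<close>
 define Bad where "Bad = {w \<in> path_space. \<not> (\<lambda>n. ?el n w) \<longlonglongrightarrow> Z w}"
 have Bad: "Bad \<in> sets (natural_filtration r)"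
 proof -
  have [measurable]: "?el n \<in> borel_measurable (natural_filtration r)" for n
   using p(2)[of n] by (intro elem_integral_natural p B) (simp_all add: r_def)
  have [measurable]: "Z \<in> borel_measurable (natural_filtration r)"
   by (rule measurable_filtration_mono[OF Z(2)]) (simp_all add: canonical_filtration_natural r_def)
  have "Bad = {w \<in> space (natural_filtration r). \<not> (\<lambda>n. norm (?el n w - Z w)) \<longlonglongrightarrow> 0}"
   by (simp add: Bad_def tendsto_norm_zero_iff LIM_zero_iff)
  also have "\<dots> \<in> sets (natural_filtration r)" by measurable
  finally show ?thesis .
 qed
 moreover have "emeasure P Bad = 0"
 proof -
  have "Bad \<in> events" using Bad subalgebra_natural by (auto simp: subalgebra_def)
  moreover have "AE w in P. w \<notin> Bad" using AE by eventually_elim (simp add: Bad_def)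
  ultimately show ?thesis by (simp add: AE_iff_null_sets[symmetric] null_sets_def[symmetric] flip: null_setsD1)
 qed
 ultimately have "AE w in P. ?sh w \<notin> Bad"
  unfolding e_def using st by (intro null_set_path_shift) (auto simp: r_def)
 moreover have "AE w in P. w \<in> path_space" by (rule AE_I2) simp
 ultimately have "AE w in P. Z (?sh w) = Z w + (LINT u:{0..t}|lborel. \<Phi> u (v u))"
  using AE
 proof eventually_elim
  case (elim w)
  then have "(\<lambda>n. ?el n (?sh w)) \<longlonglongrightarrow> Z (?sh w)" by (simp add: Bad_def path_shift_in_path_space)
  moreover have "(\<lambda>n. ?el n (?sh w)) \<longlonglongrightarrow> Z w + (LINT u:{0..t}|lborel. \<Phi> u (v u))"
   unfolding el_sh by (intro tendsto_add elim lim)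
  ultimately show ?case by (rule LIMSEQ_unique)
 qed
 moreover have "(LINT u:{0..t}|lborel. \<Phi> u (v u)) = (LINT u:{0..t}|lborel. indicator {s..} u *\<^sub>R a *\<^sub>R \<Phi> u e)"
  by (rule set_lebesgue_integral_cong) (simp_all add: \<Phi>v)
 ultimately show ?thesis by (simp add: e_def)
qed

end

lemma norm_set_integral_Icc_le:
 fixes f :: "real => 'a::{banach,second_countable_topology}"
 assumes "0 \<le> s" "s \<le> u" and f: "set_integrable lborel {0..u} f"
  and bd: "\<And>r. 0 \<le> r ==> r \<le> u ==> norm (f r) \<le> indicator {s..} r * C"
 shows "norm (LINT r:{0..u}|lborel. f r) \<le> C * (u - s)"
proof -
 have i: "integrable lborel (\<lambda>r. indicat_real {s..u} r * C)"
  by (rule integrable_mult_left, rule integrable_real_indicator) (simp_all add: emeasure_lborel_Icc_eq)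
 have "norm (LINT r:{0..u}|lborel. f r) \<le> (LINT r|lborel. indicat_real {s..u} r * C)"
  unfolding set_lebesgue_integral_def
 proof (rule Bochner_Integration.integral_norm_bound_integral)
  show "integrable lborel (\<lambda>r. indicat_real {0..u} r *\<^sub>R f r)" using f by (simp add: set_integrable_def)
  show "norm (indicat_real {0..u} r *\<^sub>R f r) \<le> indicat_real {s..u} r * C" for r
   using bd[of r] assms(1,2) by (auto simp: indicator_def split: if_splits)
 qed (rule i)
 also have "\<dots> = C * (u - s)" using assms by simp
 finally show ?thesis .
qed

lemma set_integral_Icc_indicator_const:
 fixes q :: "'a::{banach,second_countable_topology}"
 assumes "0 \<le> s" "s \<le> u"
 shows "set_integrable lborel {0..u} (\<lambda>r. indicat_real {s..} r *\<^sub>R q)"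
  and "(LINT r:{0..u}|lborel. indicat_real {s..} r *\<^sub>R q) = (u - s) *\<^sub>R q"
proof -
 have eq: "indicat_real {0..u} r *\<^sub>R indicat_real {s..} r *\<^sub>R q = indicat_real {s..u} r *\<^sub>R q" for r
  using assms by (auto simp: indicator_def)
 show "set_integrable lborel {0..u} (\<lambda>r. indicat_real {s..} r *\<^sub>R q)"
  unfolding set_integrable_def eq
  by (rule integrable_scaleR_left, rule integrable_real_indicator) (simp_all add: emeasure_lborel_Icc_eq)
 show "(LINT r:{0..u}|lborel. indicat_real {s..} r *\<^sub>R q) = (u - s) *\<^sub>R q"
  unfolding set_lebesgue_integral_def eq using assms by simp
qed

context wiener_mild_solution
begin

lemma S_linear: "t \<ge> 0 ==> bounded_linear (S t)"
 using S by (simp add: C0_semigroup_def)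

lemma S_continuous: "continuous_on {0..u} (\<lambda>r. S (u - r) q)"
proof -
 have "continuous_on {0..u} (\<lambda>r. (\<lambda>(t, x). S t x) (u - r, q))"
  by (rule continuous_on_compose2[OF C0_semigroup_continuous_on[OF S]]) (auto intro!: continuous_intros)
 then show ?thesis by simp
qed

text \<open>Almost surely the mild equation holds both at the path and at its shift; the difference
  of the two contains the change of the nonlinearity and the known change of the stochastic
  integral.\<close>

lemma X_path_shift_eq:
 assumes su: "0 \<le> s" "s \<le> u"
 shows "AE w in P. let Y = (\<lambda>r. X r (path_shift s (a *\<^sub>R J (adjoint J k)) w)) in
  set_integrable lborel {0..u} (\<lambda>r. S (u - r) (F r (Y r)) - S (u - r) (F r (X r w))) \<and>
  Y u - X u w = (LINT r:{0..u}|lborel. S (u - r) (F r (Y r)) - S (u - r) (F r (X r w))) +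
   (LINT r:{0..u}|lborel. indicator {s..} r *\<^sub>R a *\<^sub>R S (u - r) (R (adjoint J k)))"
proof -
 let ?sh = "path_shift s (a *\<^sub>R J (adjoint J k))"
 have u0: "0 \<le> u" using su by simp
 from u0 X have 1: "AE w in restr_to_subalg P (\<F> u).
   set_integrable lborel {0..u} (\<lambda>r. S (u - r) (F r (X r w)))"
  unfolding mild_solution_def by auto
 from u0 X obtain Z where Z: "Z \<in> borel_measurable (\<F> u)"
   "has_stoch_integral P J coord (\<lambda>r. S (u - r) \<circ> R) 0 u Z"
  and 2: "AE w in restr_to_subalg P (\<F> u).
   X u w = S (u - 0) x\<^sub>0 + (LINT r:{0..u}|lborel. S (u - r) (F r (X r w))) + Z w"
  unfolding mild_solution_def by auto
 have 3: "AE w in P. Z (?sh w) = Z w + (LINT r:{0..u}|lborel. indicator {s..} r *\<^sub>R a *\<^sub>R (S (u - r) \<circ> R) (adjoint J k))"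
 proof (rule stoch_integral_path_shift[OF su(1) u0 Z(2,1)])
  show "bounded_linear (S (u - r) \<circ> R)" if "r \<in> {0..u}" for r
   unfolding o_def by (rule bounded_linear_compose[OF S_linear R]) (use that in simp)
  show "set_integrable lborel {0..u} (\<lambda>r. (S (u - r) \<circ> R) (adjoint J k))"
   unfolding o_def by (rule borel_integrable_atLeastAtMost') (rule S_continuous)
 qed
 show ?thesis
  using AE_restr_P[OF 1] AE_restr_path_shift[OF su(1) 1, of a k] AE_restr_P[OF 2]
   AE_restr_path_shift[OF su(1) 2, of a k] 3
 proof eventually_elim
  case (elim w)
  have "X u (?sh w) - X u w =
    ((LINT r:{0..u}|lborel. S (u - r) (F r (X r (?sh w)))) - (LINT r:{0..u}|lborel. S (u - r) (F r (X r w)))) +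
    (Z (?sh w) - Z w)"
   using elim(3,4) by simp
  then show ?case
   using set_integral_diff[OF elim(2,1)] elim(5) by (simp add: Let_def)
 qed
qed

text \<open>The largest distance \<open>m\<close> between the two solutions satisfies
  \<open>m \<le> (M * c\<^sub>F * m + K) * (t - s)\<close>, whose first term is absorbed on short
  intervals. So \<open>m\<close> is of order \<open>t - s\<close>, the nonlinearity contributes only
  second order, and \<open>S (t - r) q\<close> is close to \<open>q\<close>.\<close>

lemma X_path_shift_approx:
 assumes T: "0 \<le> T" and \<epsilon>: "\<epsilon> > 0"
 shows "\<exists>d>0. \<forall>s t. 0 \<le> s --> s < t --> t \<le> T --> t - s \<le> d -->
  (AE w in P. norm (X t (path_shift s (a *\<^sub>R J (adjoint J k)) w) - X t w - (a * (t - s)) *\<^sub>R R (adjoint J k)) \<le> \<epsilon> * (t - s))"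
proof -
 define q where "q = R (adjoint J k)"
 obtain M where M: "M \<ge> 1" "\<And>t x. 0 \<le> t ==> t \<le> T ==> norm (S t x) \<le> M * norm x"
  using C0_semigroup_bounded[OF S, of T] by blast
 define K where "K = \<bar>a\<bar> * M * norm q"
 have K: "K \<ge> 0" using M(1) by (simp add: K_def)
 have McF: "M * c\<^sub>F > 0" using M(1) c\<^sub>F by simp
 \<comment> \<open>Chosen such that \<open>\<bar>a\<bar> * \<eta>\<close> is at most
   \<open>\<epsilon> / 2\<close>; the added 1 keeps the denominator positive for
   \<open>a = 0\<close>.\<close>
 define \<eta> where "\<eta> = \<epsilon> / (2 * (\<bar>a\<bar> + 1))"
 have \<eta>: "\<eta> > 0" using \<epsilon> by (simp add: \<eta>_def)
 have a\<eta>: "\<bar>a\<bar> * \<eta> \<le> \<epsilon> / 2"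
 proof -
  have "\<bar>a\<bar> * \<eta> \<le> (\<bar>a\<bar> + 1) * \<eta>" using \<eta> by (intro mult_right_mono) auto
  also have "\<dots> = \<epsilon> / 2"
  proof -
   have "x * (\<epsilon> / (2 * x)) = \<epsilon> / 2" if "x > 0" for x using that by simp
   from this[of "\<bar>a\<bar> + 1"] show ?thesis by (simp add: \<eta>_def)
  qed
  finally show ?thesis .
 qed
 have "((\<lambda>r. S r q) \<longlongrightarrow> q) (at_right 0)" using S by (simp add: C0_semigroup_def)
 then have "eventually (\<lambda>r. dist (S r q) q < \<eta>) (at_right 0)" using \<eta> by (rule tendstoD)
 then obtain d1 where d1: "d1 > 0" "\<And>r. 0 < r ==> r < d1 ==> dist (S r q) q < \<eta>"
  by (auto simp: eventually_at_right_field)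
 \<comment> \<open>The three bounds serve, in this order, the closeness of \<open>S r q\<close> to
   \<open>q\<close>, the absorption of the term with \<open>m\<close>, and the smallness of the
   contribution of the nonlinearity.\<close>
 define d where "d = min (d1 / 2) (min (1 / (2 * (M * c\<^sub>F))) (\<epsilon> / (4 * (M * c\<^sub>F) * (K + 1))))"
 have d: "d > 0" using d1(1) McF K \<epsilon> by (simp add: d_def)
 have d_le: "d < d1" "d * (M * c\<^sub>F) \<le> 1/2" "M * c\<^sub>F * (2 * d * K) \<le> \<epsilon> / 2"
 proof -
  show "d < d1" using d1(1) by (simp add: d_def min_def)
  have "d \<le> 1 / (2 * (M * c\<^sub>F))" by (simp add: d_def)
  then have "d * (M * c\<^sub>F) \<le> 1 / (2 * (M * c\<^sub>F)) * (M * c\<^sub>F)" using McF by (intro mult_right_mono) auto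
  then show "d * (M * c\<^sub>F) \<le> 1/2" using M(1) c\<^sub>F by simp
  have "d \<le> \<epsilon> / (4 * (M * c\<^sub>F) * (K + 1))" by (simp add: d_def)
  then have "d * (4 * (M * c\<^sub>F) * (K + 1)) \<le> \<epsilon>"
   using McF K by (subst (asm) pos_le_divide_eq) auto
  moreover have "d * (4 * (M * c\<^sub>F) * K) \<le> d * (4 * (M * c\<^sub>F) * (K + 1))"
   using d McF by (intro mult_left_mono) auto
  ultimately show "M * c\<^sub>F * (2 * d * K) \<le> \<epsilon> / 2" by (simp add: mult_ac)
 qed
 have Sq: "norm (S r q - q) \<le> \<eta>" if "0 \<le> r" "r \<le> d" for r
 proof (cases "r = 0")
  case True then show ?thesis using S \<eta> by (simp add: C0_semigroup_def)
 next
  case False then show ?thesis using d1(2)[of r] that d_le(1) by (simp add: dist_norm)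
 qed
 show ?thesis
 proof (intro exI[of _ d] conjI d allI impI)
  fix s t assume st: "0 \<le> s" "s < t" "t \<le> T" "t - s \<le> d"
  let ?sh = "path_shift s (a *\<^sub>R J (adjoint J k))"
  \<comment> \<open>At each time the equation holds off a null set, so it is used on a countable
    dense set that includes the endpoint \<open>t\<close>; continuity carries the bound to the time
    \<open>r0\<close> of greatest distance.\<close>
  define D0 where "D0 = insert t ({s<..<t} \<inter> \<rat>)"
  have D0: "countable D0" "D0 \<subseteq> {s..t}" using st by (auto simp: D0_def countable_rat)
  have D0_dense: "{s..t} \<subseteq> closure D0"
  proof -
   have "closure ({s<..<t} \<inter> \<rat>) = closure {s<..<t}"
    by (rule closure_open_Int_superset) (simp_all add: Rats_closure_real)
   then show ?thesis using st closure_mono[of "{s<..<t} \<inter> \<rat>" D0] by (auto simp: D0_def)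
  qed
  have "AE w in P. \<forall>u\<in>D0. let Y = (\<lambda>r. X r (?sh w)) in
   set_integrable lborel {0..u} (\<lambda>r. S (u - r) (F r (Y r)) - S (u - r) (F r (X r w))) \<and>
   Y u - X u w = (LINT r:{0..u}|lborel. S (u - r) (F r (Y r)) - S (u - r) (F r (X r w))) +
   (LINT r:{0..u}|lborel. indicator {s..} r *\<^sub>R a *\<^sub>R S (u - r) (R (adjoint J k)))"
   unfolding AE_ball_countable[OF D0(1)]
  proof
   fix u assume "u \<in> D0"
   then show "AE w in P. let Y = (\<lambda>r. X r (?sh w)) in
    set_integrable lborel {0..u} (\<lambda>r. S (u - r) (F r (Y r)) - S (u - r) (F r (X r w))) \<and>
    Y u - X u w = (LINT r:{0..u}|lborel. S (u - r) (F r (Y r)) - S (u - r) (F r (X r w))) +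
    (LINT r:{0..u}|lborel. indicator {s..} r *\<^sub>R a *\<^sub>R S (u - r) (R (adjoint J k)))"
    using D0(2) by (intro X_path_shift_eq st(1)) auto
  qed
  moreover have "AE w in P. continuous_on {0..t} (\<lambda>r. X r w)"
   using st by (intro AE_restr_P[OF X_continuous[of t]]) auto
  moreover have "AE w in P. continuous_on {0..t} (\<lambda>r. X r (?sh w))"
   by (rule AE_restr_path_shift[where t=t], rule st(1), rule X_continuous) (use st in auto)
  moreover have "AE w in P. w \<in> path_space" by (rule AE_I2) simp
  ultimately show "AE w in P. norm (X t (?sh w) - X t w - (a * (t - s)) *\<^sub>R R (adjoint J k)) \<le> \<epsilon> * (t - s)"
  proof eventually_elim
   case (elim w)
   define Y where "Y r = X r (?sh w)" for r
   define g where "g r = norm (Y r - X r w)" for r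
   define D where "D u r = S (u - r) (F r (Y r)) - S (u - r) (F r (X r w))" for u r
   have eq: "set_integrable lborel {0..u} (D u)"
     "Y u - X u w = (LINT r:{0..u}|lborel. D u r) + (LINT r:{0..u}|lborel. indicator {s..} r *\<^sub>R a *\<^sub>R S (u - r) q)"
    if "u \<in> D0" for u
    using bspec[OF elim(1) that] unfolding Let_def Y_def D_def q_def by (rule conjunct1, rule conjunct2)
   have "continuous_on {0..t} g" unfolding g_def Y_def by (intro continuous_intros elim)
   then have g_cont: "continuous_on {s..t} g" using st by (elim continuous_on_subset) auto
   obtain r0 where r0: "r0 \<in> {s..t}" "\<And>r. r \<in> {s..t} ==> g r \<le> g r0"
    using continuous_attains_sup[of "{s..t}" g] g_cont st by auto
   define m where "m = g r0"
   have m0: "0 \<le> m" by (simp add: m_def g_def)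
   have Y_before: "Y r = X r w" if "0 \<le> r" "r < s" for r
    unfolding Y_def using that elim(4) by (rule X_path_shift_before)
   have D_bd: "norm (D u r) \<le> indicator {s..} r * (M * c\<^sub>F * m)" if "0 \<le> r" "r \<le> u" "u \<le> t" for u r
   proof (cases "r < s")
    case True then show ?thesis using Y_before that by (simp add: D_def)
   next
    case False
    have "norm (D u r) = norm (S (u - r) (F r (Y r) - F r (X r w)))"
     unfolding D_def using that by (subst linear_diff[OF bounded_linear.linear[OF S_linear]]) auto
    also have "\<dots> \<le> M * norm (F r (Y r) - F r (X r w))" using that st by (intro M) auto
    also have "\<dots> \<le> M * (c\<^sub>F * g r)"
     unfolding g_def using M(1) that by (intro mult_left_mono F_Lipschitz) auto
    also have "\<dots> \<le> M * (c\<^sub>F * m)"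
     unfolding m_def using M(1) c\<^sub>F that False by (intro mult_left_mono r0) auto
    finally show ?thesis using False by (simp add: mult.assoc)
   qed
   have Dint: "norm (LINT r:{0..u}|lborel. D u r) \<le> (M * c\<^sub>F * m) * (u - s)" if "u \<in> D0" for u
    using that D0(2) st by (intro norm_set_integral_Icc_le eq(1) D_bd) auto
   have iq: "set_integrable lborel {0..u} (\<lambda>r. indicator {s..} r *\<^sub>R a *\<^sub>R S (u - r) q)" for u
   proof -
    have "set_integrable lborel {0..u} (\<lambda>r. a *\<^sub>R S (u - r) q)"
     by (intro set_integrable_scaleR_right borel_integrable_atLeastAtMost' S_continuous)
    then have "set_integrable lborel ({0..u} \<inter> {s..}) (\<lambda>r. a *\<^sub>R S (u - r) q)"
     by (rule set_integrable_subset) auto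
    then show ?thesis unfolding set_integrable_def by (simp only: indicator_inter_arith scaleR_scaleR mult.assoc)
   qed
   have Sint: "norm (LINT r:{0..u}|lborel. indicator {s..} r *\<^sub>R a *\<^sub>R S (u - r) q) \<le> K * (u - s)" if "u \<in> D0" for u
   proof (rule norm_set_integral_Icc_le[OF _ _ iq])
    show "0 \<le> s" "s \<le> u" using that D0(2) st by auto
    fix r assume r: "0 \<le> r" "r \<le> u"
    have "norm (S (u - r) q) \<le> M * norm q" using r that D0(2) st by (intro M) auto
    then have "\<bar>a\<bar> * norm (S (u - r) q) \<le> K"
     unfolding K_def mult.assoc by (intro mult_left_mono) auto
    then show "norm (indicat_real {s..} r *\<^sub>R a *\<^sub>R S (u - r) q) \<le> indicator {s..} r * K"
     by (simp add: indicator_def)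
   qed
   have g_bd: "g u \<le> (M * c\<^sub>F * m + K) * (t - s)" if "u \<in> D0" for u
   proof -
    have "g u \<le> (M * c\<^sub>F * m) * (u - s) + K * (u - s)"
     unfolding g_def eq(2)[OF that] by (intro norm_triangle_mono Dint Sint that)
    also have "\<dots> = (M * c\<^sub>F * m + K) * (u - s)" by (simp add: distrib_right)
    also have "\<dots> \<le> (M * c\<^sub>F * m + K) * (t - s)"
     using that D0(2) McF m0 K by (intro mult_left_mono) auto
    finally show ?thesis .
   qed
   have r0D: "r0 \<in> closure D0" using D0_dense r0(1) by blast
   have "closure D0 \<subseteq> {s..t}" using D0(2) by (rule closure_minimal) simp
   from continuous_le_on_closure[OF continuous_on_subset[OF g_cont this] r0D g_bd]
   have "g r0 \<le> (M * c\<^sub>F * m + K) * (t - s)" .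
   then have "m \<le> (M * c\<^sub>F * m + K) * (t - s)" by (simp add: m_def)
   also have "\<dots> = m * ((t - s) * (M * c\<^sub>F)) + K * (t - s)" by (simp add: algebra_simps)
   also have "\<dots> \<le> m * (1/2) + K * (t - s)"
   proof -
    have "(t - s) * (M * c\<^sub>F) \<le> d * (M * c\<^sub>F)" using st McF by (intro mult_right_mono) auto
    then have "(t - s) * (M * c\<^sub>F) \<le> 1/2" using d_le(2) by simp
    then show ?thesis using m0 by (intro add_right_mono mult_left_mono) auto
   qed
   finally have "m \<le> 2 * (K * (t - s))" by simp
   moreover have "K * (t - s) \<le> K * d" using st K by (intro mult_left_mono) auto
   ultimately have "m \<le> 2 * (K * d)" by linarith
   then have m_bd: "m \<le> 2 * d * K" by (simp only: mult_ac)
   have tD0: "t \<in> D0" by (simp add: D0_def)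
   have st': "s \<le> t" using st by simp
   have const: "(LINT r:{0..t}|lborel. indicat_real {s..} r *\<^sub>R (a *\<^sub>R q)) = (a * (t - s)) *\<^sub>R q"
    using set_integral_Icc_indicator_const(2)[OF st(1) st', of "a *\<^sub>R q"] by (simp add: mult.commute)
   have i2: "set_integrable lborel {0..t} (\<lambda>r. indicat_real {s..} r *\<^sub>R (a *\<^sub>R q))"
    by (rule set_integral_Icc_indicator_const(1)[OF st(1) st'])
   have n2: "norm (LINT r:{0..t}|lborel. indicator {s..} r *\<^sub>R a *\<^sub>R S (t - r) q - indicat_real {s..} r *\<^sub>R (a *\<^sub>R q)) \<le> (\<bar>a\<bar> * \<eta>) * (t - s)"
   proof (rule norm_set_integral_Icc_le[OF st(1) st' set_integral_diff(1)[OF iq i2]])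
    fix r assume r: "0 \<le> r" "r \<le> t"
    show "norm (indicat_real {s..} r *\<^sub>R a *\<^sub>R S (t - r) q - indicat_real {s..} r *\<^sub>R a *\<^sub>R q) \<le> indicator {s..} r * (\<bar>a\<bar> * \<eta>)"
    proof (cases "r < s")
     case False
     have "norm (a *\<^sub>R S (t - r) q - a *\<^sub>R q) = \<bar>a\<bar> * norm (S (t - r) q - q)"
      by (simp flip: scaleR_diff_right)
     also have "\<dots> \<le> \<bar>a\<bar> * \<eta>" using r False st by (intro mult_left_mono Sq) auto
     finally show ?thesis using False by simp
    qed simp
   qed
   have "Y t - X t w - (a * (t - s)) *\<^sub>R q = (LINT r:{0..t}|lborel. D t r) +
     ((LINT r:{0..t}|lborel. indicator {s..} r *\<^sub>R a *\<^sub>R S (t - r) q) - (LINT r:{0..t}|lborel. indicat_real {s..} r *\<^sub>R (a *\<^sub>R q)))"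
    by (simp only: eq(2)[OF tD0] const add_diff_eq)
   also have "(LINT r:{0..t}|lborel. indicator {s..} r *\<^sub>R a *\<^sub>R S (t - r) q) - (LINT r:{0..t}|lborel. indicat_real {s..} r *\<^sub>R (a *\<^sub>R q)) =
     (LINT r:{0..t}|lborel. indicator {s..} r *\<^sub>R a *\<^sub>R S (t - r) q - indicat_real {s..} r *\<^sub>R (a *\<^sub>R q))"
    by (rule set_integral_diff(2)[OF iq i2, symmetric])
   also have "norm ((LINT r:{0..t}|lborel. D t r) + \<dots>) \<le> (M * c\<^sub>F * m) * (t - s) + (\<bar>a\<bar> * \<eta>) * (t - s)"
    by (rule norm_triangle_mono[OF Dint[OF tD0] n2])
   also have "\<dots> \<le> (\<epsilon> / 2) * (t - s) + (\<epsilon> / 2) * (t - s)"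
   proof (intro add_mono mult_right_mono a\<eta>)
    have "M * c\<^sub>F * m \<le> M * c\<^sub>F * (2 * d * K)" using m_bd McF by (intro mult_left_mono) auto
    then show "M * c\<^sub>F * m \<le> \<epsilon> / 2" using d_le(3) by simp
   qed (use st in auto)
   finally show ?case by (simp add: Y_def q_def)
  qed
 qed
qed

text \<open>\<open>X t\<close> is measurable for the natural filtration only strictly after
  \<open>t\<close>. The Cameron--Martin formula is therefore used up to \<open>r = t + 1\<close>,
  and the factor of the tilt after \<open>t\<close>, which has mean one given \<open>\<F> t\<close>,
  is integrated out.\<close>

lemma integral_tilt_X:
 fixes H :: "_ => complex" and f :: "'h => real"
 assumes st: "0 \<le> s" "s \<le> t" and H: "H \<in> borel_measurable (\<F> s)" "\<And>w. norm (H w) \<le> b"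
  and f: "f \<in> borel_measurable borel" "\<And>x. \<bar>f x\<bar> \<le> c"
 shows "(LINT w|P. (f (X t w) * tilt a k s t w) *\<^sub>R H w) =
  (LINT w|P. f (X t (path_shift s (a *\<^sub>R J (adjoint J k)) w)) *\<^sub>R H w)"
proof -
 interpret adj: linear "adjoint J" by (rule adjoint_linear_hilbert[OF J])
 define r where "r = t + 1"
 have sr: "s \<le> r" and t0: "0 \<le> t" and tr: "t \<le> r" using st by (auto simp: r_def)
 have Xn: "X t \<in> borel_measurable (natural_filtration r)"
  by (rule measurable_filtration_mono[OF X_canonical[OF t0]]) (simp_all add: canonical_filtration_natural r_def)
 have fX: "(\<lambda>w. f (X t w)) \<in> borel_measurable (natural_filtration r)"
  by (rule measurable_compose[OF Xn f(1)])
 define \<Phi> where "\<Phi> w = (f (X t w) * tilt a k s t w) *\<^sub>R H w" for w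
 have \<Phi>m: "\<Phi> \<in> borel_measurable (\<F> t)"
 proof -
  have [measurable]: "H \<in> borel_measurable (\<F> t)"
   by (rule measurable_canonical_mono[OF H(1) st(2)])
  have [measurable]: "(\<lambda>w. f (X t w)) \<in> borel_measurable (\<F> t)"
   by (rule measurable_compose[OF X_canonical[OF t0] f(1)])
  have [measurable]: "(\<lambda>w. w s) \<in> borel_measurable (\<F> t)"
    "(\<lambda>w. w t) \<in> borel_measurable (\<F> t)"
   using st t0 by (intro coord_measurable_canonical; simp)+
  show ?thesis unfolding \<Phi>_def by measurable
 qed
 have \<Phi>i: "integrable P \<Phi>"
 proof (rule Bochner_Integration.integrable_bound)
  show "integrable P (\<lambda>w. (c * b) * tilt a k s t w)"
   by (intro integrable_mult_right integral_tilt_cis(1) st)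
  show "\<Phi> \<in> borel_measurable P" by (rule measurable_canonical_P[OF \<Phi>m])
  show "AE w in P. norm (\<Phi> w) \<le> norm ((c * b) * tilt a k s t w)"
  proof (rule AE_I2)
   fix w
   have "\<bar>f (X t w)\<bar> * norm (H w) \<le> c * b" using f(2)[of "X t w"] H(2)[of w] by (intro mult_mono) auto
   then have "(\<bar>f (X t w)\<bar> * norm (H w)) * tilt a k s t w \<le> \<bar>c * b\<bar> * tilt a k s t w"
    by (intro mult_right_mono) auto
   then show "norm (\<Phi> w) \<le> norm ((c * b) * tilt a k s t w)"
    by (simp add: \<Phi>_def abs_mult mult_ac)
  qed
 qed
 have "(LINT w|P. \<Phi> w) = (LINT w|P. \<Phi> w * (tilt a k t r w *\<^sub>R cis ((w r - w t) \<bullet> 0)))"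
  unfolding integral_mult_tilt_cis(2)[OF t0 tr \<Phi>m \<Phi>i] by (simp add: adj.zero cis_zero)
 also have "\<dots> = (LINT w|P. (f (X t w) * tilt a k s r w) *\<^sub>R H w)"
 proof (rule Bochner_Integration.integral_cong[OF refl])
  fix w
  have "tilt a k s r w = tilt a k s t w * tilt a k t r w"
   unfolding exp_add[symmetric] by (rule arg_cong[of _ _ exp]) (simp add: inner_diff_left field_simps)
  then show "\<Phi> w * (tilt a k t r w *\<^sub>R cis ((w r - w t) \<bullet> 0)) = (f (X t w) * tilt a k s r w) *\<^sub>R H w"
   by (simp add: \<Phi>_def cis_zero mult_ac scaleR_conv_of_real)
 qed
 also have "\<dots> = (LINT w|P. f (X t (path_shift s (a *\<^sub>R J (adjoint J k)) w)) *\<^sub>R H w)"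
  by (rule cameron_martin[OF st(1) sr H fX f(2)])
 finally show ?thesis unfolding \<Phi>_def .
qed

end

section \<open>Gaussian second-order expansion\<close>

text \<open>
 The imaginary exponential is, up to third order, a combination of the two real exponentials
 that correspond to Cameron--Martin shifts in the directions \<open>1\<close> and \<open>-1\<close>. This is what allows us
 to work with shifts only, although the drift is identified through characteristic functions.
\<close>

definition exp_remainder :: "real => real => complex" where
 "exp_remainder v x = of_real (exp (v / 2)) * cis x - 1
   - Complex (-1/2) (1/2) * (of_real (exp (x - v / 2)) - 1)
   - Complex (-1/2) (-1/2) * (of_real (exp (- x - v / 2)) - 1)"

lemma exp_remainder_measurable [measurable]: "exp_remainder v \<in> borel_measurable borel"
 unfolding exp_remainder_def[abs_def] by measurable

text \<open>The two coefficients have difference \<open>\<i>\<close> and sum \<open>-1\<close>,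
  which matches the terms of first and second order. All products of the exponentials involved have
  explicit Gaussian means, so the second moment is exactly
  \<open>2 * (exp v - 2 + cos v - sin v)\<close>; this is of order \<open>v ^ 3\<close>, and its
  square root bounds the first moment.\<close>

lemma exp_remainder_real_gaussian:
 assumes v: "0 \<le> v" "v \<le> 1"
 shows "integrable (real_gaussian v) (exp_remainder v)"
  and "(\<integral>x. norm (exp_remainder v x) \<partial>real_gaussian v) \<le> 3 * (v * sqrt v)"
proof -
 interpret prob_space "real_gaussian v" by (rule prob_space_real_gaussian[OF v(1)])
 let ?G = "real_gaussian v"
 define f where "f a c x = exp (a * x - a\<^sup>2 * v / 2) *\<^sub>R cis (c * x)" for a c x
 define C where "C a c x = exp (a * x - a\<^sup>2 * v / 2) * cos (c * x)" for a c x
 define D where "D a c x = exp (a * x - a\<^sup>2 * v / 2) * sin (c * x)" for a c x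
 have f: "integrable ?G (f a c)" for a c
  by (rule Bochner_Integration.integrable_bound[OF integral_exp_cis_real_gaussian(1)[OF v(1), of a]]) (auto simp: f_def[abs_def])
 have CD: "Re (f a c x) = C a c x" "Im (f a c x) = D a c x" for a c x by (simp_all add: f_def C_def D_def)
 have If: "(LINT x|?G. f a c x) = cis (c * a * v) * of_real (exp (- (v * c\<^sup>2) / 2))" for a c
  unfolding f_def by (rule integral_exp_cis_real_gaussian(2)[OF v(1)])
 have C: "integrable ?G (C a c)" "(LINT x|?G. C a c x) = cos (c * a * v) * exp (- (v * c\<^sup>2) / 2)" for a c
  using integrable_Re[OF f[of a c]] integral_Re[OF f[of a c]] unfolding CD If by simp_all
 have D: "integrable ?G (D a c)" "(LINT x|?G. D a c x) = sin (c * a * v) * exp (- (v * c\<^sup>2) / 2)" for a c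
  using integrable_Im[OF f[of a c]] integral_Im[OF f[of a c]] unfolding CD If by simp_all
 define A where "A = exp (v / 2)"
 have A: "exp v = A * A" "exp (- (v / 2)) = 1 / A" "A \<noteq> 0"
  by (simp_all add: A_def exp_minus inverse_eq_divide flip: exp_add)
 have er: "exp_remainder v x = of_real A * f 0 1 x - 1 - Complex (-1/2) (1/2) * (f 1 0 x - 1) - Complex (-1/2) (-1/2) * (f (-1) 0 x - 1)" for x
  by (simp add: exp_remainder_def f_def A_def scaleR_conv_of_real cis_zero)
 show i: "integrable ?G (exp_remainder v)"
  unfolding er[abs_def] by (intro Bochner_Integration.integrable_diff integrable_mult_right f) simp_all
 have sq: "(norm (exp_remainder v x))\<^sup>2 = A * A + 4 + (A * A * C 2 0 x + A * A * C (-2) 0 x) / 2 - 4 * A * C 0 1 x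
   + A * (C 1 1 x + C (-1) 1 x) - A * (D 1 1 x - D (-1) 1 x) - 2 * (C 1 0 x + C (-1) 0 x)" for x
 proof -
  define p where "p = exp (x - v / 2)"
  define n where "n = exp (- x - v / 2)"
  have CD: "A * A * C 2 0 x = p * p" "A * A * C (-2) 0 x = n * n" "C 0 1 x = cos x" "C 1 0 x = p" "C (-1) 0 x = n"
   "C 1 1 x = p * cos x" "C (-1) 1 x = n * cos x" "D 1 1 x = p * sin x" "D (-1) 1 x = n * sin x"
   by (simp_all add: A_def C_def D_def p_def n_def flip: exp_add)
  have "(norm (exp_remainder v x))\<^sup>2 = (A * cos x - 2 + (p + n) / 2)\<^sup>2 + (A * sin x - (p - n) / 2)\<^sup>2"
   unfolding cmod_power2 by (simp add: exp_remainder_def A_def p_def n_def field_simps)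
  also have "\<dots> = A * A * (cos x * cos x + sin x * sin x) + 4 + (p * p + n * n) / 2 - 4 * A * cos x + A * (p + n) * cos x - A * (p - n) * sin x - 2 * (p + n)"
   by (simp add: power2_eq_square field_simps del: sin_cos_squared_add3)
  finally show ?thesis unfolding sin_cos_squared_add3
   unfolding CD by (simp add: algebra_simps)
 qed
 have isq: "integrable ?G (\<lambda>x. (norm (exp_remainder v x))\<^sup>2)" unfolding sq using C(1) D(1) by simp
 have "(LINT x|?G. (norm (exp_remainder v x))\<^sup>2) = 2 * (exp v - 2 + cos v - sin v)"
  unfolding sq using C D A by (simp add: prob_space algebra_simps)
 \<comment> \<open>The Taylor polynomials of degree 2 cancel. The remainders of \<open>exp\<close>,
   \<open>cos\<close> and \<open>sin\<close> are at most 3/2, 1/2 and 1/2 times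
   \<open>v ^ 3\<close>, and the sum is doubled.\<close>
 also have "\<dots> \<le> 5 * v ^ 3"
 proof -
  have "norm (exp (complex_of_real v) - (\<Sum>k\<le>2. complex_of_real v ^ k / fact k)) \<le> exp \<bar>Re (complex_of_real v)\<bar> * norm (complex_of_real v) ^ Suc 2 / fact 2"
   by (rule Taylor_exp)
  moreover have "exp (complex_of_real v) - (\<Sum>k\<le>2. complex_of_real v ^ k / fact k) = complex_of_real (exp v - (1 + v + v\<^sup>2 / 2))"
   by (simp add: eval_nat_numeral exp_of_real)
  ultimately have "\<bar>exp v - (1 + v + v\<^sup>2 / 2)\<bar> \<le> exp v * v ^ 3 / 2" using v by (simp add: eval_nat_numeral norm_of_real del: of_real_diff of_real_add)
  then have "exp v - (1 + v + v\<^sup>2 / 2) \<le> exp v * v ^ 3 / 2" by linarith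
  moreover have "exp v * v ^ 3 \<le> 3 * v ^ 3" using v exp_le by (intro mult_right_mono) (auto intro: order_trans[of "exp v" "exp 1" 3])
  moreover have "norm (exp (\<i> * v) - (\<Sum>k\<le>2. (\<i> * v) ^ k / fact k)) \<le> exp \<bar>Re (\<i> * v)\<bar> * norm (\<i> * v) ^ Suc 2 / fact 2"
   by (rule Taylor_exp)
  then have n: "norm (cis v - (1 + \<i> * v - v\<^sup>2 / 2)) \<le> v ^ 3 / 2"
   using v by (simp add: cis_conv_exp norm_mult eval_nat_numeral algebra_simps)
  have "\<bar>cos v - (1 - v\<^sup>2 / 2)\<bar> \<le> v ^ 3 / 2" "\<bar>sin v - v\<bar> \<le> v ^ 3 / 2"
   using order_trans[OF abs_Re_le_cmod n] order_trans[OF abs_Im_le_cmod n] by simp_all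
  then have "cos v \<le> 1 - v\<^sup>2 / 2 + v ^ 3 / 2" "v - v ^ 3 / 2 \<le> sin v" by linarith+
  ultimately show ?thesis by simp
 qed
 \<comment> \<open>Rounded up to the square of \<open>3 * (v * sqrt v)\<close>.\<close>
 also have "\<dots> \<le> 9 * v ^ 3" using v by simp
 finally have "(LINT x|?G. (norm (exp_remainder v x))\<^sup>2) \<le> 9 * v ^ 3" .
 moreover have "(LINT x|?G. norm (exp_remainder v x))\<^sup>2 \<le> (LINT x|?G. (norm (exp_remainder v x))\<^sup>2)"
  using variance_positive[of "\<lambda>x. norm (exp_remainder v x)"] variance_eq[OF integrable_norm[OF i] isq] by simp
 moreover have "(3 * (v * sqrt v))\<^sup>2 = 9 * v ^ 3" using v by (simp add: power2_eq_square power3_eq_cube)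
 ultimately have "(LINT x|?G. norm (exp_remainder v x))\<^sup>2 \<le> (3 * (v * sqrt v))\<^sup>2" by linarith
 then show "(LINT x|?G. norm (exp_remainder v x)) \<le> 3 * (v * sqrt v)"
  by (rule power2_le_imp_le) (use v in simp)
qed

section \<open>Truncation\<close>

text \<open>Equal to 1 up to norm \<open>R + 1\<close> and to 0 from \<open>R + 2\<close> on. The
  spare unit beyond \<open>R\<close> lets a path that is known to be below \<open>R\<close> move,
  and be displaced along \<open>q\<close>, during a short step without meeting the cutoff.\<close>

definition cutoff :: "real => 'a::real_normed_vector => real" where
 "cutoff R x = max 0 (min 1 (R + 2 - norm x))"

lemma cutoff_le: "0 \<le> cutoff R x" "cutoff R x \<le> 1"
 by (auto simp: cutoff_def)

lemma cutoff_eq_1: "norm x \<le> R + 1 ==> cutoff R x = 1"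
 by (simp add: cutoff_def)

lemma cutoff_eq_0: "R + 2 \<le> norm x ==> cutoff R x = 0"
 by (simp add: cutoff_def)

lemma cutoff_Lipschitz: "\<bar>cutoff R x - cutoff R y\<bar> \<le> norm (x - y)"
 using norm_triangle_ineq3[of x y] by (auto simp: cutoff_def max_def min_def abs_if split: if_splits)

text \<open>The gradient is bounded only on balls. One \<open>C\<close> in the Lipschitz constant
  comes from the slope of \<open>h\<close>, the other from \<open>h\<close> times the slope of the
  cutoff; if one of the points lies outside the ball, only the second occurs.\<close>

lemma cutoff_mult_bounds:
 fixes h :: "'a::real_inner => real"
 assumes D: "\<And>x. GDERIV h x :> D x"
  and bd: "\<And>x. norm x \<le> R + 2 ==> \<bar>h x\<bar> \<le> C" "\<And>x. norm x \<le> R + 2 ==> norm (D x) \<le> C"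
  and C: "C \<ge> 0"
 shows "\<bar>h x * cutoff R x\<bar> \<le> C"
  and "\<bar>h x * cutoff R x - h y * cutoff R y\<bar> \<le> 2 * C * norm (x - y)"
proof -
 have 1: "\<bar>h x * cutoff R x\<bar> \<le> C" for x
 proof (cases "norm x \<le> R + 2")
  case True
  have "\<bar>h x\<bar> * \<bar>cutoff R x\<bar> \<le> C * 1" using bd(1)[OF True] cutoff_le[of R x] C by (intro mult_mono) auto
  then show ?thesis by (simp add: abs_mult)
 qed (use C in \<open>simp add: cutoff_eq_0\<close>)
 show "\<bar>h x * cutoff R x\<bar> \<le> C" by (rule 1)
 have h_lip: "\<bar>h x - h y\<bar> \<le> C * norm (x - y)" if "norm x \<le> R + 2" "norm y \<le> R + 2" for x y
 proof -
  have "norm (h x - h y) \<le> C * norm (x - y)"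
  proof (rule differentiable_bound[of "cball 0 (R + 2)"])
   show "(h has_derivative (\<lambda>z. z \<bullet> D x)) (at x within cball 0 (R + 2))" for x
    using D[of x] by (simp add: gderiv_def has_derivative_at_withinI)
   show "onorm (\<lambda>z. z \<bullet> D x) \<le> C" if "x \<in> cball 0 (R + 2)" for x
   proof (rule onorm_bound[OF C])
    fix z
    have "norm (z \<bullet> D x) \<le> norm z * norm (D x)" using Cauchy_Schwarz_ineq2[of z "D x"] by simp
    also have "\<dots> \<le> norm z * C" using that by (intro mult_left_mono bd) auto
    finally show "norm (z \<bullet> D x) \<le> C * norm z" by (simp add: mult.commute)
   qed
  qed (use that in auto)
  then show ?thesis by simp
 qed
 have out: "\<bar>h x * cutoff R x - h y * cutoff R y\<bar> \<le> 2 * C * norm (x - y)" if "norm x \<le> R + 2" "\<not> norm y \<le> R + 2" for x y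
 proof -
  have y: "cutoff R y = 0" using that by (simp add: cutoff_eq_0)
  have "\<bar>h x\<bar> * \<bar>cutoff R x - cutoff R y\<bar> \<le> C * norm (x - y)"
   using bd(1)[OF that(1)] C by (intro mult_mono cutoff_Lipschitz) auto
  moreover have "C * norm (x - y) \<le> 2 * C * norm (x - y)" using C by (intro mult_right_mono) auto
  ultimately show ?thesis by (simp add: y abs_mult)
 qed
 show "\<bar>h x * cutoff R x - h y * cutoff R y\<bar> \<le> 2 * C * norm (x - y)"
 proof (cases "norm x \<le> R + 2"; cases "norm y \<le> R + 2")
  assume xy: "norm x \<le> R + 2" "norm y \<le> R + 2"
  have "\<bar>h x * cutoff R x - h y * cutoff R y\<bar> = \<bar>(h x - h y) * cutoff R x + h y * (cutoff R x - cutoff R y)\<bar>"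
   by (simp add: algebra_simps)
  also have "\<dots> \<le> \<bar>h x - h y\<bar> * \<bar>cutoff R x\<bar> + \<bar>h y\<bar> * \<bar>cutoff R x - cutoff R y\<bar>"
   unfolding abs_mult[symmetric] by (rule abs_triangle_ineq)
  also have "\<dots> \<le> (C * norm (x - y)) * 1 + C * norm (x - y)"
   using h_lip[OF xy] bd(1)[OF xy(2)] cutoff_le[of R x] C
   by (intro add_mono mult_mono cutoff_Lipschitz) auto
  finally show ?thesis by simp
 next
  assume "norm x \<le> R + 2" "\<not> norm y \<le> R + 2" then show ?thesis by (rule out)
 next
  assume "\<not> norm x \<le> R + 2" "norm y \<le> R + 2"
  from out[OF this(2,1)] show ?thesis by (simp add: abs_minus_commute norm_minus_commute)
 next
  assume "\<not> norm x \<le> R + 2" "\<not> norm y \<le> R + 2"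
  then show ?thesis using C by (simp add: cutoff_eq_0)
 qed
qed

section \<open>The one-step estimate\<close>

lemma norm_integral_le_AE:
 fixes f :: "'a => 'b::{banach,second_countable_topology}"
 assumes "integrable M f" "integrable M g" "AE x in M. norm (f x) \<le> g x"
 shows "norm (LINT x|M. f x) \<le> (LINT x|M. g x)"
 by (rule order_trans[OF integral_norm_bound integral_mono_AE]) (use assms in auto)

text \<open>The real exponentials inside \<open>exp_remainder\<close> turn into evaluations of
  \<open>g\<close> at \<open>Yp\<close> and \<open>Ym\<close>, which are close to \<open>Z\<close>
  displaced by \<open>d\<close> and \<open>- d\<close> times \<open>q\<close>. To first order the
  differences from \<open>g (Z w)\<close> are \<open>d * D w\<close> and \<open>- d * D w\<close>,
  and the coefficients combine them to \<open>\<i> * (d * D w)\<close>. \<open>D\<close> is only a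
  candidate for the derivative; its error stays in the bound as an integral.\<close>

lemma (in prob_space) one_step_estimate:
 fixes g :: "'h::{real_inner,banach,second_countable_topology} => real" and H :: "'a => complex"
 assumes K: "integrable (real_gaussian u) (exp_remainder u)" "(\<integral>x. norm (exp_remainder u x) \<partial>real_gaussian u) \<le> K * (u * sqrt u)"
  and u: "0 \<le> u" and \<Delta> [measurable]: "\<Delta> \<in> borel_measurable M" and law: "distr M borel \<Delta> = real_gaussian u"
  and g [measurable]: "g \<in> borel_measurable borel" and g_bd: "\<And>x. \<bar>g x\<bar> \<le> C"
  and g_lip: "\<And>x y. \<bar>g x - g y\<bar> \<le> L * norm (x - y)" and L: "L \<ge> 0"
  and Z [measurable]: "Z \<in> borel_measurable M" and Yp [measurable]: "Yp \<in> borel_measurable M" and Ym [measurable]: "Ym \<in> borel_measurable M"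
  and Yp_near: "AE w in M. norm (Yp w - Z w - d *\<^sub>R q) \<le> \<epsilon> * d"
  and Ym_near: "AE w in M. norm (Ym w - Z w + d *\<^sub>R q) \<le> \<epsilon> * d"
  and H [measurable]: "H \<in> borel_measurable M" and H_bd: "\<And>w. norm (H w) \<le> b"
  and Yp_eq: "(LINT w|M. (g (Z w) * exp (\<Delta> w - u / 2)) *\<^sub>R H w) = (LINT w|M. g (Yp w) *\<^sub>R H w)"
  and Ym_eq: "(LINT w|M. (g (Z w) * exp (- \<Delta> w - u / 2)) *\<^sub>R H w) = (LINT w|M. g (Ym w) *\<^sub>R H w)"
  and D [measurable]: "D \<in> borel_measurable M" and D_bd: "\<And>w. \<bar>D w\<bar> * norm (H w) \<le> Q" and d: "0 \<le> d"
 shows "norm ((LINT w|M. g (Z w) *\<^sub>R ((of_real (exp (u / 2)) * cis (\<Delta> w) - 1) * H w)) - (LINT w|M. \<i> * (d * D w) * H w)) \<le>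
  2 * b * L * \<epsilon> * d + (LINT w|M. norm (H w) * (\<bar>g (Z w + d *\<^sub>R q) - g (Z w) - d * D w\<bar> + \<bar>g (Z w - d *\<^sub>R q) - g (Z w) + d * D w\<bar>))
  + C * b * (K * (u * sqrt u))"
proof -
 define \<alpha> where "\<alpha> = Complex (-1/2) (1/2)"
 define \<alpha>' where "\<alpha>' = Complex (-1/2) (-1/2)"
 have \<alpha>: "\<alpha> - \<alpha>' = \<i>" "norm \<alpha> \<le> 1" "norm \<alpha>' \<le> 1"
  by (auto simp: \<alpha>_def \<alpha>'_def complex_eq_iff cmod_def power2_eq_square)
 have b: "0 \<le> b" using H_bd norm_ge_zero order_trans by blast
 have C: "0 \<le> C" using g_bd[of 0] by simp
 have hb: "norm (g x *\<^sub>R H w) \<le> C * b" for x w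
  unfolding norm_scaleR using g_bd[of x] H_bd[of w] C by (intro mult_mono) auto
 have ig: "integrable M (\<lambda>w. g (V w) *\<^sub>R H w)" if [measurable]: "V \<in> borel_measurable M" for V
  using hb by (intro integrable_const_bound[of _ "C * b"]) auto
 have iexp: "integrable M (\<lambda>w. (g (Z w) * exp (a * \<Delta> w - u / 2)) *\<^sub>R H w)" if "a\<^sup>2 = 1" for a
 proof (rule Bochner_Integration.integrable_bound)
  have "integrable (distr M borel \<Delta>) (\<lambda>x. exp (a * x - a\<^sup>2 * u / 2))"
   unfolding law by (rule integral_exp_cis_real_gaussian(1)[OF u])
  then have "integrable M (\<lambda>w. exp (a * \<Delta> w - u / 2))"
   by (subst (asm) integrable_distr_eq) (simp_all add: that)
  then show "integrable M (\<lambda>w. (C * b) * exp (a * \<Delta> w - u / 2))" by (rule integrable_mult_right)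
  show "AE w in M. norm ((g (Z w) * exp (a * \<Delta> w - u / 2)) *\<^sub>R H w) \<le> norm (C * b * exp (a * \<Delta> w - u / 2))"
  proof (rule AE_I2)
   fix w
   have "norm (g (Z w) *\<^sub>R H w) * exp (a * \<Delta> w - u / 2) \<le> (C * b) * exp (a * \<Delta> w - u / 2)"
    by (intro mult_right_mono hb) simp
   then show "norm ((g (Z w) * exp (a * \<Delta> w - u / 2)) *\<^sub>R H w) \<le> norm (C * b * exp (a * \<Delta> w - u / 2))"
    using C b by (simp add: abs_mult mult_ac)
  qed
 qed simp
 have irem: "integrable M (\<lambda>w. exp_remainder u (\<Delta> w))"
  using K(1) unfolding law[symmetric] by (subst (asm) integrable_distr_eq) simp_all
 have irem': "integrable M (\<lambda>w. g (Z w) *\<^sub>R (exp_remainder u (\<Delta> w) * H w))"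
 proof (rule Bochner_Integration.integrable_bound)
  show "integrable M (\<lambda>w. (C * b) * norm (exp_remainder u (\<Delta> w)))"
   by (intro integrable_mult_right integrable_norm irem)
  show "AE w in M. norm (g (Z w) *\<^sub>R (exp_remainder u (\<Delta> w) * H w)) \<le> norm (C * b * norm (exp_remainder u (\<Delta> w)))"
  proof (rule AE_I2)
   fix w
   have "norm (g (Z w) *\<^sub>R H w) * norm (exp_remainder u (\<Delta> w)) \<le> (C * b) * norm (exp_remainder u (\<Delta> w))"
    by (intro mult_right_mono hb) simp
   then show "norm (g (Z w) *\<^sub>R (exp_remainder u (\<Delta> w) * H w)) \<le> norm (C * b * norm (exp_remainder u (\<Delta> w)))"
    using C b by (simp add: norm_mult abs_mult mult_ac)
  qed
 qed simp
 have iD: "integrable M (\<lambda>w. D w *\<^sub>R H w)"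
  using D_bd by (intro integrable_const_bound[of _ Q]) auto
 \<comment> \<open>The two first-order errors; what remains after their subtraction is an exact
   multiple of \<open>D\<close>.\<close>
 define Rp where "Rp w = (g (Yp w) - g (Z w) - d * D w) *\<^sub>R H w" for w
 define Rm where "Rm w = (g (Ym w) - g (Z w) + d * D w) *\<^sub>R H w" for w
 have Rp: "Rp w = g (Yp w) *\<^sub>R H w - g (Z w) *\<^sub>R H w - d *\<^sub>R (D w *\<^sub>R H w)"
  and Rm: "Rm w = g (Ym w) *\<^sub>R H w - g (Z w) *\<^sub>R H w + d *\<^sub>R (D w *\<^sub>R H w)" for w
  by (simp_all add: Rp_def Rm_def scaleR_diff_left scaleR_add_left)
 have iRp: "integrable M Rp" and iRm: "integrable M Rm"
  unfolding Rp[abs_def] Rm[abs_def] by (intro Bochner_Integration.integrable_diff Bochner_Integration.integrable_add integrable_scaleR_right ig iD; simp)+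
 have IRp: "(LINT w|M. Rp w) = (LINT w|M. g (Yp w) *\<^sub>R H w) - (LINT w|M. g (Z w) *\<^sub>R H w) - d *\<^sub>R (LINT w|M. D w *\<^sub>R H w)"
  and IRm: "(LINT w|M. Rm w) = (LINT w|M. g (Ym w) *\<^sub>R H w) - (LINT w|M. g (Z w) *\<^sub>R H w) + d *\<^sub>R (LINT w|M. D w *\<^sub>R H w)"
  unfolding Rp Rm using ig[OF Yp] ig[OF Ym] ig[OF Z] iD by (simp_all del: scaleR_scaleR)
 have split: "g (Z w) *\<^sub>R ((of_real (exp (u / 2)) * cis (\<Delta> w) - 1) * H w) =
   \<alpha> * ((g (Z w) * exp (1 * \<Delta> w - u / 2)) *\<^sub>R H w - g (Z w) *\<^sub>R H w) +
   \<alpha>' * ((g (Z w) * exp ((-1) * \<Delta> w - u / 2)) *\<^sub>R H w - g (Z w) *\<^sub>R H w) +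
   g (Z w) *\<^sub>R (exp_remainder u (\<Delta> w) * H w)" for w
  unfolding exp_remainder_def \<alpha>_def[symmetric] \<alpha>'_def[symmetric] by (simp add: scaleR_conv_of_real algebra_simps)
 have "(LINT w|M. g (Z w) *\<^sub>R ((of_real (exp (u / 2)) * cis (\<Delta> w) - 1) * H w)) =
   \<alpha> * ((LINT w|M. g (Yp w) *\<^sub>R H w) - (LINT w|M. g (Z w) *\<^sub>R H w)) +
   \<alpha>' * ((LINT w|M. g (Ym w) *\<^sub>R H w) - (LINT w|M. g (Z w) *\<^sub>R H w)) +
   (LINT w|M. g (Z w) *\<^sub>R (exp_remainder u (\<Delta> w) * H w))"
  unfolding split using iexp[of 1] iexp[of "-1"] ig[OF Z] irem' Yp_eq Ym_eq by simp
 also have "\<dots> = \<alpha> * (LINT w|M. Rp w) + \<alpha>' * (LINT w|M. Rm w) + (\<alpha> - \<alpha>') * (d *\<^sub>R (LINT w|M. D w *\<^sub>R H w)) +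
   (LINT w|M. g (Z w) *\<^sub>R (exp_remainder u (\<Delta> w) * H w))"
  unfolding IRp IRm by (simp add: algebra_simps)
 also have "(\<alpha> - \<alpha>') * (d *\<^sub>R (LINT w|M. D w *\<^sub>R H w)) = (LINT w|M. \<i> * (d * D w) * H w)"
 proof -
  have "(LINT w|M. \<i> * (d * D w) * H w) = (LINT w|M. (\<i> * d) * (D w *\<^sub>R H w))"
   by (simp add: scaleR_conv_of_real mult_ac)
  then show ?thesis unfolding \<alpha> by (simp add: scaleR_conv_of_real)
 qed
 finally have eq: "(LINT w|M. g (Z w) *\<^sub>R ((of_real (exp (u / 2)) * cis (\<Delta> w) - 1) * H w)) - (LINT w|M. \<i> * (d * D w) * H w) =
   \<alpha> * (LINT w|M. Rp w) + \<alpha>' * (LINT w|M. Rm w) + (LINT w|M. g (Z w) *\<^sub>R (exp_remainder u (\<Delta> w) * H w))"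
  by simp
 define \<psi> where "\<psi> a w = norm (H w) * \<bar>g (Z w + a *\<^sub>R q) - g (Z w) - a * D w\<bar>" for a w
 have i\<psi>: "integrable M (\<psi> a)" if "\<bar>a\<bar> = d" for a
 proof (rule integrable_const_bound[of _ "2 * (C * b) + d * Q"])
  show "\<psi> a \<in> borel_measurable M" unfolding \<psi>_def[abs_def] by measurable
  show "AE w in M. norm (\<psi> a w) \<le> 2 * (C * b) + d * Q"
  proof (rule AE_I2)
   fix w
   let ?x = "Z w + a *\<^sub>R q" and ?y = "Z w"
   have "norm (\<psi> a w) \<le> norm (H w) * (\<bar>g ?x\<bar> + \<bar>g ?y\<bar> + d * \<bar>D w\<bar>)"
    using that abs_triangle_ineq4[of "g ?x - g ?y" "a * D w"] abs_triangle_ineq4[of "g ?x" "g ?y"]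
    by (simp add: \<psi>_def abs_mult mult_left_mono)
   also have "\<dots> = norm (g ?x *\<^sub>R H w) + norm (g ?y *\<^sub>R H w) + d * (\<bar>D w\<bar> * norm (H w))"
    by (simp add: algebra_simps)
   also have "\<dots> \<le> C * b + C * b + d * Q" by (intro add_mono hb mult_left_mono D_bd d)
   finally show "norm (\<psi> a w) \<le> 2 * (C * b) + d * Q" by simp
  qed
 qed
 have near: "norm (LINT w|M. (g (Y w) - g (Z w) - a * D w) *\<^sub>R H w) \<le> b * L * \<epsilon> * d + (LINT w|M. \<psi> a w)"
  if a: "\<bar>a\<bar> = d" and Y: "AE w in M. norm (Y w - Z w - a *\<^sub>R q) \<le> \<epsilon> * d"
   and i: "integrable M (\<lambda>w. (g (Y w) - g (Z w) - a * D w) *\<^sub>R H w)" for a Y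
 proof -
  have "norm (LINT w|M. (g (Y w) - g (Z w) - a * D w) *\<^sub>R H w) \<le> (LINT w|M. b * L * \<epsilon> * d + \<psi> a w)"
  proof (rule norm_integral_le_AE[OF i])
   show "AE w in M. norm ((g (Y w) - g (Z w) - a * D w) *\<^sub>R H w) \<le> b * L * \<epsilon> * d + \<psi> a w"
    using Y
   proof eventually_elim
    case (elim w)
    let ?y = "g (Y w)" and ?z = "g (Z w + a *\<^sub>R q)"
    have "\<bar>?y - ?z\<bar> \<le> L * (\<epsilon> * d)"
     using g_lip[of "Y w" "Z w + a *\<^sub>R q"] mult_left_mono[OF elim L] by (simp add: diff_diff_eq)
    then have 1: "norm (H w) * \<bar>?y - ?z\<bar> \<le> b * (L * (\<epsilon> * d))" using H_bd[of w] b by (intro mult_mono) auto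
    have "\<bar>?y - g (Z w) - a * D w\<bar> \<le> \<bar>?y - ?z\<bar> + \<bar>?z - g (Z w) - a * D w\<bar>"
     using abs_triangle_ineq[of "?y - ?z" "?z - g (Z w) - a * D w"] by simp
    then have "norm (H w) * \<bar>?y - g (Z w) - a * D w\<bar> \<le> norm (H w) * \<bar>?y - ?z\<bar> + \<psi> a w"
     unfolding \<psi>_def distrib_left[symmetric] by (rule mult_left_mono) simp
    then show ?case using 1 by (simp add: mult_ac)
   qed
  qed (use i\<psi>[OF a] in simp)
  then show ?thesis using i\<psi>[OF a] by (simp add: prob_space)
 qed
 have nRp: "norm (LINT w|M. Rp w) \<le> b * L * \<epsilon> * d + (LINT w|M. \<psi> d w)"
  using near[of d Yp] iRp Yp_near d by (simp add: Rp_def[abs_def])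
 have nRm: "norm (LINT w|M. Rm w) \<le> b * L * \<epsilon> * d + (LINT w|M. \<psi> (- d) w)"
  using near[of "- d" Ym] iRm Ym_near d by (simp add: Rm_def[abs_def])
 have nrem: "norm (LINT w|M. g (Z w) *\<^sub>R (exp_remainder u (\<Delta> w) * H w)) \<le> C * b * (K * (u * sqrt u))"
 proof -
  have "norm (LINT w|M. g (Z w) *\<^sub>R (exp_remainder u (\<Delta> w) * H w)) \<le> (LINT w|M. C * b * norm (exp_remainder u (\<Delta> w)))"
  proof (rule norm_integral_le_AE[OF irem' _ AE_I2])
   fix w
   have "norm (g (Z w) *\<^sub>R H w) * norm (exp_remainder u (\<Delta> w)) \<le> (C * b) * norm (exp_remainder u (\<Delta> w))"
    by (intro mult_right_mono hb) simp
   then show "norm (g (Z w) *\<^sub>R (exp_remainder u (\<Delta> w) * H w)) \<le> C * b * norm (exp_remainder u (\<Delta> w))"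
    by (simp add: norm_mult mult_ac)
  qed (intro irem' integrable_mult_right integrable_norm irem)+
  also have "\<dots> = C * b * (\<integral>x. norm (exp_remainder u x) \<partial>distr M borel \<Delta>)"
   by (subst integral_distr) simp_all
  also have "\<dots> \<le> C * b * (K * (u * sqrt u))" unfolding law using K(2) C b by (intro mult_left_mono) auto
  finally show ?thesis .
 qed
 have "norm (\<alpha> * (LINT w|M. Rp w)) \<le> norm (LINT w|M. Rp w)" "norm (\<alpha>' * (LINT w|M. Rm w)) \<le> norm (LINT w|M. Rm w)"
  using \<alpha>(2,3) by (simp_all add: norm_mult mult_left_le_one_le)
 then have "norm (\<alpha> * (LINT w|M. Rp w) + \<alpha>' * (LINT w|M. Rm w) + (LINT w|M. g (Z w) *\<^sub>R (exp_remainder u (\<Delta> w) * H w))) \<le>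
   (b * L * \<epsilon> * d + (LINT w|M. \<psi> d w)) + (b * L * \<epsilon> * d + (LINT w|M. \<psi> (- d) w)) + C * b * (K * (u * sqrt u))"
  using nRp nRm nrem by (intro norm_triangle_le add_mono) linarith+
 moreover have "(LINT w|M. norm (H w) * (\<bar>g (Z w + d *\<^sub>R q) - g (Z w) - d * D w\<bar> + \<bar>g (Z w - d *\<^sub>R q) - g (Z w) + d * D w\<bar>)) =
   (LINT w|M. \<psi> d w) + (LINT w|M. \<psi> (- d) w)"
  using i\<psi>[of d] i\<psi>[of "- d"] d by (subst Bochner_Integration.integral_add[symmetric]) (simp_all add: \<psi>_def distrib_left)
 ultimately show ?thesis unfolding eq by (simp add: mult_ac)
qed

lemma real_gaussian_abs_moment:
 obtains c where "c \<ge> 0" "\<And>v. 0 \<le> v ==> integrable (real_gaussian v) (\<lambda>x. \<bar>x\<bar>)"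
  "\<And>v. 0 \<le> v ==> (\<integral>x. \<bar>x\<bar> \<partial>real_gaussian v) \<le> c * sqrt v"
proof (rule that[of "\<integral>z. \<bar>z\<bar> \<partial>std_normal_distribution"])
 have "integrable lborel (\<lambda>z. std_normal_density z *\<^sub>R \<bar>z\<bar>)" using integrable_normal_moment_abs[where \<mu>=0 and \<sigma>=1 and k=1] by simp
 then have "integrable std_normal_distribution (\<lambda>z. \<bar>z\<bar>)" by (subst integrable_density) simp_all
 then have i: "integrable std_normal_distribution (\<lambda>z. sqrt v * \<bar>z\<bar>)" for v by (rule integrable_mult_right)
 show "0 \<le> (LINT z|std_normal_distribution. \<bar>z\<bar>)" by simp
 fix v :: real assume v: "0 \<le> v"
 show "integrable (real_gaussian v) (\<lambda>x. \<bar>x\<bar>)"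
  unfolding real_gaussian_eq_distr[OF v] using i v by (subst integrable_distr_eq) (simp_all add: abs_mult)
 show "(\<integral>x. \<bar>x\<bar> \<partial>real_gaussian v) \<le> (LINT z|std_normal_distribution. \<bar>z\<bar>) * sqrt v"
  unfolding real_gaussian_eq_distr[OF v] using v by (subst integral_distr) (simp_all add: abs_mult)
qed

section \<open>An abstract Girsanov theorem\<close>

text \<open>
 The martingale is \<open>E u = h u (X u) * e u\<close> with \<open>e\<close> of finite variation. The process \<open>\<beta>\<close> is a
 Brownian motion of variance \<open>\<kappa>\<close>; by Cameron--Martin, tilting by \<open>exp (\<plusminus>\<beta>)\<close> over a short interval
 \<open>(u, v]\<close> moves \<open>X v\<close> by approximately \<open>\<plusminus>(v - u) q\<close>. This is the only information on the joint law of
 \<open>X\<close> and \<open>\<beta>\<close> that is needed to find the drift of \<open>\<beta>\<close> under the measure with density \<open>E\<close>.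
\<close>

definition cm_shift :: "'w measure => 'w measure => ('w => 'h::real_normed_vector) => ('w => real) => 'h => real => ('w => 'h) => bool" where
 "cm_shift M N X L d \<epsilon> Y \<longleftrightarrow> Y \<in> borel_measurable M \<and> (AE w in M. norm (Y w - X w - d) \<le> \<epsilon>) \<and>
  (\<forall>H f b c. H \<in> borel_measurable N --> (\<forall>w. norm (H w) \<le> b) --> f \<in> borel_measurable borel --> (\<forall>x. \<bar>f x\<bar> \<le> c) -->
   (LINT w|M. (f (X w) * exp (L w)) *\<^sub>R (H w :: complex)) = (LINT w|M. f (Y w) *\<^sub>R H w))"

text \<open>The bounds on \<open>e\<close> hold only while \<open>X\<close> stays in a ball, and
  those on \<open>h\<close> and \<open>Dh\<close> grow with \<open>X\<close>, so every estimate
  needs a truncation in \<open>X\<close>. The martingale property is assumed in the weak form in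
  which it is used, tested with bounded functions of the past.\<close>

locale abstract_girsanov = prob_space M for M :: "'w measure" +
 fixes G :: "real => 'w measure" and T :: real
  and X :: "real => 'w => 'h::{real_inner,banach,second_countable_topology}"
  and h :: "real => 'h => real" and Dh :: "real => 'h => 'h" and e \<beta> :: "real => 'w => real"
  and q :: 'h and \<kappa> m C :: real
 assumes sub: "\<And>u. subalgebra M (G u)"
  and mono: "\<And>u v. u \<le> v ==> sets (G u) \<subseteq> sets (G v)"
  and X: "\<And>u. 0 \<le> u ==> X u \<in> borel_measurable (G u)"
  and X_cont: "AE w in M. continuous_on {0..T} (\<lambda>u. X u w)"
  and h_cont: "continuous_on ({0..} \<times> UNIV) (\<lambda>(t, x). h t x)"
  and h_pos: "\<And>t x. 0 \<le> t ==> 0 < h t x"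
  and h_bd: "\<And>t x. 0 \<le> t ==> \<bar>h t x\<bar> \<le> C * (1 + norm x powr m)"
  and Dh: "\<And>t x. 0 \<le> t ==> GDERIV (h t) x :> Dh t x"
  and Dh_cont: "continuous_on ({0..} \<times> UNIV) (\<lambda>(t, x). Dh t x)"
  and Dh_bd: "\<And>t x. 0 \<le> t ==> norm (Dh t x) \<le> C * (1 + norm x powr m)"
  and m: "0 \<le> m" and C: "0 \<le> C"
  and e: "\<And>u. 0 \<le> u ==> e u \<in> borel_measurable (G u)" and e_pos: "\<And>u w. 0 < e u w"
  and e_loc: "\<And>R. \<exists>c\<ge>0. AE w in M. \<forall>u v. 0 \<le> u --> u \<le> v --> v \<le> T --> (\<forall>r\<in>{0..v}. norm (X r w) \<le> R) -->
    e v w \<le> c \<and> \<bar>e v w - e u w\<bar> \<le> c * (v - u)"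
  and E_int: "\<And>u. 0 \<le> u ==> u \<le> T ==> integrable M (\<lambda>w. h u (X u w) * e u w)"
  and E_mart: "\<And>u v H b. 0 \<le> u ==> u \<le> v ==> v \<le> T ==> H \<in> borel_measurable (G u) ==> (\<And>w. \<bar>H w\<bar> \<le> b) ==>
    (LINT w|M. H w * (h v (X v w) * e v w)) = (LINT w|M. H w * (h u (X u w) * e u w))"
  and \<beta>: "\<And>u. 0 \<le> u ==> \<beta> u \<in> borel_measurable (G u)"
  and \<beta>_law: "\<And>u v. 0 \<le> u ==> u \<le> v ==> distr M borel (\<lambda>w. \<beta> v w - \<beta> u w) = real_gaussian ((v - u) * \<kappa>)"
  and \<kappa>: "0 \<le> \<kappa>"
  and shift: "\<And>a \<epsilon>. \<bar>a\<bar> = 1 ==> 0 < \<epsilon> ==> \<exists>d>0. \<forall>u v. 0 \<le> u --> u < v --> v \<le> T --> v - u \<le> d -->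
    (\<exists>Y. cm_shift M (G u) (X v) (\<lambda>w. a * (\<beta> v w - \<beta> u w) - (v - u) * \<kappa> / 2) ((a * (v - u)) *\<^sub>R q) (\<epsilon> * (v - u)) Y)"
begin

definition E :: "real => 'w => real" where "E u w = h u (X u w) * e u w"

text \<open>The derivative of \<open>ln (h u)\<close> in direction \<open>q\<close> along the path:
  the drift that \<beta> acquires under the density \<open>E\<close>.\<close>

definition drift :: "real => 'w => real" where
 "drift u w = (Dh u (X u w) \<bullet> q) / h u (X u w)"

lemma measurable_G_mono: "f \<in> measurable (G u) N ==> u \<le> v ==> f \<in> measurable (G v) N"
 using sub[of u] sub[of v] mono[of u v] by (auto simp: measurable_def subalgebra_def)

lemma measurable_G: "f \<in> measurable (G u) N ==> f \<in> measurable M N"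
 by (rule measurable_from_subalg[OF sub])

lemma h_measurable: "0 \<le> u ==> h u \<in> borel_measurable borel"
proof -
 assume "0 \<le> u"
 then have "continuous_on UNIV (\<lambda>x. (\<lambda>(t, x). h t x) (u, x))"
  by (intro continuous_on_compose2[OF h_cont]) (auto intro!: continuous_intros)
 then show ?thesis by (intro borel_measurable_continuous_onI) simp
qed

lemma Dh_measurable: "0 \<le> u ==> Dh u \<in> borel_measurable borel"
proof -
 assume "0 \<le> u"
 then have "continuous_on UNIV (\<lambda>x. (\<lambda>(t, x). Dh t x) (u, x))"
  by (intro continuous_on_compose2[OF Dh_cont]) (auto intro!: continuous_intros)
 then show ?thesis by (intro borel_measurable_continuous_onI) simp
qed

lemma hX_measurable: "0 \<le> u ==> (\<lambda>w. h u (X u w)) \<in> borel_measurable (G u)"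
 by (rule measurable_compose[OF X h_measurable])

lemma DhX_measurable: "0 \<le> u ==> (\<lambda>w. Dh u (X u w)) \<in> borel_measurable (G u)"
 by (rule measurable_compose[OF X Dh_measurable])

lemma drift_measurable: "0 \<le> u ==> drift u \<in> borel_measurable (G u)"
 unfolding drift_def[abs_def]
 by (intro borel_measurable_divide borel_measurable_inner hX_measurable DhX_measurable borel_measurable_const)

lemma E_measurable: "0 \<le> u ==> E u \<in> borel_measurable (G u)"
 unfolding E_def[abs_def] by (intro borel_measurable_times hX_measurable e)

lemma E_integrable: "0 \<le> u ==> u \<le> T ==> integrable M (E u)"
 unfolding E_def[abs_def] by (rule E_int)

lemma E_nonneg: "0 \<le> u ==> 0 \<le> E u w"
 unfolding E_def using h_pos[of u "X u w"] e_pos[of u w] by simp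

lemma E_martingale:
 "0 \<le> u ==> u \<le> v ==> v \<le> T ==> H \<in> borel_measurable (G u) ==> (\<And>w. \<bar>H w\<bar> \<le> b) ==>
  (LINT w|M. H w * E v w) = (LINT w|M. H w * E u w)"
 unfolding E_def by (rule E_mart)

lemma E_mult_integrable:
 fixes H :: "'w => 'b::{banach,second_countable_topology}"
 assumes "0 \<le> u" "u \<le> T" and H: "H \<in> borel_measurable M" "\<And>w. norm (H w) \<le> b"
 shows "integrable M (\<lambda>w. E u w *\<^sub>R H w)"
proof (rule Bochner_Integration.integrable_bound)
 show "integrable M (\<lambda>w. b * E u w)" using E_integrable[OF assms(1,2)] by simp
 show "(\<lambda>w. E u w *\<^sub>R H w) \<in> borel_measurable M"
  using measurable_G[OF E_measurable[OF assms(1)]] H(1) by simp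
 show "AE w in M. norm (E u w *\<^sub>R H w) \<le> norm (b * E u w)"
 proof (rule AE_I2)
  fix w
  have "E u w * norm (H w) \<le> E u w * b" using E_nonneg[OF assms(1)] H(2) by (intro mult_left_mono) auto
  also have "\<dots> \<le> \<bar>b * E u w\<bar>" by (simp add: mult.commute)
  finally show "norm (E u w *\<^sub>R H w) \<le> norm (b * E u w)" using E_nonneg[OF assms(1), of w] by simp
 qed
qed

lemma E_martingale_complex:
 fixes H :: "'w => complex"
 assumes u: "0 \<le> u" "u \<le> v" "v \<le> T" and H: "H \<in> borel_measurable (G u)" "\<And>w. norm (H w) \<le> b"
 shows "(LINT w|M. E v w *\<^sub>R H w) = (LINT w|M. E u w *\<^sub>R H w)"
proof -
 have v: "0 \<le> v" "u \<le> T" using u by auto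
 note i = E_mult_integrable[OF v(1) u(3) measurable_G[OF H(1)] H(2)] E_mult_integrable[OF u(1) v(2) measurable_G[OF H(1)] H(2)]
 have R: "(\<lambda>w. Re (H w)) \<in> borel_measurable (G u)" "\<bar>Re (H w)\<bar> \<le> b" for w
  using H(1) abs_Re_le_cmod[of "H w"] H(2)[of w] by auto
 have I: "(\<lambda>w. Im (H w)) \<in> borel_measurable (G u)" "\<bar>Im (H w)\<bar> \<le> b" for w
  using H(1) abs_Im_le_cmod[of "H w"] H(2)[of w] by auto
 show ?thesis
 proof (rule complex_eqI)
  show "Re (LINT w|M. E v w *\<^sub>R H w) = Re (LINT w|M. E u w *\<^sub>R H w)"
   unfolding integral_Re[OF i(1), symmetric] integral_Re[OF i(2), symmetric]
   using E_martingale[OF u R] by (simp add: mult.commute)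
  show "Im (LINT w|M. E v w *\<^sub>R H w) = Im (LINT w|M. E u w *\<^sub>R H w)"
   unfolding integral_Im[OF i(1), symmetric] integral_Im[OF i(2), symmetric]
   using E_martingale[OF u I] by (simp add: mult.commute)
 qed
qed

lemma h_Dh_local_bound:
 assumes "norm x \<le> R" "0 \<le> t"
 shows "\<bar>h t x\<bar> \<le> C * (1 + R powr m)" "norm (Dh t x) \<le> C * (1 + R powr m)"
proof -
 have "C * (1 + norm x powr m) \<le> C * (1 + R powr m)"
  using assms m C by (intro mult_left_mono add_left_mono powr_mono2) auto
 then show "\<bar>h t x\<bar> \<le> C * (1 + R powr m)" "norm (Dh t x) \<le> C * (1 + R powr m)"
  using h_bd[OF assms(2), of x] Dh_bd[OF assms(2), of x] by auto
qed

end

section \<open>Localisation to paths with \<open>X\<close> bounded and \<open>h\<close> bounded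
  below\<close>

locale girsanov_interval = abstract_girsanov +
 fixes s t :: real
 assumes s: "0 \<le> s" and st: "s < t" and t: "t \<le> T"
begin

text \<open>Contains all points of the equidistant partitions of \<open>[s, t]\<close>.\<close>

definition D :: "real set" where "D = {0..t} \<inter> (\<lambda>x. s + (t - s) * x) ` \<rat>"

lemma D_countable: "countable D"
 unfolding D_def by (rule countable_subset[OF Int_lower2]) (intro countable_image countable_rat)

lemma D_range: "u \<in> D ==> 0 \<le> u" "u \<in> D ==> u \<le> t" "u \<in> D ==> u \<le> T"
 using t by (auto simp: D_def)

lemma D_dense:
 assumes "u \<in> D"
 shows "{0..u} \<subseteq> closure (D \<inter> {0..u})"
proof (cases "u = 0")
 case True
 then show ?thesis using assms closure_subset[of "D \<inter> {0..u}"] by auto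
next
 case False
 then have u: "0 < u" "u \<le> t" using D_range[OF assms] by auto
 let ?f = "\<lambda>x. s + (t - s) * x"
 have "?f ` closure \<rat> \<subseteq> closure (?f ` \<rat>)"
  by (rule continuous_image_closure_subset[of UNIV]) (auto intro!: continuous_intros)
 moreover have "surj ?f"
 proof (rule surjI)
  fix y show "?f ((y - s) / (t - s)) = y" using st by simp
 qed
 ultimately have "closure (?f ` \<rat>) = UNIV" by (auto simp: Rats_closure_real)
 then have "closure ({0<..<u} \<inter> ?f ` \<rat>) = closure {0<..<u}"
  by (intro closure_open_Int_superset) auto
 moreover have "{0<..<u} \<inter> ?f ` \<rat> \<subseteq> D \<inter> {0..u}" using u by (auto simp: D_def)
 ultimately have "closure {0<..<u} \<subseteq> closure (D \<inter> {0..u})" by (metis closure_mono)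
 then show ?thesis using u by simp
qed

text \<open>Takes the place of a stopping time. Only times in the countable set \<open>D\<close> are
  tested, which makes the event measurable at \<open>u\<close>; on continuous paths the bounds
  extend to all times between. The lower bound on \<open>h\<close> controls the quotient in
  \<open>drift\<close>.\<close>

definition good :: "real => real => 'a => bool" where
 "good R u w \<longleftrightarrow> (\<forall>r\<in>D. r \<le> u --> norm (X r w) \<le> R \<and> 1 / R \<le> h r (X r w))"

definition z :: "real => real => 'a => real" where
 "z R u w = (if good R u w then 1 else 0)"

lemma z_simps: "0 \<le> z R u w" "z R u w \<le> 1" "\<bar>z R u w\<bar> \<le> 1"
 by (auto simp: z_def)

lemma z_antimono: "u \<le> v ==> z R v w \<le> z R u w"
 by (auto simp: z_def good_def)

lemma z_mono: "0 < R ==> z R u w \<le> z (R + 1) u w"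
proof -
 assume "0 < R"
 then have "1 / (R + 1) \<le> 1 / R" by (simp add: frac_le)
 then have "good R u w ==> good (R + 1) u w" by (fastforce simp: good_def)
 then show ?thesis by (auto simp: z_def)
qed

lemma z_measurable: "0 \<le> u ==> z R u \<in> borel_measurable (G u)"
proof -
 assume u: "0 \<le> u"
 have "{w \<in> space (G u). good R u w} \<in> sets (G u)"
 proof (cases "D \<inter> {..u} = {}")
  case True
  then have "{w \<in> space (G u). good R u w} = space (G u)" by (auto simp: good_def)
  then show ?thesis by simp
 next
  case False
  have "{w \<in> space (G u). norm (X r w) \<le> R \<and> 1 / R \<le> h r (X r w)} \<in> sets (G u)" if "r \<in> D \<inter> {..u}" for r
  proof -
   have r: "0 \<le> r" "r \<le> u" using that D_range(1) by auto
   have [measurable]: "X r \<in> borel_measurable (G u)" "(\<lambda>w. h r (X r w)) \<in> borel_measurable (G u)"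
    by (rule measurable_G_mono[OF X[OF r(1)] r(2)], rule measurable_G_mono[OF hX_measurable[OF r(1)] r(2)])
   show ?thesis by measurable
  qed
  then have "(\<Inter>r\<in>D \<inter> {..u}. {w \<in> space (G u). norm (X r w) \<le> R \<and> 1 / R \<le> h r (X r w)}) \<in> sets (G u)"
   using D_countable False by (intro sets.countable_INT') auto
  also have "(\<Inter>r\<in>D \<inter> {..u}. {w \<in> space (G u). norm (X r w) \<le> R \<and> 1 / R \<le> h r (X r w)}) = {w \<in> space (G u). good R u w}"
   using False by (auto simp: good_def)
  finally show ?thesis .
 qed
 then show ?thesis unfolding z_def[abs_def] by (intro measurable_If) auto
qed

lemma good_all:
 assumes cont: "continuous_on {0..T} (\<lambda>u. X u w)" and u: "u \<in> D" and g: "good R u w" and r: "r \<in> {0..u}"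
 shows "norm (X r w) \<le> R" "1 / R \<le> h r (X r w)"
proof -
 have cl: "closure (D \<inter> {0..u}) \<subseteq> {0..u}" by (rule closure_minimal) auto
 have c0: "continuous_on {0..u} (\<lambda>u. X u w)"
  by (rule continuous_on_subset[OF cont]) (use D_range(3)[OF u] in auto)
 have c1: "continuous_on {0..u} (\<lambda>r. norm (X r w))" by (intro continuous_intros c0)
 have c2: "continuous_on {0..u} (\<lambda>r. h r (X r w))"
 proof -
  have "continuous_on {0..u} (\<lambda>r. (\<lambda>(t, x). h t x) (r, X r w))"
   by (rule continuous_on_compose2[OF h_cont]) (auto intro!: continuous_intros c0)
  then show ?thesis by simp
 qed
 have rc: "r \<in> closure (D \<inter> {0..u})" using D_dense[OF u] r by auto
 have b1: "norm (X x w) \<le> R" and b2: "1 / R \<le> h x (X x w)" if "x \<in> D \<inter> {0..u}" for x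
  using g that by (auto simp: good_def)
 show "norm (X r w) \<le> R"
  by (rule continuous_le_on_closure[OF continuous_on_subset[OF c1 cl] rc b1])
 show "1 / R \<le> h r (X r w)"
  by (rule continuous_ge_on_closure[OF continuous_on_subset[OF c2 cl] rc b2])
qed

definition hc :: "real => real => 'b => real" where "hc R v x = h v x * cutoff R x"

text \<open>The cost of one step on a fixed path: the two first-order errors of \<open>hc\<close>
  for displacements along \<open>q\<close> and \<open>- q\<close>, with the derivative frozen at
  time \<open>u\<close>, and the step length times the change of \<open>h\<close> along the
  path.\<close>

definition \<psi> :: "real => real => real => 'a => real" where
 "\<psi> R u v w = \<bar>hc R v (X v w + (v - u) *\<^sub>R q) - hc R v (X v w) - (v - u) * (Dh u (X u w) \<bullet> q)\<bar>
  + \<bar>hc R v (X v w - (v - u) *\<^sub>R q) - hc R v (X v w) + (v - u) * (Dh u (X u w) \<bullet> q)\<bar>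
  + (v - u) * \<bar>h u (X u w) - hc R v (X v w)\<bar>"

lemma hc_measurable: "0 \<le> v ==> hc R v \<in> borel_measurable borel"
proof -
 assume "0 \<le> v"
 then have [measurable]: "h v \<in> borel_measurable borel" by (rule h_measurable)
 show ?thesis unfolding hc_def[abs_def] cutoff_def[abs_def] by measurable
qed

lemma hc_bounds:
 assumes "0 \<le> v" "0 \<le> R"
 shows "\<bar>hc R v x\<bar> \<le> C * (1 + (R + 2) powr m)"
  and "\<bar>hc R v x - hc R v y\<bar> \<le> 2 * (C * (1 + (R + 2) powr m)) * norm (x - y)"
proof -
 have C1: "0 \<le> C * (1 + (R + 2) powr m)" using C by simp
 show "\<bar>hc R v x\<bar> \<le> C * (1 + (R + 2) powr m)" unfolding hc_def
  by (rule cutoff_mult_bounds(1)[OF Dh[OF assms(1)] h_Dh_local_bound(1)[OF _ assms(1)] h_Dh_local_bound(2)[OF _ assms(1)] C1])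
 show "\<bar>hc R v x - hc R v y\<bar> \<le> 2 * (C * (1 + (R + 2) powr m)) * norm (x - y)" unfolding hc_def
  by (rule cutoff_mult_bounds(2)[OF Dh[OF assms(1)] h_Dh_local_bound(1)[OF _ assms(1)] h_Dh_local_bound(2)[OF _ assms(1)] C1])
qed

lemma \<psi>_measurable: "0 \<le> u ==> u \<le> v ==> \<psi> R u v \<in> borel_measurable (G v)"
proof -
 assume u: "0 \<le> u" "u \<le> v"
 then have v: "0 \<le> v" by simp
 note [measurable] = hc_measurable[OF v] X[OF v] measurable_G_mono[OF DhX_measurable[OF u(1)] u(2)]
  measurable_G_mono[OF hX_measurable[OF u(1)] u(2)]
 show ?thesis unfolding \<psi>_def[abs_def] by measurable
qed

lemma \<psi>_nonneg: "u \<le> v ==> 0 \<le> \<psi> R u v w"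
 unfolding \<psi>_def by (intro add_nonneg_nonneg mult_nonneg_nonneg) auto

text \<open>The majorant for dominated convergence. Each of the two differences costs
  \<open>2 * norm q\<close> by the Lipschitz bound and \<open>norm q\<close> by the derivative term;
  the last summand costs 2.\<close>

lemma z_\<psi>_bound:
 assumes u: "u \<in> D" "u \<le> v" and R: "0 \<le> R"
 shows "z R u w * \<psi> R u v w \<le> (v - u) * (C * (1 + (R + 2) powr m) * (6 * norm q + 2))"
proof (cases "good R u w")
 case True
 define C1 where "C1 = C * (1 + (R + 2) powr m)"
 have C1: "0 \<le> C1" using C by (simp add: C1_def)
 have u0: "0 \<le> u" "0 \<le> v" using D_range(1)[OF u(1)] u(2) by auto
 have Xu: "norm (X u w) \<le> R + 2" using True u(1) by (fastforce simp: good_def)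
 have D: "\<bar>Dh u (X u w) \<bullet> q\<bar> \<le> C1 * norm q"
  using Cauchy_Schwarz_ineq2[of "Dh u (X u w)" q] mult_right_mono[OF h_Dh_local_bound(2)[OF Xu u0(1)] norm_ge_zero[of q]]
  unfolding C1_def by linarith
 have vu: "0 \<le> v - u" using u by simp
 have a1: "\<bar>hc R v (X v w + (v - u) *\<^sub>R q) - hc R v (X v w)\<bar> \<le> 2 * C1 * ((v - u) * norm q)"
  using hc_bounds(2)[OF u0(2) R, of "X v w + (v - u) *\<^sub>R q" "X v w"] vu by (simp add: C1_def)
 have a2: "\<bar>hc R v (X v w - (v - u) *\<^sub>R q) - hc R v (X v w)\<bar> \<le> 2 * C1 * ((v - u) * norm q)"
  using hc_bounds(2)[OF u0(2) R, of "X v w - (v - u) *\<^sub>R q" "X v w"] vu by (simp add: C1_def)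
 have a3: "\<bar>(v - u) * (Dh u (X u w) \<bullet> q)\<bar> \<le> C1 * ((v - u) * norm q)"
  unfolding abs_mult using mult_left_mono[OF D vu] vu by (simp add: mult_ac)
 have a4: "\<bar>h u (X u w) - hc R v (X v w)\<bar> \<le> 2 * C1"
  using h_Dh_local_bound(1)[OF Xu u0(1)] hc_bounds(1)[OF u0(2) R, of "X v w"] by (simp add: C1_def)
 have "\<psi> R u v w \<le> (2 * C1 * ((v - u) * norm q) + C1 * ((v - u) * norm q)) + (2 * C1 * ((v - u) * norm q) + C1 * ((v - u) * norm q)) + (v - u) * (2 * C1)"
  unfolding \<psi>_def
  by (intro add_mono order_trans[OF abs_triangle_ineq4] order_trans[OF abs_triangle_ineq] a1 a2 a3 mult_left_mono a4 vu)
 also have "\<dots> = (v - u) * (C1 * (6 * norm q + 2))" by (simp add: algebra_simps)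
 finally show ?thesis using True by (simp add: z_def C1_def)
next
 case False
 then show ?thesis using C u by (simp add: z_def)
qed

lemma z_\<psi>_integrable:
 assumes "u \<in> D" "u \<le> v" "0 \<le> R"
 shows "integrable M (\<lambda>w. z R u w * \<psi> R u v w)"
proof (rule integrable_const_bound)
 have u: "0 \<le> u" by (rule D_range(1)[OF assms(1)])
 show "AE w in M. norm (z R u w * \<psi> R u v w) \<le> (v - u) * (C * (1 + (R + 2) powr m) * (6 * norm q + 2))"
  using z_\<psi>_bound[OF assms] z_simps(1) \<psi>_nonneg[OF assms(2)] by (intro AE_I2) (auto simp: abs_mult)
 show "(\<lambda>w. z R u w * \<psi> R u v w) \<in> borel_measurable M"
  by (intro borel_measurable_times measurable_G[OF z_measurable[OF u]] measurable_G[OF \<psi>_measurable[OF u assms(2)]])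
qed

text \<open>The weight selects paths that are good at level \<open>R\<close> at time
  \<open>u\<close> but not at level \<open>R + 1\<close> at time \<open>v\<close>; on them
  \<open>E\<close> itself is the only available bound.\<close>

lemma z_E_integrable:
 assumes "0 \<le> u" "0 \<le> v" "0 \<le> r" "r \<le> T"
 shows "integrable M (\<lambda>w. z R u w * (1 - z R' v w) * (E r w + 1))"
proof (rule Bochner_Integration.integrable_bound)
 show "integrable M (\<lambda>w. E r w + 1)" using E_integrable[OF assms(3,4)] by simp
 show "(\<lambda>w. z R u w * (1 - z R' v w) * (E r w + 1)) \<in> borel_measurable M"
  by (intro borel_measurable_times borel_measurable_add borel_measurable_diff borel_measurable_const
   measurable_G[OF z_measurable] measurable_G[OF E_measurable] assms)
 show "AE w in M. norm (z R u w * (1 - z R' v w) * (E r w + 1)) \<le> norm (E r w + 1)"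
  by (intro AE_I2) (auto simp: z_def)
qed

end

section \<open>The compensated exponential over one step of a partition\<close>

lemma norm_cis_minus_1_le: "norm (cis x - 1) \<le> \<bar>x\<bar>"
proof -
 have "norm (exp (\<i> * x) - (\<Sum>k\<le>0. (\<i> * x) ^ k / fact k)) \<le> exp \<bar>Re (\<i> * x)\<bar> * norm (\<i> * x) ^ Suc 0 / fact 0"
  by (rule Taylor_exp)
 then show ?thesis by (simp add: cis_conv_exp norm_mult)
qed

lemma norm_cis_Taylor_1_le: "norm (\<i> * x * cis (- x) + cis (- x) - 1) \<le> x\<^sup>2"
proof -
 have "norm (exp (\<i> * x) - (\<Sum>k\<le>1. (\<i> * x) ^ k / fact k)) \<le> exp \<bar>Re (\<i> * x)\<bar> * norm (\<i> * x) ^ Suc 1 / fact 1"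
  by (rule Taylor_exp)
 then have "norm (cis x - (1 + \<i> * x)) \<le> x\<^sup>2"
  by (simp add: cis_conv_exp norm_mult power2_eq_square)
 moreover have "\<i> * x * cis (- x) + cis (- x) - 1 = - (cis (- x) * (cis x - (1 + \<i> * x)))"
  by (simp add: algebra_simps cis_mult)
 ultimately show ?thesis by (simp add: norm_mult)
qed

context girsanov_interval
begin

text \<open>The factor that one step contributes to the compensated exponential of \<beta> minus its
  drift, with the drift frozen at the left end. Under the density \<open>E\<close> its conditional
  mean ought to be nearly 1.\<close>

definition F :: "real => real => 'a => complex" where
 "F u v w = of_real (exp ((v - u) * \<kappa> / 2)) * cis (\<beta> v w - \<beta> u w - (v - u) * drift u w)"

text \<open>In turn: the deterministic error, the pathwise expansion error, and the mass of the
  paths that leave the localisation during the step.\<close>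

definition err :: "real => real => real => real => real" where
 "err R \<epsilon> u v = (v - u) * (\<epsilon> + sqrt (v - u)) + (LINT w|M. z R u w * \<psi> R u v w)
  + (LINT w|M. z R u w * (1 - z (R + 1) v w) * (E v w + 1))"

text \<open>\<open>E v\<close> is replaced by a truncated version, the exponential of the increment
  is expanded by \<open>one_step_estimate\<close>, and the phase of the drift by Taylor's formula.
  The first-order terms cancel, as \<open>drift\<close> is the derivative divided by
  \<open>h\<close>. The constant depends on \<open>R\<close> and \<open>B\<close> but not on
  \<epsilon>; only the admissible step length does, so \<epsilon> can be chosen after
  \<open>c\<close>.\<close>

lemma step_estimate:
 assumes R: "0 < R" and B: "0 \<le> B"
 shows "\<exists>c\<ge>0. \<forall>\<epsilon>>0. \<exists>d0>0. \<forall>u v H. u \<in> D --> v \<in> D --> u < v --> v - u \<le> d0 -->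
  H \<in> borel_measurable (G u) --> (\<forall>w. norm (H w) \<le> B * z R u w) -->
  norm (LINT w|M. E v w *\<^sub>R (H w * (F u v w - 1))) \<le> c * err R \<epsilon> u v"
proof -
 define C1 where "C1 = C * (1 + (R + 2) powr m)"
 have C1: "0 \<le> C1" using C by (simp add: C1_def)
 note K = exp_remainder_real_gaussian
 obtain c0 where c0: "c0 \<ge> 0" and c0_int: "\<And>V. 0 \<le> V ==> integrable (real_gaussian V) (\<lambda>x. \<bar>x\<bar>)"
  and c0_bd: "\<And>V. 0 \<le> V ==> (\<integral>x. \<bar>x\<bar> \<partial>real_gaussian V) \<le> c0 * sqrt V"
  using real_gaussian_abs_moment by blast
 obtain ce where ce: "ce \<ge> 0" and ce_AE: "AE w in M. \<forall>u v. 0 \<le> u --> u \<le> v --> v \<le> T --> (\<forall>r\<in>{0..v}. norm (X r w) \<le> R + 1) -->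
    e v w \<le> ce \<and> \<bar>e v w - e u w\<bar> \<le> ce * (v - u)"
  using e_loc[of "R + 1"] by blast
 define cq where "cq = C1 * norm q"
 define cb where "cb = cq * R"
 have cq: "0 \<le> cq" and cb: "0 \<le> cb" using C1 R by (auto simp: cq_def cb_def)
 define b where "b = B * ce"
 have b: "0 \<le> b" using B ce by (simp add: b_def)
 \<comment> \<open>One constant per source of error: \<open>k1\<close> for the approximate position
   of the shifted solution, \<open>k2\<close> for the exponential remainder, \<open>k3\<close> for
   the second-order term of the drift phase, \<open>k4\<close> for the change of \<open>e\<close>,
   \<open>k5\<close> for \<psi>, and \<open>k6\<close> for the paths that leave.\<close>
 define k1 where "k1 = 4 * b * C1"
 define k2 where "k2 = C1 * b * 3 * (\<kappa> * sqrt \<kappa>)"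
 define k3 where "k3 = b * C1 * cb\<^sup>2"
 define k4 where "k4 = B * C1 * ce * (\<kappa> + 2 * (c0 * sqrt \<kappa>) + 2 * cb)"
 define k5 where "k5 = b + b * cb"
 define k6 where "k6 = 3 * B * (1 + C1 * ce)"
 have k: "0 \<le> k1" "0 \<le> k2" "0 \<le> k3" "0 \<le> k4" "0 \<le> k5" "0 \<le> k6"
  using b C1 \<kappa> c0 cb B ce by (auto simp: k1_def k2_def k3_def k4_def k5_def k6_def)
 define c where "c = k1 + k2 + k3 + k4 + k5 + k6"
 have c: "0 \<le> c" using k by (simp add: c_def)
 show ?thesis
 proof (rule exI[of _ c], intro conjI c allI impI)
  fix \<epsilon> :: real assume \<epsilon>: "0 < \<epsilon>"
  let ?shift = "\<lambda>a u v Y. cm_shift M (G u) (X v) (\<lambda>w. a * (\<beta> v w - \<beta> u w) - (v - u) * \<kappa> / 2) ((a * (v - u)) *\<^sub>R q) (\<epsilon> * (v - u)) Y"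
  obtain d1 where d1: "d1 > 0" "\<And>u v. 0 \<le> u ==> u < v ==> v \<le> T ==> v - u \<le> d1 ==> \<exists>Y. ?shift 1 u v Y"
   using shift[of 1, OF _ \<epsilon>] by auto
  obtain d2 where d2: "d2 > 0" "\<And>u v. 0 \<le> u ==> u < v ==> v \<le> T ==> v - u \<le> d2 ==> \<exists>Y. ?shift (-1) u v Y"
   using shift[of "-1", OF _ \<epsilon>] by auto
  \<comment> \<open>The last bound keeps the variance \<open>V\<close> of the increment at most 1,
    as the remainder estimate requires.\<close>
  define d0 where "d0 = min (min d1 d2) (1 / (\<kappa> + 1))"
  show "\<exists>d0>0. \<forall>u v H. u \<in> D --> v \<in> D --> u < v --> v - u \<le> d0 -->
   H \<in> borel_measurable (G u) --> (\<forall>w. norm (H w) \<le> B * z R u w) -->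
   norm (LINT w|M. E v w *\<^sub>R (H w * (F u v w - 1))) \<le> c * err R \<epsilon> u v"
  proof (intro exI[of _ d0] conjI allI impI)
   show "0 < d0" using d1(1) d2(1) \<kappa> by (simp add: d0_def)
   fix u v :: real and H :: "'a => complex"
   assume uD: "u \<in> D" and vD: "v \<in> D" and uv: "u < v" and small: "v - u \<le> d0"
    and H: "H \<in> borel_measurable (G u)" and H_bd: "\<forall>w. norm (H w) \<le> B * z R u w"
   define d where "d = v - u"
   define V where "V = d * \<kappa>"
   define \<Delta> where "\<Delta> w = \<beta> v w - \<beta> u w" for w
   have u0: "0 \<le> u" and v0: "0 \<le> v" and vT: "v \<le> T" and uT: "u \<le> T" and uv': "u \<le> v"
    using D_range[OF uD] D_range[OF vD] uv by auto
   have d: "0 < d" "d \<le> 1 / (\<kappa> + 1)" "d \<le> 1"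
   proof -
    show "0 < d" "d \<le> 1 / (\<kappa> + 1)" using uv small by (auto simp: d_def d0_def)
    moreover have "1 / (\<kappa> + 1) \<le> 1" using \<kappa> by simp
    ultimately show "d \<le> 1" by linarith
   qed
   have V: "0 \<le> V" "V \<le> 1"
   proof -
    show "0 \<le> V" using d \<kappa> by (simp add: V_def)
    have "d * \<kappa> \<le> d * (\<kappa> + 1)" using d by (intro mult_left_mono) auto
    also have "\<dots> \<le> 1" using d(2) \<kappa> by (simp add: pos_le_divide_eq)
    finally show "V \<le> 1" by (simp add: V_def)
   qed
   define ew where "ew = exp (V / 2)"
   have ew: "1 \<le> ew" "ew - 1 \<le> V" "ew \<le> 2"
   proof -
    show "1 \<le> ew" using V by (simp add: ew_def)
    have "ew \<le> 1 + V / 2 + (V / 2)\<^sup>2" unfolding ew_def using V by (intro exp_bound) auto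
    moreover have "(V / 2)\<^sup>2 \<le> V / 2" using V mult_left_le[of V V] by (simp add: power2_eq_square)
    ultimately show "ew - 1 \<le> V" "ew \<le> 2" using V by linarith+
   qed
   define y where "y w = d * drift u w" for w
   \<comment> \<open>A bounded substitute for \<open>e u\<close>, equal to it on almost all paths
     that are good at level \<open>R + 1\<close> up to time \<open>v\<close>.\<close>
   define e' where "e' w = min (e u w) ce" for w
   have e': "0 \<le> e' w" "e' w \<le> ce" for w using e_pos[of u w] ce by (auto simp: e'_def)
   define H' where "H' w = e' w *\<^sub>R (H w * cis (- y w))" for w
   define D' where "D' w = (Dh u (X u w) \<bullet> q) * z R u w" for w
   note [measurable] = measurable_G_mono[OF X[OF u0] uv'] X[OF v0] hX_measurable[OF v0] measurable_G_mono[OF hX_measurable[OF u0] uv']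
    measurable_G_mono[OF DhX_measurable[OF u0] uv'] measurable_G_mono[OF \<beta>[OF u0] uv'] \<beta>[OF v0]
    measurable_G_mono[OF e[OF u0] uv'] e[OF v0] measurable_G_mono[OF drift_measurable[OF u0] uv'] E_measurable[OF v0]
    measurable_G_mono[OF z_measurable[OF u0] uv'] z_measurable[OF v0] measurable_G_mono[OF H uv'] hc_measurable[OF v0]
    \<psi>_measurable[OF u0 uv']
   have y_m [measurable]: "y \<in> borel_measurable (G v)" unfolding y_def by measurable
   have e'_m [measurable]: "e' \<in> borel_measurable (G v)" unfolding e'_def by measurable
   have H'_m [measurable]: "H' \<in> borel_measurable (G v)" unfolding H'_def by measurable
   have H'_u: "H' \<in> borel_measurable (G u)"
   proof -
    note [measurable] = drift_measurable[OF u0] e[OF u0] H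
    show ?thesis unfolding H'_def y_def e'_def by measurable
   qed
   have D'_m [measurable]: "D' \<in> borel_measurable (G v)" unfolding D'_def by measurable
   have \<Delta>_m [measurable]: "\<Delta> \<in> borel_measurable (G v)" unfolding \<Delta>_def by measurable
   have z01: "z R u w = 0 \<or> (z R u w = 1 \<and> good R u w)" for w by (auto simp: z_def)
   have H_B: "norm (H w) \<le> B" for w
    using H_bd[rule_format, of w] z_simps(2)[of R u w] B mult_left_le[of "z R u w" B] by linarith
   have H0: "H w = 0" if "z R u w = 0" for w using H_bd[rule_format, of w] that by simp
   have H'_bd: "norm (H' w) \<le> b * z R u w" for w
   proof -
    have "norm (H' w) = e' w * norm (H w)" using e'(1)[of w] by (simp add: H'_def norm_mult)
    also have "\<dots> \<le> ce * (B * z R u w)" using e'[of w] H_bd ce by (intro mult_mono) auto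
    finally show ?thesis by (simp add: b_def mult_ac)
   qed
   have H'_b: "norm (H' w) \<le> b" for w
    using H'_bd[of w] z_simps(2)[of R u w] b mult_left_le[of "z R u w" b] by linarith
   have Xu: "norm (X u w) \<le> R + 2" and hu: "1 / R \<le> h u (X u w)" if "good R u w" for w
    using that uD by (auto simp: good_def)
   have Dh_q: "\<bar>Dh u (X u w) \<bullet> q\<bar> \<le> cq" if "good R u w" for w
    using Cauchy_Schwarz_ineq2[of "Dh u (X u w)" q]
     mult_right_mono[OF h_Dh_local_bound(2)[OF Xu[OF that] u0] norm_ge_zero[of q]]
    unfolding cq_def C1_def by linarith
   have D'_bd: "\<bar>D' w\<bar> \<le> cq" for w
    using z01[of w] Dh_q[of w] cq by (auto simp: D'_def)
   have drift_bd: "\<bar>drift u w\<bar> \<le> cb" if "good R u w" for w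
   proof -
    have "\<bar>Dh u (X u w) \<bullet> q\<bar> / h u (X u w) \<le> cq / (1 / R)"
     using Dh_q[OF that] hu[OF that] R cq by (intro frac_le) auto
    then show ?thesis using h_pos[OF u0, of "X u w"] by (simp add: drift_def cb_def)
   qed
   have y_bd: "\<bar>y w\<bar> \<le> cb * d" if "good R u w" for w
    using mult_left_mono[OF drift_bd[OF that], of d] d(1) by (simp add: y_def abs_mult mult.commute)
   have hc_C1: "\<bar>hc R v x\<bar> \<le> C1" for x using hc_bounds(1)[OF v0] R by (simp add: C1_def)
   define \<Gamma> where "\<Gamma> w = complex_of_real ew * cis (\<Delta> w - y w) - 1" for w
   have \<Gamma>_m [measurable]: "\<Gamma> \<in> borel_measurable (G v)" unfolding \<Gamma>_def by measurable
   have \<Gamma>3: "norm (\<Gamma> w) \<le> 3" for w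
   proof -
    have "norm (\<Gamma> w) \<le> norm (complex_of_real ew * cis (\<Delta> w - y w)) + norm (1 :: complex)"
     unfolding \<Gamma>_def by (rule norm_triangle_ineq4)
    then show ?thesis using ew by (simp add: norm_mult)
   qed
   have \<Gamma>_bd: "norm (\<Gamma> w) \<le> V + 2 * \<bar>\<Delta> w\<bar> + 2 * (cb * d)" if "good R u w" for w
   proof -
    have "\<Gamma> w = complex_of_real ew * (cis (\<Delta> w - y w) - 1) + complex_of_real (ew - 1)"
     by (simp add: \<Gamma>_def algebra_simps)
    then have "norm (\<Gamma> w) \<le> ew * norm (cis (\<Delta> w - y w) - 1) + (ew - 1)"
     using norm_triangle_ineq[of "complex_of_real ew * (cis (\<Delta> w - y w) - 1)" "complex_of_real (ew - 1)"] ew(1)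
     unfolding norm_mult norm_of_real by simp
    also have "ew * norm (cis (\<Delta> w - y w) - 1) \<le> 2 * (\<bar>\<Delta> w\<bar> + cb * d)"
     using ew norm_cis_minus_1_le[of "\<Delta> w - y w"] y_bd[OF that] by (intro mult_mono) auto
    finally show ?thesis using ew(2) by simp
   qed
   \<comment> \<open>\<open>T1\<close> carries the increment of \<beta>, \<open>T2\<close> the phase
     of the drift, and \<open>T3\<close> the error of replacing \<open>E v\<close>.
     \<open>T4\<close> is the first-order part of \<open>T1\<close>; it cancels against that of
     \<open>T2\<close>.\<close>
   define T1 where "T1 w = hc R v (X v w) *\<^sub>R ((of_real ew * cis (\<Delta> w) - 1) * H' w)" for w
   define T2 where "T2 w = (hc R v (X v w) * e' w) *\<^sub>R (H w * (cis (- y w) - 1))" for w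
   define T3 where "T3 w = (E v w - hc R v (X v w) * e' w) *\<^sub>R (H w * \<Gamma> w)" for w
   define T4 where "T4 w = \<i> * (d * D' w) * H' w" for w
   have tot: "E v w *\<^sub>R (H w * \<Gamma> w) = T1 w + T2 w + T3 w" for w
   proof -
    have "cis (\<Delta> w - y w) = cis (\<Delta> w) * cis (- y w)" by (simp add: cis_mult)
    then show ?thesis unfolding T1_def T2_def T3_def H'_def \<Gamma>_def scaleR_conv_of_real
     by (simp add: algebra_simps)
   qed
   have i_tot: "integrable M (\<lambda>w. E v w *\<^sub>R (H w * \<Gamma> w))"
   proof (rule E_mult_integrable[OF v0 vT measurable_G[of _ v]])
    show "(\<lambda>w. H w * \<Gamma> w) \<in> borel_measurable (G v)" by measurable
    show "norm (H w * \<Gamma> w) \<le> B * 3" for w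
     unfolding norm_mult using H_B \<Gamma>3 B by (intro mult_mono) auto
   qed
   have i_T1: "integrable M T1"
   proof (rule integrable_const_bound[of _ "C1 * (3 * b)"])
    show "T1 \<in> borel_measurable M" by (rule measurable_G[of _ v]) (unfold T1_def, measurable)
    show "AE w in M. norm (T1 w) \<le> C1 * (3 * b)"
    proof (rule AE_I2)
     fix w
     have "norm (complex_of_real ew * cis (\<Delta> w) - 1) \<le> 3"
      using norm_triangle_ineq4[of "complex_of_real ew * cis (\<Delta> w)" 1] ew by (simp add: norm_mult)
     then show "norm (T1 w) \<le> C1 * (3 * b)"
      unfolding T1_def norm_scaleR norm_mult using hc_C1 H'_b C1 b by (intro mult_mono) auto
    qed
   qed
   have i_T2: "integrable M T2"
   proof (rule integrable_const_bound[of _ "(C1 * ce) * (B * 2)"])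
    show "T2 \<in> borel_measurable M" by (rule measurable_G[of _ v]) (unfold T2_def, measurable)
    show "AE w in M. norm (T2 w) \<le> (C1 * ce) * (B * 2)"
    proof (rule AE_I2)
     fix w
     have "norm (cis (- y w) - 1) \<le> 2"
      using norm_triangle_ineq4[of "cis (- y w)" 1] by simp
     moreover have "\<bar>hc R v (X v w) * e' w\<bar> \<le> C1 * ce"
      unfolding abs_mult using hc_C1 e'[of w] C1 by (intro mult_mono) auto
     ultimately show "norm (T2 w) \<le> (C1 * ce) * (B * 2)"
      unfolding T2_def norm_scaleR norm_mult using H_B B C1 ce by (intro mult_mono) auto
    qed
   qed
   have i_T4: "integrable M T4"
   proof (rule integrable_const_bound[of _ "(d * cq) * b"])
    show "T4 \<in> borel_measurable M" by (rule measurable_G[of _ v]) (unfold T4_def, measurable)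
    show "AE w in M. norm (T4 w) \<le> (d * cq) * b"
    proof (rule AE_I2)
     fix w
     have "norm (T4 w) = (d * \<bar>D' w\<bar>) * norm (H' w)" using d(1) by (simp add: T4_def norm_mult abs_mult)
     also have "\<dots> \<le> (d * cq) * b" using D'_bd H'_b d(1) cq by (intro mult_mono) auto
     finally show "norm (T4 w) \<le> (d * cq) * b" .
    qed
   qed
   have i_T3: "integrable M T3"
   proof -
    have "T3 = (\<lambda>w. E v w *\<^sub>R (H w * \<Gamma> w) - T1 w - T2 w)" by (rule ext) (simp add: tot)
    then show ?thesis using i_tot i_T1 i_T2 by simp
   qed
   define I\<psi> where "I\<psi> = (LINT w|M. z R u w * \<psi> R u v w)"
   define I\<xi> where "I\<xi> = (LINT w|M. z R u w * (1 - z (R + 1) v w) * (E v w + 1))"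
   have i_\<psi>: "integrable M (\<lambda>w. z R u w * \<psi> R u v w)" by (rule z_\<psi>_integrable[OF uD uv']) (use R in simp)
   have zz: "0 \<le> z R u w * (1 - z (R + 1) v w)" "z R u w * (1 - z (R + 1) v w) \<le> 1" for w
    by (auto simp: z_def)
   have i_\<xi>: "integrable M (\<lambda>w. z R u w * (1 - z (R + 1) v w) * (E v w + 1))" by (rule z_E_integrable[OF u0 v0 v0 vT])
   have est1: "norm ((LINT w|M. T1 w) - (LINT w|M. T4 w)) \<le> k1 * (d * \<epsilon>) + b * I\<psi> + k2 * (d * sqrt d)"
   proof -
    have d12: "v - u \<le> d1" "v - u \<le> d2" using small by (auto simp: d0_def)
    obtain Yp Ym where Yp: "?shift 1 u v Yp" and Ym: "?shift (-1) u v Ym"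
     using d1(2)[OF u0 uv vT d12(1)] d2(2)[OF u0 uv vT d12(2)] by (elim exE) (rule that)
    have Yp2: "AE w in M. norm (Yp w - X v w - d *\<^sub>R q) \<le> \<epsilon> * d" using Yp by (simp add: cm_shift_def d_def)
    have Ym2: "AE w in M. norm (Ym w - X v w + d *\<^sub>R q) \<le> \<epsilon> * d"
    proof -
     have "Ym w - X v w - ((-1) * (v - u)) *\<^sub>R q = Ym w - X v w + d *\<^sub>R q" for w by (simp add: d_def algebra_simps)
     then show ?thesis using Ym by (simp only: cm_shift_def d_def[symmetric])
    qed
    have Ys: "(LINT w|M. (hc R v (X v w) * exp (a * (\<beta> v w - \<beta> u w) - (v - u) * \<kappa> / 2)) *\<^sub>R H' w) = (LINT w|M. hc R v (Y w) *\<^sub>R H' w)"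
     if "?shift a u v Y" for a Y
     using that H'_u H'_b hc_measurable[OF v0] hc_C1 unfolding cm_shift_def by blast
    have Yp3: "(LINT w|M. (hc R v (X v w) * exp (\<Delta> w - V / 2)) *\<^sub>R H' w) = (LINT w|M. hc R v (Yp w) *\<^sub>R H' w)"
     using Ys[OF Yp] by (simp add: \<Delta>_def V_def d_def)
    have Ym3: "(LINT w|M. (hc R v (X v w) * exp (- \<Delta> w - V / 2)) *\<^sub>R H' w) = (LINT w|M. hc R v (Ym w) *\<^sub>R H' w)"
     using Ys[OF Ym] by (simp add: \<Delta>_def V_def d_def)
    have YM: "Yp \<in> borel_measurable M" "Ym \<in> borel_measurable M" using Yp Ym by (simp_all add: cm_shift_def)
    have law: "distr M borel \<Delta> = real_gaussian V"
     using \<beta>_law[OF u0 uv'] by (simp add: \<Delta>_def[abs_def] V_def d_def)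
    have lip: "\<bar>hc R v x - hc R v x'\<bar> \<le> (2 * C1) * norm (x - x')" for x x'
     using hc_bounds(2)[OF v0] R by (simp add: C1_def)
    have DH: "\<bar>D' w\<bar> * norm (H' w) \<le> cq * b" for w
     using D'_bd H'_b cq by (intro mult_mono) auto
    have "norm ((LINT w|M. T1 w) - (LINT w|M. T4 w)) \<le> 2 * b * (2 * C1) * \<epsilon> * d +
      (LINT w|M. norm (H' w) * (\<bar>hc R v (X v w + d *\<^sub>R q) - hc R v (X v w) - d * D' w\<bar> + \<bar>hc R v (X v w - d *\<^sub>R q) - hc R v (X v w) + d * D' w\<bar>))
      + C1 * b * (3 * (V * sqrt V))"
     unfolding T1_def T4_def ew_def
     by (rule one_step_estimate[OF K[OF V] V(1) measurable_G[OF \<Delta>_m] law hc_measurable[OF v0] hc_C1 lip _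
        measurable_G[OF X[OF v0]] YM Yp2 Ym2 measurable_G[OF H'_m] H'_b Yp3 Ym3 measurable_G[OF D'_m] DH])
      (use C1 d(1) in auto)
    moreover have "(LINT w|M. norm (H' w) * (\<bar>hc R v (X v w + d *\<^sub>R q) - hc R v (X v w) - d * D' w\<bar> + \<bar>hc R v (X v w - d *\<^sub>R q) - hc R v (X v w) + d * D' w\<bar>))
      \<le> (LINT w|M. b * (z R u w * \<psi> R u v w))"
    proof (rule integral_mono')
     show "integrable M (\<lambda>w. b * (z R u w * \<psi> R u v w))" using i_\<psi> by simp
     show "0 \<le> b * (z R u w * \<psi> R u v w)" for w
      using b z_simps(1) \<psi>_nonneg[OF uv'] by (intro mult_nonneg_nonneg) auto
     fix w
     show "norm (H' w) * (\<bar>hc R v (X v w + d *\<^sub>R q) - hc R v (X v w) - d * D' w\<bar> + \<bar>hc R v (X v w - d *\<^sub>R q) - hc R v (X v w) + d * D' w\<bar>)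
      \<le> b * (z R u w * \<psi> R u v w)"
     proof (cases "z R u w = 0")
      case True then show ?thesis by (simp add: H'_def H0)
     next
      case False
      then have z1: "z R u w = 1" using z01[of w] by auto
      have "0 \<le> (v - u) * \<bar>h u (X u w) - hc R v (X v w)\<bar>" using uv by simp
      then have "\<bar>hc R v (X v w + d *\<^sub>R q) - hc R v (X v w) - d * D' w\<bar> + \<bar>hc R v (X v w - d *\<^sub>R q) - hc R v (X v w) + d * D' w\<bar> \<le> \<psi> R u v w"
       unfolding \<psi>_def by (simp add: D'_def z1 d_def)
      then show ?thesis unfolding z1 using H'_b b by (simp add: mult_mono)
     qed
    qed
    moreover have "(LINT w|M. b * (z R u w * \<psi> R u v w)) = b * I\<psi>" by (simp add: I\<psi>_def)
    moreover have "C1 * b * (3 * (V * sqrt V)) = k2 * (d * sqrt d)"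
     using d(1) \<kappa> by (simp add: k2_def V_def real_sqrt_mult mult_ac)
    moreover have "2 * b * (2 * C1) * \<epsilon> * d = k1 * (d * \<epsilon>)" by (simp add: k1_def mult_ac)
    ultimately show ?thesis by linarith
   qed
   have est2: "norm (LINT w|M. T4 w + T2 w) \<le> b * cb * I\<psi> + k3 * d\<^sup>2"
   proof -
    have pt: "norm (T4 w + T2 w) \<le> b * cb * (z R u w * \<psi> R u v w) + k3 * d\<^sup>2" for w
    proof (cases "z R u w = 0")
     case True
     then show ?thesis using k by (simp add: T4_def T2_def H'_def H0)
    next
     case False
     then have z1: "z R u w = 1" and g: "good R u w" using z01[of w] by auto
     define h1 where "h1 = h u (X u w)"
     define h2 where "h2 = hc R v (X v w)"
     have h1: "0 < h1" unfolding h1_def by (rule h_pos[OF u0])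
     \<comment> \<open>Here the first-order terms meet: the derivative in \<open>T4\<close> is the
       drift times \<open>h\<close> at the left end, whereas \<open>T2\<close> contains the
       truncated \<open>h\<close> at the right end. The mismatch of the two is the last summand of
       \<psi>.\<close>
     have D'y: "d * D' w = y w * h1" using h1 by (simp add: D'_def z1 y_def drift_def h1_def)
     have "T4 w + T2 w = (e' w *\<^sub>R H w) * (\<i> * (y w * (h1 - h2)) * cis (- y w) + h2 * (\<i> * y w * cis (- y w) + cis (- y w) - 1))"
      unfolding T4_def T2_def H'_def D'y h2_def[symmetric] by (simp add: scaleR_conv_of_real algebra_simps)
     then have "norm (T4 w + T2 w) = (e' w * norm (H w)) * norm (\<i> * (y w * (h1 - h2)) * cis (- y w) + h2 * (\<i> * y w * cis (- y w) + cis (- y w) - 1))"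
      using e'(1)[of w] by (simp add: norm_mult)
     also have "\<dots> \<le> b * (cb * \<psi> R u v w + C1 * (cb * d)\<^sup>2)"
     proof (rule mult_mono)
      show "e' w * norm (H w) \<le> b" unfolding b_def mult.commute[of B] using e'[of w] H_B B ce by (intro mult_mono) auto
      have "norm (\<i> * (y w * (h1 - h2)) * cis (- y w)) \<le> cb * \<psi> R u v w"
      proof -
       have "norm (\<i> * (y w * (h1 - h2)) * cis (- y w)) = \<bar>y w\<bar> * \<bar>h1 - h2\<bar>" by (simp add: norm_mult flip: of_real_diff)
       also have "\<dots> \<le> (cb * d) * \<bar>h1 - h2\<bar>" using y_bd[OF g] by (intro mult_right_mono) auto
       also have "\<dots> = cb * (d * \<bar>h1 - h2\<bar>)" by simp
       also have "\<dots> \<le> cb * \<psi> R u v w"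
        using cb unfolding \<psi>_def h1_def h2_def d_def by (intro mult_left_mono) auto
       finally show ?thesis .
      qed
      moreover have "norm (h2 * (\<i> * y w * cis (- y w) + cis (- y w) - 1)) \<le> C1 * (cb * d)\<^sup>2"
      proof -
       have "(y w)\<^sup>2 \<le> (cb * d)\<^sup>2" using y_bd[OF g] by (metis power2_abs power_mono abs_ge_zero)
       then have "norm (\<i> * y w * cis (- y w) + cis (- y w) - 1) \<le> (cb * d)\<^sup>2"
        using norm_cis_Taylor_1_le[of "y w"] by linarith
       then show ?thesis unfolding norm_mult using hc_C1[of "X v w"] C1 by (intro mult_mono) (auto simp: h2_def)
      qed
      ultimately show "norm (\<i> * (y w * (h1 - h2)) * cis (- y w) + h2 * (\<i> * y w * cis (- y w) + cis (- y w) - 1)) \<le> cb * \<psi> R u v w + C1 * (cb * d)\<^sup>2"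
       by (intro norm_triangle_le add_mono)
     qed (use b in auto)
     also have "\<dots> = b * cb * (z R u w * \<psi> R u v w) + k3 * d\<^sup>2"
      by (simp add: z1 k3_def algebra_simps power_mult_distrib)
     finally show ?thesis .
    qed
    have "norm (LINT w|M. T4 w + T2 w) \<le> (LINT w|M. b * cb * (z R u w * \<psi> R u v w) + k3 * d\<^sup>2)"
     using i_T4 i_T2 i_\<psi> by (intro norm_integral_le_AE AE_I2 pt) auto
    also have "\<dots> = b * cb * I\<psi> + k3 * d\<^sup>2" using i_\<psi> by (simp add: I\<psi>_def prob_space)
    finally show ?thesis .
   qed
   have est3: "norm (LINT w|M. T3 w) \<le> B * C1 * ce * d * (V + 2 * (c0 * sqrt V) + 2 * (cb * d)) + k6 * I\<xi>"
   proof -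
    have i_\<Delta>: "integrable M (\<lambda>w. \<bar>\<Delta> w\<bar>)" "(LINT w|M. \<bar>\<Delta> w\<bar>) \<le> c0 * sqrt V"
    proof -
     have law: "distr M borel \<Delta> = real_gaussian V"
      using \<beta>_law[OF u0 uv'] by (simp add: \<Delta>_def[abs_def] V_def d_def)
     note [measurable] = measurable_G[OF \<Delta>_m]
     show "integrable M (\<lambda>w. \<bar>\<Delta> w\<bar>)"
      using c0_int[OF V(1)] unfolding law[symmetric] by (subst (asm) integrable_distr_eq) simp_all
     show "(LINT w|M. \<bar>\<Delta> w\<bar>) \<le> c0 * sqrt V"
      using c0_bd[OF V(1)] unfolding law[symmetric] by (subst (asm) integral_distr) simp_all
    qed
    have pt: "AE w in M. norm (T3 w) \<le> B * C1 * ce * d * (V + 2 * \<bar>\<Delta> w\<bar> + 2 * (cb * d)) +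
      k6 * (z R u w * (1 - z (R + 1) v w) * (E v w + 1))"
     using ce_AE X_cont
    proof eventually_elim
     case (elim w)
     have Ev: "0 \<le> E v w" by (rule E_nonneg[OF v0])
     have first: "0 \<le> B * C1 * ce * d * (V + 2 * \<bar>\<Delta> w\<bar> + 2 * (cb * d))"
      using B C1 ce d(1) V(1) cb by (intro mult_nonneg_nonneg add_nonneg_nonneg) auto
     have second: "0 \<le> k6 * (z R u w * (1 - z (R + 1) v w) * (E v w + 1))"
      using k z_simps(1)[of R u w] z_simps(2)[of "R + 1" v w] Ev by (intro mult_nonneg_nonneg) auto
     show ?case
     proof (cases "z R u w = 0")
      case True then show ?thesis using first by (simp add: T3_def H0)
     next
      case False
      then have z1: "z R u w = 1" and g: "good R u w" using z01[of w] by auto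
      show ?thesis
      proof (cases "good (R + 1) v w")
       case True
       have Xv: "\<forall>r\<in>{0..v}. norm (X r w) \<le> R + 1" using good_all(1)[OF elim(2) vD True] by blast
       then have Xu': "\<forall>r\<in>{0..u}. norm (X r w) \<le> R + 1" using uv by auto
       have eu: "e u w \<le> ce" using elim(1) u0 uT Xu' by blast
       have ev: "\<bar>e v w - e u w\<bar> \<le> ce * (v - u)" using elim(1) u0 uv' vT Xv by blast
       have Xv': "norm (X v w) \<le> R + 1" using Xv v0 by simp
       \<comment> \<open>On such a path the cutoff is 1 and \<open>e'\<close> agrees with
         \<open>e u\<close>, so only the change of \<open>e\<close> is left. It is of order
         \<open>d\<close>, and \<Gamma> contributes another \<open>sqrt d\<close> in the
         mean.\<close>
       have "hc R v (X v w) = h v (X v w)" using Xv' by (simp add: hc_def cutoff_eq_1)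
       moreover have "e' w = e u w" using eu by (simp add: e'_def)
       ultimately have L: "E v w - hc R v (X v w) * e' w = hc R v (X v w) * (e v w - e u w)"
        by (simp add: E_def algebra_simps)
       have "norm (T3 w) = (\<bar>hc R v (X v w)\<bar> * \<bar>e v w - e u w\<bar>) * (norm (H w) * norm (\<Gamma> w))"
        by (simp add: T3_def L norm_mult abs_mult)
       also have "\<dots> \<le> (C1 * (ce * d)) * (B * (V + 2 * \<bar>\<Delta> w\<bar> + 2 * (cb * d)))"
        using hc_C1 ev H_B \<Gamma>_bd[OF g] C1 ce B d(1) unfolding d_def[symmetric] by (intro mult_mono) auto
       also have "\<dots> = B * C1 * ce * d * (V + 2 * \<bar>\<Delta> w\<bar> + 2 * (cb * d))" by (simp add: mult_ac)
       finally show ?thesis using second by linarith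
      next
       case False
       then have z0: "z (R + 1) v w = 0" by (simp add: z_def)
       \<comment> \<open>For a path that leaves, a crude bound by a multiple of
         \<open>E v w + 1\<close> is enough, because such paths are rare on fine partitions.\<close>
       have "\<bar>hc R v (X v w) * e' w\<bar> \<le> C1 * ce"
        unfolding abs_mult using hc_C1 e'[of w] C1 by (intro mult_mono) auto
       then have "\<bar>E v w - hc R v (X v w) * e' w\<bar> \<le> E v w + C1 * ce" using Ev by linarith
       also have "\<dots> \<le> (1 + C1 * ce) * (E v w + 1)" using Ev C1 ce by (simp add: algebra_simps)
       finally have "norm (T3 w) \<le> ((1 + C1 * ce) * (E v w + 1)) * (B * 3)"
        unfolding T3_def norm_scaleR norm_mult using H_B \<Gamma>3 B Ev C1 ce by (intro mult_mono) auto
       also have "\<dots> = k6 * (z R u w * (1 - z (R + 1) v w) * (E v w + 1))"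
        unfolding z1 z0 k6_def by (simp add: algebra_simps)
       finally show ?thesis using first by linarith
      qed
     qed
    qed
    have "norm (LINT w|M. T3 w) \<le> (LINT w|M. B * C1 * ce * d * (V + 2 * \<bar>\<Delta> w\<bar> + 2 * (cb * d)) +
      k6 * (z R u w * (1 - z (R + 1) v w) * (E v w + 1)))"
     by (rule norm_integral_le_AE[OF i_T3 _ pt]) (use i_\<Delta> i_\<xi> in auto)
    also have "\<dots> = B * C1 * ce * d * (V + 2 * (LINT w|M. \<bar>\<Delta> w\<bar>) + 2 * (cb * d)) + k6 * I\<xi>"
     using i_\<Delta>(1) i_\<xi> by (simp add: prob_space I\<xi>_def)
    also have "\<dots> \<le> B * C1 * ce * d * (V + 2 * (c0 * sqrt V) + 2 * (cb * d)) + k6 * I\<xi>"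
     using i_\<Delta>(2) B C1 ce d(1) by (intro add_right_mono mult_left_mono add_mono) auto
    finally show ?thesis .
   qed
   have I\<psi>0: "0 \<le> I\<psi>" unfolding I\<psi>_def
    using z_simps(1) \<psi>_nonneg[OF uv'] by (intro Bochner_Integration.integral_nonneg mult_nonneg_nonneg) auto
   have I\<xi>0: "0 \<le> I\<xi>" unfolding I\<xi>_def
   proof (intro Bochner_Integration.integral_nonneg mult_nonneg_nonneg)
    show "0 \<le> z R u w" "0 \<le> 1 - z (R + 1) v w" "0 \<le> E v w + 1" for w
     using z_simps[of R u w] z_simps[of "R + 1" v w] E_nonneg[OF v0, of w] by auto
   qed
   \<comment> \<open>As \<open>d \<le> 1\<close>, all higher orders reduce to
     \<open>d * sqrt d\<close>; summed over the cells of a partition it still tends to 0.\<close>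
   have sq: "d\<^sup>2 \<le> d * sqrt d" "d * V \<le> \<kappa> * (d * sqrt d)" "d * sqrt V = sqrt \<kappa> * (d * sqrt d)"
   proof -
    have "sqrt d * sqrt d \<le> 1 * sqrt d" using d by (intro mult_right_mono) auto
    then have "d \<le> sqrt d" using d(1) by simp
    then show 1: "d\<^sup>2 \<le> d * sqrt d" using d(1) by (simp add: power2_eq_square)
    show "d * V \<le> \<kappa> * (d * sqrt d)" using mult_left_mono[OF 1 \<kappa>] by (simp add: V_def power2_eq_square mult_ac)
    show "d * sqrt V = sqrt \<kappa> * (d * sqrt d)" by (simp add: V_def real_sqrt_mult mult_ac)
   qed
   have est3': "B * C1 * ce * d * (V + 2 * (c0 * sqrt V) + 2 * (cb * d)) \<le> k4 * (d * sqrt d)"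
   proof -
    have "d * (V + 2 * (c0 * sqrt V) + 2 * (cb * d)) = d * V + 2 * c0 * (d * sqrt V) + 2 * cb * d\<^sup>2"
     by (simp add: algebra_simps power2_eq_square)
    also have "\<dots> \<le> \<kappa> * (d * sqrt d) + 2 * c0 * (sqrt \<kappa> * (d * sqrt d)) + 2 * cb * (d * sqrt d)"
     using sq cb c0 by (intro add_mono mult_left_mono) auto
    also have "\<dots> = (\<kappa> + 2 * (c0 * sqrt \<kappa>) + 2 * cb) * (d * sqrt d)" by (simp add: algebra_simps)
    finally have "(B * C1 * ce) * (d * (V + 2 * (c0 * sqrt V) + 2 * (cb * d))) \<le> (B * C1 * ce) * ((\<kappa> + 2 * (c0 * sqrt \<kappa>) + 2 * cb) * (d * sqrt d))"
     using B C1 ce by (intro mult_left_mono) auto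
    then show ?thesis by (simp add: k4_def mult_ac)
   qed
   have goal_eq: "(LINT w|M. E v w *\<^sub>R (H w * (F u v w - 1))) = (LINT w|M. T1 w + T2 w + T3 w)"
    unfolding tot[symmetric] by (simp add: F_def \<Gamma>_def ew_def V_def d_def \<Delta>_def y_def)
   have split: "(LINT w|M. T1 w + T2 w + T3 w) = ((LINT w|M. T1 w) - (LINT w|M. T4 w)) + (LINT w|M. T4 w + T2 w) + (LINT w|M. T3 w)"
    using i_T1 i_T2 i_T3 i_T4 by simp
   have "norm (LINT w|M. T1 w + T2 w + T3 w) \<le>
     (k1 * (d * \<epsilon>) + b * I\<psi> + k2 * (d * sqrt d)) + (b * cb * I\<psi> + k3 * d\<^sup>2) + (k4 * (d * sqrt d) + k6 * I\<xi>)"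
    unfolding split using est1 est2 est3 est3' by (intro norm_triangle_le add_mono) auto
   also have "\<dots> \<le> (k1 * (d * \<epsilon>) + b * I\<psi> + k2 * (d * sqrt d)) + (b * cb * I\<psi> + k3 * (d * sqrt d)) + (k4 * (d * sqrt d) + k6 * I\<xi>)"
    using sq(1) k by (intro add_mono mult_left_mono order_refl) auto
   also have "\<dots> = k1 * (d * \<epsilon>) + (k2 + k3 + k4) * (d * sqrt d) + k5 * I\<psi> + k6 * I\<xi>"
    by (simp add: k5_def algebra_simps)
   also have "\<dots> \<le> c * (d * \<epsilon>) + c * (d * sqrt d) + c * I\<psi> + c * I\<xi>"
    using k \<epsilon> d(1) I\<psi>0 I\<xi>0 by (intro add_mono mult_right_mono) (auto simp: c_def)
   also have "\<dots> = c * (d * (\<epsilon> + sqrt d) + I\<psi> + I\<xi>)" by (simp add: algebra_simps)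
   finally show "norm (LINT w|M. E v w *\<^sub>R (H w * (F u v w - 1))) \<le> c * err R \<epsilon> u v"
    unfolding goal_eq err_def I\<psi>_def I\<xi>_def d_def .
  qed
 qed
qed

end

section \<open>Riemann sums, mean values along lines, and the step error on a fixed path\<close>

lemma Riemann_sum_tendsto:
 fixes f :: "real => real"
 assumes ab: "0 \<le> a" "a < b" and f: "continuous_on {0..b} f"
 shows "(\<lambda>N. \<Sum>i<N. (b - a) / real N * f (a + (b - a) * real i / real N)) \<longlonglongrightarrow> (LINT u:{0..b}|lborel. f u) - (LINT u:{0..a}|lborel. f u)"
proof (rule LIMSEQ_I)
 fix r :: real assume r: "0 < r"
 define I where "I x = integral {0..x} f" for x
 have I: "(LINT u:{0..x}|lborel. f u) = I x" if "x \<le> b" for x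
  unfolding I_def by (rule set_borel_integral_eq_integral(2)) (rule borel_integrable_atLeastAtMost', rule continuous_on_subset[OF f], use that in auto)
 have I': "(I has_real_derivative f x) (at x)" if "0 < x" "x < b" for x
  using integral_has_real_derivative[OF f, of x] that by (simp add: I_def[abs_def] at_within_Icc_at)
 have Ic: "continuous_on {0..b} I" unfolding I_def[abs_def]
  by (rule indefinite_integral_continuous_1) (rule integrable_continuous_real[OF f])
 define \<epsilon> where "\<epsilon> = r / (b - a) / 2"
 have \<epsilon>: "0 < \<epsilon>" using r ab by (simp add: \<epsilon>_def)
 have "uniformly_continuous_on {0..b} f" by (rule compact_uniformly_continuous[OF f]) simp
 then obtain D where D: "D > 0" "\<And>x y. x \<in> {0..b} ==> y \<in> {0..b} ==> dist y x < D ==> dist (f y) (f x) < \<epsilon>"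
  using \<epsilon> unfolding uniformly_continuous_on_def by meson
 obtain N0 :: nat where N0: "(b - a) / D < real N0" using reals_Archimedean2 by blast
 show "\<exists>no. \<forall>N\<ge>no. norm ((\<Sum>i<N. (b - a) / real N * f (a + (b - a) * real i / real N)) - ((LINT u:{0..b}|lborel. f u) - (LINT u:{0..a}|lborel. f u))) < r"
 proof (intro exI[of _ "Suc N0"] allI impI)
  fix N assume N: "Suc N0 \<le> N"
  then have N0': "0 < real N" "(b - a) / D < real N" using N0 by auto
  define d where "d = (b - a) / real N"
  define p where "p i = a + (b - a) * real i / real N" for i :: nat
  have d: "0 < d" "d < D" using ab N0' D(1) by (auto simp: d_def field_simps)
  have p_Suc: "p (Suc i) = p i + d" for i by (simp add: p_def d_def add_divide_distrib distrib_left)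
  have p_ge: "a \<le> p i" for i using ab by (simp add: p_def)
  have pN: "p N = b" "p 0 = a" using N0' by (simp_all add: p_def)
  have p_le: "p i \<le> b" if "i \<le> N" for i
  proof -
   have "(b - a) * real i / real N \<le> (b - a) * real N / real N" using that ab N0' by (intro divide_right_mono mult_left_mono) auto
   then show ?thesis using N0' by (simp add: p_def)
  qed
  \<comment> \<open>By the mean value theorem the increment of the antiderivative \<open>I\<close>
    over a cell is \<open>d\<close> times a value of \<open>f\<close> inside it, which is near the
    value at the left end.\<close>
  have step: "\<bar>d * f (p i) - (I (p (Suc i)) - I (p i))\<bar> \<le> d * \<epsilon>" if "i < N" for i
  proof -
   have lt: "p i < p (Suc i)" using d by (simp add: p_Suc)
   have r: "0 \<le> p i" "p (Suc i) \<le> b" using p_ge[of i] ab p_le[of "Suc i"] that by auto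
   have "\<exists>l z. p i < z \<and> z < p (Suc i) \<and> (I has_real_derivative l) (at z) \<and> I (p (Suc i)) - I (p i) = (p (Suc i) - p i) * l"
   proof (rule MVT[OF lt])
    show "continuous_on {p i..p (Suc i)} I" by (rule continuous_on_subset[OF Ic]) (use r in auto)
    show "I differentiable (at x)" if "p i < x" "x < p (Suc i)" for x
     using I'[of x] that r by (auto simp: real_differentiable_def)
   qed
   then obtain l z where z: "p i < z" "z < p (Suc i)" "(I has_real_derivative l) (at z)" "I (p (Suc i)) - I (p i) = d * l"
    by (auto simp: p_Suc)
   have "l = f z" by (rule DERIV_unique[OF z(3) I']) (use z r in auto)
   moreover have "dist (f (p i)) (f z) < \<epsilon>" by (rule D(2)) (use z r lt d in \<open>auto simp: dist_real_def p_Suc\<close>)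
   ultimately have "\<bar>f (p i) - l\<bar> \<le> \<epsilon>" by (simp add: dist_real_def)
   then have "d * \<bar>f (p i) - l\<bar> \<le> d * \<epsilon>" using d by (intro mult_left_mono) auto
   then show ?thesis using d by (simp add: z(4) abs_mult flip: right_diff_distrib)
  qed
  have "(\<Sum>i<N. I (p (Suc i)) - I (p i)) = I b - I a"
   using sum_lessThan_telescope[of "\<lambda>i. I (p i)" N] by (simp add: pN)
  then have "\<bar>(\<Sum>i<N. d * f (p i)) - (I b - I a)\<bar> = \<bar>\<Sum>i<N. d * f (p i) - (I (p (Suc i)) - I (p i))\<bar>"
   by (simp add: sum_subtractf)
  also have "\<dots> \<le> (\<Sum>i<N. \<bar>d * f (p i) - (I (p (Suc i)) - I (p i))\<bar>)" by (rule sum_abs)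
  also have "\<dots> \<le> (\<Sum>i<N. d * \<epsilon>)" by (intro sum_mono step) auto
  also have "\<dots> = r / 2" using N0' ab by (simp add: d_def \<epsilon>_def field_simps)
  also have "\<dots> < r" using r by simp
  finally show "norm ((\<Sum>i<N. (b - a) / real N * f (a + (b - a) * real i / real N)) - ((LINT u:{0..b}|lborel. f u) - (LINT u:{0..a}|lborel. f u))) < r"
   using ab by (simp add: I p_def d_def)
 qed
qed

text \<open>The mean value theorem on the line through \<open>x\<close> in direction
  \<open>q\<close>; the sign of \<open>b\<close> decides on which side of 0 the intermediate point
  lies.\<close>

lemma GDERIV_line_MVT:
 fixes f :: "'h::real_inner => real"
 assumes D: "\<And>y. GDERIV f y :> Df y" and b: "b \<noteq> 0"
 obtains \<theta> where "\<bar>\<theta>\<bar> \<le> \<bar>b\<bar>" "f (x + b *\<^sub>R q) - f x = b * (Df (x + \<theta> *\<^sub>R q) \<bullet> q)"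
proof -
 have d: "((\<lambda>\<theta>. f (x + \<theta> *\<^sub>R q)) has_real_derivative (Df (x + \<theta> *\<^sub>R q) \<bullet> q)) (at \<theta>)" for \<theta>
 proof -
  have "((\<lambda>\<theta>. x + \<theta> *\<^sub>R q) has_derivative (\<lambda>y. y *\<^sub>R q)) (at \<theta>)" by (auto intro!: derivative_eq_intros)
  from has_derivative_compose[OF this D[unfolded gderiv_def]]
  have "((\<lambda>\<theta>. f (x + \<theta> *\<^sub>R q)) has_derivative (\<lambda>y. y *\<^sub>R q \<bullet> Df (x + \<theta> *\<^sub>R q))) (at \<theta>)" .
  then show ?thesis unfolding has_field_derivative_def by (rule has_derivative_eq_rhs) (simp add: fun_eq_iff inner_commute)
 qed
 show thesis
 proof (cases "0 < b")
  case True
  from MVT2[OF this, of "\<lambda>\<theta>. f (x + \<theta> *\<^sub>R q)" "\<lambda>\<theta>. Df (x + \<theta> *\<^sub>R q) \<bullet> q"] d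
  obtain z where "0 < z" "z < b" "f (x + b *\<^sub>R q) - f x = b * (Df (x + z *\<^sub>R q) \<bullet> q)" by auto
  then show thesis by (intro that[of z]) auto
 next
  case False
  then have "b < 0" using b by simp
  from MVT2[OF this, of "\<lambda>\<theta>. f (x + \<theta> *\<^sub>R q)" "\<lambda>\<theta>. Df (x + \<theta> *\<^sub>R q) \<bullet> q"] d
  obtain z where "b < z" "z < 0" "f x - f (x + b *\<^sub>R q) = - b * (Df (x + z *\<^sub>R q) \<bullet> q)" by auto
  then show thesis by (intro that[of z]) auto
 qed
qed

context girsanov_interval
begin

text \<open>On a fixed path everything is uniformly continuous on the compact time interval. The
  admissible step length \<open>L\<close> depends on the path, so this enters the main estimate only
  through dominated convergence.\<close>

lemma good_step:
 assumes cont: "continuous_on {0..T} (\<lambda>u. X u w)" and R: "0 < R" and \<epsilon>: "0 < \<epsilon>"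
 shows "\<exists>L>0. \<forall>u v. u \<in> D --> v \<in> D --> u < v --> v - u \<le> L --> good R u w --> good (R + 1) v w \<and> \<psi> R u v w \<le> \<epsilon> * (v - u)"
proof -
 \<comment> \<open>The first bound fits into the gap between the levels \<open>1 / R\<close> and
   \<open>1 / (R + 1)\<close>, the second is the share of the last summand of \<psi>.\<close>
 define \<eta> where "\<eta> = min (1 / R - 1 / (R + 1)) (\<epsilon> / 3)"
 define \<zeta> where "\<zeta> = \<epsilon> / (3 * (norm q + 1))"
 have "1 / (R + 1) < 1 / R" using R by (simp add: frac_less2)
 then have \<eta>: "0 < \<eta>" using \<epsilon> by (simp add: \<eta>_def)
 have nq: "0 < norm q + 1" by (simp add: add_nonneg_pos)
 have \<zeta>: "0 < \<zeta>" using \<epsilon> nq by (simp add: \<zeta>_def)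
 have ch: "continuous_on {0..T} (\<lambda>r. h r (X r w))"
 proof -
  have "continuous_on {0..T} (\<lambda>r. (\<lambda>(t, x). h t x) (r, X r w))"
   by (rule continuous_on_compose2[OF h_cont]) (auto intro!: continuous_intros cont)
  then show ?thesis by simp
 qed
 \<comment> \<open>Joint in time and displacement, because the mean value theorem produces an
   intermediate displacement that is not under control.\<close>
 have cD: "continuous_on ({0..T} \<times> {-1..1}) (\<lambda>p. Dh (fst p) (X (fst p) w + snd p *\<^sub>R q))"
 proof -
  have "continuous_on ({0..T} \<times> {-1..1 :: real}) (\<lambda>p. (\<lambda>(t, x). Dh t x) (fst p, X (fst p) w + snd p *\<^sub>R q))"
   by (rule continuous_on_compose2[OF Dh_cont])
    (auto intro!: continuous_intros continuous_on_compose2[OF cont])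
  then show ?thesis by simp
 qed
 obtain d1 where d1: "d1 > 0" "\<And>x y. x \<in> {0..T} ==> y \<in> {0..T} ==> dist y x < d1 ==> dist (X y w) (X x w) < 1 / 2"
  using compact_uniformly_continuous[OF cont] unfolding uniformly_continuous_on_def by (meson compact_Icc half_gt_zero zero_less_one)
 obtain d2 where d2: "d2 > 0" "\<And>x y. x \<in> {0..T} ==> y \<in> {0..T} ==> dist y x < d2 ==> dist (h y (X y w)) (h x (X x w)) < \<eta>"
  using compact_uniformly_continuous[OF ch] \<eta> unfolding uniformly_continuous_on_def by (meson compact_Icc)
 have "uniformly_continuous_on ({0..T} \<times> {-1..1}) (\<lambda>p. Dh (fst p) (X (fst p) w + snd p *\<^sub>R q))"
  by (rule compact_uniformly_continuous[OF cD]) (intro compact_Times compact_Icc)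
 then obtain d3 where d3: "d3 > 0" "\<And>x y. x \<in> {0..T} \<times> {-1..1} ==> y \<in> {0..T} \<times> {-1..1} ==> dist y x < d3 ==>
   dist (Dh (fst y) (X (fst y) w + snd y *\<^sub>R q)) (Dh (fst x) (X (fst x) w + snd x *\<^sub>R q)) < \<zeta>"
  using \<zeta> unfolding uniformly_continuous_on_def by meson
 \<comment> \<open>The path may move by less than 1/2 because of \<open>d1\<close>, and the last
   entry limits the displacement along \<open>q\<close> to 1/2; so all points stay within norm
   \<open>R + 1\<close>, where the cutoff is 1.\<close>
 define L where "L = min (min (d1 / 2) (d2 / 2)) (min (d3 / 3) (min 1 (1 / (2 * (norm q + 1)))))"
 have L: "0 < L" "L < d1" "L < d2" "2 * L < d3" "L \<le> 1" "L \<le> 1 / (2 * (norm q + 1))"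
 proof -
  define a where "a = 1 / (2 * (norm q + 1))"
  have "0 < a" using nq by (simp add: a_def)
  then show "0 < L" "L < d1" "L < d2" "2 * L < d3" "L \<le> 1" "L \<le> 1 / (2 * (norm q + 1))"
   using d1(1) d2(1) d3(1) unfolding L_def a_def[symmetric] by linarith+
 qed
 have dq: "L * norm q \<le> 1 / 2"
 proof -
  have "L * norm q \<le> 1 / (2 * (norm q + 1)) * (norm q + 1)" using L by (intro mult_mono) auto
  also have "\<dots> = 1 / 2" using nq by simp
  finally show ?thesis .
 qed
 have "good (R + 1) v w \<and> \<psi> R u v w \<le> \<epsilon> * (v - u)"
  if uv: "u \<in> D" "v \<in> D" "u < v" "v - u \<le> L" and g: "good R u w" for u v
 proof -
  have uT: "0 \<le> u" "v \<le> T" using D_range(1)[OF uv(1)] D_range(3)[OF uv(2)] by auto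
  have Xu: "norm (X u w) \<le> R" and hu: "1 / R \<le> h u (X u w)" using g uv(1) by (auto simp: good_def)
  have near: "norm (X r w - X u w) < 1 / 2" "\<bar>h r (X r w) - h u (X u w)\<bar> < \<eta>" if "u \<le> r" "r \<le> v" for r
   using d1(2)[of u r] d2(2)[of u r] that uv uT L by (auto simp: dist_real_def dist_norm)
  have "good (R + 1) v w" unfolding good_def
  proof (intro ballI impI)
   fix r assume r: "r \<in> D" "r \<le> v"
   show "norm (X r w) \<le> R + 1 \<and> 1 / (R + 1) \<le> h r (X r w)"
   proof (cases "r \<le> u")
    case True
    then show ?thesis using g r \<open>1 / (R + 1) < 1 / R\<close> by (fastforce simp: good_def)
   next
    case False
    then have "norm (X r w - X u w) < 1 / 2" "\<bar>h r (X r w) - h u (X u w)\<bar> < 1 / R - 1 / (R + 1)"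
     using near[of r] r by (auto simp: \<eta>_def)
    then show ?thesis using Xu hu norm_triangle_sub[of "X r w" "X u w"] by linarith
   qed
  qed
  moreover have "\<psi> R u v w \<le> \<epsilon> * (v - u)"
  proof -
   define d where "d = v - u"
   have d: "0 < d" "d \<le> L" using uv by (auto simp: d_def)
   have v0: "0 \<le> v" using uT uv by simp
   have hc: "hc R v (X v w + \<theta> *\<^sub>R q) = h v (X v w + \<theta> *\<^sub>R q)" if "\<bar>\<theta>\<bar> \<le> d" for \<theta>
   proof -
    have "\<bar>\<theta>\<bar> * norm q \<le> L * norm q" using that d by (intro mult_right_mono) auto
    then have "norm (\<theta> *\<^sub>R q) \<le> 1 / 2" using dq by simp
    moreover have "norm (X v w) \<le> R + 1 / 2" using near(1)[of v] Xu norm_triangle_sub[of "X v w" "X u w"] uv by linarith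
    ultimately have "norm (X v w + \<theta> *\<^sub>R q) \<le> R + 1" using norm_triangle_ineq[of "X v w" "\<theta> *\<^sub>R q"] by linarith
    then show ?thesis by (simp add: hc_def cutoff_eq_1)
   qed
   have Dq: "\<bar>Dh v (X v w + \<theta> *\<^sub>R q) \<bullet> q - Dh u (X u w) \<bullet> q\<bar> \<le> \<epsilon> / 3" if "\<bar>\<theta>\<bar> \<le> d" for \<theta>
   proof -
    have "dist (v, \<theta>) (u, 0) \<le> dist v u + dist \<theta> 0" unfolding dist_prod_def
     using sqrt_sum_squares_le_sum[of "dist v u" "dist \<theta> 0"] by simp
    also have "\<dots> < d3" using that d L(4) by (simp add: d_def dist_real_def)
    finally have *: "dist (v, \<theta>) (u, 0) < d3" .
    have "- 1 \<le> \<theta>" "\<theta> \<le> 1" using that d L(5) by linarith+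
    then have "dist (Dh v (X v w + \<theta> *\<^sub>R q)) (Dh u (X u w)) < \<zeta>"
     using d3(2)[of "(u, 0)" "(v, \<theta>)"] * uv uT by auto
    then have "norm (Dh v (X v w + \<theta> *\<^sub>R q) - Dh u (X u w)) * norm q \<le> \<zeta> * (norm q + 1)"
     using \<zeta> by (intro mult_mono) (auto simp: dist_norm)
    also have "\<dots> = \<epsilon> / 3" using nq by (simp add: \<zeta>_def field_simps)
    finally show ?thesis
     using Cauchy_Schwarz_ineq2[of "Dh v (X v w + \<theta> *\<^sub>R q) - Dh u (X u w)" q] by (simp add: inner_diff_left)
   qed
   have line: "\<bar>hc R v (X v w + a *\<^sub>R q) - hc R v (X v w) - a * (Dh u (X u w) \<bullet> q)\<bar> \<le> d * (\<epsilon> / 3)" if a: "\<bar>a\<bar> = d" for a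
   proof -
    have "a \<noteq> 0" using a d by auto
    from GDERIV_line_MVT[OF Dh[OF v0] this] obtain \<theta> where
     \<theta>: "\<bar>\<theta>\<bar> \<le> \<bar>a\<bar>" "h v (X v w + a *\<^sub>R q) - h v (X v w) = a * (Dh v (X v w + \<theta> *\<^sub>R q) \<bullet> q)" by blast
    have "hc R v (X v w) = h v (X v w)" using hc[of 0] d by simp
    then have "hc R v (X v w + a *\<^sub>R q) - hc R v (X v w) - a * (Dh u (X u w) \<bullet> q)
      = a * (Dh v (X v w + \<theta> *\<^sub>R q) \<bullet> q - Dh u (X u w) \<bullet> q)"
     using hc[of a] a \<theta>(2) by (simp add: right_diff_distrib)
    then show ?thesis using Dq[of \<theta>] \<theta>(1) a d by (simp add: abs_mult mult_left_mono)
   qed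
   have "hc R v (X v w) = h v (X v w)" using hc[of 0] d by simp
   then have "\<bar>h u (X u w) - hc R v (X v w)\<bar> \<le> \<epsilon> / 3" using near(2)[of v] uv by (simp add: \<eta>_def abs_minus_commute)
   then have "d * \<bar>h u (X u w) - hc R v (X v w)\<bar> \<le> d * (\<epsilon> / 3)" using d by (intro mult_left_mono) auto
   moreover have "\<bar>hc R v (X v w + d *\<^sub>R q) - hc R v (X v w) - d * (Dh u (X u w) \<bullet> q)\<bar> \<le> d * (\<epsilon> / 3)"
    using line[of d] d by simp
   moreover have "\<bar>hc R v (X v w - d *\<^sub>R q) - hc R v (X v w) + d * (Dh u (X u w) \<bullet> q)\<bar> \<le> d * (\<epsilon> / 3)"
    using line[of "- d"] d by simp
   ultimately show ?thesis unfolding \<psi>_def d_def[symmetric] by (simp add: mult.commute)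
  qed
  ultimately show ?thesis by blast
 qed
 with L(1) show ?thesis by blast
qed

end

section \<open>Telescoping over equidistant partitions\<close>

context girsanov_interval
begin

definition grid :: "nat => nat => real" where "grid N j = s + (t - s) * real j / real N"

text \<open>The product of the factors \<open>F\<close> over the first \<open>j\<close> cells: a
  compensated exponential with the drift integral replaced by its left Riemann sum.\<close>

definition U :: "nat => nat => 'a => complex" where
 "U N j w = of_real (exp (real j * ((t - s) / real N * \<kappa> / 2))) *
  cis (\<beta> (grid N j) w - \<beta> s w - (\<Sum>i<j. (t - s) / real N * drift (grid N i) w))"

text \<open>The modulus of the product over all cells, hence a bound for all partial products on
  every partition.\<close>

definition growth :: real where "growth = exp ((t - s) * \<kappa> / 2)"

lemma growth: "1 \<le> growth" "0 \<le> growth"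
 using st \<kappa> by (auto simp: growth_def)

lemma grid_Suc: "grid N (Suc j) = grid N j + (t - s) / real N"
 by (simp add: grid_def add_divide_distrib distrib_left)

lemma grid_0: "grid N 0 = s"
 by (simp add: grid_def)

lemma grid_N: "0 < N ==> grid N N = t"
 by (simp add: grid_def)

lemma grid_mono: "i \<le> j ==> grid N i \<le> grid N j"
 unfolding grid_def using st by (intro add_left_mono divide_right_mono mult_left_mono) auto

lemma grid_D: "0 < N ==> j \<le> N ==> grid N j \<in> D"
proof -
 assume N: "0 < N" and j: "j \<le> N"
 have "grid N j = s + (t - s) * (real j / real N)" by (simp add: grid_def)
 moreover have "real j / real N \<in> \<rat>" by simp
 moreover have "0 \<le> grid N j" using grid_mono[of 0 j N] s by (simp add: grid_0)
 moreover have "grid N j \<le> t" using grid_mono[OF j, of N] by (simp add: grid_N[OF N])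
 ultimately show ?thesis unfolding D_def by (intro IntI image_eqI[where x="real j / real N"]) auto
qed

lemma grid_range: "0 < N ==> j \<le> N ==> 0 \<le> grid N j \<and> s \<le> grid N j \<and> grid N j \<le> t \<and> grid N j \<le> T"
 using D_range[OF grid_D, of N j] grid_mono[of 0 j N] by (auto simp: grid_0)

lemma grid_less: "0 < N ==> grid N j < grid N (Suc j)"
 using st by (simp add: grid_Suc)

lemma U_0: "U N 0 w = 1"
 by (simp add: U_def grid_0)

lemma U_Suc: "U N (Suc j) w = U N j w * F (grid N j) (grid N (Suc j)) w"
proof -
 have d: "grid N (Suc j) - grid N j = (t - s) / real N" by (simp add: grid_Suc)
 have 1: "exp (real (Suc j) * ((t - s) / real N * \<kappa> / 2)) = exp (real j * ((t - s) / real N * \<kappa> / 2)) * exp ((t - s) / real N * \<kappa> / 2)"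
  unfolding exp_add[symmetric] of_nat_Suc distrib_right by (simp only: mult_1 add.commute)
 have 2: "\<beta> (grid N (Suc j)) w - \<beta> s w - (\<Sum>i<Suc j. (t - s) / real N * drift (grid N i) w) =
   (\<beta> (grid N j) w - \<beta> s w - (\<Sum>i<j. (t - s) / real N * drift (grid N i) w)) +
   (\<beta> (grid N (Suc j)) w - \<beta> (grid N j) w - (t - s) / real N * drift (grid N j) w)" by simp
 show ?thesis unfolding U_def F_def d 1 2 cis_mult[symmetric] of_real_mult by (simp only: mult_ac)
qed

lemma U_norm: "j \<le> N ==> norm (U N j w) \<le> growth"
proof (cases "N = 0")
 case True
 then show "j \<le> N ==> norm (U N j w) \<le> growth" using growth by (simp add: U_def norm_mult)
next
 case False
 assume j: "j \<le> N"
 have "real j * ((t - s) / real N * \<kappa> / 2) \<le> real N * ((t - s) / real N * \<kappa> / 2)"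
  using j st \<kappa> by (intro mult_right_mono) auto
 also have "\<dots> = (t - s) * \<kappa> / 2" using False by simp
 finally show ?thesis by (simp add: U_def norm_mult growth_def)
qed

lemma U_measurable: "0 < N ==> j \<le> N ==> U N j \<in> borel_measurable (G (grid N j))"
proof -
 assume N: "0 < N" and j: "j \<le> N"
 note r = grid_range[OF N j]
 have 1: "(\<lambda>w. \<Sum>i<j. (t - s) / real N * drift (grid N i) w) \<in> borel_measurable (G (grid N j))"
 proof (intro borel_measurable_sum borel_measurable_times borel_measurable_const)
  fix i assume "i \<in> {..<j}"
  then have "i \<le> j" "i \<le> N" using j by auto
  then show "drift (grid N i) \<in> borel_measurable (G (grid N j))"
   using measurable_G_mono[OF drift_measurable grid_mono] grid_range[OF N, of i] by auto
 qed
 have [measurable]: "\<beta> (grid N j) \<in> borel_measurable (G (grid N j))" "\<beta> s \<in> borel_measurable (G (grid N j))"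
  using \<beta>[of "grid N j"] measurable_G_mono[OF \<beta>[OF s], of "grid N j"] r by auto
 note [measurable] = 1
 show ?thesis unfolding U_def[abs_def] by measurable
qed

text \<open>The expectation of \<open>E\<close> times \<open>U\<close> telescopes over the cells,
  with the localisation \<open>z\<close> taken at their left ends. In front of factors known at the
  left end, the martingale property exchanges \<open>E\<close> at the two ends. Removing the paths
  that cease to be good costs the decrease of \<open>I\<close>, which telescopes as well. The factor
  3 counts this loss and the insertion of \<open>z\<close> at the two ends of the interval.\<close>

lemma partition_bound:
 assumes k: "k \<in> borel_measurable (G s)" "\<And>w. norm (k w :: complex) \<le> 1" and N: "0 < N"
 shows "norm ((LINT w|M. E t w *\<^sub>R (k w * U N N w)) - (LINT w|M. E s w *\<^sub>R k w)) \<le>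
  (\<Sum>j<N. norm (LINT w|M. E (grid N (Suc j)) w *\<^sub>R (k w * z R (grid N j) w * U N j w * (F (grid N j) (grid N (Suc j)) w - 1))))
  + 3 * growth * (LINT w|M. E t w * (1 - z R t w))"
proof -
 define p where "p = grid N"
 define a where "a j = (LINT w|M. E (p (Suc j)) w *\<^sub>R (k w * z R (p j) w * U N j w * (F (p j) (p (Suc j)) w - 1)))" for j
 define S where "S j = (LINT w|M. E (p j) w *\<^sub>R (k w * z R (p j) w * U N j w))" for j
 define I where "I j = (LINT w|M. E (p j) w * z R (p j) w)" for j
 have pr: "0 \<le> p j" "s \<le> p j" "p j \<le> t" "p j \<le> T" if "j \<le> N" for j
  using grid_range[OF N that] by (auto simp: p_def)
 have kM: "k \<in> borel_measurable (G (p j))" if "j \<le> N" for j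
  by (rule measurable_G_mono[OF k(1) pr(2)[OF that]])
 have zM: "z R (p i) \<in> borel_measurable (G (p j))" if "i \<le> j" "j \<le> N" for i j
  by (rule measurable_G_mono[OF z_measurable[OF pr(1)]]) (use that grid_mono in \<open>auto simp: p_def\<close>)
 have UM: "U N j \<in> borel_measurable (G (p j))" if "j \<le> N" for j
  using U_measurable[OF N that] by (simp add: p_def)
 have kzU: "norm (k w * complex_of_real y * U N j w) \<le> growth * y" if "0 \<le> y" "j \<le> N" for y j w
 proof -
  have "norm (k w * complex_of_real y * U N j w) = norm (k w) * y * norm (U N j w)" using that by (simp add: norm_mult)
  also have "\<dots> \<le> 1 * y * growth" using that k(2) U_norm[OF that(2)] by (intro mult_mono) auto
  finally show ?thesis by (simp add: mult.commute)
 qed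
 have kzU1: "norm (k w * complex_of_real y * U N j w) \<le> growth" if "0 \<le> y" "y \<le> 1" "j \<le> N" for y j w
  using kzU[OF that(1,3), of w] mult_left_le[of y growth] that growth by linarith
 have ii: "integrable M (\<lambda>w. E (p l) w *\<^sub>R (k w * z R (p i) w * U N j w))" if "i \<le> N" "j \<le> N" "l \<le> N" for i j l
 proof (rule E_mult_integrable[OF pr(1)[OF that(3)] pr(4)[OF that(3)], of _ growth])
  note [measurable] = measurable_G[OF kM[OF that(1)]] measurable_G[OF zM[OF order_refl that(1)]] measurable_G[OF UM[OF that(2)]]
  show "(\<lambda>w. k w * z R (p i) w * U N j w) \<in> borel_measurable M" by measurable
  show "norm (k w * z R (p i) w * U N j w) \<le> growth" for w by (rule kzU1[OF z_simps(1,2) that(2)])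
 qed
 have iz: "integrable M (\<lambda>w. E (p l) w * z R (p i) w)" if "i \<le> N" "l \<le> N" for i l
  using E_mult_integrable[OF pr(1)[OF that(2)] pr(4)[OF that(2)] measurable_G[OF zM[OF order_refl that(1)]], of 1] z_simps(3) by simp
 have Imart: "(LINT w|M. E (p l) w * z R (p i) w) = I i" if "i \<le> l" "l \<le> N" for i l
 proof -
  have "i \<le> N" using that by simp
  from E_martingale[OF pr(1)[OF this] _ pr(4)[OF that(2)] zM[OF order_refl this], of 1] grid_mono[OF that(1), of N] z_simps(3)
  show ?thesis by (simp add: I_def p_def mult.commute)
 qed
 \<comment> \<open>One cell yields the wanted term \<open>a j\<close> and the loss \<open>r\<close>
   from paths that cease to be good within the cell.\<close>
 have step: "norm (S (Suc j) - S j) \<le> norm (a j) + growth * (I j - I (Suc j))" if "Suc j \<le> N" for j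
 proof -
  have j: "j \<le> N" using that by simp
  define r where "r = (LINT w|M. E (p (Suc j)) w *\<^sub>R (k w * (z R (p j) w - z R (p (Suc j)) w) * U N (Suc j) w))"
  have zz: "0 \<le> z R (p j) w - z R (p (Suc j)) w" "z R (p j) w - z R (p (Suc j)) w \<le> 1" for w
   using z_antimono[of "p j" "p (Suc j)" R w] grid_mono[of j "Suc j" N] z_simps[of R "p j" w] z_simps[of R "p (Suc j)" w]
   by (auto simp: p_def)
  have r_eq: "(\<lambda>w. E (p (Suc j)) w *\<^sub>R (k w * (z R (p j) w - z R (p (Suc j)) w) * U N (Suc j) w)) =
    (\<lambda>w. E (p (Suc j)) w *\<^sub>R (k w * z R (p j) w * U N (Suc j) w) - E (p (Suc j)) w *\<^sub>R (k w * z R (p (Suc j)) w * U N (Suc j) w))"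
   by (simp add: fun_eq_iff algebra_simps)
  have ir: "integrable M (\<lambda>w. E (p (Suc j)) w *\<^sub>R (k w * (z R (p j) w - z R (p (Suc j)) w) * U N (Suc j) w))"
   unfolding r_eq using ii[OF j that that] ii[OF that that that] by (rule Bochner_Integration.integrable_diff)
  have 1: "S (Suc j) = (LINT w|M. E (p (Suc j)) w *\<^sub>R (k w * z R (p j) w * U N (Suc j) w)) - r"
   unfolding r_def r_eq S_def Bochner_Integration.integral_diff[OF ii[OF j that that] ii[OF that that that]] by simp
  have 2: "(LINT w|M. E (p (Suc j)) w *\<^sub>R (k w * z R (p j) w * U N j w)) = S j"
   unfolding S_def
  proof (rule E_martingale_complex[OF pr(1)[OF j] _ pr(4)[OF that], of _ growth])
   show "p j \<le> p (Suc j)" using grid_mono[of j "Suc j" N] by (simp add: p_def)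
   note [measurable] = kM[OF j] zM[OF order_refl j] UM[OF j]
   show "(\<lambda>w. k w * z R (p j) w * U N j w) \<in> borel_measurable (G (p j))" by measurable
   show "norm (k w * z R (p j) w * U N j w) \<le> growth" for w by (rule kzU1[OF z_simps(1,2) j])
  qed
  have a_eq: "(\<lambda>w. E (p (Suc j)) w *\<^sub>R (k w * z R (p j) w * U N j w * (F (p j) (p (Suc j)) w - 1))) =
    (\<lambda>w. E (p (Suc j)) w *\<^sub>R (k w * z R (p j) w * U N (Suc j) w) - E (p (Suc j)) w *\<^sub>R (k w * z R (p j) w * U N j w))"
   by (simp add: fun_eq_iff algebra_simps U_Suc p_def)
  have 3: "a j = (LINT w|M. E (p (Suc j)) w *\<^sub>R (k w * z R (p j) w * U N (Suc j) w)) - S j"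
   unfolding a_def a_eq Bochner_Integration.integral_diff[OF ii[OF j that that] ii[OF j j that]] 2 ..
  have ir': "integrable M (\<lambda>w. growth * (E (p (Suc j)) w * z R (p j) w - E (p (Suc j)) w * z R (p (Suc j)) w))"
   by (intro integrable_mult_right Bochner_Integration.integrable_diff iz j that)
  have "norm r \<le> (LINT w|M. growth * (E (p (Suc j)) w * z R (p j) w - E (p (Suc j)) w * z R (p (Suc j)) w))"
   unfolding r_def
  proof (rule norm_integral_le_AE[OF ir ir' AE_I2])
   fix w
   have "norm (E (p (Suc j)) w *\<^sub>R (k w * (z R (p j) w - z R (p (Suc j)) w) * U N (Suc j) w))
     = E (p (Suc j)) w * norm (k w * complex_of_real (z R (p j) w - z R (p (Suc j)) w) * U N (Suc j) w)"
    using E_nonneg[OF pr(1)[OF that], of w] by simp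
   also have "\<dots> \<le> E (p (Suc j)) w * (growth * (z R (p j) w - z R (p (Suc j)) w))"
    by (rule mult_left_mono[OF kzU[OF zz(1) that] E_nonneg[OF pr(1)[OF that]]])
   also have "\<dots> = growth * (E (p (Suc j)) w * z R (p j) w - E (p (Suc j)) w * z R (p (Suc j)) w)"
    by (simp add: algebra_simps)
   finally show "norm (E (p (Suc j)) w *\<^sub>R (k w * (z R (p j) w - z R (p (Suc j)) w) * U N (Suc j) w)) \<le>
    growth * (E (p (Suc j)) w * z R (p j) w - E (p (Suc j)) w * z R (p (Suc j)) w)" .
  qed
  also have "\<dots> = growth * (I j - I (Suc j))"
   unfolding integral_mult_right_zero Bochner_Integration.integral_diff[OF iz[OF j that] iz[OF that that]]
   using Imart[OF _ that, of j] Imart[OF order_refl that] by simp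
  finally have "norm r \<le> growth * (I j - I (Suc j))" .
  moreover have "S (Suc j) - S j = a j - r" using 1 3 by simp
  ultimately show ?thesis using norm_triangle_ineq4[of "a j" r] by simp
 qed
 have sum: "norm (S n - S 0) \<le> (\<Sum>j<n. norm (a j)) + growth * (I 0 - I n)" if "n \<le> N" for n
  using that
 proof (induction n)
  case (Suc n)
  have "norm (S (Suc n) - S 0) \<le> norm (S (Suc n) - S n) + norm (S n - S 0)"
   using norm_triangle_ineq[of "S (Suc n) - S n" "S n - S 0"] by simp
  then show ?case using step[OF Suc.prems] Suc by (simp add: algebra_simps)
 qed simp
 define L where "L = (LINT w|M. E t w * (1 - z R t w))"
 have p0: "p 0 = s" and pN: "p N = t" using N by (simp_all add: p_def grid_0 grid_N)
 have t0: "0 \<le> t" using s st by simp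
 have sT: "s \<le> T" using st t by simp
 have L: "L = (LINT w|M. E t w) - I N"
  using iz[of N N] E_integrable[OF t0 t] by (simp add: L_def I_def pN right_diff_distrib)
 have EsEt: "(LINT w|M. E s w) = (LINT w|M. E t w)"
  using E_martingale[OF s less_imp_le[OF st] t, of "\<lambda>_. 1" 1] by simp
 have I0: "I N \<le> I 0"
 proof -
  have "I N \<le> (LINT w|M. E (p N) w * z R (p 0) w)" unfolding I_def
   using iz[of N N] iz[of 0 N] E_nonneg[OF t0] z_antimono[OF less_imp_le[OF st]]
   by (intro integral_mono mult_left_mono) (auto simp: p0 pN)
  then show ?thesis using Imart[of 0 N] by simp
 qed
 have I0': "I 0 \<le> (LINT w|M. E s w)" unfolding I_def p0
  using iz[of 0 0] E_integrable[OF s sT] E_nonneg[OF s] z_simps(2) p0 by (intro integral_mono mult_left_le) auto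
 define Y where "Y = (LINT w|M. E t w *\<^sub>R (k w * U N N w))"
 define Y0 where "Y0 = (LINT w|M. E s w *\<^sub>R k w)"
 have YN: "norm (Y - S N) \<le> growth * L"
 proof -
  note [measurable] = measurable_G[OF k(1)] measurable_G[OF UM[OF order_refl]]
  have iY: "integrable M (\<lambda>w. E t w *\<^sub>R (k w * U N N w))"
   by (rule E_mult_integrable[OF t0 t, of _ growth]) (use kzU1[of 1 N] in auto)
  have iS: "integrable M (\<lambda>w. E t w *\<^sub>R (k w * z R t w * U N N w))" using ii[of N N N] by (simp add: pN)
  have iL: "integrable M (\<lambda>w. growth * (E t w * (1 - z R t w)))"
   using iz[of N N] E_integrable[OF t0 t] by (simp add: pN right_diff_distrib)
  have Y_eq: "Y - S N = (LINT w|M. E t w *\<^sub>R (k w * U N N w) - E t w *\<^sub>R (k w * z R t w * U N N w))"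
   unfolding Bochner_Integration.integral_diff[OF iY iS] by (simp add: Y_def S_def pN)
  have "norm (Y - S N) \<le> (LINT w|M. growth * (E t w * (1 - z R t w)))"
   unfolding Y_eq
  proof (rule norm_integral_le_AE[OF Bochner_Integration.integrable_diff[OF iY iS] iL AE_I2])
   fix w
   have "norm (E t w *\<^sub>R (k w * U N N w) - E t w *\<^sub>R (k w * z R t w * U N N w)) = E t w * norm (k w * complex_of_real (1 - z R t w) * U N N w)"
   proof -
    have "E t w *\<^sub>R (k w * U N N w) - E t w *\<^sub>R (k w * z R t w * U N N w) = E t w *\<^sub>R (k w * complex_of_real (1 - z R t w) * U N N w)"
     by (simp add: algebra_simps)
    then show ?thesis using E_nonneg[OF t0, of w] by simp
   qed
   also have "\<dots> \<le> E t w * (growth * (1 - z R t w))"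
    by (rule mult_left_mono[OF kzU E_nonneg[OF t0]]) (use z_simps in auto)
   finally show "norm (E t w *\<^sub>R (k w * U N N w) - E t w *\<^sub>R (k w * z R t w * U N N w)) \<le> growth * (E t w * (1 - z R t w))"
    by (simp add: mult_ac)
  qed
  also have "\<dots> = growth * L" by (simp add: L_def)
  finally show ?thesis .
 qed
 have Y0: "norm (S 0 - Y0) \<le> (LINT w|M. E s w) - I 0"
 proof -
  note [measurable] = measurable_G[OF k(1)]
  have iY: "integrable M (\<lambda>w. E s w *\<^sub>R k w)"
   by (rule E_mult_integrable[OF s sT, of _ 1]) (use k in auto)
  have iS: "integrable M (\<lambda>w. E s w *\<^sub>R (k w * z R s w))" using ii[of 0 0 0] by (simp add: p0 U_0)
  have iL: "integrable M (\<lambda>w. E s w - E s w * z R s w)"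
   using iz[of 0 0] E_integrable[OF s sT] by (simp add: p0)
  have S_eq: "S 0 - Y0 = (LINT w|M. E s w *\<^sub>R (k w * z R s w) - E s w *\<^sub>R k w)"
   unfolding Bochner_Integration.integral_diff[OF iS iY] by (simp add: Y0_def S_def p0 U_0)
  have "norm (S 0 - Y0) \<le> (LINT w|M. E s w - E s w * z R s w)"
   unfolding S_eq
  proof (rule norm_integral_le_AE[OF Bochner_Integration.integrable_diff[OF iS iY] iL AE_I2])
   fix w
   have "E s w *\<^sub>R (k w * z R s w) - E s w *\<^sub>R k w = - (E s w *\<^sub>R (k w * complex_of_real (1 - z R s w)))"
    by (simp add: algebra_simps)
   then have "norm (E s w *\<^sub>R (k w * z R s w) - E s w *\<^sub>R k w) = E s w * (norm (k w) * (1 - z R s w))"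
    using E_nonneg[OF s, of w] z_simps(2)[of R s w] by (simp add: norm_mult del: of_real_diff)
   also have "\<dots> \<le> E s w * (1 * (1 - z R s w))"
    using E_nonneg[OF s, of w] z_simps(2)[of R s w] k(2) by (intro mult_left_mono mult_right_mono) auto
   finally show "norm (E s w *\<^sub>R (k w * z R s w) - E s w *\<^sub>R k w) \<le> E s w - E s w * z R s w"
    by (simp add: right_diff_distrib)
  qed
  also have "\<dots> = (LINT w|M. E s w) - I 0"
   using iz[of 0 0] E_integrable[OF s sT] by (simp add: p0 I_def)
  finally show ?thesis .
 qed
 have "norm (Y - Y0) \<le> norm (Y - S N) + norm (S N - S 0) + norm (S 0 - Y0)"
  using norm_triangle_ineq[of "Y - S N" "S N - S 0"] norm_triangle_ineq[of "Y - S N + (S N - S 0)" "S 0 - Y0"] by simp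
 also have "\<dots> \<le> growth * L + ((\<Sum>j<N. norm (a j)) + growth * (I 0 - I N)) + ((LINT w|M. E s w) - I 0)"
  by (intro add_mono YN sum[OF order_refl] Y0)
 also have "\<dots> \<le> growth * L + ((\<Sum>j<N. norm (a j)) + growth * L) + growth * L"
 proof -
  have "I 0 - I N \<le> L" "(LINT w|M. E s w) - I 0 \<le> L" "0 \<le> L" using L EsEt I0 I0' by linarith+
  moreover have "L \<le> growth * L" using growth mult_right_mono[OF growth(1) \<open>0 \<le> L\<close>] by simp
  ultimately show ?thesis using growth by (intro add_mono mult_left_mono) auto
 qed
 finally show ?thesis unfolding Y_def Y0_def a_def L_def p_def by simp
qed

end

section \<open>Vanishing of the accumulated errors\<close>

context girsanov_interval
begin

definition \<Psi> :: "real => nat => 'a => real" where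
 "\<Psi> R N w = (\<Sum>j<N. z R (grid N j) w * \<psi> R (grid N j) (grid N (Suc j)) w)"

definition \<Xi> :: "real => nat => 'a => real" where
 "\<Xi> R N w = (\<Sum>j<N. z R (grid N j) w * (1 - z (R + 1) (grid N (Suc j)) w))"

text \<open>Once the cells are shorter than the \<open>L\<close> of the path, every term of \<Psi>
  is at most \<epsilon> times the cell length and every term of \<Xi> is 0.\<close>

lemma \<Psi>_\<Xi>_tendsto:
 assumes cont: "continuous_on {0..T} (\<lambda>u. X u w)" and R: "0 < R"
 shows "(\<lambda>N. \<Psi> R N w) \<longlonglongrightarrow> 0" "(\<lambda>N. \<Xi> R N w) \<longlonglongrightarrow> 0"
proof -
 have ev: "\<exists>N0. \<forall>N\<ge>N0. \<bar>\<Psi> R N w\<bar> \<le> (t - s) * \<epsilon> \<and> \<Xi> R N w = 0" if \<epsilon>: "0 < \<epsilon>" for \<epsilon>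
 proof -
  obtain L where L: "0 < L" and step: "\<And>u v. u \<in> D ==> v \<in> D ==> u < v ==> v - u \<le> L ==> good R u w ==>
    good (R + 1) v w \<and> \<psi> R u v w \<le> \<epsilon> * (v - u)"
   using good_step[OF cont R \<epsilon>] by blast
  obtain N0 :: nat where N0: "(t - s) / L < real N0" using reals_Archimedean2 by blast
  show ?thesis
  proof (intro exI[of _ "Suc N0"] allI impI)
   fix N assume N: "Suc N0 \<le> N"
   then have N0': "0 < N" "(t - s) / L < real N" using N0 by auto
   have d: "(t - s) / real N \<le> L" using N0' L by (simp add: field_simps)
   have summand: "0 \<le> z R (grid N j) w * \<psi> R (grid N j) (grid N (Suc j)) w"
    "z R (grid N j) w * \<psi> R (grid N j) (grid N (Suc j)) w \<le> \<epsilon> * ((t - s) / real N)"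
    "z R (grid N j) w * (1 - z (R + 1) (grid N (Suc j)) w) = 0" if "j < N" for j
   proof -
    have eq: "grid N (Suc j) - grid N j = (t - s) / real N" by (simp add: grid_Suc)
    have D: "grid N j \<in> D" "grid N (Suc j) \<in> D" using grid_D[OF N0'(1)] that by auto
    note st' = step[OF D grid_less[OF N0'(1)]]
    show "0 \<le> z R (grid N j) w * \<psi> R (grid N j) (grid N (Suc j)) w"
     by (intro mult_nonneg_nonneg z_simps \<psi>_nonneg grid_mono) simp
    show "z R (grid N j) w * \<psi> R (grid N j) (grid N (Suc j)) w \<le> \<epsilon> * ((t - s) / real N)"
     using st' d \<epsilon> st by (auto simp: z_def eq)
    show "z R (grid N j) w * (1 - z (R + 1) (grid N (Suc j)) w) = 0"
     using st' d by (auto simp: z_def eq)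
   qed
   have "0 \<le> \<Psi> R N w" unfolding \<Psi>_def by (intro sum_nonneg summand) auto
   moreover have "\<Psi> R N w \<le> (\<Sum>j<N. \<epsilon> * ((t - s) / real N))" unfolding \<Psi>_def by (intro sum_mono summand) auto
   moreover have "(\<Sum>j<N. \<epsilon> * ((t - s) / real N)) = (t - s) * \<epsilon>" using N0'(1) by simp
   moreover have "\<Xi> R N w = 0" unfolding \<Xi>_def by (intro sum.neutral) (use summand in auto)
   ultimately show "\<bar>\<Psi> R N w\<bar> \<le> (t - s) * \<epsilon> \<and> \<Xi> R N w = 0" by simp
  qed
 qed
 show "(\<lambda>N. \<Psi> R N w) \<longlonglongrightarrow> 0"
 proof (rule LIMSEQ_I)
  fix r :: real assume r: "0 < r"
  have "0 < r / (2 * (t - s))" using r st by simp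
  from ev[OF this] obtain N0 where N0: "\<forall>N\<ge>N0. \<bar>\<Psi> R N w\<bar> \<le> (t - s) * (r / (2 * (t - s)))" by blast
  have "(t - s) * (r / (2 * (t - s))) = r / 2" using st by (simp add: field_simps)
  also have "\<dots> < r" using r by simp
  finally have "(t - s) * (r / (2 * (t - s))) < r" .
  then show "\<exists>no. \<forall>n\<ge>no. norm (\<Psi> R n w - 0) < r"
   using N0 by (intro exI[of _ N0]) (auto intro: le_less_trans)
 qed
 obtain N0 where "\<forall>N\<ge>N0. \<Xi> R N w = 0" using ev[OF zero_less_one] by blast
 then have "\<forall>\<^sub>F N in sequentially. \<Xi> R N w = 0" unfolding eventually_sequentially by blast
 then show "(\<lambda>N. \<Xi> R N w) \<longlonglongrightarrow> 0" by (rule tendsto_eventually)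
qed

text \<open>A summand is 1 only in a cell where the path ceases to be good, already at level
  \<open>R\<close>. It is thus at most the decrease of \<open>z R\<close> over the cell, and these
  decreases add up to at most 1.\<close>

lemma \<Xi>_bounds: "0 < R ==> 0 \<le> \<Xi> R N w \<and> \<Xi> R N w \<le> 1"
proof
 assume R: "0 < R"
 show "0 \<le> \<Xi> R N w" unfolding \<Xi>_def by (intro sum_nonneg mult_nonneg_nonneg) (auto simp: z_simps)
 have "z R (grid N j) w * (1 - z (R + 1) (grid N (Suc j)) w) \<le> z R (grid N j) w - z R (grid N (Suc j)) w" for j
 proof -
  have "z R (grid N (Suc j)) w \<le> z (R + 1) (grid N (Suc j)) w" by (rule z_mono[OF R])
  moreover have "z R (grid N (Suc j)) w \<le> z R (grid N j) w" by (intro z_antimono grid_mono) simp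
  moreover have "z R (grid N j) w = 0 \<or> z R (grid N j) w = 1" by (simp add: z_def)
  ultimately show ?thesis using z_simps[of R "grid N (Suc j)" w] by auto
 qed
 then have "\<Xi> R N w \<le> (\<Sum>j<N. z R (grid N j) w - z R (grid N (Suc j)) w)" unfolding \<Xi>_def by (intro sum_mono) simp
 also have "\<dots> = z R (grid N 0) w - z R (grid N N) w"
  using sum_lessThan_telescope[of "\<lambda>j. - z R (grid N j) w" N] by simp
 also have "\<dots> \<le> 1" using z_simps[of R "grid N 0" w] z_simps[of R "grid N N" w] by linarith
 finally show "\<Xi> R N w \<le> 1" .
qed

lemma \<Psi>_bound: "0 < R ==> \<bar>\<Psi> R N w\<bar> \<le> (t - s) * (C * (1 + (R + 2) powr m) * (6 * norm q + 2))"
proof (cases "N = 0")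
 case True
 then show ?thesis using C st by (simp add: \<Psi>_def)
next
 case False
 assume R: "0 < R"
 have "0 \<le> \<Psi> R N w" unfolding \<Psi>_def by (intro sum_nonneg mult_nonneg_nonneg z_simps \<psi>_nonneg grid_mono) simp
 moreover have "\<Psi> R N w \<le> (\<Sum>j<N. (t - s) / real N * (C * (1 + (R + 2) powr m) * (6 * norm q + 2)))"
  unfolding \<Psi>_def
 proof (rule sum_mono)
  fix j assume "j \<in> {..<N}"
  then have "grid N j \<in> D" using False by (intro grid_D) auto
  from z_\<psi>_bound[OF this grid_mono[of j "Suc j" N], of R w] R
  show "z R (grid N j) w * \<psi> R (grid N j) (grid N (Suc j)) w \<le> (t - s) / real N * (C * (1 + (R + 2) powr m) * (6 * norm q + 2))"
   by (simp add: grid_Suc)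
 qed
 moreover have "(\<Sum>j<N. (t - s) / real N * (C * (1 + (R + 2) powr m) * (6 * norm q + 2))) = (t - s) * (C * (1 + (R + 2) powr m) * (6 * norm q + 2))"
  using False by simp
 ultimately show ?thesis by simp
qed

lemma t_nonneg: "0 \<le> t"
 using s st by simp

lemma zM [measurable]:
 assumes "0 < N" "j \<le> N"
 shows "z R (grid N j) \<in> borel_measurable M"
 using measurable_G[OF z_measurable] grid_range[OF assms] by blast

lemma \<Psi>_measurable: "\<Psi> R N \<in> borel_measurable M"
 unfolding \<Psi>_def[abs_def]
proof (intro borel_measurable_sum borel_measurable_times)
 fix j assume "j \<in> {..<N}"
 then have j: "0 < N" "j \<le> N" by auto
 show "z R (grid N j) \<in> borel_measurable M" by (rule zM[OF j])
 show "\<psi> R (grid N j) (grid N (Suc j)) \<in> borel_measurable M"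
  using measurable_G[OF \<psi>_measurable[OF _ grid_mono]] grid_range[OF j] by simp
qed

lemma \<Xi>_measurable: "\<Xi> R N \<in> borel_measurable M"
 unfolding \<Xi>_def[abs_def]
 by (intro borel_measurable_sum borel_measurable_times borel_measurable_diff borel_measurable_const zM) auto

lemma \<Psi>_\<Xi>_integral_tendsto:
 assumes R: "0 < R"
 shows "(\<lambda>N. \<integral>w. \<Psi> R N w \<partial>M) \<longlonglongrightarrow> 0" "(\<lambda>N. \<integral>w. \<Xi> R N w * (E t w + 1) \<partial>M) \<longlonglongrightarrow> 0"
proof -
 have "(\<lambda>N. \<integral>w. \<Psi> R N w \<partial>M) \<longlonglongrightarrow> (LINT w|M. 0)"
 proof (rule integral_dominated_convergence)
  show "\<Psi> R N \<in> borel_measurable M" for N by (rule \<Psi>_measurable)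
  show "integrable M (\<lambda>w. (t - s) * (C * (1 + (R + 2) powr m) * (6 * norm q + 2)))" by simp
  show "AE w in M. norm (\<Psi> R N w) \<le> (t - s) * (C * (1 + (R + 2) powr m) * (6 * norm q + 2))" for N
   using \<Psi>_bound[OF R] by simp
  show "AE w in M. (\<lambda>N. \<Psi> R N w) \<longlonglongrightarrow> 0" using X_cont by eventually_elim (rule \<Psi>_\<Xi>_tendsto(1)[OF _ R])
 qed simp
 then show "(\<lambda>N. \<integral>w. \<Psi> R N w \<partial>M) \<longlonglongrightarrow> 0" by simp
 have "(\<lambda>N. \<integral>w. \<Xi> R N w * (E t w + 1) \<partial>M) \<longlonglongrightarrow> (LINT w|M. 0)"
 proof (rule integral_dominated_convergence)
  note [measurable] = \<Xi>_measurable measurable_G[OF E_measurable[OF t_nonneg]]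
  show "(\<lambda>w. \<Xi> R N w * (E t w + 1)) \<in> borel_measurable M" for N by measurable
  show "integrable M (\<lambda>w. E t w + 1)" using E_integrable[OF t_nonneg t] by simp
  show "AE w in M. norm (\<Xi> R N w * (E t w + 1)) \<le> E t w + 1" for N
  proof (rule AE_I2)
   fix w
   show "norm (\<Xi> R N w * (E t w + 1)) \<le> E t w + 1"
    using \<Xi>_bounds[OF R, of N w] E_nonneg[OF t_nonneg, of w] mult_right_mono[of "\<Xi> R N w" 1 "E t w + 1"]
    by (simp add: abs_mult)
  qed
  show "AE w in M. (\<lambda>N. \<Xi> R N w * (E t w + 1)) \<longlonglongrightarrow> 0"
   using X_cont by eventually_elim (rule tendsto_mult_left_zero[OF \<Psi>_\<Xi>_tendsto(2)[OF _ R]])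
 qed simp
 then show "(\<lambda>N. \<integral>w. \<Xi> R N w * (E t w + 1) \<partial>M) \<longlonglongrightarrow> 0" by simp
qed

text \<open>Summed over the cells, the deterministic part of \<open>err\<close> becomes
  \<open>(t - s) * (\<epsilon> + sqrt d)\<close>, and the other parts become the integrals of \<Psi>
  and of \<Xi> times \<open>E t + 1\<close>. The mesh tends to 0 with \<epsilon> fixed, and
  \<epsilon> is arbitrary.\<close>

lemma step_sum_tendsto:
 assumes k: "k \<in> borel_measurable (G s)" "\<And>w. norm (k w :: complex) \<le> 1" and R: "0 < R"
 shows "(\<lambda>N. \<Sum>j<N. norm (LINT w|M. E (grid N (Suc j)) w *\<^sub>R (k w * z R (grid N j) w * U N j w *
  (F (grid N j) (grid N (Suc j)) w - 1)))) \<longlonglongrightarrow> 0"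
  (is "(\<lambda>N. \<Sum>j<N. norm (?a N j)) \<longlonglongrightarrow> 0")
proof -
 obtain c where c: "c \<ge> 0" and est: "\<And>\<epsilon>. \<epsilon> > 0 ==> \<exists>d0>0. \<forall>u v H. u \<in> D --> v \<in> D --> u < v --> v - u \<le> d0 -->
  H \<in> borel_measurable (G u) --> (\<forall>w. norm (H w) \<le> growth * z R u w) -->
  norm (LINT w|M. E v w *\<^sub>R (H w * (F u v w - 1))) \<le> c * err R \<epsilon> u v"
  using step_estimate[OF R growth(2)] by blast
 define f where "f N = (t - s) * sqrt ((t - s) / real N) + (LINT w|M. \<Psi> R N w) + (LINT w|M. \<Xi> R N w * (E t w + 1))" for N
 have f: "f \<longlonglongrightarrow> 0"
 proof -
  have "(\<lambda>N. (t - s) / real N) \<longlonglongrightarrow> 0" by (rule lim_const_over_n)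
  from tendsto_real_sqrt[OF this] have "(\<lambda>N. (t - s) * sqrt ((t - s) / real N)) \<longlonglongrightarrow> 0"
   by (intro tendsto_mult_right_zero) simp
  from tendsto_add[OF tendsto_add[OF this \<Psi>_\<Xi>_integral_tendsto(1)[OF R]] \<Psi>_\<Xi>_integral_tendsto(2)[OF R]]
  show ?thesis by (simp add: f_def[abs_def])
 qed
 have bd: "\<exists>N0. \<forall>N\<ge>N0. (\<Sum>j<N. norm (?a N j)) \<le> c * ((t - s) * \<epsilon> + f N)" if \<epsilon>: "0 < \<epsilon>" for \<epsilon>
 proof -
  obtain d0 where d0: "d0 > 0" and est0: "\<forall>u v H. u \<in> D --> v \<in> D --> u < v --> v - u \<le> d0 -->
   H \<in> borel_measurable (G u) --> (\<forall>w. norm (H w) \<le> growth * z R u w) -->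
   norm (LINT w|M. E v w *\<^sub>R (H w * (F u v w - 1))) \<le> c * err R \<epsilon> u v"
   using est[OF \<epsilon>] by blast
  obtain N0 :: nat where N0: "(t - s) / d0 < real N0" using reals_Archimedean2 by blast
  show ?thesis
  proof (intro exI[of _ "Suc N0"] allI impI)
   fix N assume "Suc N0 \<le> N"
   then have N: "0 < N" "(t - s) / d0 < real N" using N0 by auto
   define d where "d = (t - s) / real N"
   have d: "d \<le> d0" using N d0 by (simp add: d_def field_simps)
   define A where "A j = (LINT w|M. z R (grid N j) w * \<psi> R (grid N j) (grid N (Suc j)) w)" for j
   define B where "B j = (LINT w|M. z R (grid N j) w * (1 - z (R + 1) (grid N (Suc j)) w) * (E t w + 1))" for j
   have a: "norm (?a N j) \<le> c * (d * (\<epsilon> + sqrt d) + A j + B j)" if j: "j < N" for j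
   proof -
    have L: "grid N (Suc j) - grid N j = d" by (simp add: grid_Suc d_def)
    have D: "grid N j \<in> D" "grid N (Suc j) \<in> D" using grid_D[OF N(1)] j by auto
    have jN: "j \<le> N" "Suc j \<le> N" using j by auto
    note r = grid_range[OF N(1) jN(1)] and r' = grid_range[OF N(1) jN(2)]
    define H where "H w = k w * complex_of_real (z R (grid N j) w) * U N j w" for w
    have HM: "H \<in> borel_measurable (G (grid N j))"
    proof -
     have [measurable]: "k \<in> borel_measurable (G (grid N j))" "z R (grid N j) \<in> borel_measurable (G (grid N j))"
       "U N j \<in> borel_measurable (G (grid N j))"
      using measurable_G_mono[OF k(1)] z_measurable U_measurable[OF N(1) jN(1)] r by auto
     show ?thesis unfolding H_def[abs_def] by measurable
    qed
    have Hb: "\<forall>w. norm (H w) \<le> growth * z R (grid N j) w"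
    proof
     fix w
     have "norm (H w) = norm (k w) * norm (U N j w) * z R (grid N j) w" by (simp add: H_def norm_mult z_simps)
     also have "\<dots> \<le> 1 * growth * z R (grid N j) w"
      using k(2) U_norm[OF jN(1)] z_simps(1) by (intro mult_mono mult_right_mono) auto
     finally show "norm (H w) \<le> growth * z R (grid N j) w" by simp
    qed
    \<comment> \<open>The weight is known at the right end of the cell, so the martingale property
      replaces \<open>E\<close> there by \<open>E t\<close>. This gives one integrable majorant for
      all cells and all partitions.\<close>
    have Beq: "(LINT w|M. z R (grid N j) w * (1 - z (R + 1) (grid N (Suc j)) w) * (E (grid N (Suc j)) w + 1)) = B j"
    proof -
     define y where "y w = z R (grid N j) w * (1 - z (R + 1) (grid N (Suc j)) w)" for w
     have yb: "\<bar>y w\<bar> \<le> 1" for w by (auto simp: y_def z_def)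
     have yM: "y \<in> borel_measurable (G (grid N (Suc j)))"
     proof -
      have [measurable]: "z R (grid N j) \<in> borel_measurable (G (grid N (Suc j)))" "z (R + 1) (grid N (Suc j)) \<in> borel_measurable (G (grid N (Suc j)))"
       using measurable_G_mono[OF z_measurable, of "grid N j"] z_measurable r r' grid_mono[of j "Suc j" N] by auto
      show ?thesis unfolding y_def[abs_def] by measurable
     qed
     have yM': "y \<in> borel_measurable M" by (rule measurable_G[OF yM])
     have i: "integrable M (\<lambda>w. y w * E u w)" if "0 \<le> u" "u \<le> T" for u
      using E_mult_integrable[OF that yM', of 1] yb by (simp add: mult.commute)
     have iy: "integrable M y" by (rule integrable_const_bound[of _ 1]) (use yb yM' in auto)
     have "(LINT w|M. y w * E (grid N (Suc j)) w) = (LINT w|M. y w * E t w)"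
      using E_martingale[OF _ _ t yM yb] r' by simp
     then show ?thesis unfolding B_def y_def[symmetric] distrib_left
      using i[OF t_nonneg t] i[of "grid N (Suc j)"] r' iy by simp
    qed
    have "norm (?a N j) \<le> c * (d * (\<epsilon> + sqrt d) + A j +
      (LINT w|M. z R (grid N j) w * (1 - z (R + 1) (grid N (Suc j)) w) * (E (grid N (Suc j)) w + 1)))"
     using est0[rule_format, OF D grid_less[OF N(1)] _ HM Hb[rule_format]] d unfolding err_def L A_def H_def by simp
    then show ?thesis unfolding Beq .
   qed
   have iA: "integrable M (\<lambda>w. z R (grid N j) w * \<psi> R (grid N j) (grid N (Suc j)) w)" if "j < N" for j
    using z_\<psi>_integrable[OF grid_D[OF N(1)] grid_mono] that R by simp
   have iB: "integrable M (\<lambda>w. z R (grid N j) w * (1 - z (R + 1) (grid N (Suc j)) w) * (E t w + 1))" if "j < N" for j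
    using z_E_integrable[OF _ _ t_nonneg t] grid_range[OF N(1)] that by simp
   have sA: "(\<Sum>j<N. A j) = (LINT w|M. \<Psi> R N w)"
    unfolding A_def \<Psi>_def by (rule Bochner_Integration.integral_sum[symmetric]) (use iA in auto)
   have sB: "(\<Sum>j<N. B j) = (LINT w|M. \<Xi> R N w * (E t w + 1))"
    unfolding B_def \<Xi>_def sum_distrib_right by (rule Bochner_Integration.integral_sum[symmetric]) (use iB in auto)
   have "(\<Sum>j<N. norm (?a N j)) \<le> (\<Sum>j<N. c * (d * (\<epsilon> + sqrt d) + A j + B j))"
    by (intro sum_mono a) simp
   also have "\<dots> = c * (real N * (d * (\<epsilon> + sqrt d)) + (\<Sum>j<N. A j) + (\<Sum>j<N. B j))"
    by (simp add: sum_distrib_left[symmetric] sum.distrib)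
   also have "\<dots> = c * ((t - s) * \<epsilon> + f N)"
    unfolding sA sB f_def using N(1) by (simp add: d_def distrib_left add.assoc)
   finally show "(\<Sum>j<N. norm (?a N j)) \<le> c * ((t - s) * \<epsilon> + f N)" .
  qed
 qed
 show ?thesis
 proof (rule LIMSEQ_I)
  fix r :: real assume r: "0 < r"
  \<comment> \<open>The added 1 covers \<open>c = 0\<close>.\<close>
  define \<epsilon> where "\<epsilon> = r / (2 * (c * (t - s) + 1))"
  have ct: "0 \<le> c * (t - s)" using c st by simp
  then have \<epsilon>: "0 < \<epsilon>" "c * (t - s) * \<epsilon> \<le> r / 2"
   using r by (auto simp: \<epsilon>_def field_simps)
  obtain N0 where N0: "\<forall>N\<ge>N0. (\<Sum>j<N. norm (?a N j)) \<le> c * ((t - s) * \<epsilon> + f N)" using bd[OF \<epsilon>(1)] by blast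
  have "(\<lambda>N. c * f N) \<longlonglongrightarrow> 0" by (rule tendsto_mult_right_zero[OF f])
  from LIMSEQ_D[OF this, of "r / 2"] r obtain N1 where N1: "\<forall>N\<ge>N1. norm (c * f N - 0) < r / 2" by auto
  show "\<exists>no. \<forall>n\<ge>no. norm ((\<Sum>j<n. norm (?a n j)) - 0) < r"
  proof (intro exI[of _ "max N0 N1"] allI impI)
   fix n assume n: "max N0 N1 \<le> n"
   have "(\<Sum>j<n. norm (?a n j)) \<le> c * ((t - s) * \<epsilon> + f n)" using N0 n by simp
   also have "\<dots> = c * (t - s) * \<epsilon> + c * f n" by (simp add: algebra_simps)
   also have "\<dots> < r" using N1[rule_format, of n] n \<epsilon>(2) by auto
   finally show "norm ((\<Sum>j<n. norm (?a n j)) - 0) < r" by (simp add: sum_nonneg)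
  qed
 qed
qed

lemma drift_continuous:
 assumes "continuous_on {0..T} (\<lambda>u. X u w)"
 shows "continuous_on {0..T} (\<lambda>u. drift u w)"
proof -
 have ch: "continuous_on {0..T} (\<lambda>r. h r (X r w))"
 proof -
  have "continuous_on {0..T} (\<lambda>r. (\<lambda>(t, x). h t x) (r, X r w))"
   by (rule continuous_on_compose2[OF h_cont]) (auto intro!: continuous_intros assms)
  then show ?thesis by simp
 qed
 have cD: "continuous_on {0..T} (\<lambda>r. Dh r (X r w))"
 proof -
  have "continuous_on {0..T} (\<lambda>r. (\<lambda>(t, x). Dh t x) (r, X r w))"
   by (rule continuous_on_compose2[OF Dh_cont]) (auto intro!: continuous_intros assms)
  then show ?thesis by simp
 qed
 have "\<forall>u\<in>{0..T}. h u (X u w) \<noteq> 0"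
 proof
  fix u assume "u \<in> {0..T}"
  then show "h u (X u w) \<noteq> 0" using h_pos[of u "X u w"] by simp
 qed
 then show ?thesis unfolding drift_def
  by (intro continuous_on_divide continuous_on_inner ch cD continuous_on_const)
qed

text \<open>Along a continuous path on a compact interval \<open>X\<close> is bounded and
  \<open>h\<close> attains a positive minimum, so the path is good at every sufficiently high
  level.\<close>

lemma z_tendsto_1:
 assumes cont: "continuous_on {0..T} (\<lambda>u. X u w)"
 shows "(\<lambda>n. z (real n) t w) \<longlonglongrightarrow> 1"
proof -
 have ch: "continuous_on {0..T} (\<lambda>r. h r (X r w))"
 proof -
  have "continuous_on {0..T} (\<lambda>r. (\<lambda>(t, x). h t x) (r, X r w))"
   by (rule continuous_on_compose2[OF h_cont]) (auto intro!: continuous_intros cont)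
  then show ?thesis by simp
 qed
 have cn: "continuous_on {0..T} (\<lambda>r. norm (X r w))" by (intro continuous_intros cont)
 have ne: "{0..T} \<noteq> {}" using st t s by simp
 obtain x where x: "\<And>r. r \<in> {0..T} ==> norm (X r w) \<le> norm (X x w)"
  using continuous_attains_sup[OF compact_Icc ne cn] by blast
 obtain y where y: "y \<in> {0..T}" "\<And>r. r \<in> {0..T} ==> h y (X y w) \<le> h r (X r w)"
  using continuous_attains_inf[OF compact_Icc ne ch] by blast
 have hy: "0 < h y (X y w)" using h_pos y(1) by simp
 obtain n0 :: nat where n0: "max (norm (X x w)) (1 / h y (X y w)) < real n0" using reals_Archimedean2 by blast
 have "good (real n) t w" if "n0 \<le> n" for n
  unfolding good_def
 proof (intro ballI impI)
  fix r assume r: "r \<in> D" "r \<le> t"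
  then have r': "r \<in> {0..T}" using D_range by auto
  have n: "norm (X x w) < real n" "1 / h y (X y w) < real n" using n0 that by auto
  have "0 < real n" using n(1) norm_ge_zero le_less_trans by blast
  then have "1 / real n \<le> h y (X y w)" using n(2) hy by (simp add: field_simps)
  then show "norm (X r w) \<le> real n \<and> 1 / real n \<le> h r (X r w)" using x[OF r'] y(2)[OF r'] n by linarith
 qed
 then have "\<forall>\<^sub>F n in sequentially. z (real n) t w = 1" unfolding eventually_sequentially by (auto simp: z_def)
 then show ?thesis by (rule tendsto_eventually)
qed

end

text \<open>With the level \<open>R\<close> fixed, the limit over partitions leaves an error of at
  most \<open>3 * growth\<close> times the \<open>E\<close>-mass of the paths that are not good;
  this mass vanishes as \<open>R\<close> tends to infinity.\<close>

theorem (in girsanov_interval) girsanov_char: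
 assumes k: "k \<in> borel_measurable (G s)" "\<And>w. norm (k w :: complex) \<le> 1"
  and I: "(\<lambda>w. LINT u:{0..s}|lborel. drift u w) \<in> borel_measurable M" "(\<lambda>w. LINT u:{0..t}|lborel. drift u w) \<in> borel_measurable M"
 shows "(LINT w|M. E t w *\<^sub>R (k w * cis ((\<beta> t w - (LINT u:{0..t}|lborel. drift u w)) - (\<beta> s w - (LINT u:{0..s}|lborel. drift u w)))))
  = of_real (exp (- ((t - s) * \<kappa> / 2))) * (LINT w|M. E s w *\<^sub>R k w)"
proof -
 \<comment> \<open>The limit of the full products, in which the Riemann sums have become drift
   integrals.\<close>
 define V where "V w = complex_of_real growth * cis (\<beta> t w - \<beta> s w - ((LINT u:{0..t}|lborel. drift u w) - (LINT u:{0..s}|lborel. drift u w)))" for w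
 have k': "norm (k w) \<le> (1 :: real)" for w by (rule k(2))
 \<comment> \<open>The index \<open>Suc N\<close> excludes the partition into 0 cells, whose right
   end is not \<open>t\<close>.\<close>
 have UV: "AE w in M. (\<lambda>N. U (Suc N) (Suc N) w) \<longlonglongrightarrow> V w"
  using X_cont
 proof eventually_elim
  case (elim w)
  have "continuous_on {0..t} (\<lambda>u. drift u w)"
   by (rule continuous_on_subset[OF drift_continuous[OF elim]]) (use t in auto)
  from Riemann_sum_tendsto[OF s st this]
  have "(\<lambda>N. \<Sum>i<N. (t - s) / real N * drift (grid N i) w) \<longlonglongrightarrow> (LINT u:{0..t}|lborel. drift u w) - (LINT u:{0..s}|lborel. drift u w)"
   by (simp add: grid_def)
  then have lim: "(\<lambda>N. \<Sum>i<Suc N. (t - s) / real (Suc N) * drift (grid (Suc N) i) w) \<longlonglongrightarrow> (LINT u:{0..t}|lborel. drift u w) - (LINT u:{0..s}|lborel. drift u w)"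
   by (rule LIMSEQ_Suc)
  have U_eq: "U (Suc N) (Suc N) w = complex_of_real growth * cis (\<beta> t w - \<beta> s w - (\<Sum>i<Suc N. (t - s) / real (Suc N) * drift (grid (Suc N) i) w))" for N
  proof -
   have "real (Suc N) * ((t - s) / real (Suc N) * \<kappa> / 2) = (t - s) * \<kappa> / 2" by (simp add: field_simps)
   then show ?thesis unfolding U_def growth_def grid_N[OF zero_less_Suc] by simp
  qed
  show ?case unfolding U_eq V_def cis_conv_exp
   by (intro tendsto_intros lim)
 qed
 note kM = measurable_G[OF k(1)]
 have UM: "U (Suc N) (Suc N) \<in> borel_measurable M" for N
  by (rule measurable_G[OF U_measurable]) auto
 obtain V' where V': "V' \<in> borel_measurable M" "AE w in M. (\<lambda>N. U (Suc N) (Suc N) w) \<longlonglongrightarrow> V' w"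
 proof
  show "(\<lambda>w. lim (\<lambda>N. U (Suc N) (Suc N) w)) \<in> borel_measurable M" by (intro borel_measurable_lim_metric UM)
  show "AE w in M. (\<lambda>N. U (Suc N) (Suc N) w) \<longlonglongrightarrow> lim (\<lambda>N. U (Suc N) (Suc N) w)"
   using UV by eventually_elim (metis limI)
 qed
 have VV': "AE w in M. V w = V' w" using UV V'(2) by eventually_elim (rule LIMSEQ_unique)
 define Y0 where "Y0 = (LINT w|M. E s w *\<^sub>R k w)"
 define Y where "Y N = (LINT w|M. E t w *\<^sub>R (k w * U (Suc N) (Suc N) w))" for N
 have lim: "Y \<longlonglongrightarrow> (LINT w|M. E t w *\<^sub>R (k w * V' w))"
  unfolding Y_def
 proof (rule integral_dominated_convergence)
  note [measurable] = measurable_G[OF E_measurable[OF t_nonneg]] kM UM V'(1)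
  show "(\<lambda>w. E t w *\<^sub>R (k w * V' w)) \<in> borel_measurable M" by measurable
  show "(\<lambda>w. E t w *\<^sub>R (k w * U (Suc N) (Suc N) w)) \<in> borel_measurable M" for N by measurable
  show "integrable M (\<lambda>w. growth * E t w)" using E_integrable[OF t_nonneg t] by simp
  show "AE w in M. norm (E t w *\<^sub>R (k w * U (Suc N) (Suc N) w)) \<le> growth * E t w" for N
  proof (rule AE_I2)
   fix w
   have "norm (E t w *\<^sub>R (k w * U (Suc N) (Suc N) w)) = E t w * (norm (k w) * norm (U (Suc N) (Suc N) w))"
    using E_nonneg[OF t_nonneg, of w] by (simp add: norm_mult)
   also have "\<dots> \<le> E t w * (1 * growth)"
    using E_nonneg[OF t_nonneg, of w] k' U_norm by (intro mult_left_mono mult_mono) auto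
   finally show "norm (E t w *\<^sub>R (k w * U (Suc N) (Suc N) w)) \<le> growth * E t w" by (simp add: mult.commute)
  qed
  show "AE w in M. (\<lambda>N. E t w *\<^sub>R (k w * U (Suc N) (Suc N) w)) \<longlonglongrightarrow> E t w *\<^sub>R (k w * V' w)"
   using V'(2) by eventually_elim (intro tendsto_intros)
 qed
 have bound: "norm ((LINT w|M. E t w *\<^sub>R (k w * V' w)) - Y0) \<le> 3 * growth * (LINT w|M. E t w * (1 - z R t w))" if R: "0 < R" for R
 proof (rule tendsto_le[OF sequentially_bot])
  show "(\<lambda>N. norm (Y N - Y0)) \<longlonglongrightarrow> norm ((LINT w|M. E t w *\<^sub>R (k w * V' w)) - Y0)" by (intro tendsto_intros lim)
  from tendsto_add[OF LIMSEQ_Suc[OF step_sum_tendsto[OF k(1) k' R]] tendsto_const[of "3 * growth * (LINT w|M. E t w * (1 - z R t w))"]]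
  show "(\<lambda>N. (\<Sum>j<Suc N. norm (LINT w|M. E (grid (Suc N) (Suc j)) w *\<^sub>R (k w * z R (grid (Suc N) j) w * U (Suc N) j w *
   (F (grid (Suc N) j) (grid (Suc N) (Suc j)) w - 1)))) + 3 * growth * (LINT w|M. E t w * (1 - z R t w))) \<longlonglongrightarrow> 3 * growth * (LINT w|M. E t w * (1 - z R t w))"
   unfolding add_0 .
  show "\<forall>\<^sub>F N in sequentially. norm (Y N - Y0) \<le> (\<Sum>j<Suc N. norm (LINT w|M. E (grid (Suc N) (Suc j)) w *\<^sub>R (k w * z R (grid (Suc N) j) w * U (Suc N) j w *
   (F (grid (Suc N) j) (grid (Suc N) (Suc j)) w - 1)))) + 3 * growth * (LINT w|M. E t w * (1 - z R t w))"
   unfolding Y_def Y0_def by (intro always_eventually allI partition_bound[OF k(1) k' zero_less_Suc])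
 qed
 have zlim: "(\<lambda>n. \<integral>w. E t w * (1 - z (real (Suc n)) t w) \<partial>M) \<longlonglongrightarrow> (LINT w|M. 0)"
 proof (rule integral_dominated_convergence)
  note [measurable] = measurable_G[OF E_measurable[OF t_nonneg]] measurable_G[OF z_measurable[OF t_nonneg]]
  show "(\<lambda>w. E t w * (1 - z (real (Suc n)) t w)) \<in> borel_measurable M" for n by measurable
  show "integrable M (E t)" by (rule E_integrable[OF t_nonneg t])
  show "AE w in M. norm (E t w * (1 - z (real (Suc n)) t w)) \<le> E t w" for n
   using E_nonneg[OF t_nonneg] by (intro AE_I2) (auto simp: z_def)
  show "AE w in M. (\<lambda>n. E t w * (1 - z (real (Suc n)) t w)) \<longlonglongrightarrow> 0"
   using X_cont
  proof eventually_elim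
   case (elim w)
   from LIMSEQ_Suc[OF z_tendsto_1[OF elim]]
   have "(\<lambda>n. E t w * (1 - z (real (Suc n)) t w)) \<longlonglongrightarrow> E t w * (1 - 1)" by (intro tendsto_intros)
   then show ?case by simp
  qed
 qed simp
 have "norm ((LINT w|M. E t w *\<^sub>R (k w * V' w)) - Y0) \<le> 3 * growth * (LINT w|M. (0 :: real))"
  by (rule LIMSEQ_le_const[OF tendsto_mult_left[OF zlim]]) (use bound in \<open>auto intro!: exI[of _ 0]\<close>)
 then have Y0: "(LINT w|M. E t w *\<^sub>R (k w * V' w)) = Y0" by simp
 define W where "W w = cis ((\<beta> t w - (LINT u:{0..t}|lborel. drift u w)) - (\<beta> s w - (LINT u:{0..s}|lborel. drift u w)))" for w
 have W: "V w = complex_of_real growth * W w" for w by (simp add: V_def W_def algebra_simps)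
 \<comment> \<open>Dividing by the compensator \<open>growth\<close> leaves the Gaussian
   characteristic function.\<close>
 have inv: "complex_of_real (exp (- ((t - s) * \<kappa> / 2))) * complex_of_real growth = 1"
  by (simp add: growth_def flip: of_real_mult exp_add)
 have gW: "AE w in M. W w = complex_of_real (exp (- ((t - s) * \<kappa> / 2))) * V' w"
  using VV'
 proof eventually_elim
  case (elim w)
  show ?case unfolding elim[symmetric] W mult.assoc[symmetric] inv by simp
 qed
 have W_int: "(LINT w|M. E t w *\<^sub>R (k w * W w)) = (LINT w|M. complex_of_real (exp (- ((t - s) * \<kappa> / 2))) * (E t w *\<^sub>R (k w * V' w)))"
 proof (rule integral_cong_AE)
  note [measurable] = measurable_G[OF E_measurable[OF t_nonneg]] kM V'(1) I measurable_G[OF \<beta>[OF t_nonneg]] measurable_G[OF \<beta>[OF s]]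
  show "(\<lambda>w. E t w *\<^sub>R (k w * W w)) \<in> borel_measurable M" unfolding W_def by measurable
  show "(\<lambda>w. complex_of_real (exp (- ((t - s) * \<kappa> / 2))) * (E t w *\<^sub>R (k w * V' w))) \<in> borel_measurable M" by measurable
  show "AE w in M. E t w *\<^sub>R (k w * W w) = complex_of_real (exp (- ((t - s) * \<kappa> / 2))) * (E t w *\<^sub>R (k w * V' w))"
   using gW by eventually_elim (simp add: mult_ac)
 qed
 show ?thesis unfolding W_def[symmetric] W_int integral_mult_right_zero Y0 Y0_def ..
qed

section \<open>Processes with independent Gaussian increments\<close>

text \<open>\<open>char\<close> states at once that increments are independent of the past and that
  they are Gaussian with variance \<open>v k\<close> per unit of time. It will hold for the
  canonical process under \<open>P\<close> and for \<open>Wh\<close> under \<open>Ph\<close>, with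
  the same \<open>v\<close>.\<close>

locale gaussian_increments = prob_space M for M :: "'w measure" +
 fixes G :: "real => 'w measure" and v :: "'k::{real_inner,banach,second_countable_topology} => real"
  and T :: real and W :: "real => 'w => 'k"
 assumes sub: "\<And>u. subalgebra M (G u)" and mono: "\<And>s t. s \<le> t ==> sets (G s) \<subseteq> sets (G t)"
  and W: "\<And>u. 0 \<le> u ==> u \<le> T ==> W u \<in> borel_measurable (G u)"
  and W0: "AE w in M. W 0 w = 0"
  and v_scale: "\<And>c k. v (c *\<^sub>R k) = c\<^sup>2 * v k" and v_nonneg: "\<And>k. 0 \<le> v k"
  and char: "\<And>s t f k. 0 \<le> s ==> s < t ==> t \<le> T ==> f \<in> borel_measurable (G s) ==> (\<And>w. norm (f w :: complex) \<le> 1) ==>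
   (LINT w|M. f w * cis ((W t w - W s w) \<bullet> k)) = of_real (exp (- ((t - s) * v k / 2))) * (LINT w|M. f w)"
begin

lemma W_M: "0 \<le> u ==> u \<le> T ==> W u \<in> borel_measurable M"
 by (rule measurable_from_subalg[OF sub W])

lemma W_mono: "0 \<le> s ==> s \<le> t ==> s \<le> T ==> W s \<in> borel_measurable (G t)"
 using W[of s] sub[of s] sub[of t] mono[of s t] by (auto simp: measurable_def subalgebra_def)

lemma char_increment:
 assumes "0 \<le> s" "s < t" "t \<le> T"
 shows "(LINT w|M. cis ((W t w - W s w) \<bullet> k)) = of_real (exp (- ((t - s) * v k / 2)))"
 using char[OF assms, of "\<lambda>_. 1" k] by (simp add: prob_space)

lemma wiener_process:
 assumes C: "\<And>k. C k \<bullet> k = v k" and cont: "AE w in M. continuous_on {0..T} (\<lambda>t. W t w)"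
 shows "wiener_process M G C {0..T} W"
 unfolding wiener_process_def
proof (intro conjI ballI impI)
 show "prob_space M" by unfold_locales
 show "W t \<in> borel_measurable (G t)" if "t \<in> {0..T}" for t using W that by simp
 show "AE w in M. W 0 w = 0" by (rule W0)
 show "AE w in M. continuous_on {0..T} (\<lambda>t. W t w)" by (rule cont)
 fix s t assume "s \<in> {0..T}" "t \<in> {0..T}" and st: "s < t"
 then have s: "0 \<le> s" "s \<le> T" and t: "0 \<le> t" "t \<le> T" by auto
 note [measurable] = W_M[OF s] W_M[OF t]
 show "indep_set (sets (G s)) {(\<lambda>w. W t w - W s w) -` B \<inter> space M | B. B \<in> sets borel}"
 proof (rule indep_setI_char)
  show "sets (G s) \<subseteq> events" using sub by (auto simp: subalgebra_def)
  fix A k assume A: "A \<in> sets (G s)"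
  then have [measurable]: "A \<in> events" using sub by (auto simp: subalgebra_def)
  have i: "(\<lambda>w. complex_of_real (indicat_real A w)) \<in> borel_measurable (G s)" using A by measurable
  have "(LINT w|M. complex_of_real (indicat_real A w) * cis ((W t w - W s w) \<bullet> k))
    = of_real (exp (- ((t - s) * v k / 2))) * (LINT w|M. complex_of_real (indicat_real A w))"
   by (rule char[OF s(1) st t(2) i]) (simp add: indicator_def)
  then show "(LINT w|M. indicator A w *\<^sub>R cis ((W t w - W s w) \<bullet> k)) = prob A *\<^sub>R (LINT w|M. cis ((W t w - W s w) \<bullet> k))"
   unfolding char_increment[OF s(1) st t(2)] by (simp add: scaleR_conv_of_real mult.commute)
 qed measurable
 show "centered_gaussian M (\<lambda>k. (t - s) *\<^sub>R C k) (\<lambda>w. W t w - W s w)"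
  unfolding centered_gaussian_def
 proof (intro conjI allI)
  fix k
  have V: "0 \<le> (t - s) * v k" using st v_nonneg by simp
  interpret N: prob_space "real_gaussian ((t - s) * v k)" by (rule prob_space_real_gaussian[OF V])
  interpret D: prob_space "distr M borel (\<lambda>w. (W t w - W s w) \<bullet> k)" by (rule prob_space_distr) measurable
  have "distr M borel (\<lambda>w. (W t w - W s w) \<bullet> k) = real_gaussian ((t - s) * v k)"
  proof (rule finite_measure_real_eqI_char)
   show "finite_measure (distr M borel (\<lambda>w. (W t w - W s w) \<bullet> k))" by unfold_locales
   show "finite_measure (real_gaussian ((t - s) * v k))" by unfold_locales
   fix r
   have "(\<integral>x. cis (r * x) \<partial>distr M borel (\<lambda>w. (W t w - W s w) \<bullet> k)) = (LINT w|M. cis ((W t w - W s w) \<bullet> (r *\<^sub>R k)))"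
    by (subst integral_distr) simp_all
   also have "\<dots> = of_real (exp (- ((t - s) * v k * r\<^sup>2) / 2))"
    unfolding char_increment[OF s(1) st t(2)] v_scale by (simp add: mult_ac)
   also have "\<dots> = (\<integral>x. cis (r * x) \<partial>real_gaussian ((t - s) * v k))"
    by (rule integral_cis_real_gaussian[OF V, symmetric])
   finally show "(\<integral>x. cis (r * x) \<partial>distr M borel (\<lambda>w. (W t w - W s w) \<bullet> k)) = (\<integral>x. cis (r * x) \<partial>real_gaussian ((t - s) * v k))" .
  qed simp_all
  then show "distr M borel (\<lambda>w. (W t w - W s w) \<bullet> k) = real_gaussian (((t - s) *\<^sub>R C k) \<bullet> k)" by (simp add: C)
 qed measurable
qed

end

text \<open>Two variables built in the same linear way from two processes: each component is the
  same finite combination of increments from time 0. The relation is closed under differences,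
  contains elementary integrals, and forces equal laws if both processes have Gaussian increments
  with the same variances.\<close>

definition linked :: "(real => 'w1 => 'k::real_inner) => (real => 'w2 => 'k) => real => ('w1 => 'h::real_inner) => ('w2 => 'h) => bool" where
 "linked W1 W2 T Y1 Y2 \<longleftrightarrow> (\<forall>x. \<exists>D k. finite D \<and> D \<subseteq> {0<..T} \<and>
  (\<forall>w. Y1 w \<bullet> x = (\<Sum>r\<in>D. (W1 r w - W1 0 w) \<bullet> k r)) \<and> (\<forall>w. Y2 w \<bullet> x = (\<Sum>r\<in>D. (W2 r w - W2 0 w) \<bullet> k r)))"

lemma linked_0: "linked W1 W2 T (\<lambda>_. 0) (\<lambda>_. 0)"
 unfolding linked_def by (intro allI exI[of _ "{}"] exI[of _ "\<lambda>_. 0"]) simp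

lemma linked_diff:
 fixes W1 :: "real => 'w1 => 'k::real_inner" and W2 :: "real => 'w2 => 'k"
 assumes "linked W1 W2 T Y1 Y2" "linked W1 W2 T Z1 Z2"
 shows "linked W1 W2 T (\<lambda>w. Y1 w - Z1 w) (\<lambda>w. Y2 w - Z2 w)"
 unfolding linked_def
proof
 fix x
 from assms(1)[unfolded linked_def, rule_format, of x]
 obtain D k where D: "finite D" "D \<subseteq> {0<..T}" "\<forall>w. Y1 w \<bullet> x = (\<Sum>r\<in>D. (W1 r w - W1 0 w) \<bullet> k r)" "\<forall>w. Y2 w \<bullet> x = (\<Sum>r\<in>D. (W2 r w - W2 0 w) \<bullet> k r)"
  by blast
 from assms(2)[unfolded linked_def, rule_format, of x]
 obtain D' k' where D': "finite D'" "D' \<subseteq> {0<..T}" "\<forall>w. Z1 w \<bullet> x = (\<Sum>r\<in>D'. (W1 r w - W1 0 w) \<bullet> k' r)" "\<forall>w. Z2 w \<bullet> x = (\<Sum>r\<in>D'. (W2 r w - W2 0 w) \<bullet> k' r)"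
  by blast
 define l where "l r = (if r \<in> D then k r else 0) - (if r \<in> D' then k' r else 0)" for r
 have *: "(\<Sum>r\<in>D. (W r w - W 0 w) \<bullet> k r) - (\<Sum>r\<in>D'. (W r w - W 0 w) \<bullet> k' r) = (\<Sum>r\<in>D \<union> D'. (W r w - W 0 w) \<bullet> l r)"
  for W :: "real => 'w => 'k" and w
 proof -
  have "(\<Sum>r\<in>A. (W r w - W 0 w) \<bullet> m r) = (\<Sum>r\<in>D \<union> D'. (W r w - W 0 w) \<bullet> (if r \<in> A then m r else 0))" if "A = D \<or> A = D'" for A m
   using that D(1) D'(1) by (intro sum.mono_neutral_cong_left) auto
  from this[of D k] this[of D' k'] show ?thesis unfolding l_def inner_diff_right sum_subtractf by simp
 qed
 show "\<exists>D k. finite D \<and> D \<subseteq> {0<..T} \<and> (\<forall>w. (Y1 w - Z1 w) \<bullet> x = (\<Sum>r\<in>D. (W1 r w - W1 0 w) \<bullet> k r)) \<and>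
   (\<forall>w. (Y2 w - Z2 w) \<bullet> x = (\<Sum>r\<in>D. (W2 r w - W2 0 w) \<bullet> k r))"
 proof (rule exI[of _ "D \<union> D'"], rule exI[of _ l], intro conjI allI)
  show "finite (D \<union> D')" "D \<union> D' \<subseteq> {0<..T}" using D(1,2) D'(1,2) by auto
  show "(Y1 w - Z1 w) \<bullet> x = (\<Sum>r\<in>D \<union> D'. (W1 r w - W1 0 w) \<bullet> l r)" for w
   unfolding inner_diff_left[of "Y1 w"] D(3)[rule_format] D'(3)[rule_format] by (rule *)
  show "(Y2 w - Z2 w) \<bullet> x = (\<Sum>r\<in>D \<union> D'. (W2 r w - W2 0 w) \<bullet> l r)" for w
   unfolding inner_diff_left[of "Y2 w"] D(4)[rule_format] D'(4)[rule_format] by (rule *)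
 qed
qed

lemma linked_add:
 assumes "linked W1 W2 T Y1 Y2" "linked W1 W2 T Z1 Z2"
 shows "linked W1 W2 T (\<lambda>w. Y1 w + Z1 w) (\<lambda>w. Y2 w + Z2 w)"
 using linked_diff[OF assms(1) linked_diff[OF linked_0 assms(2)]] by simp

lemma linked_sum:
 fixes Y1 :: "nat => 'w1 => 'h::real_inner"
 assumes "\<And>i. i < N ==> linked W1 W2 T (Y1 i) (Y2 i)"
 shows "linked W1 W2 T (\<lambda>w. \<Sum>i<N. Y1 i w) (\<lambda>w. \<Sum>i<N. Y2 i w)"
 using assms by (induction N) (simp_all add: linked_0 linked_add)

lemma linked_apply:
 fixes W1 :: "real => 'w1 => 'k::{real_inner,banach,second_countable_topology}" and W2 :: "real => 'w2 => 'k"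
  and L :: "'k => 'h::{real_inner,banach,second_countable_topology}"
 assumes L: "bounded_linear L" and t: "0 \<le> t" "t \<le> T"
 shows "linked W1 W2 T (\<lambda>w. L (W1 t w - W1 0 w)) (\<lambda>w. L (W2 t w - W2 0 w))"
 unfolding linked_def
proof (intro allI)
 fix x
 have *: "L (W t w - W 0 w) \<bullet> x = (\<Sum>r\<in>{t} - {0}. (W r w - W 0 w) \<bullet> adjoint L x)" for W :: "real => 'w => 'k" and w
  by (cases "t = 0") (simp_all add: adjoint_inner[OF L])
 show "\<exists>D k. finite D \<and> D \<subseteq> {0<..T} \<and> (\<forall>w. L (W1 t w - W1 0 w) \<bullet> x = (\<Sum>r\<in>D. (W1 r w - W1 0 w) \<bullet> k r)) \<and>
   (\<forall>w. L (W2 t w - W2 0 w) \<bullet> x = (\<Sum>r\<in>D. (W2 r w - W2 0 w) \<bullet> k r))"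
  by (rule exI[of _ "{t} - {0}"], rule exI[of _ "\<lambda>_. adjoint L x"]) (use t * in auto)
qed

lemma linked_elem_integral:
 fixes W1 :: "real => 'w1 => 'k::{real_inner,banach,second_countable_topology}" and W2 :: "real => 'w2 => 'k"
  and B :: "nat => 'k => 'h::{real_inner,banach,second_countable_topology}"
 assumes p: "\<And>i. i \<le> N ==> 0 \<le> p i" "\<And>i. i \<le> N ==> p i \<le> T" and B: "\<And>i. i < N ==> bounded_linear (B i)"
 shows "linked W1 W2 T (elem_integral W1 N p B) (elem_integral W2 N p B)"
proof -
 have "linked W1 W2 T (\<lambda>w. B i (W1 (p (Suc i)) w - W1 (p i) w)) (\<lambda>w. B i (W2 (p (Suc i)) w - W2 (p i) w))" if i: "i < N" for i
 proof -
  have "B i (x - y) = B i (x - z) - B i (y - z)" for x y z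
   using linear_diff[OF bounded_linear.linear[OF B[OF i]], of "x - z" "y - z"] by simp
  note * = this
  have 1: "B i (W1 (p (Suc i)) w - W1 (p i) w) = B i (W1 (p (Suc i)) w - W1 0 w) - B i (W1 (p i) w - W1 0 w)" for w by (rule *)
  have 2: "B i (W2 (p (Suc i)) w - W2 (p i) w) = B i (W2 (p (Suc i)) w - W2 0 w) - B i (W2 (p i) w - W2 0 w)" for w by (rule *)
  show ?thesis unfolding 1 2 using i by (intro linked_diff linked_apply B p) auto
 qed
 then show ?thesis unfolding elem_integral_def[abs_def] by (rule linked_sum)
qed

lemma linked_distr_eq:
 fixes W1 :: "real => 'w1 => 'k::{real_inner,banach,second_countable_topology}" and W2 :: "real => 'w2 => 'k"
  and Y1 :: "'w1 => 'h::{real_inner,second_countable_topology}"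
 assumes 1: "gaussian_increments M1 G1 v T W1" and 2: "gaussian_increments M2 G2 v T W2" and T: "0 \<le> T"
  and Y: "linked W1 W2 T Y1 Y2" and [measurable]: "Y1 \<in> borel_measurable M1" "Y2 \<in> borel_measurable M2"
 shows "distr M1 borel Y1 = distr M2 borel Y2"
proof -
 interpret M1: gaussian_increments M1 G1 v T W1 by (rule 1)
 interpret M2: gaussian_increments M2 G2 v T W2 by (rule 2)
 interpret D1: prob_space "distr M1 borel Y1" by (rule M1.prob_space_distr) measurable
 interpret D2: prob_space "distr M2 borel Y2" by (rule M2.prob_space_distr) measurable
 show ?thesis
 proof (rule finite_borel_measure_eqI_char)
  show "finite_measure (distr M1 borel Y1)" "finite_measure (distr M2 borel Y2)" by unfold_locales
  fix x
  from Y[unfolded linked_def, rule_format, of x]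
 obtain D k where D: "finite D" "D \<subseteq> {0<..T}" "\<forall>w. Y1 w \<bullet> x = (\<Sum>r\<in>D. (W1 r w - W1 0 w) \<bullet> k r)" "\<forall>w. Y2 w \<bullet> x = (\<Sum>r\<in>D. (W2 r w - W2 0 w) \<bullet> k r)"
  by blast
  have "(LINT w|M1. 1 * cis (\<Sum>r\<in>D. (W1 r w - W1 0 w) \<bullet> k r)) = (LINT w|M2. 1 * cis (\<Sum>r\<in>D. (W2 r w - W2 0 w) \<bullet> k r))"
  proof (rule increments_char_eq[where ?G1.0=G1 and ?G2.0=G2 and \<phi>="\<lambda>s t k. of_real (exp (- ((t - s) * v k / 2)))" and r=T and ?h1.0="\<lambda>_. 1" and ?h2.0="\<lambda>_. 1"])
   show "(LINT w|M1. 1 * (f w * cis ((W1 t w - W1 p w) \<bullet> k))) = of_real (exp (- ((t - p) * v k / 2))) * (LINT w|M1. 1 * f w)"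
    if "0 \<le> p" "p < t" "t \<le> T" "f \<in> borel_measurable (G1 p)" "\<And>w. norm (f w) \<le> 1" for p t f k
    using M1.char[OF that] by simp
   show "(LINT w|M2. 1 * (f w * cis ((W2 t w - W2 p w) \<bullet> k))) = of_real (exp (- ((t - p) * v k / 2))) * (LINT w|M2. 1 * f w)"
    if "0 \<le> p" "p < t" "t \<le> T" "f \<in> borel_measurable (G2 p)" "\<And>w. norm (f w) \<le> 1" for p t f k
    using M2.char[OF that] by simp
   show "W1 u \<in> borel_measurable (G1 p)" "W2 u \<in> borel_measurable (G2 p)" if "0 \<le> u" "u \<le> p" "p \<le> T" for u p
    using M1.W_mono[OF that(1,2)] M2.W_mono[OF that(1,2)] that by auto
   show "(LINT w|M1. 1) = (LINT w|M2. (1 :: complex))" by (simp add: M1.prob_space M2.prob_space)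
  qed (fact D)+
  then have eq: "(LINT w|M1. cis (Y1 w \<bullet> x)) = (LINT w|M2. cis (Y2 w \<bullet> x))" unfolding D(3,4)[rule_format] mult_1 .
  have "(\<integral>y. cis (y \<bullet> x) \<partial>distr M1 borel Y1) = (\<integral>\<omega>. cis (Y1 \<omega> \<bullet> x) \<partial>M1)"
   by (subst integral_distr) simp_all
  also have "\<dots> = (\<integral>\<omega>. cis (Y2 \<omega> \<bullet> x) \<partial>M2)"
   by (rule eq)
  also have "\<dots> = (\<integral>y. cis (y \<bullet> x) \<partial>distr M2 borel Y2)"
   by (subst integral_distr) simp_all
  finally show "(\<integral>y. cis (y \<bullet> x) \<partial>distr M1 borel Y1) = (\<integral>y. cis (y \<bullet> x) \<partial>distr M2 borel Y2)" .
 qed simp_all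
qed

section \<open>Measurability and regularity of time integrals along paths\<close>

lemma progressive_integral_measurable:
 fixes f :: "real => 'h::{second_countable_topology,real_normed_vector} => 'b::{banach,second_countable_topology}"
 assumes X: "(\<lambda>(r, w). X r w) \<in> borel_measurable (restrict_space borel {0..u} \<Otimes>\<^sub>M G)"
  and f: "continuous_on ({0..u} \<times> UNIV) (\<lambda>(t, x). f t x)"
 shows "(\<lambda>w. LINT r:{0..u}|lborel. f r (X r w)) \<in> borel_measurable G"
proof -
 let ?B = "restrict_space borel {0..u}" and ?L = "restrict_space lborel {0..u}"
 interpret L: finite_measure ?L
  by (rule finite_measureI) (simp add: emeasure_restrict_space space_restrict_space emeasure_lborel_Icc_eq)
 have 1: "(\<lambda>p. (fst p, X (fst p) (snd p))) \<in> measurable (?B \<Otimes>\<^sub>M G) (restrict_space borel ({0..u} \<times> UNIV))"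
 proof (rule measurable_restrict_space2)
  show "(\<lambda>p. (fst p, X (fst p) (snd p))) \<in> space (?B \<Otimes>\<^sub>M G) \<rightarrow> {0..u} \<times> UNIV"
   by (auto simp: space_pair_measure space_restrict_space)
  have "(\<lambda>x. x) \<in> borel_measurable ?B" by (rule measurable_restrict_space1) simp
  from measurable_compose[OF measurable_fst this] have "fst \<in> measurable (?B \<Otimes>\<^sub>M G) borel" .
  moreover have "(\<lambda>p. X (fst p) (snd p)) \<in> borel_measurable (?B \<Otimes>\<^sub>M G)" using X by (simp add: case_prod_beta)
  ultimately show "(\<lambda>p. (fst p, X (fst p) (snd p))) \<in> measurable (?B \<Otimes>\<^sub>M G) borel"
   by (rule borel_measurable_Pair)
 qed
 from measurable_compose[OF this borel_measurable_continuous_on_restrict[OF f]]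
 have "(\<lambda>(r, w). f r (X r w)) \<in> borel_measurable (?B \<Otimes>\<^sub>M G)" by (simp add: case_prod_beta)
 moreover have "sets (?B \<Otimes>\<^sub>M G) = sets (?L \<Otimes>\<^sub>M G)"
  by (intro sets_pair_measure_cong sets_restrict_space_cong) simp_all
 ultimately have "(\<lambda>(r, w). f r (X r w)) \<in> borel_measurable (?L \<Otimes>\<^sub>M G)" by (simp cong: measurable_cong_sets)
 from measurable_pair_swap[OF this] have "(\<lambda>(w, r). f r (X r w)) \<in> borel_measurable (G \<Otimes>\<^sub>M ?L)"
  by (simp add: case_prod_beta)
 from L.borel_measurable_lebesgue_integral[OF this]
 have "(\<lambda>w. \<integral>r. f r (X r w) \<partial>?L) \<in> borel_measurable G" by simp
 then show ?thesis unfolding set_lebesgue_integral_def by (simp add: integral_restrict_space)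
qed

lemma norm_set_integral_diff_le:
 fixes f :: "real => 'b::{banach,second_countable_topology}"
 assumes uv: "0 \<le> u" "u \<le> v" and f: "set_integrable lborel {0..v} f" and bd: "\<And>r. 0 \<le> r ==> r \<le> v ==> norm (f r) \<le> c"
 shows "norm ((LINT r:{0..v}|lborel. f r) - (LINT r:{0..u}|lborel. f r)) \<le> c * (v - u)"
proof -
 have "(LINT r:{u<..v}|lborel. f r) = (LINT r:{0..v}|lborel. indicator {u<..v} r *\<^sub>R f r)"
  unfolding set_lebesgue_integral_def using uv(1)
  by (intro Bochner_Integration.integral_cong refl) (auto simp: indicator_def)
 moreover have "norm (LINT r:{0..v}|lborel. indicator {u<..v} r *\<^sub>R f r) \<le> c * (v - u)"
 proof (rule norm_set_integral_Icc_le[OF uv])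
  have "set_integrable lborel {u<..v} f" by (rule set_integrable_subset[OF f]) (use uv in auto)
  then show "set_integrable lborel {0..v} (\<lambda>r. indicator {u<..v} r *\<^sub>R f r)"
   unfolding set_integrable_def
   by (rule Bochner_Integration.integrable_cong[THEN iffD1, rotated 2]) (use uv(1) in \<open>auto simp: indicator_def\<close>)
  show "norm (indicator {u<..v} r *\<^sub>R f r) \<le> indicator {u..} r * c" if "0 \<le> r" "r \<le> v" for r
   using bd[OF that] norm_ge_zero[of "f r"] by (auto simp: indicator_def simp del: norm_ge_zero)
 qed
 ultimately show ?thesis by (simp add: set_integral_Icc_diff[OF uv f])
qed

lemma continuous_on_set_integral_Icc:
 fixes f :: "real => 'b::{banach,second_countable_topology}"
 assumes f: "continuous_on {0..T} f"
 shows "continuous_on {0..T} (\<lambda>t. LINT r:{0..t}|lborel. f r)"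
proof -
 have "bounded (f ` {0..T})" by (intro compact_imp_bounded compact_continuous_image f compact_Icc)
 then obtain c where c: "c > 0" "\<And>r. 0 \<le> r ==> r \<le> T ==> norm (f r) \<le> c" by (auto simp: bounded_pos)
 have i: "set_integrable lborel {0..v} f" if "v \<le> T" for v
  by (rule borel_integrable_atLeastAtMost', rule continuous_on_subset[OF f]) (use that in auto)
 have *: "dist (LINT r:{0..v}|lborel. f r) (LINT r:{0..u}|lborel. f r) \<le> c * (v - u)" if "0 \<le> u" "u \<le> v" "v \<le> T" for u v
  unfolding dist_norm by (rule norm_set_integral_diff_le[OF that(1,2) i[OF that(3)]]) (use c that in auto)
 have "c-lipschitz_on {0..T} (\<lambda>t. LINT r:{0..t}|lborel. f r)"
 proof (rule lipschitz_onI)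
  fix x y assume "x \<in> {0..T}" "y \<in> {0..T}"
  then show "dist (LINT r:{0..x}|lborel. f r) (LINT r:{0..y}|lborel. f r) \<le> c * dist x y"
   using *[of x y] *[of y x] by (cases "x \<le> y") (auto simp: dist_commute dist_real_def)
 qed (use c in simp)
 then show ?thesis by (rule lipschitz_on_continuous_on)
qed

lemma exp_diff_le:
 fixes a b c :: real
 assumes "a \<le> c" "b \<le> c"
 shows "\<bar>exp a - exp b\<bar> \<le> exp c * \<bar>a - b\<bar>"
proof -
 have *: "exp x - exp y \<le> exp c * \<bar>x - y\<bar>" if "x \<le> c" for x y
 proof -
  have "1 + (y - x) \<le> exp (y - x)" by (rule exp_ge_add_one_self)
  then have "exp x * (1 + (y - x)) \<le> exp x * exp (y - x)" by (intro mult_left_mono) auto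
  also have "\<dots> = exp y" by (simp flip: exp_add)
  finally have "exp x - exp y \<le> exp x * (x - y)" by (simp add: algebra_simps)
  also have "\<dots> \<le> exp x * \<bar>x - y\<bar>" by (intro mult_left_mono) auto
  also have "\<dots> \<le> exp c * \<bar>x - y\<bar>" using that by (intro mult_right_mono) auto
  finally show ?thesis .
 qed
 show ?thesis using *[OF assms(1), of b] *[OF assms(2), of a] by (simp add: abs_minus_commute abs_le_iff)
qed

section \<open>The change of measure\<close>

text \<open>\<open>V\<close> stands for the generator applied to \<open>h\<close>, divided by
  \<open>h\<close>; \<open>m\<close> and \<open>C\<close> are a common exponent and constant for the
  growth of \<open>h\<close>, \<open>Dh\<close> and \<open>V\<close>.\<close>

locale h_transform = wiener_mild_solution J P S R F c\<^sub>F x\<^sub>0 X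
 for J :: "'h::{real_inner, banach, second_countable_topology}
        => 'k::{real_inner, banach, second_countable_topology}" and P S R F c\<^sub>F x\<^sub>0 X +
 fixes Ph :: "(real => 'k) measure" and h V :: "real => 'h => real" and Dh :: "real => 'h => 'h" and m C T :: real
 assumes R_sym: "\<And>x y. R x \<bullet> y = x \<bullet> R y"
  and h_cont: "continuous_on ({0..} \<times> UNIV) (\<lambda>(t, x). h t x)"
  and h_pos: "\<And>t x. 0 \<le> t ==> 0 < h t x"
  and h_bd: "\<And>t x. 0 \<le> t ==> \<bar>h t x\<bar> \<le> C * (1 + norm x powr m)"
  and Dh: "\<And>t x. 0 \<le> t ==> GDERIV (h t) x :> Dh t x"
  and Dh_cont: "continuous_on ({0..} \<times> UNIV) (\<lambda>(t, x). Dh t x)"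
  and Dh_bd: "\<And>t x. 0 \<le> t ==> norm (Dh t x) \<le> C * (1 + norm x powr m)"
  and V_cont: "continuous_on ({0..} \<times> UNIV) (\<lambda>(t, x). V t x)"
  and V_bd: "\<And>t x. 0 \<le> t ==> \<bar>V t x\<bar> \<le> C * (1 + norm x powr m)"
  and m: "0 \<le> m" and C: "0 \<le> C" and T: "0 < T"
  and E_mart: "is_martingale P \<F>
   (\<lambda>t w. h t (X t w) / h 0 x\<^sub>0 * exp (- (LINT s:{0..t}|lborel. V s (X s w))))"
  and Ph_sets: "sets Ph = sets path_borel"
  and Ph: "\<And>t B. t \<ge> 0 ==> B \<in> sets (\<F> t) ==> emeasure Ph B =
   (\<integral>\<^sup>+w\<in>B. ennreal (h t (X t w) / h 0 x\<^sub>0 * exp (- (LINT s:{0..t}|lborel. V s (X s w)))) \<partial>P)"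
begin

text \<open>The factor of the density without martingale part. It includes the normalisation by
  \<open>h 0 x\<^sub>0\<close>, so that the density is \<open>h\<close> along the solution times
  \<open>e\<close>.\<close>

definition e :: "real => (real => 'k) => real" where
 "e u w = exp (- (LINT s:{0..u}|lborel. V s (X s w))) / h 0 x\<^sub>0"

definition E :: "real => (real => 'k) => real" where "E u w = h u (X u w) * e u w"

definition Dlog :: "real => 'h => 'h" where "Dlog t x = Dh t x /\<^sub>R h t x"

definition Wh :: "real => (real => 'k) => 'k" where
 "Wh t w = coord t w - J (LINT r:{0..t}|lborel. R (Dlog r (X r w)))"

lemma E_eq: "h t (X t w) / h 0 x\<^sub>0 * exp (- (LINT s:{0..t}|lborel. V s (X s w))) = E t w"
 by (simp add: E_def e_def)

lemma X_progressive: "0 \<le> t ==> (\<lambda>(r, w). X r w) \<in> borel_measurable (restrict_space borel {0..t} \<Otimes>\<^sub>M \<F> t)"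
 using X unfolding mild_solution_def by auto

lemma continuous_along:
 assumes "continuous_on ({0..} \<times> UNIV) (\<lambda>(t, x). f t x)" "continuous_on {0..t} (\<lambda>r. X r w)"
 shows "continuous_on {0..t} (\<lambda>r. f r (X r w))"
proof -
 have "continuous_on {0..t} (\<lambda>r. (\<lambda>(t, x). f t x) (r, X r w))"
  by (rule continuous_on_compose2[OF assms(1)]) (auto intro!: continuous_intros assms(2))
 then show ?thesis by simp
qed

lemma continuous_on_Icc_times: "continuous_on ({0..} \<times> UNIV) g ==> continuous_on ({0..t :: real} \<times> UNIV) g"
 by (rule continuous_on_subset) auto

lemma e_measurable: "0 \<le> u ==> e u \<in> borel_measurable (\<F> u)"
 unfolding e_def[abs_def]
 using progressive_integral_measurable[OF X_progressive continuous_on_Icc_times[OF V_cont]] by measurable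

lemma e_pos: "0 < e u w"
 using h_pos[of 0 x\<^sub>0] by (simp add: e_def)

text \<open>\<open>V\<close> grows polynomially, so it is bounded by \<open>c1\<close> along a path
  that stays in a ball, and \<open>e\<close> is an exponential of its time integral.\<close>

lemma e_local_bound:
 "\<exists>c\<ge>0. AE y in P. \<forall>u v. 0 \<le> u --> u \<le> v --> v \<le> T --> (\<forall>r\<in>{0..v}. norm (X r y) \<le> \<rho>) -->
  e v y \<le> c \<and> \<bar>e v y - e u y\<bar> \<le> c * (v - u)"
proof -
 define c1 where "c1 = C * (1 + \<rho> powr m)"
 have c1: "0 \<le> c1" using C by (simp add: c1_def)
 have h0: "0 < h 0 x\<^sub>0" using h_pos by simp
 \<comment> \<open>The factor \<open>1 + c1\<close> lets one constant serve as the bound, which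
   needs 1, and as the Lipschitz constant in time, which needs \<open>c1\<close>.\<close>
 define c where "c = exp (c1 * T) * (1 + c1) / h 0 x\<^sub>0"
 have c: "0 \<le> c" using c1 h0 by (simp add: c_def)
 show ?thesis
 proof (rule exI[of _ c], intro conjI c)
  show "AE y in P. \<forall>u v. 0 \<le> u --> u \<le> v --> v \<le> T --> (\<forall>r\<in>{0..v}. norm (X r y) \<le> \<rho>) -->
    e v y \<le> c \<and> \<bar>e v y - e u y\<bar> \<le> c * (v - u)"
   using AE_restr_P[OF X_continuous[OF less_imp_le[OF T]]]
  proof eventually_elim
   case (elim y)
   show ?case
   proof (intro allI impI)
    fix u v assume uv: "0 \<le> u" "u \<le> v" "v \<le> T" and X\<rho>: "\<forall>r\<in>{0..v}. norm (X r y) \<le> \<rho>"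
    have Vb: "\<bar>V r (X r y)\<bar> \<le> c1" if "0 \<le> r" "r \<le> v" for r
    proof -
     have "norm (X r y) powr m \<le> \<rho> powr m" using X\<rho> that m by (intro powr_mono2) auto
     then have "C * (1 + norm (X r y) powr m) \<le> c1" unfolding c1_def using C by (intro mult_left_mono) auto
     then show ?thesis using V_bd[OF that(1), of "X r y"] by linarith
    qed
    define I where "I w = (LINT s:{0..w}|lborel. V s (X s y))" for w
    have i: "set_integrable lborel {0..v} (\<lambda>r. V r (X r y))"
     by (rule borel_integrable_atLeastAtMost', rule continuous_along[OF V_cont], rule continuous_on_subset[OF elim])
      (use uv in auto)
    have Iw: "\<bar>I w\<bar> \<le> c1 * T" if w: "0 \<le> w" "w \<le> v" for w
    proof -
     have "norm (I w) \<le> c1 * (w - 0)" unfolding I_def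
      by (rule norm_set_integral_Icc_le) (use w Vb set_integrable_subset[OF i, of "{0..w}"] in \<open>auto simp: indicator_def\<close>)
     also have "\<dots> \<le> c1 * T" using w uv c1 by (intro mult_left_mono) auto
     finally show ?thesis by simp
    qed
    have Id: "\<bar>I v - I u\<bar> \<le> c1 * (v - u)"
    proof -
     have "norm (I v - I u) \<le> c1 * (v - u)" unfolding I_def
      by (rule norm_set_integral_diff_le[OF uv(1,2) i]) (use Vb in auto)
     then show ?thesis by simp
    qed
    have ev: "e w y = exp (- I w) / h 0 x\<^sub>0" for w by (simp add: e_def I_def)
    have v0: "0 \<le> v" using uv by simp
    have le: "- I u \<le> c1 * T" "- I v \<le> c1 * T" using Iw[OF uv(1,2)] Iw[OF v0 order_refl] by auto
    have "exp (- I v) \<le> exp (c1 * T) * (1 + c1)"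
    proof -
     have "exp (- I v) \<le> exp (c1 * T) * 1" using le(2) by simp
     also have "\<dots> \<le> exp (c1 * T) * (1 + c1)" using c1 by (intro mult_left_mono) auto
     finally show ?thesis .
    qed
    then have 1: "e v y \<le> c" unfolding ev c_def using h0 by (intro divide_right_mono) auto
    have "\<bar>exp (- I v) - exp (- I u)\<bar> \<le> exp (c1 * T) * \<bar>- I v - - I u\<bar>" by (rule exp_diff_le[OF le(2,1)])
    also have "\<dots> \<le> exp (c1 * T) * (c1 * (v - u))" using Id by (intro mult_left_mono) auto
    also have "\<dots> \<le> exp (c1 * T) * ((1 + c1) * (v - u))" using uv by (intro mult_left_mono mult_right_mono) auto
    finally have "\<bar>exp (- I v) - exp (- I u)\<bar> / h 0 x\<^sub>0 \<le> exp (c1 * T) * (1 + c1) * (v - u) / h 0 x\<^sub>0"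
     using h0 by (intro divide_right_mono) (auto simp: mult.assoc)
    then have "\<bar>e v y - e u y\<bar> \<le> c * (v - u)" unfolding ev c_def
     using h0 by (simp add: abs_div flip: diff_divide_distrib)
    with 1 show "e v y \<le> c \<and> \<bar>e v y - e u y\<bar> \<le> c * (v - u)" by simp
   qed
  qed
 qed
qed

lemma E_measurable: "0 \<le> u ==> E u \<in> borel_measurable (\<F> u)"
 using E_mart unfolding is_martingale_def E_eq by auto

lemma E_integrable: "0 \<le> u ==> integrable P (E u)"
 using E_mart unfolding is_martingale_def E_eq by auto

text \<open>A bounded function of the past may be pulled into the conditional expectation; this is
  the form in which the abstract theorem wants the martingale property.\<close>

lemma E_martingale:
 assumes uv: "0 \<le> u" "u \<le> v" and H: "H \<in> borel_measurable (\<F> u)" "\<And>x. \<bar>H x\<bar> \<le> b"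
 shows "(LINT x|P. H x * E v x) = (LINT x|P. H x * E u x)"
proof -
 interpret f: finite_measure_subalgebra P "\<F> u"
  by unfold_locales (rule subalgebra_canonical)
 have v: "0 \<le> v" using uv by simp
 have HP: "H \<in> borel_measurable P" by (rule measurable_canonical_P[OF H(1)])
 have EM: "E w \<in> borel_measurable P" if "0 \<le> w" for w by (rule measurable_canonical_P[OF E_measurable[OF that]])
 have i: "integrable P (\<lambda>x. H x * E v x)"
 proof (rule Bochner_Integration.integrable_bound)
  show "integrable P (\<lambda>x. b * E v x)" using E_integrable[OF v] by simp
  have "0 \<le> b" using H(2)[of undefined] by linarith
  then show "AE x in P. norm (H x * E v x) \<le> norm (b * E v x)"
   using H(2) by (intro AE_I2) (auto simp: abs_mult intro!: mult_right_mono)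
 qed (use HP EM[OF v] in measurable)
 have AE: "AE x in P. real_cond_exp P (\<F> u) (E v) x = E u x"
  using E_mart uv unfolding is_martingale_def E_eq by auto
 have "(LINT x|P. H x * E v x) = (LINT x|P. H x * real_cond_exp P (\<F> u) (E v) x)"
  by (rule f.real_cond_exp_intg(2)[OF i H(1) EM[OF v], symmetric])
 also have "\<dots> = (LINT x|P. H x * E u x)"
 proof (rule integral_cong_AE)
  show "(\<lambda>x. H x * real_cond_exp P (\<F> u) (E v) x) \<in> borel_measurable P"
   using HP by measurable
  show "(\<lambda>x. H x * E u x) \<in> borel_measurable P" using HP EM[OF uv(1)] by measurable
  show "AE x in P. H x * real_cond_exp P (\<F> u) (E v) x = H x * E u x"
   using AE by eventually_elim simp
 qed
 finally show ?thesis .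
qed

text \<open>Every coordinate \<open>k\<close> of the Wiener process is treated on its own. A shift
  of the path in direction \<open>J (adjoint J k)\<close> moves the solution in direction
  \<open>R (adjoint J k)\<close>, which takes the role of \<open>q\<close>.\<close>

lemma abstract_girsanov:
 "abstract_girsanov P \<F> T X h Dh e (\<lambda>u w. coord u w \<bullet> k) (R (adjoint J k)) (\<kappa> k) m C"
proof
 show "subalgebra P (\<F> u)" for u by (rule subalgebra_canonical)
 show "sets (\<F> u) \<subseteq> sets (\<F> v)" if "u \<le> v" for u v :: real
  using that by (rule canonical_filtration_mono)
 show "X u \<in> borel_measurable (\<F> u)" if "0 \<le> u" for u using that by (rule X_canonical)
 show "AE w in P. continuous_on {0..T} (\<lambda>u. X u w)"
  by (rule AE_restr_P[OF X_continuous]) (use T in simp)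
 show "continuous_on ({0..} \<times> UNIV) (\<lambda>(t, x). h t x)" by (rule h_cont)
 show "continuous_on ({0..} \<times> UNIV) (\<lambda>(t, x). Dh t x)" by (rule Dh_cont)
 show "\<exists>c\<ge>0. AE w in P. \<forall>u v. 0 \<le> u --> u \<le> v --> v \<le> T --> (\<forall>r\<in>{0..v}. norm (X r w) \<le> \<rho>) -->
   e v w \<le> c \<and> \<bar>e v w - e u w\<bar> \<le> c * (v - u)" for \<rho> by (rule e_local_bound)
 show "integrable P (\<lambda>w. h u (X u w) * e u w)" if "0 \<le> u" "u \<le> T" for u
  using E_integrable[OF that(1)] by (simp add: E_def[abs_def])
 show "(LINT w|P. H w * (h v (X v w) * e v w)) = (LINT w|P. H w * (h u (X u w) * e u w))"
  if "0 \<le> u" "u \<le> v" "v \<le> T" "H \<in> borel_measurable (\<F> u)" "\<And>w. \<bar>H w\<bar> \<le> b" for u v H b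
  using E_martingale[OF that(1,2,4,5)] by (simp add: E_def)
 show "(\<lambda>w. coord u w \<bullet> k) \<in> borel_measurable (\<F> u)" if "0 \<le> u" for u
  unfolding coord_def using that by (intro borel_measurable_inner coord_measurable_canonical borel_measurable_const) auto
 show "distr P borel (\<lambda>w. coord v w \<bullet> k - coord u w \<bullet> k) = real_gaussian ((v - u) * \<kappa> k)" if "0 \<le> u" "u \<le> v" for u v
  using distr_increment[OF that, of k] by (simp add: coord_def inner_diff_left)
 show "\<exists>d>0. \<forall>u v. 0 \<le> u --> u < v --> v \<le> T --> v - u \<le> d --> (\<exists>Y. cm_shift P (\<F> u) (X v) (\<lambda>w. a * (coord v w \<bullet> k - coord u w \<bullet> k) - (v - u) * \<kappa> k / 2)
    ((a * (v - u)) *\<^sub>R R (adjoint J k)) (\<epsilon> * (v - u)) Y)"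
  if a: "\<bar>a\<bar> = 1" and \<epsilon>: "0 < \<epsilon>" for a \<epsilon>
 proof -
  have "\<bar>a\<bar>\<^sup>2 = 1" unfolding a by simp
  \<comment> \<open>For both signs the compensator in \<open>tilt\<close> is then the one that
    \<open>cm_shift\<close> expects.\<close>
  then have a2: "a\<^sup>2 = 1" by simp
  obtain d where d: "d > 0" and near: "\<And>s t. 0 \<le> s ==> s < t ==> t \<le> T ==> t - s \<le> d ==>
    (AE w in P. norm (X t (path_shift s (a *\<^sub>R J (adjoint J k)) w) - X t w - (a * (t - s)) *\<^sub>R R (adjoint J k)) \<le> \<epsilon> * (t - s))"
   using X_path_shift_approx[OF less_imp_le[OF T] \<epsilon>, of a k] by blast
  show ?thesis
  proof (rule exI[of _ d], intro conjI d allI impI)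
   fix u v assume uv: "0 \<le> u" "u < v" "v \<le> T" "v - u \<le> d"
   then have v: "0 \<le> v" by simp
   let ?Y = "\<lambda>w. X v (path_shift u (a *\<^sub>R J (adjoint J k)) w)"
   have "cm_shift P (\<F> u) (X v) (\<lambda>w. a * (coord v w \<bullet> k - coord u w \<bullet> k) - (v - u) * \<kappa> k / 2)
    ((a * (v - u)) *\<^sub>R R (adjoint J k)) (\<epsilon> * (v - u)) ?Y"
    unfolding cm_shift_def
   proof (intro conjI allI impI)
    show "AE w in P. norm (?Y w - X v w - (a * (v - u)) *\<^sub>R R (adjoint J k)) \<le> \<epsilon> * (v - u)"
     using near[OF uv] .
    have "X v \<in> borel_measurable (natural_filtration (v + 1))"
     by (rule measurable_filtration_mono[OF X_canonical[OF v]]) (simp_all add: canonical_filtration_natural)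
    then have "?Y \<in> borel_measurable (natural_filtration (v + 1))"
     by (rule measurable_compose[OF path_shift_measurable])
    then show "?Y \<in> borel_measurable P" by (rule measurable_from_subalg[OF subalgebra_natural])
    fix H :: "(real => 'k) => complex" and f :: "'h => real" and b c :: real
    assume H: "H \<in> borel_measurable (\<F> u)" "\<forall>w. norm (H w) \<le> b" and f: "f \<in> borel_measurable borel" "\<forall>x. \<bar>f x\<bar> \<le> c"
    have "(LINT w|P. (f (X v w) * tilt a k u v w) *\<^sub>R H w) = (LINT w|P. f (?Y w) *\<^sub>R H w)"
     by (rule integral_tilt_X[OF uv(1) less_imp_le[OF uv(2)] H(1) H(2)[rule_format] f(1) f(2)[rule_format]])
    then show "(LINT w|P. (f (X v w) * exp (a * (coord v w \<bullet> k - coord u w \<bullet> k) - (v - u) * \<kappa> k / 2)) *\<^sub>R H w) =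
      (LINT w|P. f (?Y w) *\<^sub>R H w)"
     by (simp add: a2 coord_def inner_diff_left)
   qed
   then show "\<exists>Y. cm_shift P (\<F> u) (X v) (\<lambda>w. a * (coord v w \<bullet> k - coord u w \<bullet> k) - (v - u) * \<kappa> k / 2)
    ((a * (v - u)) *\<^sub>R R (adjoint J k)) (\<epsilon> * (v - u)) Y"
    by blast
  qed
 qed
qed (use h_pos h_bd Dh Dh_bd m C e_measurable e_pos in auto)

end

context h_transform
begin

lemma girsanov_interval:
 assumes "0 \<le> s" "s < t" "t \<le> T"
 shows "girsanov_interval P \<F> T X h Dh e (\<lambda>u w. coord u w \<bullet> k) (R (adjoint J k)) (\<kappa> k) m C s t"
 by (intro girsanov_interval.intro abstract_girsanov girsanov_interval_axioms.intro assms)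

lemma Dlog_cont: "continuous_on ({0..} \<times> UNIV) (\<lambda>(t, x). Dlog t x)"
proof -
 have "continuous_on ({0..} \<times> UNIV) (\<lambda>p. (\<lambda>(t, x). Dh t x) p /\<^sub>R (\<lambda>(t, x). h t x) p)"
  by (intro continuous_on_scaleR continuous_on_inverse h_cont Dh_cont) (use h_pos in \<open>auto simp: less_imp_neq[THEN not_sym]\<close>)
 then show ?thesis by (simp add: Dlog_def[abs_def] case_prod_beta)
qed

lemma RDlog_cont: "continuous_on ({0..} \<times> UNIV) (\<lambda>(t, x). R (Dlog t x))"
 using bounded_linear.continuous_on[OF R Dlog_cont] by (simp add: case_prod_beta)

lemma Wh_canonical: "0 \<le> u ==> Wh u \<in> borel_measurable (\<F> u)"
proof -
 assume u: "0 \<le> u"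
 have "(\<lambda>w. LINT r:{0..u}|lborel. R (Dlog r (X r w))) \<in> borel_measurable (\<F> u)"
  by (rule progressive_integral_measurable[OF X_progressive[OF u] continuous_on_Icc_times[OF RDlog_cont]])
 then have "(\<lambda>w. J (LINT r:{0..u}|lborel. R (Dlog r (X r w)))) \<in> borel_measurable (\<F> u)"
  by (rule borel_measurable_continuous_on[OF linear_continuous_on[OF J]])
 then show ?thesis unfolding Wh_def[abs_def] coord_def
  using u by (intro borel_measurable_diff coord_measurable_canonical) auto
qed

text \<open>Moving \<open>J\<close> and the self-adjoint \<open>R\<close> to the other side of the
  inner product turns the drift of \<open>Wh\<close>, tested with \<open>k\<close>, into the
  derivative of \<open>ln h\<close> in direction \<open>R (adjoint J k)\<close>. Continuity of the
  path makes the integrand integrable, so inner product and integral commute.\<close>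

lemma Wh_inner:
 assumes cont: "continuous_on {0..u} (\<lambda>r. X r w)"
 shows "Wh u w \<bullet> k = coord u w \<bullet> k - (LINT r:{0..u}|lborel. (Dh r (X r w) \<bullet> R (adjoint J k)) / h r (X r w))"
proof -
 have i: "set_integrable lborel {0..u} (\<lambda>r. R (Dlog r (X r w)))"
  by (rule borel_integrable_atLeastAtMost'[OF continuous_along[OF RDlog_cont cont]])
 have "J (LINT r:{0..u}|lborel. R (Dlog r (X r w))) \<bullet> k = (LINT r:{0..u}|lborel. R (Dlog r (X r w))) \<bullet> adjoint J k"
  by (rule adjoint_inner[OF J])
 also have "\<dots> = (LINT r:{0..u}|lborel. R (Dlog r (X r w)) \<bullet> adjoint J k)"
  unfolding set_lebesgue_integral_def
  using integral_inner_left[OF i[unfolded set_integrable_def], of "adjoint J k"] by simp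
 also have "\<dots> = (LINT r:{0..u}|lborel. (Dh r (X r w) \<bullet> R (adjoint J k)) / h r (X r w))"
  by (simp add: R_sym Dlog_def divide_inverse mult.commute)
 finally show ?thesis by (simp add: Wh_def inner_diff_left)
qed

lemma X_cont_P: "AE w in P. continuous_on {0..T} (\<lambda>r. X r w)"
 by (rule AE_restr_P[OF X_continuous]) (use T in simp)

lemma char_E:
 assumes st: "0 \<le> s" "s < t" "t \<le> T" and f: "f \<in> borel_measurable (\<F> s)" "\<And>w. norm (f w :: complex) \<le> 1"
 shows "(LINT w|P. E t w *\<^sub>R (f w * cis ((Wh t w - Wh s w) \<bullet> k))) =
  of_real (exp (- ((t - s) * \<kappa> k / 2))) * (LINT w|P. E s w *\<^sub>R f w)"
proof -
 interpret gi: girsanov_interval P \<F> T X h Dh e "\<lambda>u w. coord u w \<bullet> k" "R (adjoint J k)" "\<kappa> k" m C s t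
  by (rule girsanov_interval[OF st])
 have t0: "0 \<le> t" using st by simp
 have E: "gi.E = E" by (simp add: fun_eq_iff gi.E_def E_def)
 have dm: "(\<lambda>w. LINT r:{0..u}|lborel. gi.drift r w) \<in> borel_measurable P" if u: "0 \<le> u" for u
 proof -
  have "continuous_on ({0..} \<times> UNIV) (\<lambda>(r, x). Dlog r x \<bullet> R (adjoint J k))"
   using continuous_on_inner[OF Dlog_cont continuous_on_const] by (simp add: case_prod_beta)
  then have "(\<lambda>w. LINT r:{0..u}|lborel. Dlog r (X r w) \<bullet> R (adjoint J k)) \<in> borel_measurable (\<F> u)"
   by (intro progressive_integral_measurable[OF X_progressive[OF u]] continuous_on_Icc_times)
  then have "(\<lambda>w. LINT r:{0..u}|lborel. gi.drift r w) \<in> borel_measurable (\<F> u)"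
   by (simp add: gi.drift_def Dlog_def divide_inverse mult.commute)
  then show ?thesis by (rule measurable_canonical_P)
 qed
 have WhP: "Wh u \<in> borel_measurable P" if "0 \<le> u" for u
  by (rule measurable_canonical_P[OF Wh_canonical[OF that]])
 have cP: "(\<lambda>w. coord u w \<bullet> k) \<in> borel_measurable P" if "0 \<le> u" for u
  unfolding coord_def using that by measurable
 have EP: "E t \<in> borel_measurable P" by (rule measurable_canonical_P[OF E_measurable[OF t0]])
 have fP: "f \<in> borel_measurable P" by (rule measurable_canonical_P[OF f(1)])
 have "(LINT w|P. E t w *\<^sub>R (f w * cis ((Wh t w - Wh s w) \<bullet> k))) =
  (LINT w|P. E t w *\<^sub>R (f w * cis ((coord t w \<bullet> k - (LINT u:{0..t}|lborel. gi.drift u w)) - (coord s w \<bullet> k - (LINT u:{0..s}|lborel. gi.drift u w)))))"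
 proof (rule integral_cong_AE)
  note [measurable] = WhP[OF t0] WhP[OF st(1)] EP fP cP[OF t0] cP[OF st(1)] dm[OF t0] dm[OF st(1)]
  show "(\<lambda>w. E t w *\<^sub>R (f w * cis ((Wh t w - Wh s w) \<bullet> k))) \<in> borel_measurable P" by measurable
  show "(\<lambda>w. E t w *\<^sub>R (f w * cis ((coord t w \<bullet> k - (LINT u:{0..t}|lborel. gi.drift u w)) - (coord s w \<bullet> k - (LINT u:{0..s}|lborel. gi.drift u w))))) \<in> borel_measurable P"
   by measurable
  show "AE w in P. E t w *\<^sub>R (f w * cis ((Wh t w - Wh s w) \<bullet> k)) =
   E t w *\<^sub>R (f w * cis ((coord t w \<bullet> k - (LINT u:{0..t}|lborel. gi.drift u w)) - (coord s w \<bullet> k - (LINT u:{0..s}|lborel. gi.drift u w))))"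
   using X_cont_P
  proof eventually_elim
   case (elim w)
   have c: "continuous_on {0..t} (\<lambda>r. X r w)" "continuous_on {0..s} (\<lambda>r. X r w)"
    by (rule continuous_on_subset[OF elim], use st in auto)+
   have "(Wh t w - Wh s w) \<bullet> k = (coord t w \<bullet> k - (LINT u:{0..t}|lborel. gi.drift u w)) - (coord s w \<bullet> k - (LINT u:{0..s}|lborel. gi.drift u w))"
    unfolding inner_diff_left Wh_inner[OF c(1)] Wh_inner[OF c(2)] gi.drift_def ..
   then show ?case by (simp only:)
  qed
 qed
 also have "\<dots> = of_real (exp (- ((t - s) * \<kappa> k / 2))) * (LINT w|P. E s w *\<^sub>R f w)"
  using gi.girsanov_char[OF f dm[OF st(1)] dm[OF t0]] unfolding E .
 finally show ?thesis .
qed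

lemma space_Ph: "space Ph = path_space"
 using sets_eq_imp_space_eq[OF Ph_sets] sets_eq_imp_space_eq[OF P_sets] by simp

lemma subalgebra_Ph: "subalgebra Ph (\<F> t)"
 using canonical_filtration_path_borel Ph_sets space_Ph by (auto simp: subalgebra_def)

lemma E_nonneg: "0 \<le> u ==> 0 \<le> E u w"
 unfolding E_def using h_pos[of u "X u w"] e_pos[of u w] by simp

text \<open>\<open>Ph\<close> is tied to \<open>P\<close> on each \<open>\<F> t\<close> separately,
  so integrals and null sets are transferred through the restrictions to
  \<open>\<F> t\<close>.\<close>

lemma restr_Ph:
 assumes t: "0 \<le> t"
 shows "restr_to_subalg Ph (\<F> t) = density (restr_to_subalg P (\<F> t)) (\<lambda>w. ennreal (E t w))"
proof (rule measure_eqI)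
 show "sets (restr_to_subalg Ph (\<F> t)) = sets (density (restr_to_subalg P (\<F> t)) (\<lambda>w. ennreal (E t w)))"
  by (simp add: sets_restr_to_subalg[OF subalgebra_Ph] sets_restr_to_subalg[OF subalgebra_canonical])
 fix A assume "A \<in> sets (restr_to_subalg Ph (\<F> t))"
 then have A: "A \<in> sets (\<F> t)" by (simp add: sets_restr_to_subalg[OF subalgebra_Ph])
 have m: "(\<lambda>w. ennreal (E t w) * indicator A w) \<in> borel_measurable (\<F> t)"
  using A E_measurable[OF t] by measurable
 have m': "(\<lambda>w. ennreal (E t w)) \<in> borel_measurable (restr_to_subalg P (\<F> t))"
  using E_measurable[OF t] by (simp cong: measurable_cong_sets add: sets_restr_to_subalg[OF subalgebra_canonical])
 have "emeasure (density (restr_to_subalg P (\<F> t)) (\<lambda>w. ennreal (E t w))) A =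
   (\<integral>\<^sup>+w. ennreal (E t w) * indicator A w \<partial>restr_to_subalg P (\<F> t))"
  by (rule emeasure_density[OF m']) (simp add: A sets_restr_to_subalg[OF subalgebra_canonical])
 also have "\<dots> = (\<integral>\<^sup>+w. ennreal (E t w) * indicator A w \<partial>P)"
  by (rule nn_integral_subalgebra2[OF subalgebra_canonical m])
 also have "\<dots> = emeasure (restr_to_subalg Ph (\<F> t)) A"
  using Ph[OF t A] unfolding E_eq emeasure_restr_to_subalg[OF subalgebra_Ph A] ..
 finally show "emeasure (restr_to_subalg Ph (\<F> t)) A =
   emeasure (density (restr_to_subalg P (\<F> t)) (\<lambda>w. ennreal (E t w))) A" ..
qed

lemma measurable_restr_P: "f \<in> borel_measurable (\<F> t) ==> f \<in> borel_measurable (restr_to_subalg P (\<F> t))"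
 by (simp cong: measurable_cong_sets add: sets_restr_to_subalg[OF subalgebra_canonical])

lemma integral_Ph:
 fixes f :: "(real => 'k) => complex"
 assumes t: "0 \<le> t" and f: "f \<in> borel_measurable (\<F> t)"
 shows "(LINT w|Ph. f w) = (LINT w|P. E t w *\<^sub>R f w)"
proof -
 have "(LINT w|Ph. f w) = (\<integral>w. f w \<partial>restr_to_subalg Ph (\<F> t))"
  by (rule integral_subalgebra2[OF subalgebra_Ph f, symmetric])
 also have "\<dots> = (\<integral>w. E t w *\<^sub>R f w \<partial>restr_to_subalg P (\<F> t))"
  unfolding restr_Ph[OF t]
  by (rule integral_density[OF measurable_restr_P[OF f] measurable_restr_P[OF E_measurable[OF t]]]) (simp add: E_nonneg[OF t])
 also have "\<dots> = (LINT w|P. E t w *\<^sub>R f w)"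
  by (rule integral_subalgebra2[OF subalgebra_canonical]) (use f E_measurable[OF t] in measurable)
 finally show ?thesis .
qed

text \<open>Absolute continuity on \<open>\<F> t\<close>: this is why exceptional sets have been
  kept inside \<open>\<F> t\<close>.\<close>

lemma AE_restr_Ph:
 assumes t: "0 \<le> t" and "AE w in restr_to_subalg P (\<F> t). Q w"
 shows "AE w in restr_to_subalg Ph (\<F> t). Q w"
proof -
 have "(\<lambda>w. ennreal (E t w)) \<in> borel_measurable (restr_to_subalg P (\<F> t))"
  using E_measurable[OF t] by (intro measurable_restr_P) measurable
 from AE_density[OF this] assms(2) show ?thesis unfolding restr_Ph[OF t] by auto
qed

lemma AE_Ph:
 assumes "0 \<le> t" "AE w in restr_to_subalg P (\<F> t). Q w"
 shows "AE w in Ph. Q w"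
 by (rule AE_restr_to_subalg[OF subalgebra_Ph AE_restr_Ph[OF assms]])

text \<open>At time 0 the time integral in the mild equation is over a single point, and the
  stochastic integral is a limit of elementary integrals over this point, all of which are 0. The
  value makes the density at time 0 equal to 1.\<close>

lemma X_0: "AE w in restr_to_subalg P (\<F> 0). X 0 w = x\<^sub>0"
proof -
 have "(0 :: real) \<in> {0..}" by simp
 from bspec[OF X[unfolded mild_solution_def] this] obtain Z where Z: "Z \<in> borel_measurable (\<F> 0)" "has_stoch_integral P J coord (\<lambda>u. S (0 - u) \<circ> R) 0 0 Z"
  and eq: "AE w in restr_to_subalg P (\<F> 0). X 0 w = S (0 - 0) x\<^sub>0 + (LINT u:{0..0}|lborel. S (0 - u) (F u (X u w))) + Z w"
  by (elim conjE bexE) (rule that)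
 obtain N p B where p: "\<And>n. 0 \<le> p n 0" "\<And>n. p n (N n) \<le> 0" "\<And>n i. i < N n ==> p n i \<le> p n (Suc i)"
  and B: "\<And>n i. i < N n ==> bounded_linear (B n i)"
  and lim: "AE w in P. (\<lambda>n. elem_integral coord (N n) (p n) (B n) w) \<longlonglongrightarrow> Z w"
 proof (rule has_stoch_integral_AE[OF Z(2)])
  show "coord u \<in> borel_measurable P" if "0 \<le> u" "u \<le> 0" for u
   using coord_measurable[OF that(1)] by (simp add: coord_def[abs_def])
 qed (rule that)
 have el: "elem_integral coord (N n) (p n) (B n) w = 0" for n w
 proof -
  have mono: "p n i \<le> p n j" if "i \<le> j" "j \<le> N n" for i j
   using that p(3) by (induction j rule: dec_induct) (auto intro: order_trans)
  have "p n i = 0" if "i \<le> N n" for i using mono[of 0 i] mono[of i "N n"] that p(1,2)[of n] by auto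
  then show ?thesis unfolding elem_integral_def
   using linear_0[OF bounded_linear.linear[OF B[of _ n]]] by (intro sum.neutral) simp
 qed
 have "AE w in P. Z w = 0" using lim unfolding el by eventually_elim (simp add: LIMSEQ_const_iff)
 then have "AE w in restr_to_subalg P (\<F> 0). Z w = 0"
  by (rule AE_restr_to_subalg2[OF subalgebra_canonical]) (use Z(1) in measurable)
 with eq show ?thesis
 proof eventually_elim
  case (elim w)
  have "(LINT u:{0..0}|lborel. S (0 - u) (F u (X u w))) = 0"
   unfolding set_lebesgue_integral_def
   by (intro integral_eq_zero_AE AE_I'[of "{0}"]) (auto simp: null_sets_def indicator_def)
  moreover have "S 0 = id" using S by (simp add: C0_semigroup_def)
  ultimately show ?case using elim by simp
 qed
qed

text \<open>The density at time 0 is 1 almost surely, so the total mass can be read off on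
  \<open>\<F> 0\<close>.\<close>

lemma prob_space_Ph: "prob_space Ph"
proof
 have "emeasure Ph (space Ph) = emeasure (restr_to_subalg Ph (\<F> 0)) (space Ph)"
  by (rule emeasure_restr_to_subalg[OF subalgebra_Ph, symmetric]) (metis sets.top space_canonical_filtration space_Ph)
 also have "\<dots> = (\<integral>\<^sup>+w. ennreal (E 0 w) * indicator (space Ph) w \<partial>restr_to_subalg P (\<F> 0))"
  unfolding restr_Ph[OF order_refl]
 proof (rule emeasure_density)
  show "(\<lambda>w. ennreal (E 0 w)) \<in> borel_measurable (restr_to_subalg P (\<F> 0))"
   using E_measurable[OF order_refl] by (intro measurable_restr_P) measurable
  show "space Ph \<in> sets (restr_to_subalg P (\<F> 0))"
   unfolding sets_restr_to_subalg[OF subalgebra_canonical] by (metis sets.top space_canonical_filtration space_Ph)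
 qed
 also have "\<dots> = (\<integral>\<^sup>+w. 1 \<partial>restr_to_subalg P (\<F> 0))"
 proof (rule nn_integral_cong_AE)
  have "(LINT s:{0..0}|lborel. V s (X s w)) = 0" for w
   unfolding set_lebesgue_integral_def
   by (intro integral_eq_zero_AE AE_I'[of "{0}"]) (auto simp: null_sets_def indicator_def)
  then have E0: "E 0 w = 1" if "X 0 w = x\<^sub>0" for w using h_pos[of 0 x\<^sub>0] that by (simp add: E_def e_def)
  have "AE w in restr_to_subalg P (\<F> 0). w \<in> space Ph"
   by (rule AE_I2) (simp add: space_restr_to_subalg space_Ph)
  with X_0 show "AE w in restr_to_subalg P (\<F> 0). ennreal (E 0 w) * indicator (space Ph) w = 1"
   by eventually_elim (simp add: E0)
 qed
 also have "\<dots> = 1"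
  using prob_space.emeasure_space_1[OF prob_space_restr_to_subalg[OF subalgebra_canonical prob_space_axioms]] by simp
 finally show "emeasure Ph (space Ph) = 1" .
qed

lemma \<kappa>_scale: "\<kappa> (c *\<^sub>R k) = c\<^sup>2 * \<kappa> k"
 using linear_scale[OF adjoint_linear_hilbert[OF J], of c k] by (simp add: power_mult_distrib)

lemma coord_0: "AE w in P. coord 0 w = 0"
 using P_wiener by (simp add: cylindrical_wiener_def wiener_process_def)

lemma coord_canonical: "0 \<le> u ==> coord u \<in> borel_measurable (\<F> u)"
 using coord_measurable_canonical[of u u] by (simp add: coord_def[abs_def])

lemma gaussian_P: "gaussian_increments P \<F> \<kappa> T coord"
proof
  show "subalgebra P (\<F> u)" for u by (rule subalgebra_canonical)
  show "sets (\<F> s) \<subseteq> sets (\<F> t)" if "s \<le> t" for s t :: real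
   using that by (rule canonical_filtration_mono)
  show "\<kappa> (c *\<^sub>R k) = c\<^sup>2 * \<kappa> k" for c k by (rule \<kappa>_scale)
  show "0 \<le> \<kappa> k" for k by simp
  show "coord u \<in> borel_measurable (\<F> u)" if "0 \<le> u" "u \<le> T" for u
   using that(1) by (rule coord_canonical)
  show "AE w in P. coord 0 w = 0" by (rule coord_0)
  show "(LINT w|P. f w * cis ((coord t w - coord s w) \<bullet> k)) = of_real (exp (- ((t - s) * \<kappa> k / 2))) * (LINT w|P. f w)"
   if st: "0 \<le> s" "s < t" "t \<le> T" and f: "f \<in> borel_measurable (\<F> s)" "\<And>w. norm (f w) \<le> 1" for s t f k
  proof -
   have i: "integrable P f"
    by (rule integrable_const_bound[of _ 1]) (use f(2) measurable_canonical_P[OF f(1)] in auto)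
   \<comment> \<open>With \<open>a = 0\<close> the tilt is the constant 1.\<close>
   show ?thesis using integral_mult_tilt_cis(2)[OF st(1) less_imp_le[OF st(2)] f(1) i, of 0 k k] by (simp add: coord_def mult.commute)
  qed
qed

lemma Wh_0: "AE w in Ph. Wh 0 w = 0"
proof (rule AE_Ph[OF order_refl])
 have "AE w in restr_to_subalg P (\<F> 0). coord 0 w = (0 :: 'k)"
  by (rule AE_restr_to_subalg2[OF subalgebra_canonical coord_0]) (use coord_canonical[of 0] in measurable)
 then show "AE w in restr_to_subalg P (\<F> 0). Wh 0 w = 0"
 proof eventually_elim
  case (elim w)
  have "(LINT r:{0..0}|lborel. R (Dlog r (X r w))) = 0"
   unfolding set_lebesgue_integral_def
   by (intro integral_eq_zero_AE AE_I'[of "{0}"]) (auto simp: null_sets_def indicator_def)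
  then show ?case using elim linear_0[OF bounded_linear.linear[OF J]] by (simp add: Wh_def)
 qed
qed

text \<open>Integrals under \<open>Ph\<close> of functions known at \<open>t\<close> are integrals
  under \<open>P\<close> with the density \<open>E t\<close>, and \<open>char_E\<close> evaluates
  these.\<close>

lemma gaussian_Ph: "gaussian_increments Ph \<F> \<kappa> T Wh"
proof -
 interpret Ph: prob_space Ph by (rule prob_space_Ph)
 show ?thesis
 proof
  show "subalgebra Ph (\<F> u)" for u by (rule subalgebra_Ph)
  show "sets (\<F> s) \<subseteq> sets (\<F> t)" if "s \<le> t" for s t :: real
   using that by (rule canonical_filtration_mono)
  show "\<kappa> (c *\<^sub>R k) = c\<^sup>2 * \<kappa> k" for c k by (rule \<kappa>_scale)
  show "0 \<le> \<kappa> k" for k by simp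
  show "Wh u \<in> borel_measurable (\<F> u)" if "0 \<le> u" "u \<le> T" for u
   using that(1) by (rule Wh_canonical)
  show "AE w in Ph. Wh 0 w = 0" by (rule Wh_0)
  show "(LINT w|Ph. f w * cis ((Wh t w - Wh s w) \<bullet> k)) = of_real (exp (- ((t - s) * \<kappa> k / 2))) * (LINT w|Ph. f w)"
   if st: "0 \<le> s" "s < t" "t \<le> T" and f: "f \<in> borel_measurable (\<F> s)" "\<And>w. norm (f w) \<le> 1" for s t f k
  proof -
   have t: "0 \<le> t" and st': "s \<le> t" using st by auto
   note [measurable] = measurable_canonical_mono[OF f(1) st'] Wh_canonical[OF t] measurable_canonical_mono[OF Wh_canonical[OF st(1)] st']
   have m: "(\<lambda>w. f w * cis ((Wh t w - Wh s w) \<bullet> k)) \<in> borel_measurable (\<F> t)" by measurable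
   show ?thesis unfolding integral_Ph[OF t m] integral_Ph[OF st(1) f(1)] by (rule char_E[OF st f])
  qed
 qed
qed

lemma cylindrical_wiener_Wh: "cylindrical_wiener Ph \<F> J {0..T} Wh"
 unfolding cylindrical_wiener_def
proof (rule gaussian_increments.wiener_process[OF gaussian_Ph])
 show "(J \<circ> adjoint J) k \<bullet> k = \<kappa> k" for k by (simp add: inner_adjoint_J power2_norm_eq_inner)
 have T0: "0 \<le> T" using T by simp
 have "AE w in Ph. w \<in> path_space" by (rule AE_I2) (simp add: space_Ph)
 with AE_Ph[OF T0 X_continuous[OF T0]] show "AE w in Ph. continuous_on {0..T} (\<lambda>t. Wh t w)"
 proof eventually_elim
  case (elim w)
  have "continuous_on {0..T} w" by (rule continuous_on_subset[OF path_space_continuous[OF elim(2)]]) auto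
  moreover have "continuous_on {0..T} (\<lambda>t. J (LINT r:{0..t}|lborel. R (Dlog r (X r w))))"
   by (intro bounded_linear.continuous_on[OF J] continuous_on_set_integral_Icc continuous_along[OF RDlog_cont] elim)
  ultimately show ?case unfolding Wh_def coord_def by (rule continuous_on_diff)
 qed
qed

end

section \<open>The stochastic convolution under the new measure\<close>

context h_transform
begin

lemma elem_integral_canonical:
 fixes p :: "nat => real" and B :: "nat => 'k => 'h"
 assumes W: "\<And>u. 0 \<le> u ==> u \<le> t ==> W u \<in> borel_measurable (\<F> t)"
  and p: "\<And>i. i \<le> N ==> 0 \<le> p i" "\<And>i. i \<le> N ==> p i \<le> t" and B: "\<And>i. i < N ==> bounded_linear (B i)"
 shows "elem_integral W N p B \<in> borel_measurable (\<F> t)"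
 unfolding elem_integral_def[abs_def]
proof (rule borel_measurable_sum)
 fix i assume "i \<in> {..<N}"
 then have i: "i < N" "i \<le> N" "Suc i \<le> N" by auto
 show "(\<lambda>w. B i (W (p (Suc i)) w - W (p i) w)) \<in> borel_measurable (\<F> t)"
  by (rule borel_measurable_continuous_on[OF linear_continuous_on[OF B[OF i(1)]]]) (intro borel_measurable_diff W p i)
qed

text \<open>Only exceptional sets in \<open>\<F> t\<close> transfer to \<open>Ph\<close>.
  Convergence of the elementary integrals to \<open>Z\<close> is itself an event of
  \<open>\<F> t\<close>, so it may be asserted for the restricted measure.\<close>

lemma stoch_integral_restr:
 fixes \<Phi> :: "real => 'h => 'h"
 assumes t: "0 \<le> t" and Z: "has_stoch_integral P J coord \<Phi> 0 t Z" "Z \<in> borel_measurable (\<F> t)"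
 obtains N p B where
  "\<And>n. 0 \<le> p n 0" "\<And>n. p n (N n) \<le> t" "\<And>n i. i < N n ==> p n i \<le> p n (Suc i)"
  "\<And>n i. i < N n ==> bounded_linear (B n i)"
  "(\<lambda>n. \<integral>\<^sup>+u\<in>{0..t}. hs_norm_sq (\<lambda>v. \<Phi> u v - elem_op (N n) (p n) (B n) u (J v)) \<partial>lborel) \<longlonglongrightarrow> 0"
  "(\<lambda>n. \<integral>\<^sup>+w. ennreal ((norm (Z w - elem_integral coord (N n) (p n) (B n) w))\<^sup>2) \<partial>P) \<longlonglongrightarrow> 0"
  "AE w in restr_to_subalg P (\<F> t). (\<lambda>n. elem_integral coord (N n) (p n) (B n) w) \<longlonglongrightarrow> Z w"
  "\<And>n i. i \<le> N n ==> 0 \<le> p n i" "\<And>n i. i \<le> N n ==> p n i \<le> t"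
proof -
 have coord_t: "coord u \<in> borel_measurable (\<F> t)" if "0 \<le> u" "u \<le> t" for u
  using coord_measurable_canonical[OF that] by (simp add: coord_def[abs_def])
 show thesis
 proof (rule has_stoch_integral_AE[OF Z(1)])
  show "coord u \<in> borel_measurable P" if "0 \<le> u" "u \<le> t" for u
   by (rule measurable_canonical_P[OF coord_t[OF that]])
  fix N p B
  assume *: "\<And>n. 0 \<le> p n 0" "\<And>n. p n (N n) \<le> t" "\<And>n i. i < N n ==> p n i \<le> p n (Suc i)"
   "\<And>n i. i < N n ==> bounded_linear (B n i)"
   "(\<lambda>n. \<integral>\<^sup>+u\<in>{0..t}. hs_norm_sq (\<lambda>v. \<Phi> u v - elem_op (N n) (p n) (B n) u (J v)) \<partial>lborel) \<longlonglongrightarrow> 0"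
   "(\<lambda>n. \<integral>\<^sup>+w. ennreal ((norm (Z w - elem_integral coord (N n) (p n) (B n) w))\<^sup>2) \<partial>P) \<longlonglongrightarrow> 0"
   and AE: "AE w in P. (\<lambda>n. elem_integral coord (N n) (p n) (B n) w) \<longlonglongrightarrow> Z w"
  have range: "0 \<le> p n i \<and> p n i \<le> t" if "i \<le> N n" for n i
  proof -
   have mono: "p n i \<le> p n j" if "i \<le> j" "j \<le> N n" for i j
    using that *(3) by (induction j rule: dec_induct) (auto intro: order_trans)
   show ?thesis using mono[of 0 i] mono[of i "N n"] that *(1,2)[of n] by auto
  qed
  let ?Y = "\<lambda>n. elem_integral coord (N n) (p n) (B n)"
  have el: "?Y n \<in> borel_measurable (\<F> t)" for n
   by (rule elem_integral_canonical[OF coord_t]) (use range *(4) in auto)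
  note [measurable] = Z(2) borel_measurable_lim_metric[OF el] sets_Collect_Cauchy[OF el]
  \<comment> \<open>Convergence to \<open>Z w\<close>, expressed by conditions that are visibly
    measurable.\<close>
  have "AE w in P. Cauchy (\<lambda>n. ?Y n w) \<and> norm (lim (\<lambda>n. ?Y n w) - Z w) = 0"
   using AE by eventually_elim (auto simp: limI intro: LIMSEQ_imp_Cauchy)
  then have "AE w in restr_to_subalg P (\<F> t). Cauchy (\<lambda>n. ?Y n w) \<and> norm (lim (\<lambda>n. ?Y n w) - Z w) = 0"
   by (rule AE_restr_to_subalg2[OF subalgebra_canonical]) measurable
  then have "AE w in restr_to_subalg P (\<F> t). (\<lambda>n. ?Y n w) \<longlonglongrightarrow> Z w"
   by eventually_elim (simp, metis Cauchy_convergent convergent_LIMSEQ_iff)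
  from that[OF * this] range show thesis by auto
 qed
qed

text \<open>The differences of elementary integrals are \<open>linked\<close>, so they have the same
  law under \<open>P\<close> and \<open>Ph\<close>. Mean square distances are therefore the same on
  both sides.\<close>

lemma elem_integral_isometry:
 fixes B B' :: "nat => 'k => 'h"
 assumes t: "0 \<le> t" "t \<le> T"
  and p: "\<And>i. i \<le> N ==> 0 \<le> p i" "\<And>i. i \<le> N ==> p i \<le> t" "\<And>i. i < N ==> bounded_linear (B i)"
  and p': "\<And>i. i \<le> N' ==> 0 \<le> p' i" "\<And>i. i \<le> N' ==> p' i \<le> t" "\<And>i. i < N' ==> bounded_linear (B' i)"
 shows "(\<integral>\<^sup>+w. ennreal ((norm (elem_integral Wh N p B w - elem_integral Wh N' p' B' w))\<^sup>2) \<partial>Ph) =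
  (\<integral>\<^sup>+w. ennreal ((norm (elem_integral coord N p B w - elem_integral coord N' p' B' w))\<^sup>2) \<partial>P)"
proof -
 have cm: "coord u \<in> borel_measurable (\<F> t)" "Wh u \<in> borel_measurable (\<F> t)" if "0 \<le> u" "u \<le> t" for u
  using coord_measurable_canonical[OF that] measurable_canonical_mono[OF Wh_canonical that(2)] that(1) by (auto simp: coord_def[abs_def])
 have m: "elem_integral W N p B \<in> borel_measurable (\<F> t)" "elem_integral W N' p' B' \<in> borel_measurable (\<F> t)"
  if "\<And>u. 0 \<le> u ==> u \<le> t ==> W u \<in> borel_measurable (\<F> t)" for W
  by (rule elem_integral_canonical[OF that p], assumption+, rule elem_integral_canonical[OF that p'], assumption+)
 have 1 [measurable]: "(\<lambda>w. elem_integral coord N p B w - elem_integral coord N' p' B' w) \<in> borel_measurable P"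
  by (rule measurable_from_subalg[OF subalgebra_canonical[of t]]) (intro borel_measurable_diff m cm)
 have 2 [measurable]: "(\<lambda>w. elem_integral Wh N p B w - elem_integral Wh N' p' B' w) \<in> borel_measurable Ph"
  by (rule measurable_from_subalg[OF subalgebra_Ph[of t]]) (intro borel_measurable_diff m cm)
 have T0: "0 \<le> T" using T by simp
 have le: "p i \<le> T" if "i \<le> N" for i using p(2)[OF that] t by simp
 have le': "p' i \<le> T" if "i \<le> N'" for i using p'(2)[OF that] t by simp
 have law: "distr P borel (\<lambda>w. elem_integral coord N p B w - elem_integral coord N' p' B' w) =
   distr Ph borel (\<lambda>w. elem_integral Wh N p B w - elem_integral Wh N' p' B' w)"
  by (rule linked_distr_eq[OF gaussian_P gaussian_Ph T0 linked_diff[OF linked_elem_integral[OF p(1) le p(3)] linked_elem_integral[OF p'(1) le' p'(3)]] 1 2])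
 have "(\<integral>\<^sup>+w. ennreal ((norm (elem_integral Wh N p B w - elem_integral Wh N' p' B' w))\<^sup>2) \<partial>Ph) =
   (\<integral>\<^sup>+x. ennreal ((norm x)\<^sup>2) \<partial>distr Ph borel (\<lambda>w. elem_integral Wh N p B w - elem_integral Wh N' p' B' w))"
  by (subst nn_integral_distr) simp_all
 also have "\<dots> = (\<integral>\<^sup>+w. ennreal ((norm (elem_integral coord N p B w - elem_integral coord N' p' B' w))\<^sup>2) \<partial>P)"
  unfolding law[symmetric] by (subst nn_integral_distr) simp_all
 finally show ?thesis .
qed

lemma norm_diff_sq_le: "ennreal ((norm (x - y :: 'b::real_normed_vector))\<^sup>2) \<le> ennreal ((norm (z - x))\<^sup>2) + ennreal ((norm (z - x))\<^sup>2) + (ennreal ((norm (z - y))\<^sup>2) + ennreal ((norm (z - y))\<^sup>2))"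
proof -
 have "norm (x - y) \<le> norm (z - x) + norm (z - y)"
  using norm_triangle_ineq4[of "z - y" "z - x"] by (simp add: algebra_simps)
 then have "(norm (x - y))\<^sup>2 \<le> (norm (z - x) + norm (z - y))\<^sup>2" by (intro power_mono) auto
 also have "\<dots> \<le> (norm (z - x))\<^sup>2 + (norm (z - x))\<^sup>2 + ((norm (z - y))\<^sup>2 + (norm (z - y))\<^sup>2)"
  using zero_le_power2[of "norm (z - x) - norm (z - y)"] by (simp add: power2_sum power2_diff)
 finally have "ennreal ((norm (x - y))\<^sup>2) \<le> ennreal ((norm (z - x))\<^sup>2 + (norm (z - x))\<^sup>2 + ((norm (z - y))\<^sup>2 + (norm (z - y))\<^sup>2))"
  by (rule ennreal_leI)
 then show ?thesis by (simp only: ennreal_plus add_nonneg_nonneg zero_le_power2)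
qed

text \<open>Elementary integrals against \<open>Wh\<close> and against the canonical process differ
  by drift integrals, which converge by the Hilbert--Schmidt approximation. This identifies the
  almost sure limit under \<open>Ph\<close>; equality of mean square distances and Fatou's lemma
  make it a limit in mean square.\<close>

lemma stoch_integral_Wh:
 assumes t: "0 \<le> t" "t \<le> T" and Z: "has_stoch_integral P J coord (\<lambda>u. S (t - u) \<circ> R) 0 t Z" "Z \<in> borel_measurable (\<F> t)"
 shows "(\<lambda>y. Z y - (LINT u:{0..t}|lborel. S (t - u) (R (R (Dlog u (X u y)))))) \<in> borel_measurable (\<F> t)"
  and "has_stoch_integral Ph J Wh (\<lambda>u. S (t - u) \<circ> R) 0 t (\<lambda>y. Z y - (LINT u:{0..t}|lborel. S (t - u) (R (R (Dlog u (X u y))))))"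
proof -
 have SRR_cont: "continuous_on ({0..t} \<times> UNIV) (\<lambda>(u, x). S (t - u) (R (R (Dlog u x))))"
 proof -
  have "continuous_on ({0..t} \<times> UNIV) (\<lambda>p. R ((\<lambda>(u, x). R (Dlog u x)) p))"
   by (rule bounded_linear.continuous_on[OF R continuous_on_Icc_times[OF RDlog_cont]])
  then have "continuous_on ({0..t} \<times> UNIV) (\<lambda>p. (\<lambda>(u, x). S u x) (t - fst p, R ((\<lambda>(u, x). R (Dlog u x)) p)))"
   by (intro continuous_on_compose2[OF C0_semigroup_continuous_on[OF S]]) (auto intro!: continuous_intros)
  then show ?thesis by (simp add: case_prod_beta)
 qed
 define I where "I y = (LINT u:{0..t}|lborel. S (t - u) (R (R (Dlog u (X u y)))))" for y
 have I: "I \<in> borel_measurable (\<F> t)" unfolding I_def[abs_def]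
  by (rule progressive_integral_measurable[OF X_progressive[OF t(1)] SRR_cont])
 define Z' where "Z' y = Z y - I y" for y
 have Z': "Z' \<in> borel_measurable (\<F> t)" unfolding Z'_def[abs_def] using Z(2) I by measurable
 then show "(\<lambda>y. Z y - (LINT u:{0..t}|lborel. S (t - u) (R (R (Dlog u (X u y)))))) \<in> borel_measurable (\<F> t)"
  by (simp add: Z'_def[abs_def] I_def)
 obtain N p B where p: "\<And>n. 0 \<le> p n 0" "\<And>n. p n (N n) \<le> t" "\<And>n i. i < N n ==> p n i \<le> p n (Suc i)"
  and B: "\<And>n i. i < N n ==> bounded_linear (B n i)"
  and hs: "(\<lambda>n. \<integral>\<^sup>+u\<in>{0..t}. hs_norm_sq (\<lambda>v. (S (t - u) \<circ> R) v - elem_op (N n) (p n) (B n) u (J v)) \<partial>lborel) \<longlonglongrightarrow> 0"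
  and L2: "(\<lambda>n. \<integral>\<^sup>+y. ennreal ((norm (Z y - elem_integral coord (N n) (p n) (B n) y))\<^sup>2) \<partial>P) \<longlonglongrightarrow> 0"
  and AE: "AE y in restr_to_subalg P (\<F> t). (\<lambda>n. elem_integral coord (N n) (p n) (B n) y) \<longlonglongrightarrow> Z y"
  and pr: "\<And>n i. i \<le> N n ==> 0 \<le> p n i" "\<And>n i. i \<le> N n ==> p n i \<le> t"
  by (rule stoch_integral_restr[OF t(1) Z]) (rule that)
 let ?c = "\<lambda>n. elem_integral coord (N n) (p n) (B n)" and ?w = "\<lambda>n. elem_integral Wh (N n) (p n) (B n)"
 have cM: "?c n \<in> borel_measurable P" for n
  by (rule measurable_canonical_P[OF elem_integral_canonical[of t]])
   (use coord_measurable_canonical pr B in \<open>auto simp: coord_def[abs_def]\<close>)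
 have wM: "?w n \<in> borel_measurable Ph" for n
  by (rule measurable_from_subalg[OF subalgebra_Ph elem_integral_canonical[of t]])
   (use measurable_canonical_mono[OF Wh_canonical] pr B in auto)
 have ZM: "Z \<in> borel_measurable P" by (rule measurable_canonical_P[OF Z(2)])
 have Z'M: "Z' \<in> borel_measurable Ph" by (rule measurable_from_subalg[OF subalgebra_Ph Z'])
 have lim: "AE y in Ph. (\<lambda>n. ?w n y) \<longlonglongrightarrow> Z' y"
 proof (rule AE_Ph[OF t(1)])
  show "AE y in restr_to_subalg P (\<F> t). (\<lambda>n. ?w n y) \<longlonglongrightarrow> Z' y"
   using AE X_continuous[OF t(1)]
  proof eventually_elim
   case (elim y)
   define v where "v u = R (Dlog u (X u y))" for u
   have vc: "continuous_on {0..t} v" unfolding v_def by (rule continuous_along[OF RDlog_cont elim(2)])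
   have vi: "set_integrable lborel {0..t} v" by (rule borel_integrable_atLeastAtMost'[OF vc])
   have "bounded (v ` {0..t})" by (intro compact_imp_bounded compact_continuous_image vc compact_Icc)
   then obtain K where K: "\<And>u. u \<in> {0..t} ==> norm (v u) \<le> K" unfolding bounded_iff by blast
   have fi: "set_integrable lborel {0..t} (\<lambda>u. (S (t - u) \<circ> R) (v u))"
   proof (rule borel_integrable_atLeastAtMost')
    have "continuous_on {0..t} (\<lambda>u. (\<lambda>(u, x). S (t - u) (R (R (Dlog u x)))) (u, X u y))"
     by (rule continuous_on_compose2[OF SRR_cont]) (auto intro!: continuous_intros elim(2))
    then show "continuous_on {0..t} (\<lambda>u. (S (t - u) \<circ> R) (v u))" by (simp add: v_def)
   qed
   have drift: "set_integrable lborel {0..t} (\<lambda>u. elem_op (N n) (p n) (B n) u (J (v u)))"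
    "(LINT u:{0..t}|lborel. elem_op (N n) (p n) (B n) u (J (v u))) =
     (\<Sum>i<N n. B n i (J (LINT u:{0..p n (Suc i)}|lborel. v u) - J (LINT u:{0..p n i}|lborel. v u)))" for n
    by (rule elem_integral_drift[of J "N n" "B n" "p n" t v], fact J, fact B, fact p, fact p, fact p, fact vi)+
   have "(\<lambda>n. LINT u:{0..t}|lborel. elem_op (N n) (p n) (B n) u (J (v u))) \<longlonglongrightarrow> (LINT u:{0..t}|lborel. (S (t - u) \<circ> R) (v u))"
   proof (rule tendsto_set_integral_hs_norm[OF _ _ hs K fi drift(1)])
    show "bounded_linear (S (t - u) \<circ> R)" if "u \<in> {0..t}" for u
     unfolding comp_def using that by (intro bounded_linear_compose[OF S_linear R]) auto
    show "bounded_linear (\<lambda>x. elem_op (N n) (p n) (B n) u (J x))" for n u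
     by (rule bounded_linear_elem_op[OF J B])
   qed
   then have "(\<lambda>n. LINT u:{0..t}|lborel. elem_op (N n) (p n) (B n) u (J (v u))) \<longlonglongrightarrow> I y"
    by (simp add: I_def v_def)
   from tendsto_diff[OF elim(1) this]
   have lim': "(\<lambda>n. ?c n y - (LINT u:{0..t}|lborel. elem_op (N n) (p n) (B n) u (J (v u)))) \<longlonglongrightarrow> Z' y" by (simp add: Z'_def)
   have "?w n y = ?c n y - (LINT u:{0..t}|lborel. elem_op (N n) (p n) (B n) u (J (v u)))" for n
    unfolding drift(2) elem_integral_def sum_subtractf[symmetric]
   proof (rule sum.cong[OF refl])
    fix i assume "i \<in> {..<N n}"
    then have "linear (B n i)" using B[of i n] bounded_linear.linear by auto
    moreover have "Wh (p n (Suc i)) y - Wh (p n i) y = (coord (p n (Suc i)) y - coord (p n i) y) -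
      (J (LINT u:{0..p n (Suc i)}|lborel. v u) - J (LINT u:{0..p n i}|lborel. v u))"
     by (simp add: Wh_def v_def)
    ultimately show "B n i (Wh (p n (Suc i)) y - Wh (p n i) y) = B n i (coord (p n (Suc i)) y - coord (p n i) y) -
      B n i (J (LINT u:{0..p n (Suc i)}|lborel. v u) - J (LINT u:{0..p n i}|lborel. v u))"
     by (simp only: linear_diff[of "B n i"])
   qed
   with lim' show ?case by simp
  qed
 qed
 define b where "b n = (\<integral>\<^sup>+y. ennreal ((norm (Z y - ?c n y))\<^sup>2) \<partial>P)" for n
 have b: "b \<longlonglongrightarrow> 0" using L2 by (simp add: b_def[abs_def])
 have bound: "(\<integral>\<^sup>+y. ennreal ((norm (Z' y - ?w n y))\<^sup>2) \<partial>Ph) \<le> b n + b n" for n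
 proof -
  note [measurable] = wM Z'M cM ZM
  \<comment> \<open>Fatou's lemma bounds the distance to the limit by mutual distances of elementary
    integrals, which can be computed under \<open>P\<close>.\<close>
  have "(\<integral>\<^sup>+y. ennreal ((norm (Z' y - ?w n y))\<^sup>2) \<partial>Ph) = (\<integral>\<^sup>+y. liminf (\<lambda>l. ennreal ((norm (?w l y - ?w n y))\<^sup>2)) \<partial>Ph)"
  proof (rule nn_integral_cong_AE)
   show "AE y in Ph. ennreal ((norm (Z' y - ?w n y))\<^sup>2) = liminf (\<lambda>l. ennreal ((norm (?w l y - ?w n y))\<^sup>2))"
    using lim
   proof eventually_elim
    case (elim y)
    have "(\<lambda>l. ennreal ((norm (?w l y - ?w n y))\<^sup>2)) \<longlonglongrightarrow> ennreal ((norm (Z' y - ?w n y))\<^sup>2)"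
     by (intro tendsto_ennrealI tendsto_intros elim)
    from lim_imp_Liminf[OF sequentially_bot this] show ?case by simp
   qed
  qed
  also have "\<dots> \<le> liminf (\<lambda>l. \<integral>\<^sup>+y. ennreal ((norm (?w l y - ?w n y))\<^sup>2) \<partial>Ph)"
   by (rule nn_integral_liminf) measurable
  also have "\<dots> \<le> liminf (\<lambda>l. b l + b l + (b n + b n))"
  proof (rule Liminf_mono, rule always_eventually, rule allI)
   fix l
   have "(\<integral>\<^sup>+y. ennreal ((norm (?w l y - ?w n y))\<^sup>2) \<partial>Ph) = (\<integral>\<^sup>+y. ennreal ((norm (?c l y - ?c n y))\<^sup>2) \<partial>P)"
    by (rule elem_integral_isometry[OF t pr(1) pr(2) B pr(1) pr(2) B])
   also have "\<dots> \<le> (\<integral>\<^sup>+y. ennreal ((norm (Z y - ?c l y))\<^sup>2) + ennreal ((norm (Z y - ?c l y))\<^sup>2) +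
     (ennreal ((norm (Z y - ?c n y))\<^sup>2) + ennreal ((norm (Z y - ?c n y))\<^sup>2)) \<partial>P)"
    by (intro nn_integral_mono norm_diff_sq_le)
   also have "\<dots> = b l + b l + (b n + b n)"
    unfolding b_def by (simp add: nn_integral_add)
   finally show "(\<integral>\<^sup>+y. ennreal ((norm (?w l y - ?w n y))\<^sup>2) \<partial>Ph) \<le> b l + b l + (b n + b n)" .
  qed
  also have "\<dots> = b n + b n"
  proof (rule lim_imp_Liminf[OF sequentially_bot])
   from tendsto_add[OF tendsto_add[OF b b] tendsto_const[of "b n + b n"]]
   show "(\<lambda>l. b l + b l + (b n + b n)) \<longlonglongrightarrow> b n + b n" by simp
  qed
  finally show ?thesis .
 qed
 have L2': "(\<lambda>n. \<integral>\<^sup>+y. ennreal ((norm (Z' y - ?w n y))\<^sup>2) \<partial>Ph) \<longlonglongrightarrow> 0"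
 proof (rule tendsto_sandwich[of "\<lambda>_. 0"])
  show "(\<lambda>n. b n + b n) \<longlonglongrightarrow> 0" using tendsto_add[OF b b] by simp
 qed (use bound in auto)
 have "has_stoch_integral Ph J Wh (\<lambda>u. S (t - u) \<circ> R) 0 t Z'"
  unfolding has_stoch_integral_def
 proof (intro conjI exI)
  show "Z' \<in> borel_measurable Ph" by (rule Z'M)
  show "\<forall>n. 0 \<le> p n 0 \<and> p n (N n) \<le> t \<and> (\<forall>i<N n. p n i \<le> p n (Suc i) \<and> bounded_linear (B n i))"
   using p B by auto
  show "(\<lambda>n. \<integral>\<^sup>+u\<in>{0..t}. hs_norm_sq (\<lambda>v. (S (t - u) \<circ> R) v - elem_op (N n) (p n) (B n) u (J v)) \<partial>lborel) \<longlonglongrightarrow> 0" by (rule hs)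
  show "(\<lambda>n. \<integral>\<^sup>+y. ennreal ((norm (Z' y - ?w n y))\<^sup>2) \<partial>Ph) \<longlonglongrightarrow> 0" by (rule L2')
 qed
 then show "has_stoch_integral Ph J Wh (\<lambda>u. S (t - u) \<circ> R) 0 t (\<lambda>y. Z y - (LINT u:{0..t}|lborel. S (t - u) (R (R (Dlog u (X u y))))))"
  by (simp add: Z'_def[abs_def] I_def)
qed

text \<open>The added drift enters the time integral and is subtracted in the new stochastic
  integral, so the equation that holds under \<open>P\<close> is only regrouped; its exceptional set
  transfers to \<open>Ph\<close>.\<close>

lemma mild_solution_Ph:
 "mild_solution Ph \<F> J Wh S (\<lambda>t x. F t x + R (R (Dlog t x))) R 0 x\<^sub>0 {0..T} X"
 unfolding mild_solution_def
proof (intro ballI conjI)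
 fix t assume "t \<in> {0..T}"
 then have t: "0 \<le> t" "t \<le> T" by auto
 show "(\<lambda>(r, w). X r w) \<in> borel_measurable (restrict_space borel {0..t} \<Otimes>\<^sub>M \<F> t)" by (rule X_progressive[OF t(1)])
 show "AE w in restr_to_subalg Ph (\<F> t). continuous_on {0..t} (\<lambda>r. X r w)"
  by (rule AE_restr_Ph[OF t(1) X_continuous[OF t(1)]])
 have "t \<in> {0..}" using t by simp
 note X_t = bspec[OF X[unfolded mild_solution_def] this]
 have Fi: "AE w in restr_to_subalg P (\<F> t). set_integrable lborel {0..t} (\<lambda>u. S (t - u) (F u (X u w)))"
  using X_t by (elim conjE)
 obtain Z where Z: "Z \<in> borel_measurable (\<F> t)" "has_stoch_integral P J coord (\<lambda>u. S (t - u) \<circ> R) 0 t Z"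
  and eq: "AE w in restr_to_subalg P (\<F> t). X t w = S (t - 0) x\<^sub>0 + (LINT u:{0..t}|lborel. S (t - u) (F u (X u w))) + Z w"
  using X_t by (elim conjE bexE) (rule that)
 have Ri: "set_integrable lborel {0..t} (\<lambda>u. S (t - u) (R (R (Dlog u (X u w)))))" if "continuous_on {0..t} (\<lambda>r. X r w)" for w
 proof (rule borel_integrable_atLeastAtMost')
  have "continuous_on {0..t} (\<lambda>u. R (R (Dlog u (X u w))))"
   by (intro bounded_linear.continuous_on[OF R] continuous_along[OF RDlog_cont that])
  then have "continuous_on {0..t} (\<lambda>u. (\<lambda>(r, x). S r x) (t - u, R (R (Dlog u (X u w)))))"
   by (intro continuous_on_compose2[OF C0_semigroup_continuous_on[OF S]]) (auto intro!: continuous_intros)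
  then show "continuous_on {0..t} (\<lambda>u. S (t - u) (R (R (Dlog u (X u w)))))" by simp
 qed
 have add: "indicat_real {0..t} u *\<^sub>R S (t - u) (F u (X u w) + R (R (Dlog u (X u w)))) =
   indicat_real {0..t} u *\<^sub>R (S (t - u) (F u (X u w)) + S (t - u) (R (R (Dlog u (X u w)))))" for u w
  using linear_add[OF bounded_linear.linear[OF S_linear[of "t - u"]]] by (auto simp: indicator_def)
 show "AE w in restr_to_subalg Ph (\<F> t). set_integrable lborel {0..t} (\<lambda>u. S (t - u) (F u (X u w) + R (R (Dlog u (X u w)))))"
 proof (rule AE_restr_Ph[OF t(1)])
  show "AE w in restr_to_subalg P (\<F> t). set_integrable lborel {0..t} (\<lambda>u. S (t - u) (F u (X u w) + R (R (Dlog u (X u w)))))"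
   using Fi X_continuous[OF t(1)]
  proof eventually_elim
   case (elim w)
   from set_integral_add(1)[OF elim(1) Ri[OF elim(2)]] show ?case unfolding set_integrable_def add .
  qed
 qed
 let ?Z = "\<lambda>w. Z w - (LINT u:{0..t}|lborel. S (t - u) (R (R (Dlog u (X u w)))))"
 show "\<exists>Z\<in>borel_measurable (\<F> t). has_stoch_integral Ph J Wh (\<lambda>u. S (t - u) \<circ> R) 0 t Z \<and>
   (AE w in restr_to_subalg Ph (\<F> t). X t w = S (t - 0) x\<^sub>0 +
    (LINT u:{0..t}|lborel. S (t - u) (F u (X u w) + R (R (Dlog u (X u w))))) + Z w)"
 proof (rule bexI[of _ ?Z], rule conjI)
  show "?Z \<in> borel_measurable (\<F> t)" by (rule stoch_integral_Wh(1)[OF t Z(2,1)])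
  show "has_stoch_integral Ph J Wh (\<lambda>u. S (t - u) \<circ> R) 0 t ?Z" by (rule stoch_integral_Wh(2)[OF t Z(2,1)])
  show "AE w in restr_to_subalg Ph (\<F> t). X t w = S (t - 0) x\<^sub>0 +
    (LINT u:{0..t}|lborel. S (t - u) (F u (X u w) + R (R (Dlog u (X u w))))) + ?Z w"
  proof (rule AE_restr_Ph[OF t(1)])
   show "AE w in restr_to_subalg P (\<F> t). X t w = S (t - 0) x\<^sub>0 +
    (LINT u:{0..t}|lborel. S (t - u) (F u (X u w) + R (R (Dlog u (X u w))))) + ?Z w"
    using Fi X_continuous[OF t(1)] eq
   proof eventually_elim
    case (elim w)
    have "(LINT u:{0..t}|lborel. S (t - u) (F u (X u w) + R (R (Dlog u (X u w))))) =
      (LINT u:{0..t}|lborel. S (t - u) (F u (X u w))) + (LINT u:{0..t}|lborel. S (t - u) (R (R (Dlog u (X u w)))))"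
     using set_integral_add(2)[OF elim(1) Ri[OF elim(2)]] unfolding set_lebesgue_integral_def add .
    then show ?case using elim(3) by simp
   qed
  qed
 qed
qed

end

section \<open>Growth bounds and gradients\<close>

lemma Cm_space_bound:
 assumes "\<phi> \<in> Cm_space m"
 obtains C where "C \<ge> 0" "\<And>t x. 0 \<le> t ==> norm (\<phi> t x) \<le> C * (1 + norm x powr m)"
proof (rule that[of "enn2real (Cm_norm m \<phi>)"])
 fix t :: real and x :: 'a assume t: "0 \<le> t"
 have pos: "0 < 1 + norm x powr m" by (simp add: add_pos_nonneg)
 have "(\<lambda>(t, x). ennreal (norm (\<phi> t x) / (1 + norm x powr m))) (t, x) \<le> Cm_norm m \<phi>"
  unfolding Cm_norm_def by (rule SUP_upper) (use t in simp)
 moreover have "Cm_norm m \<phi> = ennreal (enn2real (Cm_norm m \<phi>))" using assms by (simp add: Cm_space_def)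
 ultimately have "ennreal (norm (\<phi> t x) / (1 + norm x powr m)) \<le> ennreal (enn2real (Cm_norm m \<phi>))" by simp
 then have "norm (\<phi> t x) / (1 + norm x powr m) \<le> enn2real (Cm_norm m \<phi>)" by (simp add: ennreal_le_iff)
 then show "norm (\<phi> t x) \<le> enn2real (Cm_norm m \<phi>) * (1 + norm x powr m)" using pos by (simp add: pos_divide_le_eq)
qed simp

lemma GDERIV_unique:
 assumes "GDERIV f x :> D" "GDERIV f x :> D'"
 shows "D = D'"
proof -
 have "(\<lambda>y. y \<bullet> D) = (\<lambda>y. y \<bullet> D')" using assms unfolding gderiv_def by (rule has_derivative_unique)
 then have "(D - D') \<bullet> D = (D - D') \<bullet> D'" by (rule fun_cong)
 then have "(D - D') \<bullet> (D - D') = 0" by (simp add: inner_diff_right)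
 then show ?thesis by simp
qed

lemma gradient_eqI: "GDERIV f x :> D ==> gradient f x = D"
 unfolding gradient_def by (rule the_equality) (auto intro: GDERIV_unique)

text \<open>The derivative is a bounded functional, so the Riesz theorem represents it by a vector;
  uniqueness identifies it with the one selected in \<open>gradient\<close>.\<close>

lemma GDERIV_gradient:
 fixes f :: "'a::{real_inner,banach} => real"
 assumes "f differentiable (at x)"
 shows "GDERIV f x :> gradient f x"
proof -
 obtain f' where f': "(f has_derivative f') (at x)" using assms by (auto simp: differentiable_def)
 obtain D where "\<And>y. f' y = y \<bullet> D"
  using riesz_representation[OF has_derivative_bounded_linear[OF f']] by (auto simp: inner_commute)
 then have "f' = (\<lambda>y. y \<bullet> D)" by (rule ext)
 then have "GDERIV f x :> D" using f' by (simp add: gderiv_def)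
 then show ?thesis using gradient_eqI by metis
qed

lemma gradient_ln:
 fixes f :: "'a::{real_inner,banach} => real"
 assumes "f differentiable (at x)" "0 < f x"
 shows "gradient (\<lambda>y. ln (f y)) x = gradient f x /\<^sub>R f x"
 by (rule gradient_eqI, rule GDERIV_DERIV_compose[OF GDERIV_gradient[OF assms(1)]])
  (use DERIV_ln[OF assms(2)] in simp)

text \<open>The formula for the gradient of \<open>ln h\<close> is available at nonnegative times
  only; before \<open>s\<close> the indicator in the time integral is 0.\<close>

lemma mild_solution_cong:
 assumes "\<And>u x. s \<le> u ==> G u x = G' u x"
 shows "mild_solution M Fil J W S G R s x I X = mild_solution M Fil J W S G' R s x I X"
proof -
 have *: "indicat_real {s..t} u *\<^sub>R S (t - u) (G u (X u w)) = indicat_real {s..t} u *\<^sub>R S (t - u) (G' u (X u w))" for t u w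
  using assms by (cases "s \<le> u") auto
 show ?thesis unfolding mild_solution_def set_integrable_def set_lebesgue_integral_def * ..
qed

theorem theorem3p2:
  fixes J :: "'h::{real_inner, banach, second_countable_topology}
                \<Rightarrow> 'k::{real_inner, banach, second_countable_topology}"
    and P Ph :: "(real \<Rightarrow> 'k) measure"
    and domA :: "'h set" and A :: "'h \<Rightarrow> 'h" and S :: "real \<Rightarrow> 'h \<Rightarrow> 'h"
    and Q sqrtQ :: "'h \<Rightarrow> 'h"
    and F :: "real \<Rightarrow> 'h \<Rightarrow> 'h" and C\<^sub>F :: real
    and X :: "real \<Rightarrow> real \<Rightarrow> 'h \<Rightarrow> (real \<Rightarrow> 'k) \<Rightarrow> 'h" and x\<^sub>0 :: 'h
    and m :: real and h :: "real \<Rightarrow> 'h \<Rightarrow> real" and T :: real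
  assumes J: "hilbert_schmidt_embedding J"
    and P_sets: "sets P = sets path_borel"
    and P_wiener: "cylindrical_wiener P natural_filtration J {0..} coord"
    and A: "generates_semigroup domA A S"
    and Q: "sym_pos_op Q" and sqrtQ: "is_sqrt_op Q sqrtQ"
    and Q_trace: "(SUP t\<in>{0..}. trace_op (cov_op S Q t)) < \<infinity>"
    and C\<^sub>F: "C\<^sub>F > 0"
    and F_Lipschitz: "\<And>t x y. t \<ge> 0 \<Longrightarrow> norm (F t x - F t y) \<le> C\<^sub>F * norm (x - y)"
    and F_growth: "\<And>t x. t \<ge> 0 \<Longrightarrow> norm (F t x) \<le> C\<^sub>F * (1 + norm x)"
    and X: "\<And>s x. s \<ge> 0 \<Longrightarrow>
              mild_solution P canonical_filtration J coord S F sqrtQ s x {s..} (\<lambda>t. X t s x)"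
    and m: "m \<ge> 1"
    and h_pos: "\<And>t x. t \<ge> 0 \<Longrightarrow> h t x > 0"
    and h_dom: "h \<in> gen_dom P X m"
    and h_inv_gen: "(\<lambda>t x. inverse (h t x) * gen P X h t x) \<in> Cm_space m"
    and h_diff: "\<And>t x. t \<ge> 0 \<Longrightarrow> h t differentiable (at x)"
    and h_grad: "(\<lambda>t x. gradient (h t) x) \<in> Cm_space m"
    and E_martingale: "is_martingale P canonical_filtration (density_process P X x\<^sub>0 h)"
    and Ph_sets: "sets Ph = sets path_borel"
    and Ph: "\<And>t B. t \<ge> 0 \<Longrightarrow> B \<in> sets (canonical_filtration t) \<Longrightarrow>
               emeasure Ph B = (\<integral>\<^sup>+\<omega>\<in>B. ennreal (density_process P X x\<^sub>0 h t \<omega>) \<partial>P)"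
    and T: "T > 0"
  shows "cylindrical_wiener Ph canonical_filtration J {0..T}
           (shifted_process J sqrtQ X x\<^sub>0 h coord)
         \<and> mild_solution Ph canonical_filtration J (shifted_process J sqrtQ X x\<^sub>0 h coord) S
             (\<lambda>t x. F t x + Q (gradient (\<lambda>y. ln (h t y)) x)) sqrtQ 0 x\<^sub>0 {0..T}
             (\<lambda>t. X t 0 x\<^sub>0)"
proof -
  have J': "bounded_linear J" using J by (simp add: hilbert_schmidt_embedding_def)
  have S: "C0_semigroup S" using A by (simp add: generates_semigroup_def)
  have R: "bounded_linear sqrtQ" "\<And>x y. sqrtQ x \<bullet> y = x \<bullet> sqrtQ y" and RR: "\<And>x. sqrtQ (sqrtQ x) = Q x"
    using sqrtQ by (auto simp: is_sqrt_op_def sym_pos_op_def comp_def)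
  define V where "V t x = inverse (h t x) * gen P X h t x" for t x
  define Dh where "Dh t x = gradient (h t) x" for t x
  have h_Cm: "h \<in> Cm_space m" using h_dom by (simp add: gen_dom_def)
  have V_Cm: "V \<in> Cm_space m" using h_inv_gen by (simp add: V_def[abs_def])
  have Dh_Cm: "Dh \<in> Cm_space m" using h_grad by (simp add: Dh_def[abs_def])
  obtain C1 where C1: "C1 \<ge> 0" "\<And>t x. 0 \<le> t \<Longrightarrow> norm (h t x) \<le> C1 * (1 + norm x powr m)" using Cm_space_bound[OF h_Cm] by blast
  obtain C2 where C2: "C2 \<ge> 0" "\<And>t x. 0 \<le> t \<Longrightarrow> norm (V t x) \<le> C2 * (1 + norm x powr m)" using Cm_space_bound[OF V_Cm] by blast
  obtain C3 where C3: "C3 \<ge> 0" "\<And>t x. 0 \<le> t \<Longrightarrow> norm (Dh t x) \<le> C3 * (1 + norm x powr m)" using Cm_space_bound[OF Dh_Cm] by blast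
  define C where "C = C1 + C2 + C3"
  have C_le: "c * (1 + norm x powr m) \<le> C * (1 + norm x powr m)" if "c = C1 \<or> c = C2 \<or> c = C3" for c and x :: 'h
    using that C1(1) C2(1) C3(1) by (intro mult_right_mono) (auto simp: C_def)
  have density: "density_process P X x\<^sub>0 h t \<omega> = h t (X t 0 x\<^sub>0 \<omega>) / h 0 x\<^sub>0 * exp (- (LINT s:{0..t}|lborel. V s (X s 0 x\<^sub>0 \<omega>)))" for t \<omega>
    by (simp add: density_process_def V_def divide_inverse mult.commute)
  interpret h_transform J P S sqrtQ F C\<^sub>F x\<^sub>0 "\<lambda>t. X t 0 x\<^sub>0" Ph h V Dh m C T
  proof (intro h_transform.intro wiener_mild_solution.intro cylindrical_wiener_path_space.intro
      wiener_mild_solution_axioms.intro h_transform_axioms.intro)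
    show "bounded_linear J" by (rule J')
    show "sets P = sets path_borel" by (rule P_sets)
    show "cylindrical_wiener P natural_filtration J {0..} coord" by (rule P_wiener)
    show "C0_semigroup S" by (rule S)
    show "bounded_linear sqrtQ" by (rule R)
    show "0 < C\<^sub>F" by (rule C\<^sub>F)
    show "norm (F t x - F t y) \<le> C\<^sub>F * norm (x - y)" if "0 \<le> t" for t x y using that by (rule F_Lipschitz)
    show "mild_solution P canonical_filtration J coord S F sqrtQ 0 x\<^sub>0 {0..} (\<lambda>t. X t 0 x\<^sub>0)" by (rule X) simp
    show "sqrtQ x \<bullet> y = x \<bullet> sqrtQ y" for x y by (rule R)
    show "continuous_on ({0..} \<times> UNIV) (\<lambda>(t, x). h t x)" using h_Cm by (simp add: Cm_space_def)
    show "continuous_on ({0..} \<times> UNIV) (\<lambda>(t, x). Dh t x)" using Dh_Cm by (simp add: Cm_space_def)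
    show "continuous_on ({0..} \<times> UNIV) (\<lambda>(t, x). V t x)" using V_Cm by (simp add: Cm_space_def)
    show "0 < h t x" if "0 \<le> t" for t x using that by (rule h_pos)
    show "\<bar>h t x\<bar> \<le> C * (1 + norm x powr m)" if "0 \<le> t" for t x using C1(2)[OF that, of x] C_le[of C1 x] by simp
    show "\<bar>V t x\<bar> \<le> C * (1 + norm x powr m)" if "0 \<le> t" for t x using C2(2)[OF that, of x] C_le[of C2 x] by simp
    show "norm (Dh t x) \<le> C * (1 + norm x powr m)" if "0 \<le> t" for t x using C3(2)[OF that, of x] C_le[of C3 x] by simp
    show "GDERIV (h t) x :> Dh t x" if "0 \<le> t" for t x unfolding Dh_def by (rule GDERIV_gradient[OF h_diff[OF that]])
    show "0 \<le> m" "0 \<le> C" "0 < T" using m T C1(1) C2(1) C3(1) by (auto simp: C_def)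
    show "is_martingale P canonical_filtration (\<lambda>t \<omega>. h t (X t 0 x\<^sub>0 \<omega>) / h 0 x\<^sub>0 * exp (- (LINT s:{0..t}|lborel. V s (X s 0 x\<^sub>0 \<omega>))))"
      using E_martingale unfolding density[symmetric] .
    show "sets Ph = sets path_borel" by (rule Ph_sets)
    show "emeasure Ph B = (\<integral>\<^sup>+\<omega>\<in>B. ennreal (h t (X t 0 x\<^sub>0 \<omega>) / h 0 x\<^sub>0 * exp (- (LINT s:{0..t}|lborel. V s (X s 0 x\<^sub>0 \<omega>)))) \<partial>P)"
      if "0 \<le> t" "B \<in> sets (canonical_filtration t)" for t B using Ph[OF that] unfolding density .
  qed
  have Dlog_eq: "gradient (\<lambda>y. ln (h t y)) x = Dlog t x" if "0 \<le> t" for t x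
    unfolding Dlog_def Dh_def by (rule gradient_ln[OF h_diff[OF that] h_pos[OF that]])
  have Wh_eq: "shifted_process J sqrtQ X x\<^sub>0 h coord = Wh"
  proof (intro ext)
    fix t and \<omega> :: "real \<Rightarrow> 'k"
    have "(LINT s:{0..t}|lborel. sqrtQ (gradient (\<lambda>y. ln (h s y)) (X s 0 x\<^sub>0 \<omega>))) = (LINT s:{0..t}|lborel. sqrtQ (Dlog s (X s 0 x\<^sub>0 \<omega>)))"
      by (rule set_lebesgue_integral_cong) (auto simp: Dlog_eq)
    then show "shifted_process J sqrtQ X x\<^sub>0 h coord t \<omega> = Wh t \<omega>" by (simp add: shifted_process_def Wh_def)
  qed
  have "mild_solution Ph canonical_filtration J Wh S (\<lambda>t x. F t x + Q (gradient (\<lambda>y. ln (h t y)) x)) sqrtQ 0 x\<^sub>0 {0..T} (\<lambda>t. X t 0 x\<^sub>0) =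
      mild_solution Ph canonical_filtration J Wh S (\<lambda>t x. F t x + sqrtQ (sqrtQ (Dlog t x))) sqrtQ 0 x\<^sub>0 {0..T} (\<lambda>t. X t 0 x\<^sub>0)"
    by (rule mild_solution_cong) (simp add: Dlog_eq RR)
  then show ?thesis unfolding Wh_eq using cylindrical_wiener_Wh mild_solution_Ph by blast
qed

end
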